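(* Let $R$ be a (not necessarily commutative) ring whose additive group is finitely generated, let $\mathbf{k}$ be a noetherian commutative ring, and let $M$ be a finitely generated $\mathbf{OVI}(R)$-module over $\mathbf{k}$. Then $\mathbf{H}_i(\mathbf{U}, M)$ is a finitely generated $\mathbf{OI}$-module over $\mathbf{k}$ for all $i \geq 0$.
   Context: Rings are associative and unital with $1\ne 0$. Modules over categories: for a category $\mathcal{C}$, a $\mathcal{C}$-module over $\mathbf{k}$ is a functor $M\colon \mathcal{C} \to \mathrm{Mod}_{\mathbf{k}}$. For $x \in \mathcal{C}$, the principal projective $P_x$ is the $\mathcal{C}$-module $(P_x)_y = \mathbf{k}[\mathrm{Hom}_{\mathcal{C}}(x,y)]$. A $\mathcal{C}$-module $M$ is finitely generated if there is a surjection $\bigoplus_{i=1}^k P_{x_i} \to M$ for some finitely many $x_1,\dots,x_k \in \mathcal{C}$. $\mathbf{OI}$ is the category of finite totally ordered sets and order-preserving injections; $[n]=\{1,\dots,n\}$, $[0]=\varnothing$. $\mathbf{OVI}(R)$ is the following category. Objects are pairs $(V,\{v_i\}_{i\in I})$ where $V$ is a finite rank free left $R$-module and $\{v_i\}$ is a basis indexed by a totally ordered set $I$. A morphism $(V,\{v_i\}_{i \in I}) \to (W,\{w_j\}_{j\in J})$ is a pair $(f,f_0)$ with $f\colon V \to W$ an $R$-linear map and $f_0\colon I \to J$ an order-preserving injection such that $f(v_i) = w_{f_0(i)} + \sum_{j<f_0(i)} a_{i,j} w_j$ for some scalars $a_{i,j}\in R$. Every object is isomorphic to $R^n$ with its standard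 ordered basis for a unique $n$, and the automorphism group of $R^n$ is $U_n(R)$, the group of upper-triangular matrices over $R$ with $1$'s on the diagonal. There is a functor $\mathbf{OI}\to\mathbf{OVI}(R)$ taking $S$ to the free module $R[S]$ with ordered basis $S$. For an $\mathbf{OVI}(R)$-module $M$, write $M_n = M(R^n)$, a representation of $U_n(R)$ over $\mathbf{k}$. An order-preserving injection $f\colon[n]\to[m]$ induces a morphism $R^n \to R^m$, hence a map $M_n \to M_m$, which is equivariant for the homomorphism $f_*\colon U_n(R) \to U_m(R)$ that sends $g$ to the matrix whose $(f(a),f(b))$ entry is $g_{ab}$ and whose other entries agree with those of the identity matrix. The resulting maps on group homology make $[n]\mapsto \mathrm{H}_i(U_n(R), M_n)$ an $\mathbf{OI}$-module, denoted $\mathbf{H}_i(\mathbf{U},M)$. *)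

theory Defs
  imports "HOL-Algebra.Module" "HOL-Algebra.Ring_Divisibility" "HOL-Algebra.Generated_Groups"
begin

section \<open>Modules\<close>

text \<open>
  \<^locale>\<open>module\<close> requires a commutative ring of scalars; left modules over a possibly
  noncommutative ring are given by the same axioms over \<^locale>\<open>ring\<close>.  In all module records
  built below, the fields \<^const>\<open>monoid.mult\<close> and \<^const>\<open>one\<close> inherited from \<^typ>\<open>'a ring\<close> are
  irrelevant.
\<close>

locale left_module = R?: ring R + M?: abelian_group M
  for R :: "('r, 'x) ring_scheme" (structure)
    and M :: "('r, 'a, 'y) module_scheme" (structure) +
  assumes smult_closed:
      "\<lbrakk>a \<in> carrier R; x \<in> carrier M\<rbrakk> \<Longrightarrow> a \<odot>\<^bsub>M\<^esub> x \<in> carrier M"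
    and smult_l_distr:
      "\<lbrakk>a \<in> carrier R; b \<in> carrier R; x \<in> carrier M\<rbrakk> \<Longrightarrow>
        (a \<oplus> b) \<odot>\<^bsub>M\<^esub> x = a \<odot>\<^bsub>M\<^esub> x \<oplus>\<^bsub>M\<^esub> b \<odot>\<^bsub>M\<^esub> x"
    and smult_r_distr:
      "\<lbrakk>a \<in> carrier R; x \<in> carrier M; y \<in> carrier M\<rbrakk> \<Longrightarrow>
        a \<odot>\<^bsub>M\<^esub> (x \<oplus>\<^bsub>M\<^esub> y) = a \<odot>\<^bsub>M\<^esub> x \<oplus>\<^bsub>M\<^esub> a \<odot>\<^bsub>M\<^esub> y"
    and smult_assoc1:
      "\<lbrakk>a \<in> carrier R; b \<in> carrier R; x \<in> carrier M\<rbrakk> \<Longrightarrow>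
        (a \<otimes> b) \<odot>\<^bsub>M\<^esub> x = a \<odot>\<^bsub>M\<^esub> (b \<odot>\<^bsub>M\<^esub> x)"
    and smult_one: "x \<in> carrier M \<Longrightarrow> \<one> \<odot>\<^bsub>M\<^esub> x = x"

definition linear_maps ::
  "('r, 'x) ring_scheme \<Rightarrow> ('r, 'a) module \<Rightarrow> ('r, 'b) module \<Rightarrow> ('a \<Rightarrow> 'b) set" where
  "linear_maps R V W = {f \<in> carrier V \<rightarrow> carrier W.
     (\<forall>x\<in>carrier V. \<forall>y\<in>carrier V. f (x \<oplus>\<^bsub>V\<^esub> y) = f x \<oplus>\<^bsub>W\<^esub> f y) \<and>
     (\<forall>a\<in>carrier R. \<forall>x\<in>carrier V. f (a \<odot>\<^bsub>V\<^esub> x) = a \<odot>\<^bsub>W\<^esub> f x)}"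

definition is_basis ::
  "('r, 'x) ring_scheme \<Rightarrow> ('r, 'a) module \<Rightarrow> 'i set \<Rightarrow> ('i \<Rightarrow> 'a) \<Rightarrow> bool" where
  "is_basis R V I v \<longleftrightarrow> v \<in> I \<rightarrow>\<^sub>E carrier V \<and>
     (\<forall>x\<in>carrier V. \<exists>!c. c \<in> I \<rightarrow>\<^sub>E carrier R \<and> x = (\<Oplus>\<^bsub>V\<^esub>i\<in>I. c i \<odot>\<^bsub>V\<^esub> v i))"

definition regular_module :: "('r, 'x) ring_scheme \<Rightarrow> ('r, 'r) module" where
  "regular_module R = \<lparr>carrier = carrier R, monoid.mult = (\<otimes>\<^bsub>R\<^esub>), one = \<one>\<^bsub>R\<^esub>,
     ring.zero = \<zero>\<^bsub>R\<^esub>, add = (\<oplus>\<^bsub>R\<^esub>), smult = (\<otimes>\<^bsub>R\<^esub>)\<rparr>"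

text \<open>
  The direct sum of copies of a module \<open>V\<close> indexed by \<open>X\<close>, as finitely supported functions.  The free
  module on \<open>X\<close> is the case where \<open>V\<close> is the regular module.
\<close>

definition finsupp_module :: "('r, 'a) module \<Rightarrow> 'i set \<Rightarrow> ('r, 'i \<Rightarrow> 'a) module" where
  "finsupp_module V X =
    \<lparr>carrier = {c. (\<forall>x\<in>X. c x \<in> carrier V) \<and> (\<forall>x. x \<notin> X \<longrightarrow> c x = \<zero>\<^bsub>V\<^esub>) \<and>
                   finite {x. c x \<noteq> \<zero>\<^bsub>V\<^esub>}},
     monoid.mult = undefined, one = undefined,
     ring.zero = (\<lambda>x. \<zero>\<^bsub>V\<^esub>), add = (\<lambda>c d x. c x \<oplus>\<^bsub>V\<^esub> d x),
     smult = (\<lambda>a c x. a \<odot>\<^bsub>V\<^esub> c x)\<rparr>"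

definition single :: "('r, 'a) module \<Rightarrow> 'i \<Rightarrow> 'a \<Rightarrow> 'i \<Rightarrow> 'a" where
  "single V x m = (\<lambda>y. if y = x then m else \<zero>\<^bsub>V\<^esub>)"

definition free_module :: "('r, 'x) ring_scheme \<Rightarrow> 'i set \<Rightarrow> ('r, 'i \<Rightarrow> 'r) module" where
  "free_module R X = finsupp_module (regular_module R) X"

text \<open>The additive map \<open>m[x] \<mapsto> (u m)[\<phi> x]\<close> to the copies of \<open>W\<close> indexed by \<open>Y\<close>.\<close>

definition finsupp_map ::
  "('r, 'a) module \<Rightarrow> ('r, 'b) module \<Rightarrow> 'j set \<Rightarrow> ('i \<Rightarrow> 'j) \<Rightarrow> ('a \<Rightarrow> 'b) \<Rightarrow>
   ('i \<Rightarrow> 'a) \<Rightarrow> 'j \<Rightarrow> 'b" where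
  "finsupp_map V W Y \<phi> u c =
     (\<Oplus>\<^bsub>finsupp_module W Y\<^esub>x\<in>{x. c x \<noteq> \<zero>\<^bsub>V\<^esub>}. single W (\<phi> x) (u (c x)))"

definition finite_dsum :: "'i set \<Rightarrow> ('i \<Rightarrow> ('r, 'a) module) \<Rightarrow> ('r, 'i \<Rightarrow> 'a) module" where
  "finite_dsum I V =
    \<lparr>carrier = (\<Pi>\<^sub>E i\<in>I. carrier (V i)),
     monoid.mult = undefined, one = undefined,
     ring.zero = (\<lambda>i\<in>I. \<zero>\<^bsub>V i\<^esub>), add = (\<lambda>c d. \<lambda>i\<in>I. c i \<oplus>\<^bsub>V i\<^esub> d i),
     smult = (\<lambda>a c. \<lambda>i\<in>I. a \<odot>\<^bsub>V i\<^esub> c i)\<rparr>"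

text \<open>The quotient \<open>Z / B\<close> of two submodules \<open>B \<subseteq> Z\<close> of \<open>V\<close>.\<close>

definition subquotient :: "('r, 'a) module \<Rightarrow> 'a set \<Rightarrow> 'a set \<Rightarrow> ('r, 'a set) module" where
  "subquotient V Z B =
    \<lparr>carrier = (\<lambda>z. B +>\<^bsub>V\<^esub> z) ` Z,
     monoid.mult = undefined, one = undefined,
     ring.zero = B, add = set_add V,
     smult = (\<lambda>a X. \<Union>x\<in>X. B +>\<^bsub>V\<^esub> (a \<odot>\<^bsub>V\<^esub> x))\<rparr>"


section \<open>Categories and modules over them\<close>

text \<open>
  Hom sets need not be disjoint, so composition takes the objects as arguments:
  \<open>Comp C x y z b a\<close> is the composite of \<open>a : x \<rightarrow> y\<close> and \<open>b : y \<rightarrow> z\<close>.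
\<close>

record ('o, 'a) cat =
  Ob :: "'o set"
  Arr :: "'o \<Rightarrow> 'o \<Rightarrow> 'a set"
  Comp :: "'o \<Rightarrow> 'o \<Rightarrow> 'o \<Rightarrow> 'a \<Rightarrow> 'a \<Rightarrow> 'a"
  Ident :: "'o \<Rightarrow> 'a"

locale category =
  fixes C :: "('o, 'a) cat"
  assumes Ident_closed: "x \<in> Ob C \<Longrightarrow> Ident C x \<in> Arr C x x"
    and Comp_closed: "\<lbrakk>x \<in> Ob C; y \<in> Ob C; z \<in> Ob C; a \<in> Arr C x y; b \<in> Arr C y z\<rbrakk> \<Longrightarrow>
      Comp C x y z b a \<in> Arr C x z"
    and Comp_Ident_right: "\<lbrakk>x \<in> Ob C; y \<in> Ob C; a \<in> Arr C x y\<rbrakk> \<Longrightarrow>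
      Comp C x x y a (Ident C x) = a"
    and Comp_Ident_left: "\<lbrakk>x \<in> Ob C; y \<in> Ob C; a \<in> Arr C x y\<rbrakk> \<Longrightarrow>
      Comp C x y y (Ident C y) a = a"
    and Comp_assoc: "\<lbrakk>w \<in> Ob C; x \<in> Ob C; y \<in> Ob C; z \<in> Ob C;
        a \<in> Arr C w x; b \<in> Arr C x y; c \<in> Arr C y z\<rbrakk> \<Longrightarrow>
      Comp C w x z (Comp C x y z c b) a = Comp C w y z c (Comp C w x y b a)"

definition aut_group :: "('o, 'a) cat \<Rightarrow> 'o \<Rightarrow> 'a monoid" where
  "aut_group C x =
    \<lparr>carrier = {a \<in> Arr C x x. \<exists>b\<in>Arr C x x.
        Comp C x x x b a = Ident C x \<and> Comp C x x x a b = Ident C x},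
     monoid.mult = Comp C x x x, one = Ident C x\<rparr>"

record ('o, 'a, 'k, 'm) cat_mod =
  ob_mod :: "'o \<Rightarrow> ('k, 'm) module"
  arr_map :: "'o \<Rightarrow> 'o \<Rightarrow> 'a \<Rightarrow> 'm \<Rightarrow> 'm"

locale cat_module = category C
  for K :: "('k, 'x) ring_scheme" and C :: "('o, 'a) cat"
    and M :: "('o, 'a, 'k, 'm) cat_mod" +
  assumes ob_module: "x \<in> Ob C \<Longrightarrow> module K (ob_mod M x)"
    and arr_linear: "\<lbrakk>x \<in> Ob C; y \<in> Ob C; a \<in> Arr C x y\<rbrakk> \<Longrightarrow>
      arr_map M x y a \<in> linear_maps K (ob_mod M x) (ob_mod M y)"
    and arr_Ident: "\<lbrakk>x \<in> Ob C; m \<in> carrier (ob_mod M x)\<rbrakk> \<Longrightarrow>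
      arr_map M x x (Ident C x) m = m"
    and arr_Comp: "\<lbrakk>x \<in> Ob C; y \<in> Ob C; z \<in> Ob C; a \<in> Arr C x y; b \<in> Arr C y z;
        m \<in> carrier (ob_mod M x)\<rbrakk> \<Longrightarrow>
      arr_map M x z (Comp C x y z b a) m = arr_map M y z b (arr_map M x y a m)"

definition cat_module_homs :: "('k, 'x) ring_scheme \<Rightarrow> ('o, 'a) cat \<Rightarrow>
  ('o, 'a, 'k, 'm) cat_mod \<Rightarrow> ('o, 'a, 'k, 'n) cat_mod \<Rightarrow> ('o \<Rightarrow> 'm \<Rightarrow> 'n) set" where
  "cat_module_homs K C M N = {\<eta>.
     (\<forall>x\<in>Ob C. \<eta> x \<in> linear_maps K (ob_mod M x) (ob_mod N x)) \<and>
     (\<forall>x\<in>Ob C. \<forall>y\<in>Ob C. \<forall>a\<in>Arr C x y. \<forall>m\<in>carrier (ob_mod M x).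
        \<eta> y (arr_map M x y a m) = arr_map N x y a (\<eta> x m))}"

definition principal_projective ::
  "('k, 'x) ring_scheme \<Rightarrow> ('o, 'a) cat \<Rightarrow> 'o \<Rightarrow> ('o, 'a, 'k, 'a \<Rightarrow> 'k) cat_mod" where
  "principal_projective K C x =
    \<lparr>ob_mod = (\<lambda>y. free_module K (Arr C x y)),
     arr_map = (\<lambda>y z a. finsupp_map (regular_module K) (regular_module K) (Arr C x z)
       (Comp C x y z a) (\<lambda>k. k))\<rparr>"

definition cat_mod_dsum ::
  "'i set \<Rightarrow> ('i \<Rightarrow> ('o, 'a, 'k, 'm) cat_mod) \<Rightarrow> ('o, 'a, 'k, 'i \<Rightarrow> 'm) cat_mod" where
  "cat_mod_dsum I M =
    \<lparr>ob_mod = (\<lambda>y. finite_dsum I (\<lambda>i. ob_mod (M i) y)),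
     arr_map = (\<lambda>y z a c. \<lambda>i\<in>I. arr_map (M i) y z a (c i))\<rparr>"

definition fg_cat_module ::
  "('k, 'x) ring_scheme \<Rightarrow> ('o, 'a) cat \<Rightarrow> ('o, 'a, 'k, 'm) cat_mod \<Rightarrow> bool" where
  "fg_cat_module K C M \<longleftrightarrow> cat_module K C M \<and>
     (\<exists>(n :: nat) x. (\<forall>i<n. x i \<in> Ob C) \<and>
       (let P = cat_mod_dsum {..<n} (\<lambda>i. principal_projective K C (x i)) in
        \<exists>\<eta>\<in>cat_module_homs K C P M.
          \<forall>y\<in>Ob C. \<eta> y ` carrier (ob_mod P y) = carrier (ob_mod M y)))"


section \<open>The categories OI and OVI(R)\<close>

text \<open>
  To have small categories, underlying sets of totally ordered sets are taken inside \<^typ>\<open>nat\<close>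
  and those of free modules inside \<^typ>\<open>nat \<Rightarrow> 'r\<close>; every finite totally ordered set, and every
  free module with a finite ordered basis, is isomorphic to one of these.
\<close>

type_synonym ordset = "nat set \<times> nat rel"

definition oi_hom :: "ordset \<Rightarrow> ordset \<Rightarrow> (nat \<Rightarrow> nat) set" where
  "oi_hom S T = {f \<in> fst S \<rightarrow>\<^sub>E fst T. inj_on f (fst S) \<and>
     (\<forall>i j. (i, j) \<in> snd S \<longrightarrow> (f i, f j) \<in> snd T)}"

definition OI :: "(ordset, nat \<Rightarrow> nat) cat" where
  "OI = \<lparr>Ob = {S. finite (fst S) \<and> linear_order_on (fst S) (snd S)},
     Arr = oi_hom,
     Comp = (\<lambda>S T U g f. compose (fst S) g f),
     Ident = (\<lambda>S. \<lambda>i\<in>fst S. i)\<rparr>"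

record 'r ovi_obj =
  omod :: "('r, nat \<Rightarrow> 'r) module"
  oind :: ordset
  obas :: "nat \<Rightarrow> nat \<Rightarrow> 'r"

type_synonym 'r ovi_arr = "((nat \<Rightarrow> 'r) \<Rightarrow> (nat \<Rightarrow> 'r)) \<times> (nat \<Rightarrow> nat)"

definition strictly_below :: "ordset \<Rightarrow> nat \<Rightarrow> nat set" where
  "strictly_below S i = {j \<in> fst S. (j, i) \<in> snd S \<and> j \<noteq> i}"

definition ovi_hom ::
  "('r, 'x) ring_scheme \<Rightarrow> 'r ovi_obj \<Rightarrow> 'r ovi_obj \<Rightarrow> 'r ovi_arr set" where
  "ovi_hom R X Y = {(f, f0).
     f \<in> linear_maps R (omod X) (omod Y) \<inter> extensional (carrier (omod X)) \<and>
     f0 \<in> oi_hom (oind X) (oind Y) \<and>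
     (\<forall>i\<in>fst (oind X). \<exists>a \<in> strictly_below (oind Y) (f0 i) \<rightarrow> carrier R.
        f (obas X i) = obas Y (f0 i) \<oplus>\<^bsub>omod Y\<^esub>
          (\<Oplus>\<^bsub>omod Y\<^esub>j\<in>strictly_below (oind Y) (f0 i). a j \<odot>\<^bsub>omod Y\<^esub> obas Y j))}"

definition OVI :: "('r, 'x) ring_scheme \<Rightarrow> ('r ovi_obj, 'r ovi_arr) cat" where
  "OVI R = \<lparr>Ob = {X. left_module R (omod X) \<and> oind X \<in> Ob OI \<and>
       is_basis R (omod X) (fst (oind X)) (obas X)},
     Arr = ovi_hom R,
     Comp = (\<lambda>X Y Z g f. (compose (carrier (omod X)) (fst g) (fst f),
                          compose (fst (oind X)) (snd g) (snd f))),
     Ident = (\<lambda>X. (\<lambda>v\<in>carrier (omod X). v, \<lambda>i\<in>fst (oind X). i))\<rparr>"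

text \<open>The functor \<open>S \<mapsto> R[S]\<close> from OI to OVI(R).\<close>

definition std_obj :: "('r, 'x) ring_scheme \<Rightarrow> ordset \<Rightarrow> 'r ovi_obj" where
  "std_obj R S = \<lparr>omod = free_module R (fst S), oind = S,
     obas = (\<lambda>i\<in>fst S. single (regular_module R) i \<one>\<^bsub>R\<^esub>)\<rparr>"

text \<open>
  The linear map \<open>R[S] \<rightarrow> R[T]\<close> with matrix \<open>A\<close>: it sends the basis vector \<open>s\<close> to the sum of
  the \<open>A t s \<cdot> t\<close>.  As these are left modules, coordinates multiply entries from the left.
\<close>

definition matrix_map :: "('r, 'x) ring_scheme \<Rightarrow> nat set \<Rightarrow> nat set \<Rightarrow>
  (nat \<Rightarrow> nat \<Rightarrow> 'r) \<Rightarrow> (nat \<Rightarrow> 'r) \<Rightarrow> nat \<Rightarrow> 'r" where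
  "matrix_map R S T A = (\<lambda>c\<in>carrier (free_module R S).
     \<lambda>t. if t \<in> T then \<Oplus>\<^bsub>R\<^esub>s\<in>S. c s \<otimes>\<^bsub>R\<^esub> A t s else \<zero>\<^bsub>R\<^esub>)"

definition std_arr ::
  "('r, 'x) ring_scheme \<Rightarrow> ordset \<Rightarrow> ordset \<Rightarrow> (nat \<Rightarrow> nat) \<Rightarrow> 'r ovi_arr" where
  "std_arr R S T f = (matrix_map R (fst S) (fst T)
     (\<lambda>t s. if t = f s then \<one>\<^bsub>R\<^esub> else \<zero>\<^bsub>R\<^esub>), f)"

text \<open>
  \<open>unitriangular R S\<close> is the group \<open>U\<^sub>n(R)\<close> for \<open>S = [n]\<close>: the automorphisms of \<open>R[S]\<close> in OVI(R).
  The matrix of \<open>g\<close> has \<open>(a, b)\<close> entry \<open>matrix_entry R g a b\<close>; it is upper triangular with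
  diagonal entries 1.  The group law is composition of maps (for left modules over a
  noncommutative ring, this multiplies the entries of the two matrices in the opposite order).
\<close>

definition unitriangular :: "('r, 'x) ring_scheme \<Rightarrow> ordset \<Rightarrow> 'r ovi_arr monoid" where
  "unitriangular R S = aut_group (OVI R) (std_obj R S)"

definition matrix_entry :: "('r, 'x) ring_scheme \<Rightarrow> 'r ovi_arr \<Rightarrow> nat \<Rightarrow> nat \<Rightarrow> 'r" where
  "matrix_entry R g a b = fst g (single (regular_module R) b \<one>\<^bsub>R\<^esub>) a"

text \<open>
  The homomorphism \<open>f\<^sub>*\<close>: the \<open>(f a, f b)\<close> entry of \<open>f\<^sub>* g\<close> is the \<open>(a, b)\<close> entry of \<open>g\<close>, and all
  other entries agree with those of the identity matrix.
\<close>

definition unitriangular_push :: "('r, 'x) ring_scheme \<Rightarrow> ordset \<Rightarrow> ordset \<Rightarrow>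
  (nat \<Rightarrow> nat) \<Rightarrow> 'r ovi_arr \<Rightarrow> 'r ovi_arr" where
  "unitriangular_push R S T f g = (matrix_map R (fst T) (fst T)
     (\<lambda>a b. if a \<in> f ` fst S \<and> b \<in> f ` fst S
            then matrix_entry R g (inv_into (fst S) f a) (inv_into (fst S) f b)
            else if a = b then \<one>\<^bsub>R\<^esub> else \<zero>\<^bsub>R\<^esub>),
     \<lambda>i\<in>fst T. i)"


section \<open>Group homology\<close>

text \<open>
  Group homology with coefficients in a representation \<open>V\<close> of \<open>G\<close> (with action \<open>act\<close>), as the
  homology of \<open>F \<otimes>\<^sub>G V\<close> for the bar resolution \<open>F\<close>.  In degree \<open>n\<close> this is the direct sum of
  copies of \<open>V\<close> indexed by \<open>n\<close>-tuples of group elements, with differential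
  \<open>m[g\<^sub>1|\<dots>|g\<^sub>n] \<mapsto> (g\<^sub>1\<^sup>-\<^sup>1 m)[g\<^sub>2|\<dots>|g\<^sub>n] + \<Sum>\<^sub>j (-1)\<^sup>j m[g\<^sub>1|\<dots>|g\<^sub>jg\<^sub>j\<^sub>+\<^sub>1|\<dots>|g\<^sub>n] + (-1)\<^sup>n m[g\<^sub>1|\<dots>|g\<^sub>n\<^sub>-\<^sub>1]\<close>.
\<close>

definition tuples :: "('g, 'x) monoid_scheme \<Rightarrow> nat \<Rightarrow> 'g list set" where
  "tuples G n = {gs. length gs = n \<and> set gs \<subseteq> carrier G}"

definition bar_chains ::
  "('g, 'x) monoid_scheme \<Rightarrow> ('k, 'm) module \<Rightarrow> nat \<Rightarrow> ('k, 'g list \<Rightarrow> 'm) module" where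
  "bar_chains G V n = finsupp_module V (tuples G n)"

definition bar_face :: "('g, 'x) monoid_scheme \<Rightarrow> ('k, 'm) module \<Rightarrow> ('g \<Rightarrow> 'm \<Rightarrow> 'm) \<Rightarrow>
  nat \<Rightarrow> 'g list \<Rightarrow> 'm \<Rightarrow> 'g list \<Rightarrow> 'm" where
  "bar_face G V act j gs m =
    (if j = 0 then single V (tl gs) (act (inv\<^bsub>G\<^esub> (hd gs)) m)
     else if j = length gs then single V (butlast gs) m
     else single V (take (j - 1) gs @ [gs ! (j - 1) \<otimes>\<^bsub>G\<^esub> gs ! j] @ drop (j + 1) gs) m)"

text \<open>The differential from degree \<open>n\<close> to degree \<open>n - 1\<close>, used for \<open>n \<ge> 1\<close> only.\<close>

definition bar_boundary :: "('g, 'x) monoid_scheme \<Rightarrow> ('k, 'm) module \<Rightarrow> ('g \<Rightarrow> 'm \<Rightarrow> 'm) \<Rightarrow>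
  nat \<Rightarrow> ('g list \<Rightarrow> 'm) \<Rightarrow> 'g list \<Rightarrow> 'm" where
  "bar_boundary G V act n c =
    (let D = bar_chains G V (n - 1) in
     \<Oplus>\<^bsub>D\<^esub>gs\<in>{gs. c gs \<noteq> \<zero>\<^bsub>V\<^esub>}. \<Oplus>\<^bsub>D\<^esub>j\<in>{0..n}.
       (if even j then bar_face G V act j gs (c gs)
        else \<ominus>\<^bsub>D\<^esub> bar_face G V act j gs (c gs)))"

definition bar_cycles :: "('g, 'x) monoid_scheme \<Rightarrow> ('k, 'm) module \<Rightarrow> ('g \<Rightarrow> 'm \<Rightarrow> 'm) \<Rightarrow>
  nat \<Rightarrow> ('g list \<Rightarrow> 'm) set" where
  "bar_cycles G V act n = {c \<in> carrier (bar_chains G V n).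
     n \<ge> 1 \<longrightarrow> bar_boundary G V act n c = \<zero>\<^bsub>bar_chains G V (n - 1)\<^esub>}"

definition bar_boundaries :: "('g, 'x) monoid_scheme \<Rightarrow> ('k, 'm) module \<Rightarrow> ('g \<Rightarrow> 'm \<Rightarrow> 'm) \<Rightarrow>
  nat \<Rightarrow> ('g list \<Rightarrow> 'm) set" where
  "bar_boundaries G V act n =
     bar_boundary G V act (Suc n) ` carrier (bar_chains G V (Suc n))"

definition group_homology :: "('g, 'x) monoid_scheme \<Rightarrow> ('k, 'm) module \<Rightarrow>
  ('g \<Rightarrow> 'm \<Rightarrow> 'm) \<Rightarrow> nat \<Rightarrow> ('k, ('g list \<Rightarrow> 'm) set) module" where
  "group_homology G V act n =
     subquotient (bar_chains G V n) (bar_cycles G V act n) (bar_boundaries G V act n)"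

text \<open>
  The map on homology induced by a homomorphism \<open>\<phi> : G \<rightarrow> H\<close> and a \<open>\<phi>\<close>-equivariant linear map
  \<open>u : V \<rightarrow> W\<close>.
\<close>

definition group_homology_map :: "('k, 'm) module \<Rightarrow>
  ('h, 'x) monoid_scheme \<Rightarrow> ('k, 'n) module \<Rightarrow> ('h \<Rightarrow> 'n \<Rightarrow> 'n) \<Rightarrow> nat \<Rightarrow>
  ('g \<Rightarrow> 'h) \<Rightarrow> ('m \<Rightarrow> 'n) \<Rightarrow> ('g list \<Rightarrow> 'm) set \<Rightarrow> ('h list \<Rightarrow> 'n) set" where
  "group_homology_map V H W act n \<phi> u X =
     (\<Union>c\<in>X. bar_boundaries H W act n +>\<^bsub>bar_chains H W n\<^esub>
               finsupp_map V W (tuples H n) (map \<phi>) u c)"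


section \<open>The homology of unitriangular groups as an OI-module\<close>

definition homology_U :: "('r, 'x) ring_scheme \<Rightarrow> ('r ovi_obj, 'r ovi_arr, 'k, 'm) cat_mod \<Rightarrow>
  nat \<Rightarrow> (ordset, nat \<Rightarrow> nat, 'k, ('r ovi_arr list \<Rightarrow> 'm) set) cat_mod" where
  "homology_U R M i =
    \<lparr>ob_mod = (\<lambda>S. group_homology (unitriangular R S) (ob_mod M (std_obj R S))
       (arr_map M (std_obj R S) (std_obj R S)) i),
     arr_map = (\<lambda>S T f. group_homology_map (ob_mod M (std_obj R S))
       (unitriangular R T) (ob_mod M (std_obj R T))
       (arr_map M (std_obj R T) (std_obj R T)) i
       (unitriangular_push R S T f)
       (arr_map M (std_obj R S) (std_obj R T) (std_arr R S T f)))\<rparr>"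

end

theory Submission
  imports Defs "HOL-Library.Sublist" "HOL-Library.Ramsey"
begin

text \<open>
 Finitely generated OVI(R)-modules are noetherian: as the additive group of R is finitely generated,
 the morphisms out of an object embed into words over a well-quasi-ordered alphabet, so Higman's
 lemma and a Groebner basis argument apply. Dimension shifting along a presentation by principal
 projectives \<open>P_d\<close> then reduces the claim about \<open>H_i\<close> to \<open>P_d\<close>, by induction on i: only \<open>H_i(U, P_d)\<close> and
 \<open>H_j\<close> with \<open>j < i\<close> matter. For \<open>P_d\<close>, the morphisms to \<open>R^(n+1)\<close> hitting the last basis vector span an
 induced representation, whose homology is by Shapiro's lemma that of \<open>P_(d-1)\<close> over \<open>U_n\<close>. The other
 morphisms are compared with the kernel of the equivariant map \<open>P_(d+1) \<rightarrow> P_d\<close> that restricts the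
 morphisms hitting the last basis vector to the first d basis vectors and kills the others; this
 kernel is finitely generated, so its homology is known one degree lower.
\<close>

\<comment> \<open>Long exact sequences are never formed. Finite generation of \<open>H_i\<close> is
  the statement that the cycles are generated modulo the boundaries, and a connecting map is
  represented by the boundaries of all lifts of cycles. These boundaries form an OI-submodule of the
  cycles of a module whose homology is known one degree lower, so noetherianity is needed for
  OI-modules as well. Two obstacles shape the rest. The entries of R carry no useful order, so each
  is lifted to a vector of natural numbers; a morphism then has many names, and a leading term
  belongs to a name and not to an element. Moreover the restriction from \<open>P_(d+1)\<close> to
  \<open>P_d\<close> is equivariant for each n but not natural in n: after a morphism that moves the
  last index off the last place it gives zero. Still its kernel is a submodule, and transporting a
  lift of a cycle gives a lift of the transported cycle or of zero, which suffices. What the kernel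
  does not see at n+1 comes from n, whence the final argument is an induction on n that starts at
  the trivial group.\<close>
syntax (input) "_index" :: "logic \<Rightarrow> index" ("(\<open>unbreakable notation=\<open>index\<close>\<close>\<^sub>_)" [1000])
abbreviation (input) iff_ascii (infixr "<->" 25) where "A <-> B \<equiv> A \<longleftrightarrow> B"
abbreviation (input) "El \<equiv> carrier"
abbreviation (input) "Lin \<equiv> linear_maps"
abbreviation (input) "FS \<equiv> finsupp_module"
abbreviation (input) "Reg \<equiv> regular_module"
abbreviation (input) "LMod \<equiv> left_module"
abbreviation (input) "PPr \<equiv> principal_projective"
abbreviation (input) "UT \<equiv> unitriangular"
abbreviation (input) "supp V c \<equiv> {x. c x \<noteq> \<zero>\<^sub>V}"

section \<open>Linear maps and finitely supported functions\<close>

lemma linI: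
 assumes "!!x. x : El V ==> f x : El W"
  and "!!x y. x : El V ==> y : El V ==> f (x \<oplus>\<^sub>V y) = f x \<oplus>\<^sub>W f y"
  and "!!a x. a : El R ==> x : El V ==> f (a \<odot>\<^sub>V x) = a \<odot>\<^sub>W f x"
 shows "f : Lin R V W"
 using assms by (auto simp: linear_maps_def)

lemma lin_cl: "f : Lin R V W ==> x : El V ==> f x : El W"
 by (auto simp: linear_maps_def)

lemma lin_add: "f : Lin R V W ==> x : El V ==> y : El V ==>
  f (x \<oplus>\<^sub>V y) = f x \<oplus>\<^sub>W f y"
 by (auto simp: linear_maps_def)

lemma lin_smult: "f : Lin R V W ==> a : El R ==> x : El V ==>
  f (a \<odot>\<^sub>V x) = a \<odot>\<^sub>W f x"
 by (auto simp: linear_maps_def)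

lemma lin_id: "(%x. x) : Lin R V V"
 by (rule linI) auto

lemma lin_comp:
 assumes "f : Lin R V W" "g : Lin R W Z"
 shows "(%x. g (f x)) : Lin R V Z"
 by (rule linI)
   (simp_all add: lin_cl[OF assms(1)] lin_add[OF assms(1)] lin_smult[OF assms(1)]
    lin_cl[OF assms(2)] lin_add[OF assms(2)] lin_smult[OF assms(2)])

lemma lin_cong:
 assumes "f : Lin R V W" "!!x. x : El V ==> g x = f x" "LMod R V"
 shows "g : Lin R V W"
proof -
 interpret V: left_module R V by fact
 show ?thesis
  by (rule linI)
    (use assms(1,2) V.smult_closed in \<open>auto simp: lin_cl lin_add lin_smult\<close>)
qed

context left_module
begin

lemma smult_l_null: "x : El M ==> \<zero> \<odot>\<^sub>M x = \<zero>\<^sub>M"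
 using smult_l_distr[of \<zero> \<zero> x] smult_closed[of \<zero> x]
 by (metis M.add.l_cancel_one R.add.one_closed R.add.l_one)

lemma smult_r_null: "a : El R ==> a \<odot>\<^sub>M \<zero>\<^sub>M = \<zero>\<^sub>M"
 using smult_r_distr[of a "\<zero>\<^sub>M" "\<zero>\<^sub>M"] smult_closed[of a "\<zero>\<^sub>M"]
 by (metis M.add.l_cancel_one M.zero_closed M.l_zero)

lemma smult_l_minus: "a : El R ==> x : El M ==> (\<ominus> a) \<odot>\<^sub>M x = \<ominus>\<^sub>M (a \<odot>\<^sub>M x)"
 using smult_l_distr[of "\<ominus> a" a x] smult_closed[of a x] smult_closed[of "\<ominus> a" x]
 by (metis M.minus_equality R.add.inv_closed R.l_neg smult_l_null)

lemma minus_one_smult: "x : El M ==> (\<ominus> \<one>) \<odot>\<^sub>M x = \<ominus>\<^sub>M x"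
 by (simp add: smult_l_minus smult_one)

lemma smult_r_minus: "a : El R ==> x : El M ==> a \<odot>\<^sub>M (\<ominus>\<^sub>M x) = \<ominus>\<^sub>M (a \<odot>\<^sub>M x)"
 using smult_r_distr[of a "\<ominus>\<^sub>M x" x] smult_closed[of a x] smult_closed[of a "\<ominus>\<^sub>M x"]
 by (metis M.minus_equality M.add.inv_closed M.l_neg smult_r_null)

end

lemma module_lm: "module K V ==> LMod K V"
proof -
 assume "module K V"
 then interpret module K V .
 show ?thesis
  by unfold_locales (auto simp: smult_l_distr smult_r_distr smult_assoc1)
qed

lemma lm_module: "cring K ==> LMod K V ==> module K V"
proof -
 assume "cring K" "LMod K V"
 interpret left_module K V by fact
 interpret cring K by fact
 show ?thesis
  by (rule moduleI) (auto simp: smult_l_distr smult_r_distr smult_assoc1 smult_one smult_closed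
    M.abelian_group_axioms is_cring)
qed

lemma lmI:
 assumes "ring R"
  and closed: "!!x y. x : El V ==> y : El V ==> x \<oplus>\<^sub>V y : El V"
  and zero: "\<zero>\<^sub>V : El V"
  and assoc: "!!x y z. x : El V ==> y : El V ==> z : El V ==>
   (x \<oplus>\<^sub>V y) \<oplus>\<^sub>V z = x \<oplus>\<^sub>V (y \<oplus>\<^sub>V z)"
  and comm: "!!x y. x : El V ==> y : El V ==> x \<oplus>\<^sub>V y = y \<oplus>\<^sub>V x"
  and l_zero: "!!x. x : El V ==> \<zero>\<^sub>V \<oplus>\<^sub>V x = x"
  and l_inv: "!!x. x : El V ==> EX y:El V. y \<oplus>\<^sub>V x = \<zero>\<^sub>V"
  and "!!a x. a : El R ==> x : El V ==> a \<odot>\<^sub>V x : El V"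
  and "!!a b x. a : El R ==> b : El R ==> x : El V ==>
    (a \<oplus>\<^sub>R b) \<odot>\<^sub>V x = a \<odot>\<^sub>V x \<oplus>\<^sub>V b \<odot>\<^sub>V x"
  and "!!a x y. a : El R ==> x : El V ==> y : El V ==>
    a \<odot>\<^sub>V (x \<oplus>\<^sub>V y) = a \<odot>\<^sub>V x \<oplus>\<^sub>V a \<odot>\<^sub>V y"
  and "!!a b x. a : El R ==> b : El R ==> x : El V ==>
    (a \<otimes>\<^sub>R b) \<odot>\<^sub>V x = a \<odot>\<^sub>V (b \<odot>\<^sub>V x)"
  and "!!x. x : El V ==> \<one>\<^sub>R \<odot>\<^sub>V x = x"
 shows "LMod R V"
by (use abelian_groupI left_module_def left_module_axioms_def assms in \<open>blast\<close>)

context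
 fixes R :: "('r, 'x) ring_scheme" and V :: "('r, 'a) module" and W :: "('r, 'b) module"
 assumes V: "LMod R V" and W: "LMod R W"
begin

interpretation V: left_module R V by (rule V)
interpretation W: left_module R W by (rule W)

lemma lin_zero: "f : Lin R V W ==> f \<zero>\<^sub>V = \<zero>\<^sub>W"
 using lin_smult[of f R V W "\<zero>\<^sub>R" "\<zero>\<^sub>V"] lin_cl[of f R V W "\<zero>\<^sub>V"]
 by (simp add: V.smult_l_null W.smult_l_null)

lemma lin_neg: "f : Lin R V W ==> x : El V ==> f (\<ominus>\<^sub>V x) = \<ominus>\<^sub>W f x"
 using lin_smult[of f R V W "\<ominus>\<^sub>R \<one>\<^sub>R" x] lin_cl[of f R V W x]
 by (simp add: V.minus_one_smult W.minus_one_smult)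

lemma lin_diff: "f : Lin R V W ==> x : El V ==> y : El V ==>
  f (x \<ominus>\<^sub>V y) = f x \<ominus>\<^sub>W f y"
 by (simp add: a_minus_def lin_add lin_neg)

lemma lin_0: "(%_. \<zero>\<^sub>W) : Lin R V W"
 by (rule linI) (auto simp: W.smult_r_null)

lemma lin_sum:
 assumes "f : Lin R V W" "g : Lin R V W"
 shows "(%x. f x \<oplus>\<^sub>W g x) : Lin R V W"
 by (rule linI)
   (use assms in \<open>auto simp: lin_add lin_smult lin_cl W.smult_r_distr W.a_ac\<close>)

lemma lin_uminus:
 assumes "f : Lin R V W"
 shows "(%x. \<ominus>\<^sub>W f x) : Lin R V W"
 by (rule linI)
   (use assms in \<open>auto simp: lin_add lin_smult lin_cl W.smult_r_minus W.minus_add\<close>)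

lemma lin_minus:
 assumes "f : Lin R V W" "g : Lin R V W"
 shows "(%x. f x \<ominus>\<^sub>W g x) : Lin R V W"
 unfolding a_minus_def by (intro lin_sum lin_uminus assms)

lemma lin_sums:
 assumes "!!i. i : I ==> f i : Lin R V W"
 shows "(%x. \<Oplus>\<^sub>W i\<in>I. f i x) : Lin R V W"
proof (cases "finite I")
 case True
 thus ?thesis using assms
 proof (induction I)
  case empty
  show ?case by (simp add: lin_0)
 next
  case (insert i I)
  have "(%x. f i x \<oplus>\<^sub>W (\<Oplus>\<^sub>W i\<in>I. f i x)) : Lin R V W"
   using insert by (intro lin_sum) auto
  moreover have "(\<Oplus>\<^sub>W i\<in>insert i I. f i x) = f i x \<oplus>\<^sub>W (\<Oplus>\<^sub>W i\<in>I. f i x)" if "x : El V" for x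
   using insert.hyps lin_cl[OF insert.prems that] by (intro W.finsum_insert) auto
  ultimately show ?case
   by (rule lin_cong[OF _ _ V])
 qed
next
 case False
 thus ?thesis by (simp add: lin_0)
qed

lemma lin_finsum:
 assumes "f : Lin R V W" "g : I \<rightarrow> El V"
 shows "f (\<Oplus>\<^sub>V i\<in>I. g i) = (\<Oplus>\<^sub>W i\<in>I. f (g i))"
proof (cases "finite I")
 case True
 thus ?thesis using assms(2)
  by (induction I) (use assms(1) in \<open>auto simp: lin_zero lin_add lin_cl Pi_def\<close>)
qed (use assms in \<open>simp add: lin_zero\<close>)

end

section \<open>Direct sums of copies of a module\<close>

lemma fs_simps [simp]:
 "\<zero>\<^sub>(FS V X) = (%x. \<zero>\<^sub>V)"
 "c \<oplus>\<^sub>(FS V X) d = (%x. c x \<oplus>\<^sub>V d x)"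
 "a \<odot>\<^sub>(FS V X) c = (%x. a \<odot>\<^sub>V c x)"
 by (auto simp: finsupp_module_def)

lemma fs_iff:
 "c : El (FS V X) <-> (ALL x:X. c x : El V) & (ALL x. x ~: X --> c x = \<zero>\<^sub>V) &
   finite (supp V c)"
 by (auto simp: finsupp_module_def)

context
 fixes R :: "('r, 'x) ring_scheme" and V :: "('r, 'a) module"
 assumes V: "LMod R V"
begin

interpretation V: left_module R V by (rule V)

lemma fs_val: "c : El (FS V X) ==> c x : El V"
 by (cases "x : X") (auto simp: fs_iff)

lemma fs_lm: "LMod R (FS V X)"
proof (rule lmI)
 show "ring R" by (rule V.R.ring_axioms)
 fix c d assume c: "c : El (FS V X)" and d: "d : El (FS V X)"
 have "{x. c x \<oplus>\<^sub>V d x ~= \<zero>\<^sub>V} <= supp V c \<union> supp V d" by auto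
 thus "c \<oplus>\<^sub>(FS V X) d : El (FS V X)"
  using c d by (auto simp: fs_iff intro: finite_subset)
next
 fix a c assume a: "a : El R" and c: "c : El (FS V X)"
 have "{x. a \<odot>\<^sub>V c x ~= \<zero>\<^sub>V} <= supp V c" using a by (auto simp: V.smult_r_null)
 thus "a \<odot>\<^sub>(FS V X) c : El (FS V X)"
  using a c by (auto simp: fs_iff V.smult_closed V.smult_r_null intro: finite_subset)
next
 fix c assume c: "c : El (FS V X)"
 have v: "c x : El V" for x using c by (rule fs_val)
 show "EX d:El (FS V X). d \<oplus>\<^sub>(FS V X) c = \<zero>\<^sub>(FS V X)"
 proof (rule bexI[of _ "%x. \<ominus>\<^sub>V c x"])
  have "{x. \<ominus>\<^sub>V c x ~= \<zero>\<^sub>V} <= supp V c" by auto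
  thus "(%x. \<ominus>\<^sub>V c x) : El (FS V X)"
   using c by (auto simp: fs_iff intro: finite_subset)
 qed (use v in \<open>auto simp: V.l_neg\<close>)
qed (auto simp: fs_val V.a_ac V.smult_l_distr V.smult_r_distr V.smult_assoc1 V.smult_one fun_eq_iff,
 auto simp: fs_iff)

lemma fs_a_inv:
 assumes "c : El (FS V X)"
 shows "\<ominus>\<^sub>(FS V X) c = (%x. \<ominus>\<^sub>V c x)"
proof -
 interpret F: left_module R "FS V X" by (rule fs_lm)
 have v: "c x : El V" for x using assms by (rule fs_val)
 have "{x. \<ominus>\<^sub>V c x ~= \<zero>\<^sub>V} <= supp V c" by auto
 hence "(%x. \<ominus>\<^sub>V c x) : El (FS V X)"
  using assms by (auto simp: fs_iff intro: finite_subset)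
 moreover have "(%x. \<ominus>\<^sub>V c x) \<oplus>\<^sub>(FS V X) c = \<zero>\<^sub>(FS V X)"
  using v by (auto simp: V.l_neg)
 ultimately show ?thesis
  using F.M.minus_equality assms by blast
qed

lemma single_cl: "x : X ==> m : El V ==> single V x m : El (FS V X)"
 by (auto simp: fs_iff single_def)

lemma single_zero: "single V x \<zero>\<^sub>V = (%_. \<zero>\<^sub>V)"
 by (auto simp: single_def)

lemma single_lin: "x : X ==> single V x : Lin R V (FS V X)"
 by (rule linI) (auto simp: single_cl, auto simp: single_def V.smult_r_null)

text \<open>The values at the points of a finite set containing the support are split off one by
  one. That set may contain points outside \<open>X\<close>; there the value is zero and nothing is
  split off.\<close>

lemma fs_induct [consumes 1, case_names zero add]:
 assumes "c : El (FS V X)"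
  and zero: "P (%_. \<zero>\<^sub>V)"
  and add: "!!x m c. x : X ==> m : El V ==> c : El (FS V X) ==> P c ==>
   P (single V x m \<oplus>\<^sub>(FS V X) c)"
 shows "P c"
proof -
 have "ALL c:El (FS V X). supp V c <= S --> P c" if "finite S" for S
  using that
 proof (induction S)
  case empty
  have "c = (%_. \<zero>\<^sub>V)" if "supp V c <= {}" for c
   using that by auto
  thus ?case using zero by auto
 next
  case (insert x S)
  show ?case
  proof (intro ballI impI)
   fix c assume c: "c : El (FS V X)" and s: "supp V c <= insert x S"
   define d where "d = (%y. if y = x then \<zero>\<^sub>V else c y)"
   have "supp V d <= supp V c" by (auto simp: d_def)
   hence d: "d : El (FS V X)"
    using c by (auto simp: fs_iff d_def intro: finite_subset)
   have ds: "supp V d <= S" using s by (auto simp: d_def)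
   have v: "c y : El V" for y using c by (rule fs_val)
   show "P c"
   proof (cases "x : X")
    case True
    have "c = single V x (c x) \<oplus>\<^sub>(FS V X) d"
     using v by (auto simp: single_def d_def)
    thus ?thesis using add[OF True v d] insert.IH d ds by metis
   next
    case False
    hence "c = d" using c by (auto simp: d_def fs_iff)
    thus ?thesis using insert.IH d ds by auto
   qed
  qed
 qed
 thus ?thesis using assms(1) by (auto simp: fs_iff)
qed

end

text \<open>The map out of a direct sum with components \<open>F x\<close>. The sum runs over the
  support, so it makes sense for infinite index sets, and both \<open>finsupp_map\<close> and
  \<open>bar_boundary\<close> unfold to instances of it.\<close>

definition lsupp ::
 "('r, 'a) module => ('r, 'b) module => ('i => 'a => 'b) => ('i => 'a) => 'b" where
 "lsupp V D F c = (\<Oplus>\<^sub>D x\<in>supp V c. F x (c x))"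

context
 fixes R :: "('r, 'x) ring_scheme" and V :: "('r, 'a) module" and D :: "('r, 'b) module"
 assumes V: "LMod R V" and D: "LMod R D"
begin

interpretation V: left_module R V by (rule V)
interpretation D: left_module R D by (rule D)

text \<open>Nearly all identities between chain maps below are reduced by this to a single simplex
  with one coefficient.\<close>

lemma lin_eqI:
 assumes f: "f : Lin R (FS V X) D"
  and g: "g : Lin R (FS V X) D"
  and eq: "!!x m. x : X ==> m : El V ==> f (single V x m) = g (single V x m)"
  and c: "c : El (FS V X)"
 shows "f c = g c"
 using c
proof (induction rule: fs_induct[OF V, consumes 1, case_names zero add])
 case zero
 show ?case using lin_zero[OF fs_lm[OF V] D f]
   lin_zero[OF fs_lm[OF V] D g] by simp
next
 case (add x m c)
 thus ?case
  using single_cl[OF V add(1,2)] by (metis lin_add[OF f] lin_add[OF g] eq)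
qed

text \<open>The supports of \<open>c\<close>, \<open>d\<close> and their sum differ; linearity of
  \<open>lsupp\<close> is proved on one common finite set.\<close>

lemma lsupp_superset:
 assumes F: "!!x. x : X ==> F x : Lin R V D"
  and c: "c : El (FS V X)"
  and S: "finite S" "supp V c <= S" "S <= X"
 shows "lsupp V D F c = (\<Oplus>\<^sub>D x\<in>S. F x (c x))"
proof -
 have v: "c x : El V" for x using V c by (rule fs_val)
 have *: "F x (c x) : El D" if "x : S" for x
  using lin_cl[OF F v] S that by blast
 have z: "F x \<zero>\<^sub>V = \<zero>\<^sub>D" if "x : S" for x
  using lin_zero[OF V D F] S that by blast
 show ?thesis
  unfolding lsupp_def
  by (rule D.add.finprod_mono_neutral_cong_left) (use S * z in auto)
qed

lemma lsupp_lin: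
 assumes F: "!!x. x : X ==> F x : Lin R V D"
 shows "lsupp V D F : Lin R (FS V X) D"
proof (rule linI)
 interpret FV: left_module R "FS V X" by (rule fs_lm[OF V])
 have sub: "supp V c <= X" "finite (supp V c)"
  if "c : El (FS V X)" for c
  using that by (auto simp: fs_iff)
 have v: "c x : El V" if "c : El (FS V X)" for c x
  using V that by (rule fs_val)
 fix c assume c: "c : El (FS V X)"
 show "lsupp V D F c : El D"
  unfolding lsupp_def using sub[OF c] v[OF c] by (intro D.finsum_closed) (auto intro: lin_cl[OF F])
 { fix d assume d: "d : El (FS V X)"
  let ?S = "supp V c \<union> supp V d"
  have S: "finite ?S" "?S <= X" using sub c d by auto
  have cd: "{x. (c \<oplus>\<^sub>(FS V X) d) x ~= \<zero>\<^sub>V} <= ?S" by auto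
  have "lsupp V D F (c \<oplus>\<^sub>(FS V X) d) = (\<Oplus>\<^sub>D x\<in>?S. F x (c x \<oplus>\<^sub>V d x))"
   using lsupp_superset[OF F FV.a_closed[OF c d] S(1) cd S(2)] by simp
  also have "... = (\<Oplus>\<^sub>D x\<in>?S. F x (c x) \<oplus>\<^sub>D F x (d x))"
   using S v c d by (intro D.finsum_cong') (auto simp: lin_add[OF F] lin_cl[OF F])
  also have "... = (\<Oplus>\<^sub>D x\<in>?S. F x (c x)) \<oplus>\<^sub>D (\<Oplus>\<^sub>D x\<in>?S. F x (d x))"
   using S v c d by (intro D.finsum_addf) (auto simp: lin_cl[OF F])
  also have "... = lsupp V D F c \<oplus>\<^sub>D lsupp V D F d"
   using lsupp_superset[OF F c S(1) _ S(2)] lsupp_superset[OF F d S(1) _ S(2)] by simp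
  finally show "lsupp V D F (c \<oplus>\<^sub>(FS V X) d) =
   lsupp V D F c \<oplus>\<^sub>D lsupp V D F d" . }
 { fix a assume a: "a : El R"
  let ?S = "supp V c"
  have ac: "{x. (a \<odot>\<^sub>(FS V X) c) x ~= \<zero>\<^sub>V} <= ?S" using a by (auto simp: V.smult_r_null)
  have "(%x. a \<odot>\<^sub>D x) : {f. f : El D \<rightarrow> El D}" using a D.smult_closed by auto
  have sm: "a \<odot>\<^sub>D (\<Oplus>\<^sub>D x\<in>S. g x) = (\<Oplus>\<^sub>D x\<in>S. a \<odot>\<^sub>D g x)" if "finite S" "g : S \<rightarrow> El D" for S g
   using that by (induction S) (auto simp: D.smult_r_null D.smult_r_distr a D.smult_closed Pi_def)
  have "lsupp V D F (a \<odot>\<^sub>(FS V X) c) = (\<Oplus>\<^sub>D x\<in>?S. F x (a \<odot>\<^sub>V c x))"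
   using lsupp_superset[OF F FV.smult_closed[OF a c] sub(2)[OF c] ac sub(1)[OF c]] by simp
  also have "... = (\<Oplus>\<^sub>D x\<in>?S. a \<odot>\<^sub>D F x (c x))"
   using sub[OF c] v[OF c] a by (intro D.finsum_cong') (auto simp: lin_smult[OF F] D.smult_closed lin_cl[OF F])
  also have "... = a \<odot>\<^sub>D (\<Oplus>\<^sub>D x\<in>?S. F x (c x))"
   using sub[OF c] v[OF c] by (intro sm[symmetric]) (auto simp: lin_cl[OF F])
  finally show "lsupp V D F (a \<odot>\<^sub>(FS V X) c) = a \<odot>\<^sub>D lsupp V D F c"
   by (simp add: lsupp_def) }
qed

lemma lsupp_single:
 assumes F: "!!x. x : X ==> F x : Lin R V D" and "x : X" "m : El V"
 shows "lsupp V D F (single V x m) = F x m"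
proof -
 have s: "{y. single V x m y ~= \<zero>\<^sub>V} <= {x}" by (auto simp: single_def)
 have "lsupp V D F (single V x m) = (\<Oplus>\<^sub>D y\<in>{x}. F y (single V x m y))"
  by (rule lsupp_superset[OF F single_cl[OF V]]) (use assms s in auto)
 also have "... = F x m"
  using lin_cl[OF F] assms(2,3) by (simp add: single_def)
 finally show ?thesis .
qed

end

lemma fsm_eq_lift:
 "finsupp_map V W Y \<phi> u = lsupp V (FS W Y) (%x m. single W (\<phi> x) (u m))"
 by (auto simp: finsupp_map_def lsupp_def)

context
 fixes R :: "('r, 'x) ring_scheme" and V :: "('r, 'a) module" and W :: "('r, 'b) module"
  and X :: "'i set" and Y :: "'j set" and \<phi> u
 assumes V: "LMod R V" and W: "LMod R W"
  and \<phi>: "!!x. x : X ==> \<phi> x : Y" and u: "u : Lin R V W"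
begin

lemma fsm_lin:
 "finsupp_map V W Y \<phi> u : Lin R (FS V X) (FS W Y)"
 unfolding fsm_eq_lift
 by (rule lsupp_lin[OF V fs_lm[OF W]])
   (rule lin_comp[OF u single_lin[OF W \<phi>]])

lemma fsm_single:
 "x : X ==> m : El V ==> finsupp_map V W Y \<phi> u (single V x m) = single W (\<phi> x) (u m)"
 unfolding fsm_eq_lift
 by (rule lsupp_single[OF V fs_lm[OF W] lin_comp[OF u single_lin[OF W \<phi>]]])

end

lemma values_lin:
 assumes V: "LMod R V" and W: "LMod R W" and u: "u : Lin R V W"
 shows "(%c x. u (c x)) : Lin R (FS V X) (FS W X)"
proof (rule linI)
 note z = lin_zero[OF V W u]
 fix c assume c: "c : El (FS V X)"
 have "{x. u (c x) ~= \<zero>\<^sub>W} <= supp V c" using z by auto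
 thus "(%x. u (c x)) : El (FS W X)"
  using c u z by (auto simp: fs_iff lin_cl intro: finite_subset)
qed (use u in \<open>auto simp: fun_eq_iff lin_add lin_smult fs_val[OF V]\<close>)

lemma values_single:
 assumes V: "LMod R V" and W: "LMod R W" and u: "u : Lin R V W"
 shows "(%y. u (single V x m y)) = single W x (u m)"
 using lin_zero[OF V W u] by (auto simp: single_def)

lemma fsm_ident:
 assumes V: "LMod R V" and W: "LMod R W" and u: "u : Lin R V W"
  and c: "c : El (FS V X)" and \<phi>: "!!x. x : X ==> \<phi> x = x"
 shows "finsupp_map V W X \<phi> u c = (%x. u (c x))"
 by (rule lin_eqI[OF V fs_lm[OF W] fsm_lin[OF V W _ u]
    values_lin[OF V W u] _ c])
   (use \<phi> in \<open>auto simp: fsm_single[OF V W _ u, of X \<phi> X] values_single[OF V W u]\<close>)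

lemma fsm_comp:
 assumes V: "LMod R V" and W: "LMod R W" and Z: "LMod R Z"
  and \<phi>: "!!x. x : X ==> \<phi> x : Y" and \<psi>: "!!y. y : Y ==> \<psi> y : Y'"
  and u: "u : Lin R V W" and v: "v : Lin R W Z"
  and eq: "!!x. x : X ==> \<theta> x = \<psi> (\<phi> x)" "!!m. m : El V ==> w m = v (u m)"
  and c: "c : El (FS V X)"
 shows "finsupp_map V Z Y' \<theta> w c = finsupp_map W Z Y' \<psi> v (finsupp_map V W Y \<phi> u c)"
proof (rule lin_eqI[OF V fs_lm[OF Z] _ _ _ c])
 have w: "w : Lin R V Z" by (rule lin_cong[OF lin_comp[OF u v] _ V]) (use eq in auto)
 have \<theta>: "!!x. x : X ==> \<theta> x : Y'" using eq \<phi> \<psi> by auto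
 show "finsupp_map V Z Y' \<theta> w : Lin R (FS V X) (FS Z Y')"
  using V Z \<theta> w by (rule fsm_lin)
 show "(%c. finsupp_map W Z Y' \<psi> v (finsupp_map V W Y \<phi> u c)) \<in>
   Lin R (FS V X) (FS Z Y')"
  by (rule lin_comp[OF fsm_lin[OF V W \<phi> u] fsm_lin[OF W Z \<psi> v]])
 fix x m assume x: "x : X" and m: "m : El V"
 show "finsupp_map V Z Y' \<theta> w (single V x m) =
   finsupp_map W Z Y' \<psi> v (finsupp_map V W Y \<phi> u (single V x m))"
  using fsm_single[OF V Z \<theta> w x m] fsm_single[OF V W \<phi> u x m]
   fsm_single[OF W Z \<psi> v \<phi>[OF x] lin_cl[OF u m]] eq x m by simp
qed

section \<open>Submodules\<close>

definition submod :: "('r, 'x) ring_scheme => ('r, 'a) module => 'a set => bool" where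
 "submod R V N <-> N <= El V & \<zero>\<^sub>V : N & (ALL x:N. ALL y:N. x \<oplus>\<^sub>V y : N) &
   (ALL a:El R. ALL x:N. a \<odot>\<^sub>V x : N)"

lemma submodI:
 assumes "N <= El V" "\<zero>\<^sub>V : N" "!!x y. x : N ==> y : N ==> x \<oplus>\<^sub>V y : N"
  "!!a x. a : El R ==> x : N ==> a \<odot>\<^sub>V x : N"
 shows "submod R V N"
 using assms by (auto simp: submod_def)

lemma subD:
 assumes "submod R V N"
 shows "N <= El V" "\<zero>\<^sub>V : N" "!!x y. x : N ==> y : N ==> x \<oplus>\<^sub>V y : N"
  "!!a x. a : El R ==> x : N ==> a \<odot>\<^sub>V x : N"
 using assms by (auto simp: submod_def)

lemma restr_simps [simp]:
 "El (V(|carrier := N|)) = N" "\<zero>\<^sub>(V(|carrier := N|)) = \<zero>\<^sub>V"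
 "x \<oplus>\<^sub>(V(|carrier := N|)) y = x \<oplus>\<^sub>V y" "a \<odot>\<^sub>(V(|carrier := N|)) x = a \<odot>\<^sub>V x"
 for V :: "('r, 'a) module"
 by auto

inductive_set cspan :: "('r, 'x) ring_scheme => ('r, 'a) module => 'a set => 'a set"
 for R V X where
 cspan_zero: "\<zero>\<^sub>V : cspan R V X"
| cspan_base: "x : X ==> x : cspan R V X"
| cspan_add: "x : cspan R V X ==> y : cspan R V X ==> x \<oplus>\<^sub>V y : cspan R V X"
| cspan_smult: "a : El R ==> x : cspan R V X ==> a \<odot>\<^sub>V x : cspan R V X"

context
 fixes R :: "('r, 'x) ring_scheme" and V :: "('r, 'a) module"
 assumes V: "LMod R V"
begin

interpretation V: left_module R V by (rule V)

lemma submod_neg: "submod R V N ==> x : N ==> \<ominus>\<^sub>V x : N"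
 using V.minus_one_smult[of x] by (metis subD(1,4) subsetD V.R.add.inv_closed V.R.one_closed)

lemma submod_diff: "submod R V N ==> x : N ==> y : N ==> x \<ominus>\<^sub>V y : N"
 by (simp add: a_minus_def subD(3) submod_neg)

lemma submod_lm:
 assumes N: "submod R V N"
 shows "LMod R (V(|carrier := N|))"
proof (rule lmI)
 show "ring R" by (rule V.R.ring_axioms)
 note NV = subsetD[OF subD(1)[OF N]]
 fix x assume x: "x : El (V(|carrier := N|))"
 hence "\<ominus>\<^sub>V x : N" using submod_neg[OF N] by simp
 thus "EX y:El (V(|carrier := N|)). y \<oplus>\<^sub>(V(|carrier := N|)) x = \<zero>\<^sub>(V(|carrier := N|))"
  using NV x V.l_neg by auto
qed (use subD[OF N] subsetD[OF subD(1)[OF N]] in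
 \<open>simp_all add: V.a_ac V.smult_l_distr V.smult_r_distr V.smult_assoc1 V.smult_one\<close>)

lemma submod_a_inv:
 assumes N: "submod R V N" and x: "x : N"
 shows "\<ominus>\<^sub>(V(|carrier := N|)) x = \<ominus>\<^sub>V x"
proof -
 interpret N: left_module R "V(|carrier := N|)" by (rule submod_lm[OF N])
 have "x : El V" using subD(1)[OF N] x by auto
 thus ?thesis
  using N.M.minus_equality[of "\<ominus>\<^sub>V x" x] submod_neg[OF N x] x V.l_neg[of x] by simp
qed

lemma submod_incl_lin: "N <= El V ==> (%x. x) : Lin R (V(|carrier := N|)) V"
 by (rule linI) auto

lemma submod_carrier: "submod R V (El V)"
 by (rule submodI) (auto simp: V.smult_closed)

lemma submod_zero: "submod R V {\<zero>\<^sub>V}"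
 by (rule submodI) (auto simp: V.smult_r_null)

lemma cspan_sub:
 assumes "X <= El V"
 shows "submod R V (cspan R V X)"
proof (rule submodI)
 show "cspan R V X <= El V"
 proof
  fix x assume "x : cspan R V X"
  thus "x : El V"
   by induction (use assms V.smult_closed in auto)
 qed
qed (auto intro: cspan.intros)

end

lemma cspan_least: "submod R V N ==> X <= N ==> cspan R V X <= N"
proof
 fix x assume "submod R V N" "X <= N" "x : cspan R V X"
 from this(3,1,2) show "x : N"
  by induction (auto dest: subD)
qed

lemma cspan_mono: "X <= Y ==> cspan R V X <= cspan R V Y"
proof
 fix x assume "X <= Y" "x : cspan R V X"
 from this(2,1) show "x : cspan R V Y"
  by induction (auto intro: cspan.intros)
qed

lemma cspan_image:
 assumes V: "LMod R V" and W: "LMod R W" and f: "f : Lin R V W"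
  and X: "X <= El V" and x: "x : cspan R V X" and Y: "f ` X <= cspan R W Y"
 shows "f x : cspan R W Y"
 using x
proof induction
 case cspan_zero
 show ?case using lin_zero[OF V W f] by (simp add: cspan.cspan_zero)
next
 case (cspan_base x)
 thus ?case using Y by auto
next
 case (cspan_add x y)
 thus ?case
  using lin_add[OF f] subD(1)[OF cspan_sub[OF V X]]
  by (simp add: subset_eq cspan.cspan_add)
next
 case (cspan_smult a x)
 thus ?case
  using lin_smult[OF f] subD(1)[OF cspan_sub[OF V X]]
  by (simp add: subset_eq cspan.cspan_smult)
qed

lemma submod_vimage:
 assumes V: "LMod R V" and W: "LMod R W" and f: "f : Lin R V W"
  and N: "submod R W N"
 shows "submod R V {x : El V. f x : N}"
proof (rule submodI)
 interpret V: left_module R V by (rule V)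
 show "{x : El V. f x : N} <= El V" by auto
 show "\<zero>\<^sub>V : {x : El V. f x : N}" using lin_zero[OF V W f] subD[OF N] by auto
qed (use subD[OF N] left_module.smult_closed[OF V] left_module.axioms(2)[OF V] in
 \<open>auto simp: lin_add[OF f] lin_smult[OF f] abelian_monoid.a_closed abelian_group.axioms(1)\<close>)

lemma submod_image:
 assumes V: "LMod R V" and W: "LMod R W" and f: "f : Lin R V W"
  and N: "submod R V N"
 shows "submod R W (f ` N)"
proof (rule submodI)
 note NV = subsetD[OF subD(1)[OF N]]
 show "f ` N <= El W" using NV lin_cl[OF f] by auto
 show "\<zero>\<^sub>W : f ` N" using lin_zero[OF V W f] subD[OF N] by (metis imageI)
 fix x y assume "x : f ` N" "y : f ` N"
 thus "x \<oplus>\<^sub>W y : f ` N"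
  using lin_add[OF f] NV subD(3)[OF N] by (smt (verit) image_iff)
next
 note NV = subsetD[OF subD(1)[OF N]]
 fix a x assume "a : El R" "x : f ` N"
 thus "a \<odot>\<^sub>W x : f ` N"
  using lin_smult[OF f] NV subD(4)[OF N] by (smt (verit) image_iff)
qed

lemma submod_fs:
 assumes N: "submod R V N"
 shows "El (FS (V(|carrier := N|)) X) <= El (FS V X)"
 using subsetD[OF subD(1)[OF N]] by (auto simp: fs_iff)

text \<open>Preimages are chosen coefficient by coefficient, with zero for a zero coefficient, so
  the lifted chains keep finite support.\<close>

lemma values_surj:
 assumes V: "LMod R V" and W: "LMod R W" and u: "u : Lin R V W"
  and Z: "submod R W N" and c: "c : El (FS Z X)" and Zl: "LMod R Z"
  and ops: "\<zero>\<^sub>Z = \<zero>\<^sub>W" "!!x y. x \<oplus>\<^sub>Z y = x \<oplus>\<^sub>W y"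
  and surj: "!!z. z : El Z ==> EX v:El V. EX w:N. z = u v \<oplus>\<^sub>W w"
 shows "EX y:El (FS V X). EX w:El (FS (W(|carrier := N|)) X).
   c = (%x. u (y x) \<oplus>\<^sub>W w x)"
proof -
 have z: "u \<zero>\<^sub>V \<oplus>\<^sub>W \<zero>\<^sub>W = \<zero>\<^sub>W"
  using left_module.axioms(2)[OF W] lin_zero[OF V W u] by (simp add: abelian_monoid.l_zero
    abelian_group.axioms(1) abelian_monoid.zero_closed)
 have "EX v w. v : El V & w : N & c x = u v \<oplus>\<^sub>W w & (c x = \<zero>\<^sub>W --> v = \<zero>\<^sub>V & w = \<zero>\<^sub>W)" for x
 by (metis left_module.axioms(2) V abelian_group.axioms(1) abelian_monoid.zero_closed z subD(2) Z surj fs_val Zl c)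
 then obtain y w where yw: "!!x. y x : El V" "!!x. w x : N" "!!x. c x = u (y x) \<oplus>\<^sub>W w x"
  "!!x. c x = \<zero>\<^sub>W ==> y x = \<zero>\<^sub>V & w x = \<zero>\<^sub>W" by metis
 have fin: "finite (supp W c)" and out: "!!x. x ~: X ==> c x = \<zero>\<^sub>W"
  using c ops by (auto simp: fs_iff)
 have "supp V y <= supp W c" "supp W w <= supp W c"
  using yw(4) by auto
 hence "finite (supp V y)" "finite (supp W w)" using fin finite_subset by blast+
 hence "y : El (FS V X)" "w : El (FS (W(|carrier := N|)) X)"
  using yw(1,2,4) out by (auto simp: fs_iff)
 thus ?thesis
  using yw(3) by blast
qed

section \<open>The bar complex\<close>

lemma tup_iff: "gs : tuples G n <-> length gs = n & set gs <= El G"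
 by (auto simp: tuples_def)

lemma tuples_Cons [simp]: "v # s : tuples G (Suc n) <-> v : El G & s : tuples G n"
 by (auto simp: tup_iff)

lemma tuples_SucE:
 assumes "gs : tuples G (Suc n)"
 obtains v s where "gs = v # s" "v : El G" "s : tuples G n"
 using assms by (cases gs) (auto simp: tup_iff)

lemma tuples_0 [simp]: "gs : tuples G 0 <-> gs = []"
 by (auto simp: tup_iff)

section \<open>Omitting a vertex, and signs\<close>

definition omit :: "nat => 'a list => 'a list" where
 "omit j gs = take j gs @ drop (Suc j) gs"

lemma omit_simps [simp]: "omit 0 (v # s) = s" "omit (Suc j) (v # s) = v # omit j s"
 by (auto simp: omit_def)

lemma omit_tuples: "gs : tuples G (Suc n) ==> j <= n ==> omit j gs : tuples G n"
 by (auto simp: tup_iff omit_def dest: in_set_takeD in_set_dropD)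

definition signed :: "('k, 'a) module => nat => 'a => 'a" where
 "signed D j x = (if even j then x else \<ominus>\<^sub>D x)"

lemma signed_simps [simp]: "signed D 0 x = x"
 by (auto simp: signed_def)

lemma signed_cl: "abelian_group D ==> x : El D ==> signed D j x : El D"
 by (simp add: signed_def abelian_group.a_inv_closed)

lemma signed_lin:
 assumes "LMod R V" "LMod R W" "f : Lin R V W"
 shows "(%x. signed W j (f x)) : Lin R V W"
 using lin_uminus[OF assms] assms by (cases "even j") (simp_all add: signed_def)

lemma abelian_minus_zero: "abelian_group D ==> \<ominus>\<^sub>D \<zero>\<^sub>D = \<zero>\<^sub>D"
 by (metis abelian_group.minus_equality abelian_group.l_neg abelian_group.minus_minus
   abelian_group.a_inv_closed abelian_group.axioms(1) abelian_monoid.l_zero abelian_monoid.zero_closed)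

lemma abelian_cancel:
 assumes "abelian_group D" "x : El D" "k : El D"
 shows "(\<ominus>\<^sub>D (x \<ominus>\<^sub>D k)) \<oplus>\<^sub>D (\<ominus>\<^sub>D k) = \<zero>\<^sub>D \<ominus>\<^sub>D x"
proof -
 interpret D: abelian_group D by fact
 show ?thesis using assms by (simp add: a_minus_def D.minus_add D.a_assoc D.r_neg)
qed

lemma signed_image:
 assumes "LMod R V" "LMod R W" "f : Lin R V W" "x : El V"
 shows "f (signed V j x) = signed W j (f x)"
 using lin_neg[OF assms] by (simp add: signed_def)

locale grp_rep =
 fixes K :: "('k, 'y) ring_scheme" and G :: "('g, 'z) monoid_scheme" and V :: "('k, 'm) module"
  and act :: "'g => 'm => 'm"
 assumes V: "LMod K V" and G: "group G"
  and act_lin: "g : El G ==> act g : Lin K V V"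
  and act_one: "m : El V ==> act \<one>\<^sub>G m = m"
  and act_mult: "g : El G ==> h : El G ==> m : El V ==>
   act (g \<otimes>\<^sub>G h) m = act g (act h m)"
begin

sublocale V: left_module K V by (rule V)
sublocale G: group G by (rule G)

abbreviation Ch :: "nat => ('k, 'g list => 'm) module" where
 "Ch n == FS V (tuples G n)"

lemma Ch: "LMod K (Ch n)"
 by (rule fs_lm[OF V])

lemma Ch_ab: "abelian_group (Ch n)"
 using Ch by (rule left_module.axioms(2))

lemma act_cl: "g : El G ==> m : El V ==> act g m : El V"
 using lin_cl[OF act_lin] .

lemma bar_face_lin:
 assumes gs: "gs : tuples G (Suc n)" and j: "j <= Suc n"
 shows "bar_face G V act j gs : Lin K V (Ch n)"
proof -
 have hd: "hd gs : El G" "tl gs : tuples G n" "butlast gs : tuples G n"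
  using gs by (cases gs; auto simp: tup_iff dest: in_set_butlastD)+
 show ?thesis
 proof (cases "j = 0 \<or> j = length gs")
  case True
  thus ?thesis
   using lin_comp[OF act_lin single_lin[OF V hd(2)]] single_lin[OF V hd(3)] hd gs
   by (auto simp: bar_face_def[abs_def] tup_iff)
 next
  case False
  let ?l = "take (j - 1) gs @ [gs ! (j - 1) \<otimes>\<^sub>G gs ! j] @ drop (j + 1) gs"
  have "gs ! (j - 1) : El G" "gs ! j : El G"
   using False gs j by (auto simp: tup_iff intro: nth_mem subsetD)
  hence "?l : tuples G n"
   using gs j False by (auto simp: tup_iff dest: in_set_takeD in_set_dropD)
  from single_lin[OF V this] False show ?thesis by (simp add: bar_face_def[abs_def])
 qed
qed

lemma bar_bd_eq_lift:
 "bar_boundary G V act n = lsupp V (Ch (n - 1))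
   (%gs m. \<Oplus>\<^sub>(Ch (n - 1))j\<in>{0..n}. signed (Ch (n - 1)) j (bar_face G V act j gs m))"
 by (intro ext) (simp add: bar_boundary_def lsupp_def bar_chains_def signed_def Let_def)

lemma bar_terms_lin:
 assumes "gs : tuples G (Suc n)"
 shows "(%m. \<Oplus>\<^sub>(Ch n)j\<in>{0..Suc n}. signed (Ch n) j (bar_face G V act j gs m)) \<in>
  Lin K V (Ch n)"
 by (rule lin_sums[OF V Ch], rule signed_lin[OF V Ch], rule bar_face_lin)
   (use assms in auto)

lemma bar_bd_lin: "bar_boundary G V act (Suc n) : Lin K (Ch (Suc n)) (Ch n)"
 unfolding bar_bd_eq_lift diff_Suc_1
 by (rule lsupp_lin[OF V Ch]) (rule bar_terms_lin)

lemma bar_bd_single: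
 assumes "gs : tuples G (Suc n)" "m : El V"
 shows "bar_boundary G V act (Suc n) (single V gs m) =
  (\<Oplus>\<^sub>(Ch n)j\<in>{0..Suc n}. signed (Ch n) j (bar_face G V act j gs m))"
 unfolding bar_bd_eq_lift diff_Suc_1
 by (rule lsupp_single[OF V Ch bar_terms_lin assms])

text \<open>
 The homogeneous complex, in which a simplex is the list of its vertices: \<^term>\<open>hbd n\<close> omits the
 vertices of lists of length \<^term>\<open>n\<close> in turn and does not involve the action.
\<close>

definition hterms :: "nat => 'g list => 'm => 'g list => 'm" where
 "hterms n gs m = (\<Oplus>\<^sub>(Ch (n - 1))j\<in>{..<n}. signed (Ch (n - 1)) j (single V (omit j gs) m))"

definition hbd :: "nat => ('g list => 'm) => 'g list => 'm" where
 "hbd n = lsupp V (Ch (n - 1)) (hterms n)"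

text \<open>The join with a new first vertex \<open>v\<close>. The index is the degree of the
  target, so \<open>cone 0\<close> has no meaning; it is only ever applied to the zero
  chain.\<close>

definition cone :: "nat => 'g => ('g list => 'm) => 'g list => 'm" where
 "cone n v = finsupp_map V V (tuples G n) (Cons v) (%m. m)"

lemma hterms_lin:
 assumes "gs : tuples G n"
 shows "hterms n gs : Lin K V (Ch (n - 1))"
proof (cases n)
 case 0
 show ?thesis unfolding hterms_def[abs_def]
  by (rule lin_sums[OF V Ch]) (simp add: 0)
next
 case (Suc n')
 show ?thesis unfolding hterms_def[abs_def]
  by (rule lin_sums[OF V Ch], rule signed_lin[OF V Ch], rule single_lin[OF V])
    (use assms in \<open>auto intro: omit_tuples\<close>)
qed

lemma hbd_lin: "hbd n : Lin K (Ch n) (Ch (n - 1))"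
 unfolding hbd_def by (rule lsupp_lin[OF V Ch]) (rule hterms_lin)

lemma hbd_linear_Suc: "hbd (Suc n) : Lin K (Ch (Suc n)) (Ch n)"
 using hbd_lin[of "Suc n"] by simp

lemma hbd_single: "gs : tuples G n ==> m : El V ==> hbd n (single V gs m) = hterms n gs m"
 unfolding hbd_def by (rule lsupp_single[OF V Ch hterms_lin])

lemma cone_lin: "v : El G ==> cone (Suc n) v : Lin K (Ch n) (Ch (Suc n))"
 unfolding cone_def by (rule fsm_lin[OF V V _ lin_id]) simp

lemma cone_single: "v : El G ==> s : tuples G n ==> m : El V ==>
  cone (Suc n) v (single V s m) = single V (v # s) m"
 unfolding cone_def by (rule fsm_single[OF V V _ lin_id, of "tuples G n"]) simp

lemma cone_zero [simp]: "cone n v (%_. \<zero>\<^sub>V) = (%_. \<zero>\<^sub>V)"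
 using abelian_monoid.finsum_empty[OF abelian_group.axioms(1)[OF Ch_ab]]
 by (simp add: cone_def finsupp_map_def)

lemma hbd_0:
 assumes "c : El (Ch 0)"
 shows "hbd 0 c = (%_. \<zero>\<^sub>V)"
proof -
 interpret C0: left_module K "Ch 0" by (rule Ch)
 have "hbd 0 : Lin K (Ch 0) (Ch 0)" using hbd_lin[of 0] by simp
 from lin_eqI[OF V Ch this lin_0[OF Ch Ch] _ assms]
 show ?thesis by (simp add: hbd_single hterms_def)
qed

text \<open>Face 0 omits \<open>v\<close>. Face \<open>Suc j\<close> keeps \<open>v\<close> and
  omits vertex \<open>j\<close> of \<open>s\<close>, which changes every sign.\<close>

lemma hbd_cone_single:
 assumes v: "v : El G" and s: "s : tuples G n" and m: "m : El V"
 shows "hbd (Suc n) (single V (v # s) m) = single V s m \<ominus>\<^sub>(Ch n) cone n v (hbd n (single V s m))"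
proof -
 interpret C: left_module K "Ch n" by (rule Ch)
 have *: "signed (Ch n) j (single V (omit j (v # s)) m) : El (Ch n)" if "j < Suc n" for j
  using that omit_tuples[of "v # s" G n j] v s m
  by (intro signed_cl[OF Ch_ab] single_cl[OF V]) auto
 have "hbd (Suc n) (single V (v # s) m) =
  (\<Oplus>\<^sub>(Ch n)j\<in>{..<Suc n}. signed (Ch n) j (single V (omit j (v # s)) m))"
  using v s m by (simp add: hbd_single hterms_def)
 also have "{..<Suc n} = insert 0 (Suc ` {..<n})"
  using lessThan_Suc_eq_insert_0 by auto
 also have "(\<Oplus>\<^sub>(Ch n)j\<in>insert 0 (Suc ` {..<n}). signed (Ch n) j (single V (omit j (v # s)) m)) =
  signed (Ch n) 0 (single V (omit 0 (v # s)) m) \<oplus>\<^sub>(Ch n)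
  (\<Oplus>\<^sub>(Ch n)j\<in>Suc ` {..<n}. signed (Ch n) j (single V (omit j (v # s)) m))"
  by (rule C.finsum_insert) (use * *[of 0] in auto)
 also have "(\<Oplus>\<^sub>(Ch n)j\<in>Suc ` {..<n}. signed (Ch n) j (single V (omit j (v # s)) m)) =
   (\<Oplus>\<^sub>(Ch n)j\<in>{..<n}. signed (Ch n) (Suc j) (single V (omit (Suc j) (v # s)) m))"
  by (rule C.finsum_reindex) (use * in auto)
 also have "... = \<ominus>\<^sub>(Ch n) cone n v (hbd n (single V s m))"
 proof (cases n)
  case 0
  thus ?thesis using s m abelian_minus_zero[OF Ch_ab, of n, symmetric]
   by (simp add: hbd_single hterms_def C.finsum_empty[unfolded 0])
 next
  case (Suc n')
  let ?f = "%c. \<ominus>\<^sub>(Ch n) cone n v c"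
  have f: "?f : Lin K (Ch n') (Ch n)"
   unfolding Suc by (rule lin_uminus[OF Ch Ch cone_lin[OF v]])
  have om: "omit j s : tuples G n'" if "j < n" for j
   using omit_tuples[of s G n' j] s Suc that by simp
  have "?f (hbd n (single V s m)) = ?f (\<Oplus>\<^sub>(Ch n')j\<in>{..<n}. signed (Ch n') j (single V (omit j s) m))"
   using s m Suc by (simp add: hbd_single hterms_def)
  also have "... = (\<Oplus>\<^sub>(Ch n)j\<in>{..<n}. ?f (signed (Ch n') j (single V (omit j s) m)))"
   by (rule lin_finsum[OF Ch Ch f]) (use om m in \<open>auto intro!: signed_cl[OF Ch_ab] single_cl[OF V]\<close>)
  also have "... = (\<Oplus>\<^sub>(Ch n)j\<in>{..<n}. signed (Ch n) (Suc j) (single V (omit (Suc j) (v # s)) m))"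
  proof (rule C.finsum_cong')
   fix j assume "j : {..<n}"
   hence j: "j < n" by simp
   have "?f (signed (Ch n') j (single V (omit j s) m)) =
     signed (Ch n) j (?f (single V (omit j s) m))"
    by (rule signed_image[OF Ch Ch f single_cl[OF V om[OF j] m]])
   also have "?f (single V (omit j s) m) = \<ominus>\<^sub>(Ch n) single V (v # omit j s) m"
    using cone_single[OF v om[OF j] m] Suc by simp
   also have "signed (Ch n) j ... = signed (Ch n) (Suc j) (single V (v # omit j s) m)"
    using abelian_group.minus_minus[OF Ch_ab single_cl[OF V], of "v # omit j s" "Suc n'" m]
     om[OF j] v m Suc by (simp add: signed_def)
   finally show "?f (signed (Ch n') j (single V (omit j s) m)) =
     signed (Ch n) (Suc j) (single V (omit (Suc j) (v # s)) m)" by simp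
  qed (use *[of "Suc j" for j] in auto)
  finally show ?thesis by simp
 qed
 finally show ?thesis by (simp add: a_minus_def)
qed

lemma hbd_cone:
 assumes v: "v : El G" and c: "c : El (Ch n)"
 shows "hbd (Suc n) (cone (Suc n) v c) = c \<ominus>\<^sub>(Ch n) cone n v (hbd n c)"
proof -
 have 0: "(%c. cone n v (hbd n c)) : Lin K (Ch n) (Ch n)"
 proof (cases n)
  case 0
  show ?thesis
   by (rule lin_cong[OF lin_0[OF Ch Ch] _ Ch]) (simp add: 0 hbd_0)
 next
  case (Suc n')
  show ?thesis unfolding Suc by (rule lin_comp[OF hbd_linear_Suc cone_lin[OF v]])
 qed
 show ?thesis
  by (rule lin_eqI[OF V Ch lin_comp[OF cone_lin[OF v] hbd_linear_Suc]
     lin_minus[OF Ch Ch lin_id 0] _ c])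
    (simp add: cone_single[OF v] hbd_cone_single[OF v])
qed

text \<open>Induction by splitting off the first vertex: with \<open>e\<close> the boundary of the
  remaining simplex, applying the boundary twice gives \<open>e\<close> minus the boundary of its
  cone, and the latter is \<open>e\<close> again since \<open>e\<close> is a cycle by induction. No
  double sum over pairs of faces arises.\<close>

lemma hbd_hbd:
 assumes "c : El (Ch (Suc n))"
 shows "hbd n (hbd (Suc n) c) = (%_. \<zero>\<^sub>V)"
 using assms
proof (induction n arbitrary: c)
 case 0
 show ?case using hbd_0[OF lin_cl[OF hbd_linear_Suc 0]] by simp
next
 case (Suc n)
 interpret C: left_module K "Ch n" by (rule Ch)
 interpret C': left_module K "Ch (Suc n)" by (rule Ch)
 show ?case
 proof (rule lin_eqI[OF V Ch lin_comp[OF hbd_linear_Suc hbd_linear_Suc]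
    lin_0[OF Ch Ch, simplified] _ Suc.prems])
  fix gs m assume gs: "gs : tuples G (Suc (Suc n))" and m: "m : El V"
  obtain v s where vs: "gs = v # s" "v : El G" "s : tuples G (Suc n)"
   using gs by (rule tuples_SucE)
  let ?e = "hbd (Suc n) (single V s m)"
  have sm: "single V s m : El (Ch (Suc n))" using vs(3) m by (rule single_cl[OF V])
  have e: "?e : El (Ch n)" by (rule lin_cl[OF hbd_linear_Suc sm])
  have "hbd (Suc n) (hbd (Suc (Suc n)) (single V gs m)) =
    hbd (Suc n) (single V s m \<ominus>\<^sub>(Ch (Suc n)) cone (Suc n) v ?e)"
   using hbd_cone_single[OF vs(2,3) m] vs(1) by simp
  also have "... = ?e \<ominus>\<^sub>(Ch n) hbd (Suc n) (cone (Suc n) v ?e)"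
   by (rule lin_diff[OF Ch Ch hbd_linear_Suc sm lin_cl[OF cone_lin[OF vs(2)] e]])
  also have "... = ?e \<ominus>\<^sub>(Ch n) (?e \<ominus>\<^sub>(Ch n) \<zero>\<^sub>(Ch n))"
   using hbd_cone[OF vs(2) e] Suc.IH[OF sm] by simp
  also have "... = \<zero>\<^sub>(Ch n)"
   using e C.M.r_neg[OF e] abelian_minus_zero[OF Ch_ab] C.M.r_zero[OF e] unfolding a_minus_def by metis
  finally show "hbd (Suc n) (hbd (Suc (Suc n)) (single V gs m)) = (%_. \<zero>\<^sub>V)" by simp
 qed
qed

subsection \<open>Passage from homogeneous to inhomogeneous chains\<close>

lemma mult_inv_cancel: "a : El G ==> b : El G ==> a \<otimes>\<^sub>G (inv\<^bsub>G\<^esub> a \<otimes>\<^sub>G b) = b"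
 by (simp add: G.m_assoc[symmetric])

lemma inv_mult_cancel: "a : El G ==> b : El G ==> inv\<^bsub>G\<^esub> a \<otimes>\<^sub>G (a \<otimes>\<^sub>G b) = b"
 by (simp add: G.m_assoc[symmetric])

text \<open>From the vertices of a homogeneous simplex to the entries of a bar symbol.
  \<open>pprods\<close> is the inverse once the first vertex is prescribed.\<close>

fun quots :: "'g list => 'g list" where
 "quots (a # b # l) = (inv\<^bsub>G\<^esub> a \<otimes>\<^sub>G b) # quots (b # l)"
| "quots _ = []"

fun pprods :: "'g => 'g list => 'g list" where
 "pprods a [] = [a]"
| "pprods a (g # gs) = a # pprods (a \<otimes>\<^sub>G g) gs"

lemma length_quots [simp]: "length (quots gs) = length gs - 1"
 by (induction gs rule: quots.induct) auto

lemma quots_cl: "set gs <= El G ==> set (quots gs) <= El G"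
 by (induction gs rule: quots.induct) auto

lemma quots_tuples: "gs : tuples G (Suc n) ==> quots gs : tuples G n"
 using quots_cl by (auto simp: tup_iff)

lemma pprods_tuples: "a : El G ==> gs : tuples G n ==> pprods a gs : tuples G (Suc n)"
 by (induction gs arbitrary: a n) (auto simp: tup_iff)

lemma hd_pprods [simp]: "hd (pprods a gs) = a"
 by (cases gs) auto

lemma quots_pprods: "a : El G ==> set gs <= El G ==> quots (pprods a gs) = gs"
proof (induction gs arbitrary: a)
 case (Cons g gs)
 have "pprods (a \<otimes>\<^sub>G g) gs ~= []" by (cases gs) auto
 then obtain b l where bl: "pprods (a \<otimes>\<^sub>G g) gs = b # l" by (meson list.exhaust)
 have b: "b = a \<otimes>\<^sub>G g" using hd_pprods[of "a \<otimes>\<^sub>G g" gs] bl by simp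
 have "quots (b # l) = gs" using Cons.IH[of "a \<otimes>\<^sub>G g"] Cons.prems bl by simp
 moreover have "inv\<^bsub>G\<^esub> a \<otimes>\<^sub>G b = g"
  using Cons.prems b by (simp add: G.m_assoc[symmetric])
 ultimately show ?case by (simp add: bl)
qed simp

lemma pprods_quots:
 assumes "h : El G" "v : El G" "set s <= El G"
 shows "pprods (h \<otimes>\<^sub>G v) (quots (v # s)) = map (%g. h \<otimes>\<^sub>G g) (v # s)"
 using assms
proof (induction s arbitrary: v)
 case (Cons b l)
 have "h \<otimes>\<^sub>G v \<otimes>\<^sub>G (inv\<^bsub>G\<^esub> v \<otimes>\<^sub>G b) = h \<otimes>\<^sub>G b"
  using Cons.prems by (simp add: G.m_assoc mult_inv_cancel)
 thus ?case using Cons by simp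
qed simp

lemma quots_translate:
 "h : El G ==> set gs <= El G ==> quots (map (%g. h \<otimes>\<^sub>G g) gs) = quots gs"
 by (induction gs rule: quots.induct) (auto simp: G.inv_mult_group G.m_assoc inv_mult_cancel)

lemma quots_butlast: "quots (butlast gs) = butlast (quots gs)"
proof (induction gs rule: quots.induct)
 case (1 a b l)
 thus ?case by (cases l) auto
qed auto

lemma quots_omit:
 assumes "set gs <= El G" "Suc j < length gs - 1"
 shows "take j (quots gs) @ [quots gs ! j \<otimes>\<^sub>G quots gs ! Suc j] @ drop (Suc (Suc j)) (quots gs) =
  quots (omit (Suc j) gs)"
 using assms
proof (induction gs arbitrary: j rule: quots.induct)
 case (1 a b l)
 then obtain c l' where l: "l = c # l'" by (cases l) auto
 show ?case
 proof (cases j)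
  case 0
  have "inv\<^bsub>G\<^esub> a \<otimes>\<^sub>G b \<otimes>\<^sub>G (inv\<^bsub>G\<^esub> b \<otimes>\<^sub>G c) = inv\<^bsub>G\<^esub> a \<otimes>\<^sub>G c"
   using 1 l by (simp add: G.m_assoc mult_inv_cancel)
  thus ?thesis using 0 l by simp
 next
  case (Suc j')
  have "take j' (quots (b # l)) @ [quots (b # l) ! j' \<otimes>\<^sub>G quots (b # l) ! Suc j'] @
    drop (Suc (Suc j')) (quots (b # l)) = quots (omit (Suc j') (b # l))"
   using 1 Suc by simp
  thus ?thesis using Suc by simp
 qed
qed auto

text \<open>The projection to coinvariants: a simplex is translated until its first vertex is 1,
  which moves its coefficient by the inverse of that vertex. \<open>smap\<close> is the section with
  values in the simplices that start at 1.\<close>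

definition qmap :: "nat => ('g list => 'm) => 'g list => 'm" where
 "qmap n = lsupp V (Ch n) (%gs m. single V (quots gs) (act (inv\<^bsub>G\<^esub> (hd gs)) m))"

definition smap :: "nat => ('g list => 'm) => 'g list => 'm" where
 "smap n = finsupp_map V V (tuples G (Suc n)) (pprods \<one>\<^sub>G) (%m. m)"

lemma qterm_lin: "gs : tuples G (Suc n) ==>
  (%m. single V (quots gs) (act (inv\<^bsub>G\<^esub> (hd gs)) m)) : Lin K V (Ch n)"
 by (erule tuples_SucE, rule lin_comp[OF act_lin single_lin[OF V]]) (auto intro: quots_tuples)

lemma qmap_lin: "qmap n : Lin K (Ch (Suc n)) (Ch n)"
 unfolding qmap_def by (rule lsupp_lin[OF V Ch]) (rule qterm_lin)

lemma qmap_single: "gs : tuples G (Suc n) ==> m : El V ==>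
  qmap n (single V gs m) = single V (quots gs) (act (inv\<^bsub>G\<^esub> (hd gs)) m)"
 unfolding qmap_def by (rule lsupp_single[OF V Ch qterm_lin])

lemma smap_lin: "smap n : Lin K (Ch n) (Ch (Suc n))"
 unfolding smap_def by (rule fsm_lin[OF V V _ lin_id]) (simp add: pprods_tuples)

lemma smap_single: "gs : tuples G n ==> m : El V ==>
  smap n (single V gs m) = single V (pprods \<one>\<^sub>G gs) m"
 unfolding smap_def
 by (rule fsm_single[OF V V _ lin_id, of "tuples G n"]) (simp_all add: pprods_tuples)

lemma qmap_smap:
 assumes "c : El (Ch n)"
 shows "qmap n (smap n c) = c"
 by (rule lin_eqI[OF V Ch lin_comp[OF smap_lin qmap_lin] lin_id _ assms])
   (simp add: smap_single qmap_single pprods_tuples act_one, simp add: quots_pprods tup_iff)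

text \<open>Omitting the first vertex \<open>a\<close> makes \<open>b\<close> the vertex used for
  normalising, so the coefficient changes by the inverse of the first bar entry; this is the action
  in face 0. Omitting an inner vertex multiplies two neighbouring entries, and omitting the last one
  drops an entry.\<close>

lemma qmap_face:
 assumes gs: "gs : tuples G (Suc (Suc n))" and j: "j <= Suc n" and m: "m : El V"
 shows "bar_face G V act j (quots gs) (act (inv\<^bsub>G\<^esub> (hd gs)) m) =
  single V (quots (omit j gs)) (act (inv\<^bsub>G\<^esub> (hd (omit j gs))) m)"
proof -
 obtain a b l where l: "gs = a # b # l" and ab: "a : El G" "b : El G" "set l <= El G"
  using gs by (elim tuples_SucE) (auto simp: tup_iff)
 have len: "length l = n" using gs l by (simp add: tup_iff)
 consider "j = 0" | "j = Suc n" | j' where "j = Suc j'" "j' < n"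
  using j by (cases j) force+
 thus ?thesis
 proof cases
  case 1
  have "act (inv\<^bsub>G\<^esub> (inv\<^bsub>G\<^esub> a \<otimes>\<^sub>G b)) (act (inv\<^bsub>G\<^esub> a) m) = act (inv\<^bsub>G\<^esub> b) m"
   using ab m by (simp add: act_mult[symmetric] G.inv_mult_group G.m_assoc)
  thus ?thesis using 1 l by (simp add: bar_face_def)
 next
  case 2
  have "omit j gs = butlast gs"
   using 2 len l by (simp add: omit_def butlast_conv_take)
  moreover have "hd (butlast gs) = a" using l by simp
  ultimately show ?thesis
   using 2 len l quots_butlast[of gs] by (simp add: bar_face_def)
 next
  case 3
  have "take j' (quots gs) @ [quots gs ! j' \<otimes>\<^sub>G quots gs ! Suc j'] @ drop (Suc (Suc j')) (quots gs) =
    quots (omit (Suc j') gs)"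
   by (rule quots_omit) (use 3 len l ab in auto)
  thus ?thesis using 3 len l by (simp add: bar_face_def)
 qed
qed

lemma bar_bd_qmap:
 assumes c: "c : El (Ch (Suc (Suc n)))"
 shows "bar_boundary G V act (Suc n) (qmap (Suc n) c) = qmap n (hbd (Suc (Suc n)) c)"
proof (rule lin_eqI[OF V Ch lin_comp[OF qmap_lin bar_bd_lin]
   lin_comp[OF hbd_linear_Suc qmap_lin] _ c])
 fix gs m assume gs: "gs : tuples G (Suc (Suc n))" and m: "m : El V"
 interpret C: left_module K "Ch n" by (rule Ch)
 have om: "omit j gs : tuples G (Suc n)" if "j <= Suc n" for j
  using omit_tuples[OF gs that] .
 have hd: "hd gs : El G" using gs by (auto elim: tuples_SucE)
 have "qmap n (hbd (Suc (Suc n)) (single V gs m)) =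
   qmap n (\<Oplus>\<^sub>(Ch (Suc n))j\<in>{..<Suc (Suc n)}. signed (Ch (Suc n)) j (single V (omit j gs) m))"
  by (simp add: hbd_single[OF gs m] hterms_def)
 also have "... = (\<Oplus>\<^sub>(Ch n)j\<in>{..<Suc (Suc n)}. qmap n (signed (Ch (Suc n)) j (single V (omit j gs) m)))"
  by (rule lin_finsum[OF Ch Ch qmap_lin])
    (use om m in \<open>auto intro!: signed_cl[OF Ch_ab] single_cl[OF V]\<close>)
 also have "... = (\<Oplus>\<^sub>(Ch n)j\<in>{0..Suc n}. signed (Ch n) j
   (bar_face G V act j (quots gs) (act (inv\<^bsub>G\<^esub> (hd gs)) m)))"
 proof (rule C.finsum_cong')
  show "{..<Suc (Suc n)} = {0..Suc n}" by auto
  show "(%j. signed (Ch n) j (bar_face G V act j (quots gs) (act (inv\<^bsub>G\<^esub> (hd gs)) m))) \<in>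
    {0..Suc n} \<rightarrow> El (Ch n)"
   using hd m by (auto intro!: signed_cl[OF Ch_ab] lin_cl[OF bar_face_lin] quots_tuples[OF gs]
     act_cl)
  fix j assume "j : {0..Suc n}"
  hence j: "j <= Suc n" by simp
  show "qmap n (signed (Ch (Suc n)) j (single V (omit j gs) m)) =
   signed (Ch n) j (bar_face G V act j (quots gs) (act (inv\<^bsub>G\<^esub> (hd gs)) m))"
   using signed_image[OF Ch Ch qmap_lin single_cl[OF V om[OF j] m]]
    qmap_single[OF om[OF j] m] qmap_face[OF gs j m] by simp
 qed
 also have "... = bar_boundary G V act (Suc n) (qmap (Suc n) (single V gs m))"
  using bar_bd_single[OF quots_tuples[OF gs] act_cl[OF _ m]] hd qmap_single[OF gs m] by simp
 finally show "bar_boundary G V act (Suc n) (qmap (Suc n) (single V gs m)) =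
   qmap n (hbd (Suc (Suc n)) (single V gs m))" by simp
qed

lemma bar_bd_eq:
 assumes "c : El (Ch (Suc n))"
 shows "bar_boundary G V act (Suc n) c = qmap n (hbd (Suc (Suc n)) (smap (Suc n) c))"
 using bar_bd_qmap[OF lin_cl[OF smap_lin assms]] qmap_smap[OF assms] by simp

text \<open>Lifting by the section \<open>smap\<close> transfers the claim to
  \<open>hbd_hbd\<close>, where neither the group law nor the action occurs.\<close>

lemma bar_bd_bar_bd:
 assumes "c : El (Ch (Suc (Suc n)))"
 shows "bar_boundary G V act (Suc n) (bar_boundary G V act (Suc (Suc n)) c) = (%_. \<zero>\<^sub>V)"
proof -
 let ?s = "smap (Suc (Suc n)) c"
 have s: "?s : El (Ch (Suc (Suc (Suc n))))" by (rule lin_cl[OF smap_lin assms])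
 have "bar_boundary G V act (Suc n) (bar_boundary G V act (Suc (Suc n)) c) =
   bar_boundary G V act (Suc n) (qmap (Suc n) (hbd (Suc (Suc (Suc n))) ?s))"
  by (simp add: bar_bd_eq[OF assms])
 also have "... = qmap n (hbd (Suc (Suc n)) (hbd (Suc (Suc (Suc n))) ?s))"
  by (rule bar_bd_qmap[OF lin_cl[OF hbd_linear_Suc s]])
 also have "... = (%_. \<zero>\<^sub>V)"
  using hbd_hbd[OF s] lin_zero[OF Ch Ch qmap_lin[of n]] by simp
 finally show ?thesis .
qed

subsection \<open>Translation invariant operators\<close>

text \<open>
 An operator on homogeneous chains that commutes with translations descends to bar chains; this is
 how the contraction and the prism operator below are used.
\<close>

definition transl :: "nat => 'g => ('g list => 'm) => 'g list => 'm" where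
 "transl n g = finsupp_map V V (tuples G n) (map (%h. g \<otimes>\<^sub>G h)) (act g)"

lemma map_mult_tuples: "g : El G ==> gs : tuples G n ==> map (%h. g \<otimes>\<^sub>G h) gs : tuples G n"
 by (auto simp: tup_iff)

lemma transl_lin: "g : El G ==> transl n g : Lin K (Ch n) (Ch n)"
 unfolding transl_def by (rule fsm_lin[OF V V map_mult_tuples act_lin])

lemma transl_single: "g : El G ==> gs : tuples G n ==> m : El V ==>
  transl n g (single V gs m) = single V (map (%h. g \<otimes>\<^sub>G h) gs) (act g m)"
 unfolding transl_def by (rule fsm_single[OF V V map_mult_tuples act_lin])

lemma qmap_transl:
 assumes "g : El G" "c : El (Ch (Suc n))"
 shows "qmap n (transl (Suc n) g c) = qmap n c"
proof (rule lin_eqI[OF V Ch lin_comp[OF transl_lin[OF assms(1)] qmap_lin] qmap_lin _ assms(2)])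
 fix gs m assume gs: "gs : tuples G (Suc n)" and m: "m : El V"
 then obtain v s where vs: "gs = v # s" "v : El G" "s : tuples G n" by (elim tuples_SucE)
 have "act (inv\<^bsub>G\<^esub> (g \<otimes>\<^sub>G v)) (act g m) = act (inv\<^bsub>G\<^esub> v) m"
  using vs assms(1) m by (simp add: act_mult[symmetric] G.inv_mult_group G.m_assoc)
 moreover have "quots (map (%h. g \<otimes>\<^sub>G h) gs) = quots gs"
  by (rule quots_translate) (use gs assms(1) in \<open>auto simp: tup_iff\<close>)
 moreover have "hd (map (%h. g \<otimes>\<^sub>G h) gs) = g \<otimes>\<^sub>G v" using vs by simp
 ultimately show "qmap n (transl (Suc n) g (single V gs m)) = qmap n (single V gs m)"
  using gs m assms(1) vs(1) map_mult_tuples[OF assms(1) gs] act_cl[OF assms(1) m]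
  by (simp add: transl_single qmap_single del: list.map)
qed

lemma smap_qmap_single:
 assumes gs: "gs : tuples G (Suc n)" and m: "m : El V"
 shows "smap n (qmap n (single V gs m)) = transl (Suc n) (inv\<^bsub>G\<^esub> (hd gs)) (single V gs m)"
proof -
 obtain v s where vs: "gs = v # s" "v : El G" "s : tuples G n" using gs by (elim tuples_SucE)
 have "pprods (inv\<^bsub>G\<^esub> v \<otimes>\<^sub>G v) (quots (v # s)) = map (%g. inv\<^bsub>G\<^esub> v \<otimes>\<^sub>G g) (v # s)"
  by (rule pprods_quots) (use vs in \<open>auto simp: tup_iff\<close>)
 thus ?thesis
  using vs m by (simp add: qmap_single smap_single transl_single act_cl quots_tuples)
qed

text \<open>\<open>smap n\<close> after \<open>qmap n\<close> translates a simplex. The operator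
  commutes with the translation, and \<open>qmap l\<close> absorbs it, so \<open>T\<close> descends
  to bar chains.\<close>

lemma invariant_operator:
 assumes T: "T : Lin K (Ch (Suc n)) (Ch (Suc l))"
  and inv: "!!g c. g : El G ==> c : El (Ch (Suc n)) ==>
   T (transl (Suc n) g c) = transl (Suc l) g (T c)"
  and c: "c : El (Ch (Suc n))"
 shows "qmap l (T (smap n (qmap n c))) = qmap l (T c)"
proof (rule lin_eqI[OF V Ch lin_comp[OF qmap_lin lin_comp[OF smap_lin lin_comp[OF T qmap_lin]]]
  lin_comp[OF T qmap_lin] _ c])
 fix gs m assume gs: "gs : tuples G (Suc n)" and m: "m : El V"
 have hd: "inv\<^bsub>G\<^esub> (hd gs) : El G" using gs by (auto elim: tuples_SucE)
 have s: "single V gs m : El (Ch (Suc n))" using gs m by (rule single_cl[OF V])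
 show "qmap l (T (smap n (qmap n (single V gs m)))) = qmap l (T (single V gs m))"
  using smap_qmap_single[OF gs m] inv[OF hd s] qmap_transl[OF hd lin_cl[OF T s]] by simp
qed

text \<open>
 If \<^term>\<open>hbd\<close> of the operator \<open>T\<close> plus \<open>T\<close> of \<^term>\<open>hbd\<close> is \<open>F - 1\<close>, then a cycle \<open>z\<close> is homologous
 to the image of \<open>F\<close>.
\<close>

lemma homotopy_desc:
 assumes T: "T : Lin K (Ch (Suc n)) (Ch (Suc (Suc n)))"
  and T': "T' : Lin K (Ch (Suc (Suc n))) (Ch (Suc (Suc (Suc n))))"
  and inv: "!!g c. g : El G ==> c : El (Ch (Suc n)) ==>
   T (transl (Suc n) g c) = transl (Suc (Suc n)) g (T c)"
  and F: "!!c. c : El (Ch (Suc (Suc n))) ==> F c : El (Ch (Suc (Suc n)))"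
  and eq: "!!c. c : El (Ch (Suc (Suc n))) ==>
   hbd (Suc (Suc (Suc n))) (T' c) \<oplus>\<^sub>(Ch (Suc (Suc n))) T (hbd (Suc (Suc n)) c) =
   F c \<ominus>\<^sub>(Ch (Suc (Suc n))) c"
  and z: "z : El (Ch (Suc n))" and cyc: "bar_boundary G V act (Suc n) z = (%_. \<zero>\<^sub>V)"
 shows "bar_boundary G V act (Suc (Suc n)) (qmap (Suc (Suc n)) (T' (smap (Suc n) z))) =
  qmap (Suc n) (F (smap (Suc n) z)) \<ominus>\<^sub>(Ch (Suc n)) z"
proof -
 interpret C: left_module K "Ch (Suc n)" by (rule Ch)
 interpret C2: left_module K "Ch (Suc (Suc n))" by (rule Ch)
 let ?s = "smap (Suc n) z"
 have s: "?s : El (Ch (Suc (Suc n)))" by (rule lin_cl[OF smap_lin z])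
 have hs: "hbd (Suc (Suc n)) ?s : El (Ch (Suc n))" by (rule lin_cl[OF hbd_linear_Suc s])
 have ht: "hbd (Suc (Suc (Suc n))) (T' ?s) : El (Ch (Suc (Suc n)))"
  by (rule lin_cl[OF hbd_linear_Suc lin_cl[OF T' s]])
 have th: "T (hbd (Suc (Suc n)) ?s) : El (Ch (Suc (Suc n)))" by (rule lin_cl[OF T hs])
 \<comment> \<open>The boundary of the lifted cycle need not vanish, only its image under
   \<open>qmap\<close>; by invariance of \<open>T\<close> this already removes the second summand of
   the homotopy.\<close>
 have "qmap n (hbd (Suc (Suc n)) ?s) = (%_. \<zero>\<^sub>V)"
  using cyc bar_bd_eq[OF z] by simp
 hence 0: "qmap (Suc n) (T (hbd (Suc (Suc n)) ?s)) = \<zero>\<^sub>(Ch (Suc n))"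
  using invariant_operator[OF T inv hs] lin_zero[OF Ch Ch smap_lin[of n]]
   lin_zero[OF Ch Ch T] lin_zero[OF Ch Ch qmap_lin[of "Suc n"]] by simp
 have "bar_boundary G V act (Suc (Suc n)) (qmap (Suc (Suc n)) (T' ?s)) =
   qmap (Suc n) (hbd (Suc (Suc (Suc n))) (T' ?s))"
  by (rule bar_bd_qmap[OF lin_cl[OF T' s]])
 also have "... = qmap (Suc n) (hbd (Suc (Suc (Suc n))) (T' ?s)) \<oplus>\<^sub>(Ch (Suc n))
   qmap (Suc n) (T (hbd (Suc (Suc n)) ?s))"
  unfolding 0 using C.M.r_zero[OF lin_cl[OF qmap_lin ht]] by simp
 also have "... = qmap (Suc n) (F ?s \<ominus>\<^sub>(Ch (Suc (Suc n))) ?s)"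
  using lin_add[OF qmap_lin ht th] eq[OF s] by simp
 also have "... = qmap (Suc n) (F ?s) \<ominus>\<^sub>(Ch (Suc n)) z"
  using lin_diff[OF Ch Ch qmap_lin F[OF s] s] qmap_smap[OF z] by simp
 finally show ?thesis .
qed

text \<open>For the trivial group all translations are the identity, so the cone over 1 is an
  invariant operator. With the negative of the cone as \<open>T\<close> the homotopy formula holds
  for \<open>F = 0\<close>.\<close>

lemma trivial_group_bds:
 assumes triv: "El G = {\<one>\<^sub>G}"
  and z: "z : El (Ch (Suc n))" and cyc: "bar_boundary G V act (Suc n) z = (%_. \<zero>\<^sub>V)"
 shows "z : bar_boundary G V act (Suc (Suc n)) ` El (Ch (Suc (Suc n)))"
proof -
 let ?e = "\<one>\<^sub>G"
 interpret C: left_module K "Ch (Suc n)" by (rule Ch)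
 interpret C2: left_module K "Ch (Suc (Suc n))" by (rule Ch)
 let ?T = "%n c. \<ominus>\<^sub>(Ch (Suc n)) cone (Suc n) ?e c"
 have T: "?T n : Lin K (Ch n) (Ch (Suc n))" for n
  by (rule lin_uminus[OF Ch Ch cone_lin]) simp
 have one: "map (%h. g \<otimes>\<^sub>G h) gs = gs" if "g : El G" "gs : tuples G n" for g gs n
  using that triv by (intro map_idI) (auto simp: tup_iff)
 have tr: "transl n g c = c" if "g : El G" "c : El (Ch n)" for n g c
  by (rule lin_eqI[OF V Ch transl_lin[OF that(1)] lin_id _ that(2)])
    (use that(1) triv act_one in \<open>simp add: transl_single one\<close>)
 have "bar_boundary G V act (Suc (Suc n)) (qmap (Suc (Suc n)) (?T (Suc (Suc n)) (smap (Suc n) z))) =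
  qmap (Suc n) ((%_ _. \<zero>\<^sub>V) (smap (Suc n) z)) \<ominus>\<^sub>(Ch (Suc n)) z"
 proof (rule homotopy_desc[OF T[of "Suc n"] T _ _ _ z cyc])
  fix c assume c: "c : El (Ch (Suc (Suc n)))"
  have hc: "hbd (Suc (Suc n)) c : El (Ch (Suc n))" by (rule lin_cl[OF hbd_linear_Suc c])
  have k: "cone (Suc (Suc n)) ?e (hbd (Suc (Suc n)) c) : El (Ch (Suc (Suc n)))"
   by (rule lin_cl[OF cone_lin hc]) simp
  have "hbd (Suc (Suc (Suc n))) (?T (Suc (Suc n)) c) =
   \<ominus>\<^sub>(Ch (Suc (Suc n))) (c \<ominus>\<^sub>(Ch (Suc (Suc n))) cone (Suc (Suc n)) ?e (hbd (Suc (Suc n)) c))"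
   using lin_neg[OF Ch Ch hbd_linear_Suc lin_cl[OF cone_lin c]] hbd_cone[OF _ c] by simp
  thus "hbd (Suc (Suc (Suc n))) (?T (Suc (Suc n)) c) \<oplus>\<^sub>(Ch (Suc (Suc n)))
    ?T (Suc n) (hbd (Suc (Suc n)) c) = (%_. \<zero>\<^sub>V) \<ominus>\<^sub>(Ch (Suc (Suc n))) c"
   using abelian_cancel[OF Ch_ab c k] by simp
 next
  fix g c assume "g : El G" "c : El (Ch (Suc n))"
  thus "?T (Suc n) (transl (Suc n) g c) = transl (Suc (Suc n)) g (?T (Suc n) c)"
   using tr lin_cl[OF T] by simp
 next
  show "(%_. \<zero>\<^sub>V) : El (Ch (Suc (Suc n)))" using C2.M.zero_closed by simp
 qed
 moreover have "qmap (Suc n) (%_. \<zero>\<^sub>V) = \<zero>\<^sub>(Ch (Suc n))"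
  using lin_zero[OF Ch Ch qmap_lin[of "Suc n"]] by simp
 ultimately have *: "bar_boundary G V act (Suc (Suc n))
   (qmap (Suc (Suc n)) (?T (Suc (Suc n)) (smap (Suc n) z))) = \<ominus>\<^sub>(Ch (Suc n)) z"
  using C.M.l_zero[OF C.M.a_inv_closed[OF z]] by (simp add: a_minus_def)
 have w: "qmap (Suc (Suc n)) (?T (Suc (Suc n)) (smap (Suc n) z)) : El (Ch (Suc (Suc n)))"
  by (intro lin_cl[OF qmap_lin] lin_cl[OF T] lin_cl[OF smap_lin] z)
 show ?thesis
  using lin_neg[OF Ch Ch bar_bd_lin w] * C.M.minus_minus[OF z] C2.M.a_inv_closed[OF w]
  by (metis image_eqI)
qed

end

subsection \<open>The prism operator\<close>

context abelian_group
begin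

lemma minus_diff: "x : El G ==> y : El G ==> z : El G ==> x \<ominus> (y \<ominus> z) = x \<ominus> y \<oplus> z"
 by (simp add: a_minus_def minus_add a_assoc)

text \<open>The bookkeeping of the inductive step of \<open>prism_homotopy\<close>; the assumption
  \<open>eq\<close> is the cone over the induction hypothesis.\<close>

lemma prism_cancel:
 assumes "a : El G" "b : El G" "c : El G" "p : El G" "h : El G"
  "q : El G" "d : El G" and eq: "h \<oplus> q = b \<ominus> d"
 shows "((a \<ominus> (b \<ominus> c)) \<ominus> (p \<ominus> h)) \<oplus> (p \<ominus> (c \<ominus> q)) = a \<ominus> d"
proof -
 have "((a \<ominus> (b \<ominus> c)) \<ominus> (p \<ominus> h)) \<oplus> (p \<ominus> (c \<ominus> q)) =
   (((a \<ominus> b \<oplus> c) \<ominus> p) \<oplus> h) \<oplus> ((p \<ominus> c) \<oplus> q)"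
  using assms by (simp add: minus_diff)
 also have "... = (a \<ominus> b) \<oplus> (h \<oplus> q) \<oplus> ((c \<oplus> \<ominus> c) \<oplus> (p \<oplus> \<ominus> p))"
  using assms(1-7) unfolding a_minus_def
  by (simp only: a_ac a_closed a_inv_closed)
 also have "... = (a \<ominus> b) \<oplus> (b \<ominus> d)"
  unfolding eq using assms(1-7) by (simp add: r_neg)
 also have "... = a \<ominus> d"
  using assms(1-7) by (simp add: a_minus_def a_assoc r_neg1)
 finally show ?thesis .
qed

end

context grp_rep
begin

text \<open>The usual alternating sum of the simplices
  \<open>(v_0, ..., v_i, \<rho> v_i, ..., \<rho> v_n)\<close>, written recursively in the first
  vertex so that it can be treated with \<open>cone\<close>.\<close>

primrec prb :: "('g => 'g) => 'g list => 'm => 'g list => 'm" where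
 "prb \<rho> [] m = (%_. \<zero>\<^sub>V)"
| "prb \<rho> (v # s) m = single V (v # \<rho> v # map \<rho> s) m \<ominus>\<^sub>(Ch (Suc (Suc (length s))))
   cone (Suc (Suc (length s))) v (prb \<rho> s m)"

definition prism :: "('g => 'g) => nat => ('g list => 'm) => 'g list => 'm" where
 "prism \<rho> n = lsupp V (Ch (Suc n)) (prb \<rho>)"

definition vmap :: "('g => 'g) => nat => ('g list => 'm) => 'g list => 'm" where
 "vmap \<rho> n = finsupp_map V V (tuples G n) (map \<rho>) (%m. m)"

lemma transl_cone:
 assumes "g : El G" "v : El G" "c : El (Ch n)"
 shows "transl (Suc n) g (cone (Suc n) v c) = cone (Suc n) (g \<otimes>\<^sub>G v) (transl n g c)"
 by (rule lin_eqI[OF V Ch lin_comp[OF cone_lin transl_lin]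
    lin_comp[OF transl_lin cone_lin] _ assms(3)])
   (use assms map_mult_tuples[of g] in \<open>simp_all add: cone_single transl_single act_cl\<close>)

context
 fixes \<rho> :: "'g => 'g"
 assumes \<rho>: "!!g. g : El G ==> \<rho> g : El G"
begin

lemma map_tuples: "gs : tuples G n ==> map \<rho> gs : tuples G n"
 using \<rho> by (auto simp: tup_iff)

lemma prb_lin: "gs : tuples G n ==> prb \<rho> gs : Lin K V (Ch (Suc n))"
proof (induction gs arbitrary: n)
 case Nil
 hence "prb \<rho> [] = (%m. \<zero>\<^sub>(Ch (Suc n)))" by (auto)
 thus ?case using lin_0[OF V Ch, of "Suc n"] by simp
next
 case (Cons v s)
 then obtain n' where n: "n = Suc n'" "v : El G" "s : tuples G n'"
  by (cases n) auto
 have l: "length s = n'" using n by (simp add: tup_iff)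
 have "prb \<rho> (v # s) = (%m. single V (v # \<rho> v # map \<rho> s) m \<ominus>\<^sub>(Ch (Suc n)) cone (Suc n) v (prb \<rho> s m))"
  by (simp add: fun_eq_iff l n(1))
 moreover have "v # \<rho> v # map \<rho> s : tuples G (Suc n)" using n map_tuples \<rho> by simp
 moreover have "prb \<rho> s : Lin K V (Ch n)" using Cons.IH n by simp
 ultimately show ?case
  using lin_minus[OF V Ch single_lin[OF V] lin_comp[OF _ cone_lin[OF n(2)]]] by simp
qed

lemma prism_lin: "prism \<rho> n : Lin K (Ch n) (Ch (Suc n))"
 unfolding prism_def by (rule lsupp_lin[OF V Ch]) (rule prb_lin)

lemma prism_single: "gs : tuples G n ==> m : El V ==> prism \<rho> n (single V gs m) = prb \<rho> gs m"
 unfolding prism_def by (rule lsupp_single[OF V Ch prb_lin])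

lemma vmap_lin: "vmap \<rho> n : Lin K (Ch n) (Ch n)"
 unfolding vmap_def by (rule fsm_lin[OF V V map_tuples lin_id])

lemma vmap_single: "gs : tuples G n ==> m : El V ==>
  vmap \<rho> n (single V gs m) = single V (map \<rho> gs) m"
 unfolding vmap_def by (rule fsm_single[OF V V map_tuples lin_id])

lemma hbd_vmap:
 assumes "c : El (Ch (Suc n))"
 shows "hbd (Suc n) (vmap \<rho> (Suc n) c) = vmap \<rho> n (hbd (Suc n) c)"
proof (rule lin_eqI[OF V Ch lin_comp[OF vmap_lin hbd_linear_Suc]
   lin_comp[OF hbd_linear_Suc vmap_lin] _ assms])
 fix gs m assume gs: "gs : tuples G (Suc n)" and m: "m : El V"
 interpret C: left_module K "Ch n" by (rule Ch)
 have om: "omit j gs : tuples G n" "omit j (map \<rho> gs) = map \<rho> (omit j gs)" if "j < Suc n" for j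
  using omit_tuples[OF gs] that by (auto simp: omit_def take_map drop_map)
 have "vmap \<rho> n (hbd (Suc n) (single V gs m)) =
   (\<Oplus>\<^sub>(Ch n)j\<in>{..<Suc n}. vmap \<rho> n (signed (Ch n) j (single V (omit j gs) m)))"
  unfolding hbd_single[OF gs m] hterms_def diff_Suc_1
  by (rule lin_finsum[OF Ch Ch vmap_lin])
    (use om m in \<open>auto intro!: signed_cl[OF Ch_ab] single_cl[OF V]\<close>)
 also have "... = (\<Oplus>\<^sub>(Ch n)j\<in>{..<Suc n}. signed (Ch n) j (single V (omit j (map \<rho> gs)) m))"
  by (rule C.finsum_cong')
    (use om m in \<open>auto simp: signed_image[OF Ch Ch vmap_lin] single_cl[OF V] vmap_single
     intro!: signed_cl[OF Ch_ab] single_cl[OF V] map_tuples\<close>)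
 also have "... = hbd (Suc n) (vmap \<rho> (Suc n) (single V gs m))"
  using map_tuples[OF gs] m by (simp add: vmap_single[OF gs m] hbd_single hterms_def)
 finally show "hbd (Suc n) (vmap \<rho> (Suc n) (single V gs m)) = vmap \<rho> n (hbd (Suc n) (single V gs m))"
  by simp
qed

lemma prism_Cons:
 assumes "v : El G" "s : tuples G n" "m : El V"
 shows "prism \<rho> (Suc n) (single V (v # s) m) =
  single V (v # \<rho> v # map \<rho> s) m \<ominus>\<^sub>(Ch (Suc (Suc n))) cone (Suc (Suc n)) v (prism \<rho> n (single V s m))"
proof -
 have "length s = n" using assms by (simp add: tup_iff)
 thus ?thesis using assms by (simp add: prism_single)
qed

lemma prism_cone:
 assumes v: "v : El G" and c: "c : El (Ch n)"
 shows "prism \<rho> (Suc n) (cone (Suc n) v c) =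
  cone (Suc (Suc n)) v (cone (Suc n) (\<rho> v) (vmap \<rho> n c)) \<ominus>\<^sub>(Ch (Suc (Suc n)))
  cone (Suc (Suc n)) v (prism \<rho> n c)"
 by (rule lin_eqI[OF V Ch lin_comp[OF cone_lin[OF v] prism_lin]
    lin_minus[OF Ch Ch lin_comp[OF lin_comp[OF vmap_lin cone_lin[OF \<rho>[OF v]]] cone_lin[OF v]]
     lin_comp[OF prism_lin cone_lin[OF v]]] _ c])
   (use v \<rho> map_tuples in \<open>simp add: cone_single prism_Cons vmap_single\<close>)

lemma prism_homotopy:
 assumes "c : El (Ch n)"
 shows "hbd (Suc n) (prism \<rho> n c) \<oplus>\<^sub>(Ch n) prism \<rho> (n - 1) (hbd n c) = vmap \<rho> n c \<ominus>\<^sub>(Ch n) c"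
 using assms
proof (induction n arbitrary: c)
 case 0
 interpret C: left_module K "Ch 0" by (rule Ch)
 have p0: "prism \<rho> 0 c = (%_. \<zero>\<^sub>V)" if "c : El (Ch 0)" for c
  using lin_eqI[OF V Ch prism_lin lin_0[OF Ch Ch] _ that]
  by (simp add: prism_single)
 have "vmap \<rho> 0 c = c"
  by (rule lin_eqI[OF V Ch vmap_lin lin_id _ 0]) (simp add: vmap_single)
 thus ?case
  using p0[OF 0] p0[of "%_. \<zero>\<^sub>V"] hbd_0[OF 0] lin_zero[OF Ch Ch hbd_linear_Suc[of 0]]
   C.M.zero_closed C.M.r_neg[OF 0] by (simp add: a_minus_def)
next
 case (Suc n)
 interpret C: left_module K "Ch (Suc n)" by (rule Ch)
 interpret C0: left_module K "Ch n" by (rule Ch)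
 have L1: "(%c. hbd (Suc (Suc n)) (prism \<rho> (Suc n) c) \<oplus>\<^sub>(Ch (Suc n)) prism \<rho> n (hbd (Suc n) c)) \<in>
   Lin K (Ch (Suc n)) (Ch (Suc n))"
  by (rule lin_sum[OF Ch Ch lin_comp[OF prism_lin hbd_linear_Suc] lin_comp[OF hbd_linear_Suc prism_lin]])
 show ?case unfolding diff_Suc_1
 proof (rule lin_eqI[OF V Ch L1 lin_minus[OF Ch Ch vmap_lin lin_id] _ Suc.prems])
  fix gs m assume "gs : tuples G (Suc n)" and m: "m : El V"
  then obtain v s where vs: "gs = v # s" "v : El G" "s : tuples G n" by (elim tuples_SucE)
  let ?s = "single V s m" and ?rs = "single V (map \<rho> s) m"
  have s: "?s : El (Ch n)" using vs m by (simp add: single_cl[OF V])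
  have rs: "?rs : El (Ch n)" using vs m map_tuples by (simp add: single_cl[OF V])
  define e where "e = hbd n ?s"
  have e: "e : El (Ch (n - 1))" unfolding e_def by (rule lin_cl[OF hbd_lin s])
  \<comment> \<open>For \<open>n = 0\<close> the chain \<open>e\<close> is zero and
    \<open>cone n\<close> has no meaning, so the value zero is put in by hand.\<close>
  define k where "k = (if n = 0 then (%_. \<zero>\<^sub>V) else cone n (\<rho> v) (vmap \<rho> (n - 1) e))"
  define q where "q = prism \<rho> (n - 1) e"
  have e0: "e = (%_. \<zero>\<^sub>V)" if "n = 0" using that hbd_0 s by (simp add: e_def)
  have k: "k : El (Ch n)"
  proof (cases n)
   case 0
   thus ?thesis using C0.M.zero_closed by (simp add: k_def)
  next
   case (Suc n')
   thus ?thesis using lin_cl[OF cone_lin[OF \<rho>[OF vs(2)]] lin_cl[OF vmap_lin], of e n'] e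
    by (simp add: k_def)
  qed
  have q: "q : El (Ch n)"
  proof (cases n)
   case 0
   thus ?thesis using e0 lin_zero[OF Ch Ch prism_lin[of 0]] C0.M.zero_closed by (simp add: q_def)
  next
   case (Suc n')
   thus ?thesis using lin_cl[OF prism_lin, of e n'] e by (simp add: q_def)
  qed
  have pc: "prism \<rho> n (cone n v e) = cone (Suc n) v k \<ominus>\<^sub>(Ch (Suc n)) cone (Suc n) v q"
  proof (cases n)
   case 0
   thus ?thesis
    using e0 lin_zero[OF Ch Ch prism_lin[of 0]] C.M.r_neg[OF C.M.zero_closed]
    by (simp add: k_def q_def a_minus_def)
  next
   case (Suc n')
   thus ?thesis using prism_cone[OF vs(2), of e n'] e by (simp add: k_def q_def)
  qed
  have hr: "hbd n ?rs = vmap \<rho> (n - 1) e"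
  proof (cases n)
   case 0
   thus ?thesis using e0 hbd_0[of ?rs] rs lin_zero[OF Ch Ch vmap_lin[of 0]] by simp
  next
   case (Suc n')
   thus ?thesis using hbd_vmap[of ?s n'] s vs m by (simp add: vmap_single e_def)
  qed
  have ck: "cone n (\<rho> v) (vmap \<rho> (n - 1) e) = k"
   using e0 lin_zero[OF Ch Ch vmap_lin[of 0]] by (auto simp: k_def)
  let ?P = "prism \<rho> n ?s"
  have P: "?P : El (Ch (Suc n))" by (rule lin_cl[OF prism_lin s])
  have cn: "cone n v e : El (Ch n)"
   using e0 e lin_cl[OF cone_lin[OF vs(2)], of e "n - 1"] by (cases n) auto
  let ?c = "cone (Suc n) v"
  note cc = lin_cl[OF cone_lin[OF vs(2)], of _ n]
  have hP: "hbd (Suc n) ?P : El (Ch n)" by (rule lin_cl[OF hbd_linear_Suc P])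
  have rvs: "\<rho> v # map \<rho> s : tuples G (Suc n)" "v # \<rho> v # map \<rho> s : tuples G (Suc (Suc n))"
   using vs \<rho> map_tuples by auto
  let ?a = "single V (\<rho> v # map \<rho> s) m" and ?d = "single V (v # s) m"
  have a: "?a : El (Ch (Suc n))" "single V (v # \<rho> v # map \<rho> s) m : El (Ch (Suc (Suc n)))"
   using rvs m by (auto intro: single_cl[OF V])
  have d: "?d : El (Ch (Suc n))" using vs m by (intro single_cl[OF V]) auto
  have "hbd (Suc (Suc n)) (prism \<rho> (Suc n) (single V gs m)) =
   hbd (Suc (Suc n)) (single V (v # \<rho> v # map \<rho> s) m) \<ominus>\<^sub>(Ch (Suc n))
   hbd (Suc (Suc n)) (cone (Suc (Suc n)) v ?P)"
   unfolding vs(1) prism_Cons[OF vs(2,3) m]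
   by (rule lin_diff[OF Ch Ch hbd_linear_Suc a(2) lin_cl[OF cone_lin[OF vs(2)] P]])
  also have "hbd (Suc (Suc n)) (single V (v # \<rho> v # map \<rho> s) m) = ?a \<ominus>\<^sub>(Ch (Suc n)) ?c (hbd (Suc n) ?a)"
   by (rule hbd_cone_single[OF vs(2) rvs(1) m])
  also have "hbd (Suc n) ?a = ?rs \<ominus>\<^sub>(Ch n) k"
   using hbd_cone_single[OF \<rho>[OF vs(2)] map_tuples[OF vs(3)] m] hr ck by simp
  also have "?c (?rs \<ominus>\<^sub>(Ch n) k) = ?c ?rs \<ominus>\<^sub>(Ch (Suc n)) ?c k"
   by (rule lin_diff[OF Ch Ch cone_lin[OF vs(2)] rs k])
  also have "hbd (Suc (Suc n)) (cone (Suc (Suc n)) v ?P) = ?P \<ominus>\<^sub>(Ch (Suc n)) ?c (hbd (Suc n) ?P)"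
   by (rule hbd_cone[OF vs(2) P])
  finally have A: "hbd (Suc (Suc n)) (prism \<rho> (Suc n) (single V gs m)) =
    (?a \<ominus>\<^sub>(Ch (Suc n)) (?c ?rs \<ominus>\<^sub>(Ch (Suc n)) ?c k)) \<ominus>\<^sub>(Ch (Suc n))
    (?P \<ominus>\<^sub>(Ch (Suc n)) ?c (hbd (Suc n) ?P))" .
  have "hbd (Suc n) (single V gs m) = ?s \<ominus>\<^sub>(Ch n) cone n v e"
   unfolding vs(1) e_def by (rule hbd_cone_single[OF vs(2,3) m])
  hence B: "prism \<rho> n (hbd (Suc n) (single V gs m)) =
    ?P \<ominus>\<^sub>(Ch (Suc n)) (?c k \<ominus>\<^sub>(Ch (Suc n)) ?c q)"
   using lin_diff[OF Ch Ch prism_lin s cn] pc by simp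
  have "hbd (Suc n) ?P \<oplus>\<^sub>(Ch n) q = ?rs \<ominus>\<^sub>(Ch n) ?s"
   using Suc.IH[OF s] vs m by (simp add: q_def e_def vmap_single)
  hence eq: "?c (hbd (Suc n) ?P) \<oplus>\<^sub>(Ch (Suc n)) ?c q = ?c ?rs \<ominus>\<^sub>(Ch (Suc n)) ?d"
   using lin_add[OF cone_lin[OF vs(2)] hP q] lin_diff[OF Ch Ch cone_lin[OF vs(2)] rs s]
    cone_single[OF vs(2,3) m] by simp
  show "hbd (Suc (Suc n)) (prism \<rho> (Suc n) (single V gs m)) \<oplus>\<^sub>(Ch (Suc n))
    prism \<rho> n (hbd (Suc n) (single V gs m)) =
    vmap \<rho> (Suc n) (single V gs m) \<ominus>\<^sub>(Ch (Suc n)) single V gs m"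
   unfolding A B using C.M.prism_cancel[OF a(1) cc[OF rs] cc[OF k] P cc[OF hP] cc[OF q] d eq]
    vs m by (simp add: vmap_single)
 qed
qed

end

end

lemma regular_module_simps [simp]:
 "El (Reg R) = El R" "\<zero>\<^sub>(Reg R) = \<zero>\<^sub>R"
 "x \<oplus>\<^sub>(Reg R) y = x \<oplus>\<^sub>R y" "a \<odot>\<^sub>(Reg R) x = a \<otimes>\<^sub>R x"
 by (auto simp: regular_module_def)

lemma regular_lm: "ring R ==> LMod R (Reg R)"
proof -
 assume "ring R"
 then interpret ring R .
 show ?thesis
  by (rule lmI) (auto simp: a_ac l_distr r_distr m_assoc ring_axioms intro!: bexI[of _ "\<ominus>\<^sub>R x" for x])
qed

lemma free_lm: "ring R ==> LMod R (free_module R X)"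
 unfolding free_module_def by (rule fs_lm[OF regular_lm])

text \<open>
 Coefficients in a permutation module: the vertices of a simplex with coefficient \<^term>\<open>x\<close> are
 moved by a map depending on \<^term>\<open>x\<close>.
\<close>

locale perm_rep = grp_rep K G "free_module K X" act
 for K :: "('k, 'y) ring_scheme" and G :: "('g, 'z) monoid_scheme" and X :: "'x set" and act +
 fixes mv :: "'g => 'x => 'x" and \<rho> :: "'x => 'g => 'g"
 assumes act_single: "g : El G ==> x : X ==> k : El K ==>
   act g (single (Reg K) x k) = single (Reg K) (mv g x) k"
  and mv_closed: "g : El G ==> x : X ==> mv g x : X"
  and \<rho>_closed: "x : X ==> g : El G ==> \<rho> x g : El G"
  and \<rho>_mv: "x : X ==> g : El G ==> h : El G ==> \<rho> (mv g x) (g \<otimes>\<^sub>G h) = g \<otimes>\<^sub>G \<rho> x h"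
begin

abbreviation "VX == free_module K X"
abbreviation "sx == single (Reg K)"

lemma Kr: "LMod K (Reg K)"
 by (rule regular_lm[OF V.R.ring_axioms])

lemma sx_cl: "x : X ==> k : El K ==> sx x k : El VX"
 unfolding free_module_def by (rule single_cl[OF Kr]) auto

lemma double_eq:
 assumes D: "LMod K D" and f: "f : Lin K (Ch n) D" and g: "g : Lin K (Ch n) D"
  and eq: "!!gs x k. gs : tuples G n ==> x : X ==> k : El K ==>
   f (single VX gs (sx x k)) = g (single VX gs (sx x k))"
  and c: "c : El (Ch n)"
 shows "f c = g c"
proof (rule lin_eqI[OF V D f g _ c])
 fix gs m assume gs: "gs : tuples G n" and m: "m : El VX"
 have L: "(%m. h (single VX gs m)) : Lin K (FS (Reg K) X) D"
  if "h : Lin K (Ch n) D" for h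
  using lin_comp[OF single_lin[OF V gs] that] by (simp add: free_module_def)
 show "f (single VX gs m) = g (single VX gs m)"
  by (rule lin_eqI[OF Kr D L[OF f] L[OF g]])
    (use eq[OF gs] m in \<open>auto simp: free_module_def\<close>)
qed

definition double_lift :: "('k, 'd) module => ('g list => 'x => 'k => 'd) => ('g list => 'x => 'k) => 'd" where
 "double_lift D F = lsupp VX D (%gs. lsupp (Reg K) D (F gs))"

context
 fixes D :: "('k, 'd) module" and F n
 assumes D: "LMod K D"
  and F: "!!gs x. gs : tuples G n ==> x : X ==> F gs x : Lin K (Reg K) D"
begin

lemma double_inner: "gs : tuples G n ==> lsupp (Reg K) D (F gs) : Lin K VX D"
 unfolding free_module_def by (rule lsupp_lin[OF Kr D F])

lemma double_lift_lin: "double_lift D F : Lin K (Ch n) D"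
 unfolding double_lift_def by (rule lsupp_lin[OF V D double_inner])

lemma double_lift_single:
 "gs : tuples G n ==> x : X ==> k : El K ==> double_lift D F (single VX gs (sx x k)) = F gs x k"
 unfolding double_lift_def
 using lsupp_single[OF V D double_inner, where x = gs and m = "sx x k" and X = "tuples G n"] sx_cl
  lsupp_single[OF Kr D F, where x = x and m = k and X = X] by simp

end

definition prism' :: "nat => ('g list => 'x => 'k) => 'g list => 'x => 'k" where
 "prism' n = double_lift (Ch (Suc n)) (%gs x k. prb (\<rho> x) gs (sx x k))"

definition vmap' :: "nat => ('g list => 'x => 'k) => 'g list => 'x => 'k" where
 "vmap' n = double_lift (Ch n) (%gs x k. single VX (map (\<rho> x) gs) (sx x k))"

lemma sx_lin: "x : X ==> sx x : Lin K (Reg K) VX"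
 unfolding free_module_def by (rule single_lin[OF Kr])

lemma prism'_F: "gs : tuples G n ==> x : X ==>
  (%k. prb (\<rho> x) gs (sx x k)) : Lin K (Reg K) (Ch (Suc n))"
 by (rule lin_comp[OF sx_lin prb_lin[OF \<rho>_closed]])

lemma vmap'_F: "gs : tuples G n ==> x : X ==>
  (%k. single VX (map (\<rho> x) gs) (sx x k)) : Lin K (Reg K) (Ch n)"
 by (rule lin_comp[OF sx_lin single_lin[OF V map_tuples[OF \<rho>_closed]]])

lemma prism'_lin: "prism' n : Lin K (Ch n) (Ch (Suc n))"
 unfolding prism'_def by (rule double_lift_lin[OF Ch prism'_F])

lemma vmap'_lin: "vmap' n : Lin K (Ch n) (Ch n)"
 unfolding vmap'_def by (rule double_lift_lin[OF Ch vmap'_F])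

lemma prism'_single: "gs : tuples G n ==> x : X ==> k : El K ==>
  prism' n (single VX gs (sx x k)) = prb (\<rho> x) gs (sx x k)"
 unfolding prism'_def by (rule double_lift_single[OF Ch prism'_F])

lemma vmap'_single: "gs : tuples G n ==> x : X ==> k : El K ==>
  vmap' n (single VX gs (sx x k)) = single VX (map (\<rho> x) gs) (sx x k)"
 unfolding vmap'_def by (rule double_lift_single[OF Ch vmap'_F])

text \<open>\<open>hbd\<close> changes the vertices but never the coefficient. Hence operators that
  agree on simplices with coefficient \<open>m\<close> agree on their boundaries, although
  \<open>prism'\<close> uses a different vertex map for each basis element.\<close>

lemma hbd_agree:
 assumes D: "LMod K D" and f: "f : Lin K (Ch n) D" and g: "g : Lin K (Ch n) D"
  and gs: "gs : tuples G (Suc n)" and m: "m : El VX"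
  and eq: "!!hs. hs : tuples G n ==> f (single VX hs m) = g (single VX hs m)"
 shows "f (hbd (Suc n) (single VX gs m)) = g (hbd (Suc n) (single VX gs m))"
proof -
 interpret D: left_module K D by (rule D)
 have om: "omit j gs : tuples G n" if "j < Suc n" for j
  using omit_tuples[OF gs] that by auto
 have s: "(%j. signed (Ch n) j (single VX (omit j gs) m)) : {..<Suc n} \<rightarrow> El (Ch n)"
  using om m by (auto intro!: signed_cl[OF Ch_ab] single_cl[OF V])
 show ?thesis
  unfolding hbd_single[OF gs m] hterms_def diff_Suc_1 lin_finsum[OF Ch D f s] lin_finsum[OF Ch D g s]
  by (rule D.finsum_cong')
    (use s om m eq in \<open>auto simp: signed_image[OF Ch D f] signed_image[OF Ch D g] single_cl[OF V] Pi_def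
     intro!: signed_cl[OF D.M.abelian_group_axioms] lin_cl[OF g] single_cl[OF V]\<close>)
qed

lemma prism'_homotopy:
 assumes "c : El (Ch (Suc n))"
 shows "hbd (Suc (Suc n)) (prism' (Suc n) c) \<oplus>\<^sub>(Ch (Suc n)) prism' n (hbd (Suc n) c) =
  vmap' (Suc n) c \<ominus>\<^sub>(Ch (Suc n)) c"
proof (rule double_eq[OF Ch lin_sum[OF Ch Ch lin_comp[OF prism'_lin hbd_linear_Suc]
    lin_comp[OF hbd_linear_Suc prism'_lin]] lin_minus[OF Ch Ch vmap'_lin lin_id] _ assms])
 fix gs x k assume gs: "gs : tuples G (Suc n)" and x: "x : X" and k: "k : El K"
 note sc = sx_cl[OF x k]
 let ?s = "single VX gs (sx x k)"
 have s: "?s : El (Ch (Suc n))" by (rule single_cl[OF V gs sc])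
 have agree: "prism' n (single VX hs (sx x k)) = prism (\<rho> x) n (single VX hs (sx x k))"
  if "hs : tuples G n" for hs
  using prism'_single[OF that x k] prism_single[where \<rho> = "\<rho> x", OF \<rho>_closed[OF x] that sc]
  by (rule trans[OF _ sym])
 have "prism' n (hbd (Suc n) ?s) = prism (\<rho> x) n (hbd (Suc n) ?s)"
  by (rule hbd_agree[OF Ch prism'_lin prism_lin[where \<rho> = "\<rho> x", OF \<rho>_closed[OF x]] gs sc agree])
 moreover have "prism' (Suc n) ?s = prism (\<rho> x) (Suc n) ?s"
  by (simp add: prism'_single[OF gs x k] prism_single[where \<rho> = "\<rho> x", OF \<rho>_closed[OF x] gs sc])
 moreover have "vmap' (Suc n) ?s = vmap (\<rho> x) (Suc n) ?s"
  by (simp add: vmap'_single[OF gs x k] vmap_single[where \<rho> = "\<rho> x", OF \<rho>_closed[OF x] gs sc])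
 ultimately show "hbd (Suc (Suc n)) (prism' (Suc n) ?s) \<oplus>\<^sub>(Ch (Suc n)) prism' n (hbd (Suc n) ?s) =
  vmap' (Suc n) ?s \<ominus>\<^sub>(Ch (Suc n)) ?s"
  using prism_homotopy[OF \<rho>_closed[OF x] s] by simp
qed

lemma prb_transl:
 assumes g: "g : El G" and x: "x : X" and k: "k : El K"
 shows "gs : tuples G n ==> prb (\<rho> (mv g x)) (map (%h. g \<otimes>\<^sub>G h) gs) (sx (mv g x) k) =
  transl (Suc n) g (prb (\<rho> x) gs (sx x k))"
proof (induction gs arbitrary: n)
 case Nil
 show ?case using lin_zero[OF Ch Ch transl_lin[OF g, of "Suc n"]] by simp
next
 case (Cons v s)
 then obtain n' where n: "n = Suc n'" "v : El G" "s : tuples G n'" by (cases n) auto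
 have l: "length s = n'" using n by (simp add: tup_iff)
 note sc = sx_cl[OF x k]
 let ?p = "prb (\<rho> x) s (sx x k)"
 have p: "?p : El (Ch n)"
  using lin_cl[OF prb_lin[OF \<rho>_closed[OF x] n(3)] sc] n(1) by simp
 have t: "v # \<rho> x v # map (\<rho> x) s : tuples G (Suc n)"
  using n map_tuples[OF \<rho>_closed[OF x]] \<rho>_closed[OF x] by auto
 have c: "cone (Suc n) v ?p : El (Ch (Suc n))" by (rule lin_cl[OF cone_lin[OF n(2)] p])
 have r: "map (\<rho> (mv g x)) (map (%h. g \<otimes>\<^sub>G h) s) = map (%h. g \<otimes>\<^sub>G h) (map (\<rho> x) s)"
  using n(3) \<rho>_mv[OF x g] by (auto simp: tup_iff)
 have "transl (Suc n) g (prb (\<rho> x) (v # s) (sx x k)) =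
  transl (Suc n) g (single VX (v # \<rho> x v # map (\<rho> x) s) (sx x k)) \<ominus>\<^sub>(Ch (Suc n))
  transl (Suc n) g (cone (Suc n) v ?p)"
  using lin_diff[OF Ch Ch transl_lin[OF g] single_cl[OF V t sc] c] l n(1) by simp
 also have "... = single VX ((g \<otimes>\<^sub>G v) # (g \<otimes>\<^sub>G \<rho> x v) # map (%h. g \<otimes>\<^sub>G h) (map (\<rho> x) s)) (sx (mv g x) k) \<ominus>\<^sub>(Ch (Suc n))
  cone (Suc n) (g \<otimes>\<^sub>G v) (transl n g ?p)"
  using transl_single[OF g t sc] act_single[OF g x k] transl_cone[OF g n(2) p] by simp
 also have "... = prb (\<rho> (mv g x)) (map (%h. g \<otimes>\<^sub>G h) (v # s)) (sx (mv g x) k)"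
  using Cons.IH[OF n(3)] n(1) l r \<rho>_mv[OF x g n(2)] by (simp del: map_map)
 finally show ?case by simp
qed

lemma prism'_transl:
 assumes g: "g : El G" and c: "c : El (Ch n)"
 shows "prism' n (transl n g c) = transl (Suc n) g (prism' n c)"
 by (rule double_eq[OF Ch lin_comp[OF transl_lin[OF g] prism'_lin]
    lin_comp[OF prism'_lin transl_lin[OF g]] _ c])
   (simp add: transl_single[OF g] sx_cl prism'_single act_single[OF g] mv_closed[OF g]
    map_mult_tuples[OF g] prb_transl[OF g])

text \<open>The vertices of all simplices with coefficient \<open>x\<close> may be moved by
  \<open>\<rho> x\<close> without leaving the homology class. A good choice of \<open>\<rho>\<close>
  forces the quotients of vertices into a subgroup; this is how Shapiro's lemma is obtained.\<close>

theorem perm_homotopy: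
 assumes z: "z : El (Ch (Suc n))" and cyc: "bar_boundary G VX act (Suc n) z = (%_. \<zero>\<^sub>VX)"
 shows "EX b:El (Ch (Suc (Suc n))). bar_boundary G VX act (Suc (Suc n)) b =
  qmap (Suc n) (vmap' (Suc (Suc n)) (smap (Suc n) z)) \<ominus>\<^sub>(Ch (Suc n)) z"
proof (rule bexI)
 show "bar_boundary G VX act (Suc (Suc n)) (qmap (Suc (Suc n)) (prism' (Suc (Suc n)) (smap (Suc n) z))) =
  qmap (Suc n) (vmap' (Suc (Suc n)) (smap (Suc n) z)) \<ominus>\<^sub>(Ch (Suc n)) z"
  by (rule homotopy_desc[OF prism'_lin prism'_lin prism'_transl lin_cl[OF vmap'_lin]
     prism'_homotopy z cyc])
 show "qmap (Suc (Suc n)) (prism' (Suc (Suc n)) (smap (Suc n) z)) : El (Ch (Suc (Suc n)))"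
  by (intro lin_cl[OF qmap_lin] lin_cl[OF prism'_lin] lin_cl[OF smap_lin] z)
qed

lemma perm_homotopy_lin:
 "(%z. qmap (Suc n) (vmap' (Suc (Suc n)) (smap (Suc n) z))) : Lin K (Ch (Suc n)) (Ch (Suc n))"
 by (intro lin_comp[OF smap_lin] lin_comp[OF vmap'_lin] qmap_lin)

lemma perm_homotopy_single:
 assumes gs: "gs : tuples G n" and x: "x : X" and k: "k : El K"
 shows "qmap n (vmap' (Suc n) (smap n (single VX gs (sx x k)))) =
  single VX (quots (map (\<rho> x) (pprods \<one>\<^sub>G gs))) (sx (mv (inv\<^bsub>G\<^esub> (\<rho> x \<one>\<^sub>G)) x) k)"
proof -
 have p: "pprods \<one>\<^sub>G gs : tuples G (Suc n)" using gs by (simp add: pprods_tuples)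
 have "pprods \<one>\<^sub>G gs ~= []" by (cases gs) auto
 hence "hd (map (\<rho> x) (pprods \<one>\<^sub>G gs)) = \<rho> x \<one>\<^sub>G" by (simp add: hd_map)
 thus ?thesis
  using smap_single[OF gs sx_cl[OF x k]] vmap'_single[OF p x k]
   qmap_single[OF map_tuples[OF \<rho>_closed[OF x] p] sx_cl[OF x k]]
   act_single[OF _ x k] \<rho>_closed[OF x] by simp
qed

end

subsection \<open>Functoriality of group homology\<close>

locale rep_map = A: grp_rep K G V act + B: grp_rep K H W act'
 for K :: "('k, 'y) ring_scheme" and G :: "('g, 'z) monoid_scheme" and V :: "('k, 'm) module"
  and act :: "'g => 'm => 'm" and H :: "('h, 'w) monoid_scheme" and W :: "('k, 'n) module"
  and act' :: "'h => 'n => 'n" +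
 fixes \<phi> :: "'g => 'h" and u :: "'m => 'n"
 assumes hom: "\<phi> : hom G H" and u_linear: "u : Lin K V W"
  and u_act: "g : El G ==> m : El V ==> u (act g m) = act' (\<phi> g) (u m)"
begin

abbreviation ch :: "nat => ('g list => 'm) => 'h list => 'n" where
 "ch n == finsupp_map V W (tuples H n) (map \<phi>) u"

lemma \<phi>_closed: "g : El G ==> \<phi> g : El H"
 using hom by (rule hom_in_carrier)

lemma map_\<phi>_tuples: "gs : tuples G n ==> map \<phi> gs : tuples H n"
 using \<phi>_closed by (auto simp: tup_iff)

lemma ch_lin: "ch n : Lin K (A.Ch n) (B.Ch n)"
 by (rule fsm_lin[OF A.V B.V map_\<phi>_tuples u_linear])

lemma ch_single: "gs : tuples G n ==> m : El V ==> ch n (single V gs m) = single W (map \<phi> gs) (u m)"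
 by (rule fsm_single[OF A.V B.V map_\<phi>_tuples u_linear])

lemma ch_face:
 assumes gs: "gs : tuples G (Suc n)" and m: "m : El V" and j: "j <= Suc n"
 shows "ch n (bar_face G V act j gs m) = bar_face H W act' j (map \<phi> gs) (u m)"
proof -
 interpret group_hom G H \<phi>
  using hom by (simp add: group_hom_def group_hom_axioms_def)
 have ne: "gs ~= []" and len: "length gs = Suc n" and car: "set gs <= El G" using gs by (auto simp: tup_iff)
 have hd: "hd gs : El G" "tl gs : tuples G n" "butlast gs : tuples G n"
  using gs by (cases gs; auto simp: tup_iff dest: in_set_butlastD)+
 consider "j = 0" | "j = length gs" "j ~= 0" | "0 < j" "j < length gs" using j len by linarith
 thus ?thesis
 proof cases
  case 1
  thus ?thesis using ne hd m
   by (simp add: bar_face_def ch_single A.act_cl u_act hd_map map_tl)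
 next
  case 2
  thus ?thesis using hd m by (simp add: bar_face_def ch_single map_butlast)
 next
  case 3
  have n: "gs ! (j - 1) : El G" "gs ! j : El G"
   using car 3 by (auto)
  hence "take (j - 1) gs @ [gs ! (j - 1) \<otimes>\<^sub>G gs ! j] @ drop (j + 1) gs : tuples G n"
   using 3 len car by (auto simp: tup_iff dest: in_set_takeD in_set_dropD)
  thus ?thesis using 3 n m
   by (simp add: bar_face_def ch_single take_map drop_map)
 qed
qed

lemma ch_boundary:
 assumes "c : El (A.Ch (Suc n))"
 shows "bar_boundary H W act' (Suc n) (ch (Suc n) c) = ch n (bar_boundary G V act (Suc n) c)"
proof (rule lin_eqI[OF A.V B.Ch lin_comp[OF ch_lin B.bar_bd_lin]
   lin_comp[OF A.bar_bd_lin ch_lin] _ assms])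
 fix gs m assume gs: "gs : tuples G (Suc n)" and m: "m : El V"
 interpret C: left_module K "B.Ch n" by (rule B.Ch)
 have f: "bar_face G V act j gs m : El (A.Ch n)" if "j <= Suc n" for j
  using lin_cl[OF A.bar_face_lin[OF gs that] m] .
 have f': "bar_face H W act' j (map \<phi> gs) (u m) : El (B.Ch n)" if "j <= Suc n" for j
  using lin_cl[OF B.bar_face_lin[OF map_\<phi>_tuples[OF gs] that] lin_cl[OF u_linear m]] .
 have "ch n (bar_boundary G V act (Suc n) (single V gs m)) =
  (\<Oplus>\<^sub>(B.Ch n)j\<in>{0..Suc n}. ch n (signed (A.Ch n) j (bar_face G V act j gs m)))"
  unfolding A.bar_bd_single[OF gs m]
  by (rule lin_finsum[OF A.Ch B.Ch ch_lin]) (use f in \<open>auto intro!: signed_cl[OF A.Ch_ab]\<close>)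
 also have "... = (\<Oplus>\<^sub>(B.Ch n)j\<in>{0..Suc n}. signed (B.Ch n) j (bar_face H W act' j (map \<phi> gs) (u m)))"
  by (rule C.finsum_cong')
    (use f f' in \<open>auto simp: signed_image[OF A.Ch B.Ch ch_lin] ch_face[OF gs m]
     intro!: signed_cl[OF B.Ch_ab]\<close>)
 also have "... = bar_boundary H W act' (Suc n) (ch (Suc n) (single V gs m))"
  by (simp add: ch_single[OF gs m] B.bar_bd_single[OF map_\<phi>_tuples[OF gs] lin_cl[OF u_linear m]])
 finally show "bar_boundary H W act' (Suc n) (ch (Suc n) (single V gs m)) =
   ch n (bar_boundary G V act (Suc n) (single V gs m))" by simp
qed

end

lemma rep_map_values:
 assumes "grp_rep K G V act" "grp_rep K G W act'" "u : Lin K V W"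
  and "!!g m. g : El G ==> m : El V ==> u (act g m) = act' g (u m)"
  and c: "c : El (FS V (tuples G (Suc n)))"
 shows "bar_boundary G W act' (Suc n) (%gs. u (c gs)) = (%gs. u (bar_boundary G V act (Suc n) c gs))"
proof -
 interpret rep_map K G V act G W act' "%g. g" u
  using assms(1-4) by (auto simp: rep_map_def rep_map_axioms_def hom_def)
 have "ch k d = (%gs. u (d gs))" if "d : El (A.Ch k)" for k d
  by (rule fsm_ident[OF A.V B.V u_linear that]) simp
 thus ?thesis
  using ch_boundary[OF c] c lin_cl[OF A.bar_bd_lin c] by simp
qed

section \<open>Cycles and boundaries of the bar complex\<close>

context grp_rep
begin

lemma bar_chains_eq: "bar_chains G V n = Ch n"
 by (simp add: bar_chains_def)

lemma bar_bds_sub: "submod K (Ch n) (bar_boundaries G V act n)"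
 unfolding bar_boundaries_def bar_chains_eq
 by (rule submod_image[OF Ch Ch bar_bd_lin submod_carrier[OF Ch]])

lemma bar_cycles_0: "bar_cycles G V act 0 = El (Ch 0)"
 by (auto simp: bar_cycles_def bar_chains_eq)

lemma bar_cycles_Suc: "bar_cycles G V act (Suc n) =
  {c : El (Ch (Suc n)). bar_boundary G V act (Suc n) c = (%_. \<zero>\<^sub>V)}"
 by (auto simp: bar_cycles_def bar_chains_eq)

lemma bar_cycles_sub: "submod K (Ch n) (bar_cycles G V act n)"
proof (cases n)
 case 0
 thus ?thesis using submod_carrier[OF Ch[of 0]] by (simp add: bar_cycles_0)
next
 case (Suc n')
 show ?thesis unfolding Suc bar_cycles_Suc
  using submod_vimage[OF Ch Ch bar_bd_lin submod_zero[OF Ch]] by simp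
qed

lemma bds_subset_cycles: "bar_boundaries G V act n <= bar_cycles G V act n"
proof (cases n)
 case 0
 thus ?thesis using subD(1)[OF bar_bds_sub] bar_cycles_0 by metis
next
 case (Suc n')
 show ?thesis
  unfolding Suc bar_cycles_Suc bar_boundaries_def bar_chains_eq
  using bar_bd_bar_bd lin_cl[OF bar_bd_lin] by auto
qed

end

context rep_map
begin

lemma ch_bds: "b : bar_boundaries G V act n ==> ch n b : bar_boundaries H W act' n"
proof -
 assume "b : bar_boundaries G V act n"
 then obtain c where c: "c : El (A.Ch (Suc n))" "b = bar_boundary G V act (Suc n) c"
  unfolding bar_boundaries_def A.bar_chains_eq by blast
 show ?thesis
  unfolding bar_boundaries_def B.bar_chains_eq c(2) ch_boundary[OF c(1), symmetric]
  by (rule imageI[OF lin_cl[OF ch_lin c(1)]])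
qed

lemma ch_cycles: "z : bar_cycles G V act n ==> ch n z : bar_cycles H W act' n"
proof (cases n)
 case 0
 assume "z : bar_cycles G V act n"
 with 0 show ?thesis using lin_cl[OF ch_lin[of 0]] A.bar_cycles_0 B.bar_cycles_0 by auto
next
 case (Suc n')
 assume "z : bar_cycles G V act n"
 with Suc show ?thesis
  using lin_cl[OF ch_lin] ch_boundary lin_zero[OF A.Ch B.Ch ch_lin[of n']]
  by (auto simp: A.bar_cycles_Suc B.bar_cycles_Suc)
qed

end

subsection \<open>Subquotients\<close>

lemma quotient_lm:
 assumes V: "LMod K V" and p: "p ` El V = El Q" and zero: "p \<zero>\<^sub>V = \<zero>\<^sub>Q"
  and add: "!!x y. x : El V ==> y : El V ==> p x \<oplus>\<^sub>Q p y = p (x \<oplus>\<^sub>V y)"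
  and smult: "!!a x. a : El K ==> x : El V ==> a \<odot>\<^sub>Q p x = p (a \<odot>\<^sub>V x)"
 shows "LMod K Q"
proof -
 interpret V: left_module K V by (rule V)
 note s = V.smult_closed add smult zero[symmetric]
 show ?thesis
 proof (rule lmI; (unfold p[symmetric])?; (elim imageE, hypsubst)?)
  show "ring K" by (rule V.R.ring_axioms)
 next
  fix x assume x: "x : El V"
  show "EX Y:p ` El V. Y \<oplus>\<^sub>Q p x = \<zero>\<^sub>Q"
   by (rule bexI[of _ "p (\<ominus>\<^sub>V x)"]) (use x V.l_neg in \<open>simp_all add: s\<close>)
 qed (use V.M.zero_closed in \<open>simp_all add: s V.M.a_ac V.smult_l_distr V.smult_r_distr
  V.smult_assoc1 V.smult_one\<close>)
qed

context
 fixes K :: "('k, 'y) ring_scheme" and V :: "('k, 'm) module" and B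
 assumes V: "LMod K V" and B: "submod K V B"
begin

interpretation V: left_module K V by (rule V)

lemma coset_def: "B +>\<^sub>V z = (%b. b \<oplus>\<^sub>V z) ` B"
 by (auto simp: a_r_coset_def r_coset_def)

lemma coset_self: "z : El V ==> z : B +>\<^sub>V z"
 unfolding coset_def using subD(2)[OF B] by force

lemma coset_eqI:
 assumes "x : El V" "y : El V" "x \<ominus>\<^sub>V y : B"
 shows "B +>\<^sub>V x = B +>\<^sub>V y"
proof -
 have *: "B +>\<^sub>V x <= B +>\<^sub>V y" if "x : El V" "y : El V" "x \<ominus>\<^sub>V y : B" for x y
 proof
  fix w assume "w : B +>\<^sub>V x"
  then obtain b where b: "b : B" "w = b \<oplus>\<^sub>V x" by (auto simp: coset_def)
  hence bV: "b : El V" using subD(1)[OF B] by auto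
  have "w = (b \<oplus>\<^sub>V (x \<ominus>\<^sub>V y)) \<oplus>\<^sub>V y"
   using that b bV by (simp add: a_minus_def V.M.a_assoc V.M.l_neg)
  thus "w : B +>\<^sub>V y" unfolding coset_def using subD(3)[OF B b(1) that(3)] by blast
 qed
 have "\<ominus>\<^sub>V (x \<ominus>\<^sub>V y) = y \<ominus>\<^sub>V x"
  using assms(1,2) by (simp add: a_minus_def V.M.minus_add V.M.a_comm)
 hence "y \<ominus>\<^sub>V x : B" using submod_neg[OF V B assms(3)] by simp
 thus ?thesis using *[OF assms] *[OF assms(2,1)] by auto
qed

lemma coset_memD: "x : B +>\<^sub>V z ==> z : El V ==> x : El V & x \<ominus>\<^sub>V z : B"
 using subD(1)[OF B] by (auto simp: coset_def a_minus_def V.M.a_assoc V.M.r_neg)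

text \<open>\<open>group_homology_map\<close> is a union over all representatives of a class; it
  collapses because they all give the same coset.\<close>

lemma coset_UN:
 assumes W: "LMod K W" and f: "f : Lin K V W" and B': "submod K W B'"
  and fB: "f ` B <= B'" and z: "z : El V"
 shows "(\<Union>x\<in>B +>\<^sub>V z. B' +>\<^sub>W f x) = B' +>\<^sub>W f z"
proof -
 interpret W: left_module K W by (rule W)
 have "B' +>\<^sub>W f x = B' +>\<^sub>W f z" if "x : B +>\<^sub>V z" for x
 proof -
  have x: "x : El V" "x \<ominus>\<^sub>V z : B" using coset_memD[OF that z] by auto
  have "f x \<ominus>\<^sub>W f z : B'" using lin_diff[OF V W f x(1) z] x(2) fB by auto
  hence "(%b. b \<oplus>\<^sub>W f x) ` B' = (%b. b \<oplus>\<^sub>W f z) ` B'"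
  proof -
   note fx = lin_cl[OF f x(1)] and fz = lin_cl[OF f z] and BW = subsetD[OF subD(1)[OF B']]
   assume d: "f x \<ominus>\<^sub>W f z : B'"
   have "b \<oplus>\<^sub>W f x = (b \<oplus>\<^sub>W (f x \<ominus>\<^sub>W f z)) \<oplus>\<^sub>W f z" if "b : B'" for b
    using BW[OF that] fx fz by (simp add: a_minus_def W.M.a_assoc W.M.l_neg)
   moreover have "b \<oplus>\<^sub>W f z = (b \<ominus>\<^sub>W (f x \<ominus>\<^sub>W f z)) \<oplus>\<^sub>W f x" if "b : B'" for b
    using BW[OF that] fx fz
    by (simp add: a_minus_def W.M.a_assoc W.M.l_neg W.M.minus_add W.M.a_comm[of "\<ominus>\<^sub>W f x"])
   ultimately show ?thesis
    using subD(3)[OF B' _ d] submod_diff[OF W B' _ d] by (auto simp: image_iff) metis+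
  qed
  thus ?thesis by (auto simp: a_r_coset_def r_coset_def)
 qed
 thus ?thesis using coset_self[OF z] by blast
qed

lemma subq_carrier: "El (subquotient V Z B) = (%z. B +>\<^sub>V z) ` Z"
 by (simp add: subquotient_def)

lemma subq_add:
 assumes "x : El V" "y : El V"
 shows "(B +>\<^sub>V x) \<oplus>\<^sub>(subquotient V Z B) (B +>\<^sub>V y) = B +>\<^sub>V (x \<oplus>\<^sub>V y)"
proof -
 have "set_add V (B +>\<^sub>V x) (B +>\<^sub>V y) = B +>\<^sub>V (x \<oplus>\<^sub>V y)"
  unfolding coset_def set_add_def set_mult_def
 proof (intro equalityI subsetI; clarsimp)
  fix b c assume b: "b : B" "c : B"
  hence "b : El V" "c : El V" using subD(1)[OF B] by auto
  hence "b \<oplus>\<^sub>V x \<oplus>\<^sub>V (c \<oplus>\<^sub>V y) = (b \<oplus>\<^sub>V c) \<oplus>\<^sub>V (x \<oplus>\<^sub>V y)"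
   using assms by (simp add: V.M.a_ac)
  thus "b \<oplus>\<^sub>V x \<oplus>\<^sub>V (c \<oplus>\<^sub>V y) : (%b. b \<oplus>\<^sub>V (x \<oplus>\<^sub>V y)) ` B"
   using subD(3)[OF B b] by blast
 next
  fix b assume b: "b : B"
  hence "b : El V" using subD(1)[OF B] by auto
  hence "b \<oplus>\<^sub>V (x \<oplus>\<^sub>V y) = b \<oplus>\<^sub>V x \<oplus>\<^sub>V (\<zero>\<^sub>V \<oplus>\<^sub>V y)"
   using assms by (simp add: V.M.a_ac)
  thus "EX xa:B. EX xb:B. b \<oplus>\<^sub>V (x \<oplus>\<^sub>V y) = xa \<oplus>\<^sub>V x \<oplus>\<^sub>V (xb \<oplus>\<^sub>V y)"
   using b subD(2)[OF B] by blast
 qed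
 thus ?thesis by (simp add: subquotient_def)
qed

lemma subq_smult:
 assumes a: "a : El K" and x: "x : El V"
 shows "a \<odot>\<^sub>(subquotient V Z B) (B +>\<^sub>V x) = B +>\<^sub>V (a \<odot>\<^sub>V x)"
proof -
 have *: "B +>\<^sub>V (a \<odot>\<^sub>V y) = B +>\<^sub>V (a \<odot>\<^sub>V x)" if "y : B +>\<^sub>V x" for y
 proof (rule coset_eqI)
  have y: "y : El V" "y \<ominus>\<^sub>V x : B" using coset_memD[OF that x] by auto
  thus "a \<odot>\<^sub>V y : El V" "a \<odot>\<^sub>V x : El V" using a x V.smult_closed by auto
  have "a \<odot>\<^sub>V y \<ominus>\<^sub>V a \<odot>\<^sub>V x = a \<odot>\<^sub>V (y \<ominus>\<^sub>V x)"
   using a x y by (simp add: a_minus_def V.smult_r_distr V.smult_r_minus)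
  thus "a \<odot>\<^sub>V y \<ominus>\<^sub>V a \<odot>\<^sub>V x : B" using subD(4)[OF B a y(2)] by simp
 qed
 have "(%y. B +>\<^sub>V (a \<odot>\<^sub>V y)) ` (B +>\<^sub>V x) = (%y. B +>\<^sub>V (a \<odot>\<^sub>V x)) ` (B +>\<^sub>V x)"
  by (rule image_cong[OF refl *])
 also have "... = {B +>\<^sub>V (a \<odot>\<^sub>V x)}" using coset_self[OF x] by blast
 finally show ?thesis by (simp add: subquotient_def)
qed

lemma subq_zero: "\<zero>\<^sub>(subquotient V Z B) = B +>\<^sub>V \<zero>\<^sub>V"
proof -
 have "(%b. b \<oplus>\<^sub>V \<zero>\<^sub>V) ` B = (%b. b) ` B"
  by (rule image_cong) (use subD(1)[OF B] in auto)
 thus ?thesis by (simp add: subquotient_def coset_def)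
qed

lemma subq_lm:
 assumes Z: "submod K V Z"
 shows "LMod K (subquotient V Z B)"
proof (rule quotient_lm[OF submod_lm[OF V Z]])
 note ZV = subsetD[OF subD(1)[OF Z]]
 show "(%z. B +>\<^sub>V z) ` El (V(|carrier := Z|)) = El (subquotient V Z B)"
  by (simp add: subq_carrier)
 show "B +>\<^sub>V \<zero>\<^sub>(V(|carrier := Z|)) = \<zero>\<^sub>(subquotient V Z B)" by (simp add: subq_zero)
 fix x assume x: "x : El (V(|carrier := Z|))"
 hence xV: "x : El V" using ZV by simp
 show "a \<odot>\<^sub>(subquotient V Z B) (B +>\<^sub>V x) = B +>\<^sub>V (a \<odot>\<^sub>(V(|carrier := Z|)) x)"
  if "a : El K" for a
  using subq_smult[OF that xV] by simp
 fix y assume y: "y : El (V(|carrier := Z|))"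
 hence yV: "y : El V" using ZV by simp
 show "(B +>\<^sub>V x) \<oplus>\<^sub>(subquotient V Z B) (B +>\<^sub>V y) = B +>\<^sub>V (x \<oplus>\<^sub>(V(|carrier := Z|)) y)"
  using subq_add[OF xV yV] by simp
qed

lemma subq_proj_lin:
 assumes Z: "submod K V Z"
 shows "(%z. B +>\<^sub>V z) : Lin K (V(|carrier := Z|)) (subquotient V Z B)"
proof (rule linI)
 note ZV = subsetD[OF subD(1)[OF Z]]
 fix x assume x: "x : El (V(|carrier := Z|))"
 hence xV: "x : El V" using ZV by simp
 show "B +>\<^sub>V x : El (subquotient V Z B)" using x by (simp add: subq_carrier)
 show "B +>\<^sub>V (a \<odot>\<^sub>(V(|carrier := Z|)) x) = a \<odot>\<^sub>(subquotient V Z B) (B +>\<^sub>V x)"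
  if "a : El K" for a
  using subq_smult[OF that xV] by simp
 fix y assume y: "y : El (V(|carrier := Z|))"
 hence yV: "y : El V" using ZV by simp
 show "B +>\<^sub>V (x \<oplus>\<^sub>(V(|carrier := Z|)) y) = (B +>\<^sub>V x) \<oplus>\<^sub>(subquotient V Z B) (B +>\<^sub>V y)"
  using subq_add[OF xV yV] by simp
qed

end

subsection \<open>Finite generation\<close>

text \<open>Generation modulo \<open>B\<close>. With \<open>B\<close> the boundaries, this expresses
  generation of homology by classes of cycles without forming quotients; with \<open>B\<close> zero
  it is generation in the usual sense.\<close>

definition gspan :: "('k, 'y) ring_scheme => ('o, 'a) cat => ('o, 'a, 'k, 'm) cat_mod =>
  ('o \<times> 'm) set => ('o => 'm set) => 'o => 'm set" where
 "gspan K C M Gs B y =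
   cspan K (ob_mod M y) ({arr_map M x y a m |x m a. (x, m) : Gs & a : Arr C x y} \<union> B y)"

definition fin_gen :: "('k, 'y) ring_scheme => ('o, 'a) cat => ('o, 'a, 'k, 'm) cat_mod =>
  ('o => 'm set) => ('o => 'm set) => bool" where
 "fin_gen K C M S B <-> (EX Gs. finite Gs & (ALL (x, m):Gs. x : Ob C & m : S x) &
   (ALL y:Ob C. S y <= gspan K C M Gs B y))"

definition subfam :: "('k, 'y) ring_scheme => ('o, 'a) cat => ('o, 'a, 'k, 'm) cat_mod =>
  ('o => 'm set) => bool" where
 "subfam K C M S <-> (ALL x:Ob C. submod K (ob_mod M x) (S x)) &
   (ALL x:Ob C. ALL y:Ob C. ALL a:Arr C x y. ALL m:S x. arr_map M x y a m : S y)"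

lemma famD:
 assumes "subfam K C M S"
 shows "x : Ob C ==> submod K (ob_mod M x) (S x)"
  and "x : Ob C ==> y : Ob C ==> a : Arr C x y ==> m : S x ==> arr_map M x y a m : S y"
 using assms by (auto simp: subfam_def)

context cat_module
begin

lemma ob_lm: "x : Ob C ==> LMod K (ob_mod M x)"
 by (rule module_lm[OF ob_module])

lemma arr_cl: "x : Ob C ==> y : Ob C ==> a : Arr C x y ==> m : El (ob_mod M x) ==>
  arr_map M x y a m : El (ob_mod M y)"
 by (rule lin_cl[OF arr_linear])

lemma zero_subfam: "subfam K C M (%x. {\<zero>\<^sub>(ob_mod M x)})"
 unfolding subfam_def
 using submod_zero[OF ob_lm] lin_zero[OF ob_lm ob_lm arr_linear] by auto

lemma gspan_gens_cl:
 assumes "!!x m. (x, m) : Gs ==> x : Ob C & m : El (ob_mod M x)"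
  and "!!x. x : Ob C ==> B x <= El (ob_mod M x)" and y: "y : Ob C"
 shows "{arr_map M x y a m |x m a. (x, m) : Gs & a : Arr C x y} \<union> B y <= El (ob_mod M y)"
proof (intro Un_least subsetI)
 fix v assume "v : {arr_map M x y a m |x m a. (x, m) : Gs & a : Arr C x y}"
 then obtain x m a where v: "v = arr_map M x y a m" "(x, m) : Gs" "a : Arr C x y" by blast
 show "v : El (ob_mod M y)"
  unfolding v(1) using assms(1)[OF v(2)] by (intro arr_cl[OF _ y v(3)]) (rule conjunct1, assumption, rule conjunct2)
qed (use assms(2)[OF y] in auto)

lemma gspan_sub:
 assumes "!!x m. (x, m) : Gs ==> x : Ob C & m : El (ob_mod M x)"
  and "!!x. x : Ob C ==> B x <= El (ob_mod M x)" and "y : Ob C"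
 shows "submod K (ob_mod M y) (gspan K C M Gs B y)"
 unfolding gspan_def
 by (rule cspan_sub[OF ob_lm[OF assms(3)] gspan_gens_cl[OF assms]])

lemma gspan_subfam:
 assumes G: "!!x m. (x, m) : Gs ==> x : Ob C & m : El (ob_mod M x)"
  and B: "!!x. x : Ob C ==> B x <= El (ob_mod M x)"
  and Bc: "!!x y a m. x : Ob C ==> y : Ob C ==> a : Arr C x y ==> m : B x ==> arr_map M x y a m : B y"
 shows "subfam K C M (gspan K C M Gs B)"
 unfolding subfam_def
proof (intro conjI ballI)
 fix x assume "x : Ob C"
 show "submod K (ob_mod M x) (gspan K C M Gs B x)" by (rule gspan_sub[OF G B \<open>x : Ob C\<close>])
next
 fix x y a m assume x: "x : Ob C" and y: "y : Ob C" and a: "a : Arr C x y" and m: "m : gspan K C M Gs B x"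
 show "arr_map M x y a m : gspan K C M Gs B y"
  unfolding gspan_def
 proof (rule cspan_image[OF ob_lm[OF x] ob_lm[OF y] arr_linear[OF x y a] _ m[unfolded gspan_def]])
  show "{arr_map M z x a m |z m a. (z, m) : Gs & a : Arr C z x} \<union> B x <= El (ob_mod M x)"
   by (rule gspan_gens_cl[OF G B x])
  have "arr_map M x y a (arr_map M z x b n) : {arr_map M z y a m |z m a. (z, m) : Gs & a : Arr C z y}"
   if "(z, n) : Gs" "b : Arr C z x" for z n b
  proof -
   have "Comp C z x y a b : Arr C z y"
    "arr_map M z y (Comp C z x y a b) n = arr_map M x y a (arr_map M z x b n)"
    using G[OF that(1)] Comp_closed[OF _ x y that(2) a] arr_Comp[OF _ x y that(2) a, of n] by blast+
   thus ?thesis using that(1) by (smt (verit, best) mem_Collect_eq)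
  qed
  thus "arr_map M x y a ` ({arr_map M z x a m |z m a. (z, m) : Gs & a : Arr C z x} \<union> B x) <=
    cspan K (ob_mod M y) ({arr_map M z y a m |z m a. (z, m) : Gs & a : Arr C z y} \<union> B y)"
   using Bc[OF x y a] by (auto intro!: cspan_base)
 qed
qed

lemma gspan_base:
 assumes "(x, m) : Gs" "x : Ob C" "m : El (ob_mod M x)"
 shows "m : gspan K C M Gs B x"
proof -
 have "m = arr_map M x x (Ident C x) m" using assms by (simp add: arr_Ident)
 thus ?thesis unfolding gspan_def using assms Ident_closed by (blast intro!: cspan_base)
qed

end

lemma gspan_B: "b : B y ==> b : gspan K C M Gs B y"
 by (auto simp: gspan_def intro: cspan_base)

lemma gspan_arr: "(x, m) : Gs ==> a : Arr C x y ==> arr_map M x y a m : gspan K C M Gs B y"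
 by (auto simp: gspan_def intro: cspan_base)

lemma gspan_least:
 assumes "submod K (ob_mod M y) N" "B y <= N"
  "!!x m a. (x, m) : Gs ==> a : Arr C x y ==> arr_map M x y a m : N"
 shows "gspan K C M Gs B y <= N"
 unfolding gspan_def by (rule cspan_least[OF assms(1)]) (use assms in auto)

lemma gspan_mono: "Gs <= Gs' ==> gspan K C M Gs B y <= gspan K C M Gs' B y"
 unfolding gspan_def by (rule cspan_mono) auto

subsection \<open>Systems of groups and representations\<close>

text \<open>The index category is arbitrary because the construction is applied twice: to OI itself,
  where it yields \<open>homology_U\<close>, and to the skeleton on natural numbers, where all
  arguments take place.\<close>

locale hsys =
 fixes K :: "('k, 'y) ring_scheme" and I :: "('s, 'f) cat"
  and U :: "'s => ('g, 'z) monoid_scheme" and pu :: "'s => 's => 'f => 'g => 'g"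
  and N :: "'s => ('k, 'm) module" and act :: "'s => 'g => 'm => 'm"
  and tr :: "'s => 's => 'f => 'm => 'm"
 assumes K: "cring K" and I: "category I"
  and rep: "S : Ob I ==> grp_rep K (U S) (N S) (act S)"
  and map: "S : Ob I ==> T : Ob I ==> f : Arr I S T ==>
   rep_map K (U S) (N S) (act S) (U T) (N T) (act T) (pu S T f) (tr S T f)"
  and pu_id: "S : Ob I ==> g : El (U S) ==> pu S S (Ident I S) g = g"
  and pu_comp: "S : Ob I ==> T : Ob I ==> T' : Ob I ==> f : Arr I S T ==> h : Arr I T T' ==> g : El (U S) ==>
   pu S T' (Comp I S T T' h f) g = pu T T' h (pu S T f g)"
  and tr_id: "S : Ob I ==> m : El (N S) ==> tr S S (Ident I S) m = m"
  and tr_comp: "S : Ob I ==> T : Ob I ==> T' : Ob I ==> f : Arr I S T ==> h : Arr I T T' ==> m : El (N S) ==>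
   tr S T' (Comp I S T T' h f) m = tr T T' h (tr S T f m)"
begin

definition chains :: "nat => ('s, 'f, 'k, 'g list => 'm) cat_mod" where
 "chains i = (|ob_mod = (%S. FS (N S) (tuples (U S) i)),
   arr_map = (%S T f. finsupp_map (N S) (N T) (tuples (U T) i) (map (pu S T f)) (tr S T f))|)"

definition cyc :: "nat => 's => ('g list => 'm) set" where
 "cyc i S = bar_cycles (U S) (N S) (act S) i"

definition bnd :: "nat => 's => ('g list => 'm) set" where
 "bnd i S = bar_boundaries (U S) (N S) (act S) i"

definition homology :: "nat => ('s, 'f, 'k, ('g list => 'm) set) cat_mod" where
 "homology i = (|ob_mod = (%S. group_homology (U S) (N S) (act S) i),
   arr_map = (%S T f. group_homology_map (N S) (U T) (N T) (act T) i (pu S T f) (tr S T f))|)"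

lemma chains_cat_module: "cat_module K I (chains i)"
proof (rule cat_module.intro[OF I], rule cat_module_axioms.intro)
 fix S assume S: "S : Ob I"
 interpret r: grp_rep K "U S" "N S" "act S" by (rule rep[OF S])
 show "module K (ob_mod (chains i) S)"
  using lm_module[OF K r.Ch] by (simp add: chains_def)
 fix T f assume T: "T : Ob I" and f: "f : Arr I S T"
 interpret m: rep_map K "U S" "N S" "act S" "U T" "N T" "act T" "pu S T f" "tr S T f"
  by (rule map[OF S T f])
 show "arr_map (chains i) S T f : Lin K (ob_mod (chains i) S) (ob_mod (chains i) T)"
  using m.ch_lin by (simp add: chains_def)
next
 fix S c assume S: "S : Ob I" and c: "c : El (ob_mod (chains i) S)"
 interpret r: grp_rep K "U S" "N S" "act S" by (rule rep[OF S])
 have id: "Ident I S : Arr I S S" using category.Ident_closed[OF I S] .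
 interpret m: rep_map K "U S" "N S" "act S" "U S" "N S" "act S" "pu S S (Ident I S)" "tr S S (Ident I S)"
  by (rule map[OF S S id])
 have mp: "List.map (pu S S (Ident I S)) gs = gs" if "gs : tuples (U S) i" for gs
  using that pu_id[OF S] by (intro map_idI) (auto simp: tup_iff)
 have "finsupp_map (N S) (N S) (tuples (U S) i) (List.map (pu S S (Ident I S))) (tr S S (Ident I S)) c =
   (%gs. tr S S (Ident I S) (c gs))"
  by (rule fsm_ident[OF r.V r.V m.u_linear _ mp]) (use c in \<open>simp_all add: chains_def\<close>)
 also have "... = c"
 proof
  fix gs
  have "c gs : El (N S)" by (rule fs_val[OF r.V]) (use c in \<open>simp add: chains_def\<close>)
  thus "tr S S (Ident I S) (c gs) = c gs" by (rule tr_id[OF S])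
 qed
 finally show "arr_map (chains i) S S (Ident I S) c = c" by (simp add: chains_def)
next
 fix S T T' f h c
 assume o: "S : Ob I" "T : Ob I" "T' : Ob I" and f: "f : Arr I S T" and h: "h : Arr I T T'"
  and c: "c : El (ob_mod (chains i) S)"
 interpret m: rep_map K "U S" "N S" "act S" "U T" "N T" "act T" "pu S T f" "tr S T f"
  by (rule map) (use o f in auto)
 interpret m': rep_map K "U T" "N T" "act T" "U T'" "N T'" "act T'" "pu T T' h" "tr T T' h"
  by (rule map) (use o h in auto)
 have "finsupp_map (N S) (N T') (tuples (U T') i) (List.map (pu S T' (Comp I S T T' h f)))
   (tr S T' (Comp I S T T' h f)) c =
  finsupp_map (N T) (N T') (tuples (U T') i) (List.map (pu T T' h)) (tr T T' h)
   (finsupp_map (N S) (N T) (tuples (U T) i) (List.map (pu S T f)) (tr S T f) c)"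
  by (rule fsm_comp[OF m.A.V m.B.V m'.B.V m.map_\<phi>_tuples m'.map_\<phi>_tuples m.u_linear m'.u_linear])
    (use o f h c pu_comp tr_comp in \<open>auto simp: chains_def tup_iff\<close>)
 thus "arr_map (chains i) S T' (Comp I S T T' h f) c =
  arr_map (chains i) T T' h (arr_map (chains i) S T f c)"
  by (simp add: chains_def)
qed

lemma cyc_subfam: "subfam K I (chains i) (cyc i)"
 unfolding subfam_def
proof (intro conjI ballI)
 fix S assume S: "S : Ob I"
 interpret r: grp_rep K "U S" "N S" "act S" by (rule rep[OF S])
 show "submod K (ob_mod (chains i) S) (cyc i S)"
  using r.bar_cycles_sub by (simp add: chains_def cyc_def)
 fix T f z assume T: "T : Ob I" and f: "f : Arr I S T" and z: "z : cyc i S"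
 interpret m: rep_map K "U S" "N S" "act S" "U T" "N T" "act T" "pu S T f" "tr S T f"
  by (rule map[OF S T f])
 show "arr_map (chains i) S T f z : cyc i T"
  using m.ch_cycles z by (simp add: chains_def cyc_def)
qed

lemma bnd_subfam: "subfam K I (chains i) (bnd i)"
 unfolding subfam_def
proof (intro conjI ballI)
 fix S assume S: "S : Ob I"
 interpret r: grp_rep K "U S" "N S" "act S" by (rule rep[OF S])
 show "submod K (ob_mod (chains i) S) (bnd i S)"
  using r.bar_bds_sub by (simp add: chains_def bnd_def)
 fix T f z assume T: "T : Ob I" and f: "f : Arr I S T" and z: "z : bnd i S"
 interpret m: rep_map K "U S" "N S" "act S" "U T" "N T" "act T" "pu S T f" "tr S T f"
  by (rule map[OF S T f])
 show "arr_map (chains i) S T f z : bnd i T"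
  using m.ch_bds z by (simp add: chains_def bnd_def)
qed

lemma bnd_cyc: "S : Ob I ==> bnd i S <= cyc i S"
 using grp_rep.bds_subset_cycles[OF rep] by (simp add: bnd_def cyc_def)

lemma homol_ob: "ob_mod (homology i) S = subquotient (ob_mod (chains i) S) (cyc i S) (bnd i S)"
 by (simp add: homology_def group_homology_def chains_def cyc_def bnd_def bar_chains_def)

lemma homol_arr:
 assumes S: "S : Ob I" and T: "T : Ob I" and f: "f : Arr I S T"
  and z: "z : El (ob_mod (chains i) S)"
 shows "arr_map (homology i) S T f (bnd i S +>\<^sub>(ob_mod (chains i) S) z) =
  bnd i T +>\<^sub>(ob_mod (chains i) T) arr_map (chains i) S T f z"
proof -
 interpret c: cat_module K I "chains i" by (rule chains_cat_module)
 have "(\<Union>x\<in>bnd i S +>\<^sub>(ob_mod (chains i) S) z. bnd i T +>\<^sub>(ob_mod (chains i) T) arr_map (chains i) S T f x) =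
   bnd i T +>\<^sub>(ob_mod (chains i) T) arr_map (chains i) S T f z"
  by (rule coset_UN[OF c.ob_lm[OF S] famD(1)[OF bnd_subfam S] c.ob_lm[OF T]
    c.arr_linear[OF S T f] famD(1)[OF bnd_subfam T] _ z])
   (use famD(2)[OF bnd_subfam S T f] in auto)
 thus ?thesis
  by (simp add: homology_def group_homology_map_def chains_def bnd_def bar_chains_def)
qed

lemma homol_cat_module: "cat_module K I (homology i)"
proof (rule cat_module.intro[OF I], rule cat_module_axioms.intro)
 interpret c: cat_module K I "chains i" by (rule chains_cat_module)
 note lm = c.ob_lm and B = famD(1)[OF bnd_subfam[of i]]
  and Z = famD(1)[OF cyc_subfam[of i]]
 have ZC: "z : El (ob_mod (chains i) S)" if "S : Ob I" "z : cyc i S" for S z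
  using subD(1)[OF Z[OF that(1)]] that(2) by auto
 have car: "El (ob_mod (homology i) S) = (%z. bnd i S +>\<^sub>(ob_mod (chains i) S) z) ` cyc i S" for S
  by (simp add: homol_ob subquotient_def)
 {
  fix S assume S: "S : Ob I"
  show "module K (ob_mod (homology i) S)"
   unfolding homol_ob by (rule lm_module[OF K subq_lm[OF lm[OF S] B[OF S] Z[OF S]]])
  fix T f assume T: "T : Ob I" and f: "f : Arr I S T"
  note arr = homol_arr[OF S T f, of _ i]
  show "arr_map (homology i) S T f : Lin K (ob_mod (homology i) S) (ob_mod (homology i) T)"
  proof (rule linI; unfold car; elim imageE; hypsubst)
   fix z assume z: "z : cyc i S"
   thus "arr_map (homology i) S T f (bnd i S +>\<^sub>(ob_mod (chains i) S) z) \<in>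
    (%z. bnd i T +>\<^sub>(ob_mod (chains i) T) z) ` cyc i T"
    using arr[OF ZC[OF S]] famD(2)[OF cyc_subfam S T f] by auto
  next
   fix y z assume y: "y : cyc i S" and z: "z : cyc i S"
   note yc = ZC[OF S y] and zc = ZC[OF S z]
   have "y \<oplus>\<^sub>(ob_mod (chains i) S) z : El (ob_mod (chains i) S)"
    using subD(3)[OF Z[OF S] y z] ZC[OF S] by auto
   thus "arr_map (homology i) S T f ((bnd i S +>\<^sub>(ob_mod (chains i) S) y) \<oplus>\<^sub>(ob_mod (homology i) S)
      (bnd i S +>\<^sub>(ob_mod (chains i) S) z)) =
     arr_map (homology i) S T f (bnd i S +>\<^sub>(ob_mod (chains i) S) y) \<oplus>\<^sub>(ob_mod (homology i) T)
     arr_map (homology i) S T f (bnd i S +>\<^sub>(ob_mod (chains i) S) z)"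
    unfolding homol_ob
    by (simp only: subq_add[OF lm[OF S] B[OF S] yc zc] arr yc zc lin_add[OF c.arr_linear[OF S T f] yc zc]
      subq_add[OF lm[OF T] B[OF T] c.arr_cl[OF S T f yc] c.arr_cl[OF S T f zc]])
  next
   fix a z assume a: "a : El K" and z: "z : cyc i S"
   note zc = ZC[OF S z]
   have "a \<odot>\<^sub>(ob_mod (chains i) S) z : El (ob_mod (chains i) S)"
    using subD(4)[OF Z[OF S] a z] ZC[OF S] by auto
   thus "arr_map (homology i) S T f (a \<odot>\<^sub>(ob_mod (homology i) S) (bnd i S +>\<^sub>(ob_mod (chains i) S) z)) =
     a \<odot>\<^sub>(ob_mod (homology i) T) arr_map (homology i) S T f (bnd i S +>\<^sub>(ob_mod (chains i) S) z)"
    unfolding homol_ob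
    by (simp only: subq_smult[OF lm[OF S] B[OF S] a zc] arr zc lin_smult[OF c.arr_linear[OF S T f] a zc]
      subq_smult[OF lm[OF T] B[OF T] a c.arr_cl[OF S T f zc]])
  qed
 }
 {
  fix S X assume S: "S : Ob I" and X: "X : El (ob_mod (homology i) S)"
  then obtain z where z: "z : cyc i S" "X = bnd i S +>\<^sub>(ob_mod (chains i) S) z" by (auto simp: car)
  show "arr_map (homology i) S S (Ident I S) X = X"
   unfolding z(2) homol_arr[OF S S category.Ident_closed[OF I S] ZC[OF S z(1)]]
   by (simp add: c.arr_Ident[OF S ZC[OF S z(1)]])
 }
 {
  fix S T T' f h X
  assume o: "S : Ob I" "T : Ob I" "T' : Ob I" and f: "f : Arr I S T" and h: "h : Arr I T T'"
   and X: "X : El (ob_mod (homology i) S)"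
  from X obtain z where z: "z : cyc i S" "X = bnd i S +>\<^sub>(ob_mod (chains i) S) z" by (auto simp: car)
  note zc = ZC[OF o(1) z(1)]
  show "arr_map (homology i) S T' (Comp I S T T' h f) X =
    arr_map (homology i) T T' h (arr_map (homology i) S T f X)"
   unfolding z(2) homol_arr[OF o(1,3) category.Comp_closed[OF I o f h] zc]
    homol_arr[OF o(1,2) f zc] homol_arr[OF o(2,3) h c.arr_cl[OF o(1,2) f zc]]
   by (simp add: c.arr_Comp[OF o f h zc])
 }
qed

end

section \<open>The category OVI(R) in matrix form\<close>

lemma OI_Ob: "S : Ob OI <-> finite (fst S) & linear_order_on (fst S) (snd S)"
 by (simp add: OI_def)

lemma OI_Arr: "Arr OI S T = oi_hom S T"
 by (simp add: OI_def)

lemma oi_homD: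
 assumes "f : oi_hom S T"
 shows "s : fst S ==> f s : fst T" "inj_on f (fst S)" "(i, j) : snd S ==> (f i, f j) : snd T"
  "f : extensional (fst S)"
 using assms by (auto simp: oi_hom_def PiE_iff)

lemma OI_orderD:
 assumes "S : Ob OI"
 shows "finite (fst S)" "snd S <= fst S \<times> fst S" "s : fst S ==> (s, s) : snd S"
  "(i, j) : snd S ==> (j, k) : snd S ==> (i, k) : snd S"
  "(i, j) : snd S ==> (j, i) : snd S ==> i = j"
  "i : fst S ==> j : fst S ==> (i, j) : snd S \<or> (j, i) : snd S"
proof -
 have *: "finite (fst S)" "partial_order_on (fst S) (snd S)" "total_on (fst S) (snd S)"
  using assms by (auto simp: OI_Ob linear_order_on_def)
 note p = partial_order_onD[OF *(2)]
 show "finite (fst S)" "snd S <= fst S \<times> fst S" by (fact *(1), fact p(4))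
 show refl: "s : fst S ==> (s, s) : snd S" for s using p(1) by (auto simp: refl_on_def)
 show "(i, j) : snd S ==> (j, k) : snd S ==> (i, k) : snd S" using p(2) by (rule transD)
 show "(i, j) : snd S ==> (j, i) : snd S ==> i = j" using p(3) by (rule antisymD)
 show "i : fst S ==> j : fst S ==> (i, j) : snd S \<or> (j, i) : snd S"
  using *(3) refl by (cases "i = j") (auto simp: total_on_def)
qed

lemma oi_hom_comp:
 assumes "S : Ob OI" "f : oi_hom S T" "g : oi_hom T U"
 shows "compose (fst S) g f : oi_hom S U"
proof -
 have "compose (fst S) g f : fst S \<rightarrow>\<^sub>E fst U"
  using assms(2,3) by (auto simp: oi_hom_def compose_def)
 moreover have "inj_on (compose (fst S) g f) (fst S)"
  using assms(2,3) by (auto simp: oi_hom_def compose_def inj_on_def PiE_iff)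
 moreover have "(compose (fst S) g f i, compose (fst S) g f j) : snd U" if "(i, j) : snd S" for i j
  using that OI_orderD(2)[OF assms(1)] assms(2,3) by (auto simp: oi_hom_def compose_def)
 ultimately show ?thesis by (auto simp: oi_hom_def)
qed

lemma oi_hom_id: "S : Ob OI ==> (\<lambda>i\<in>fst S. i) : oi_hom S S"
 using OI_orderD(2)[of S] by (auto simp: oi_hom_def)

lemma OI_cat: "category OI"
proof
 fix S assume "S : Ob OI"
 thus "Ident OI S : Arr OI S S" by (simp add: OI_def oi_hom_id)
next
 fix S T U f g assume "S : Ob OI" "T : Ob OI" "U : Ob OI" "f : Arr OI S T" "g : Arr OI T U"
 thus "Comp OI S T U g f : Arr OI S U" using oi_hom_comp by (simp add: OI_def)
qed (auto simp: OI_def oi_hom_def compose_def PiE_iff extensional_def fun_eq_iff)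

context category
begin

lemma aut_group_group:
 assumes X: "X : Ob C"
 shows "group (aut_group C X)"
proof (rule groupI)
 let ?G = "aut_group C X" and ?c = "Comp C X X X" and ?A = "Arr C X X" and ?i = "Ident C X"
 have m: "x \<otimes>\<^sub>?G y = ?c x y" "\<one>\<^sub>?G = ?i" for x y
  by (auto simp: aut_group_def)
 have c: "x : El ?G <-> x : ?A & (EX b:?A. ?c b x = ?i & ?c x b = ?i)" for x
  by (auto simp: aut_group_def)
 note assoc = Comp_assoc[OF X X X X] and cl = Comp_closed[OF X X X]
  and l = Comp_Ident_left[OF X X] and r = Comp_Ident_right[OF X X] and i = Ident_closed[OF X]
 have inv: "?c (?c y' x') (?c x y) = ?i"
  if "x : ?A" "x' : ?A" "y : ?A" "y' : ?A" "?c x' x = ?i" "?c y' y = ?i" for x x' y y'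
 proof -
  have "?c (?c y' x') (?c x y) = ?c (?c (?c y' x') x) y"
   by (rule assoc[OF that(3) that(1) cl[OF that(2,4)], symmetric])
  also have "?c (?c y' x') x = ?c y' (?c x' x)" by (rule assoc[OF that(1,2,4)])
  also have "... = y'" unfolding that(5) by (rule r[OF that(4)])
  finally show ?thesis using that(6) by simp
 qed
 {
  fix x y assume "x : El ?G" "y : El ?G"
  then obtain x' y' where x: "x : ?A" "x' : ?A" "?c x' x = ?i" "?c x x' = ?i"
   and y: "y : ?A" "y' : ?A" "?c y' y = ?i" "?c y y' = ?i"
   unfolding c by blast
  show "x \<otimes>\<^sub>?G y : El ?G"
   unfolding c m using inv[OF x(1,2) y(1,2) x(3) y(3)] inv[OF y(2,1) x(2,1) y(4) x(4)]
    cl[OF y(1) x(1)] cl[OF x(2) y(2)] by blast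
 }
 show "\<one>\<^sub>?G : El ?G" unfolding c m using i l[OF i] by blast
 {
  fix x y z assume "x : El ?G" "y : El ?G" "z : El ?G"
  thus "x \<otimes>\<^sub>?G y \<otimes>\<^sub>?G z = x \<otimes>\<^sub>?G (y \<otimes>\<^sub>?G z)" unfolding c m using assoc by blast
 }
 {
  fix x assume x: "x : El ?G"
  thus "\<one>\<^sub>?G \<otimes>\<^sub>?G x = x" unfolding c m using l by blast
  from x obtain y where "x : ?A" "y : ?A" "?c y x = ?i" "?c x y = ?i" unfolding c by blast
  hence "y : El ?G" "y \<otimes>\<^sub>?G x = \<one>\<^sub>?G" unfolding c m by blast+
  thus "EX y:El ?G. y \<otimes>\<^sub>?G x = \<one>\<^sub>?G" by blast
 }
qed

end

section \<open>Morphisms of standard objects as matrices\<close>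

locale ovi_ring = ring R for R :: "('r, 'x) ring_scheme" (structure) +
 assumes one_not_zero: "\<one> ~= \<zero>"
begin

abbreviation "RR == Reg R"
abbreviation "Fr X == free_module R X"
abbreviation "e == (%i. single RR i \<one>)"

lemma RR: "LMod R RR"
 by (rule regular_lm[OF ring_axioms])

lemma Fr: "LMod R (Fr X)"
 by (rule free_lm[OF ring_axioms])

lemma Fr_simps [simp]:
 "\<zero>\<^sub>(Fr X) = (%x. \<zero>)" "c \<oplus>\<^sub>(Fr X) d = (%x. c x \<oplus> d x)" "a \<odot>\<^sub>(Fr X) c = (%x. a \<otimes> c x)"
 by (simp_all add: free_module_def)

lemma Fr_carrier: "c : El (Fr X) <-> (ALL x:X. c x : El R) & (ALL x. x ~: X --> c x = \<zero>) &
  finite {x. c x ~= \<zero>}"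
 by (simp add: free_module_def fs_iff)

lemma Fr_finite: "finite X ==> c : El (Fr X) <-> (ALL x:X. c x : El R) & (ALL x. x ~: X --> c x = \<zero>)"
 unfolding Fr_carrier by (auto intro: finite_subset[of _ X])

lemma Fr_val: "c : El (Fr X) ==> c x : El R"
 using fs_val[OF RR] by (simp add: free_module_def)

lemma e_closed: "i : X ==> e i : El (Fr X)"
 unfolding free_module_def by (rule single_cl[OF RR]) auto

lemma Fr_eval_lin: "(%c. c x) : Lin R (Fr X) RR"
 by (rule linI) (auto simp: Fr_val)

lemma finsum_RR: "finsum RR h J = finsum R h J"
 by (simp add: finsum_def finprod_def regular_module_def)

lemma e_apply: "e i u = (if u = i then \<one> else \<zero>)"
 by (simp add: single_def)

lemma Fr_finsum_eval:
 assumes "g : I \<rightarrow> El (Fr X)"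
 shows "(\<Oplus>\<^sub>(Fr X)i\<in>I. g i) x = (\<Oplus>i\<in>I. g i x)"
 using lin_finsum[OF Fr RR Fr_eval_lin assms] by (simp add: finsum_RR)

lemma finsum_delta:
 assumes "finite J" "a : J \<rightarrow> El R"
 shows "(\<Oplus>j\<in>J. a j \<otimes> (if u = j then \<one> else \<zero>)) = (if u : J then a u else \<zero>)"
proof -
 have "(\<Oplus>j\<in>J. a j \<otimes> (if u = j then \<one> else \<zero>)) = (\<Oplus>j\<in>J. if u = j then a j else \<zero>)"
  by (rule finsum_cong') (use assms in \<open>auto simp: Pi_def\<close>)
 also have "... = (if u : J then a u else \<zero>)"
 proof (cases "u : J")
  case True
  thus ?thesis using finsum_singleton[OF True assms(1), of a] assms(2) by auto
 next
  case False
  have "(\<Oplus>j\<in>J. if u = j then a j else \<zero>) = (\<Oplus>j\<in>J. \<zero>)"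
   by (rule finsum_cong') (use False in auto)
  thus ?thesis using False by simp
 qed
 finally show ?thesis .
qed

lemma finsum_delta':
 assumes "finite J" "a : J \<rightarrow> El R"
 shows "(\<Oplus>j\<in>J. (if j = u then \<one> else \<zero>) \<otimes> a j) = (if u : J then a u else \<zero>)"
proof -
 have "(\<Oplus>j\<in>J. (if j = u then \<one> else \<zero>) \<otimes> a j) = (\<Oplus>j\<in>J. a j \<otimes> (if u = j then \<one> else \<zero>))"
  by (rule finsum_cong') (use assms in \<open>auto simp: Pi_def\<close>)
 thus ?thesis using finsum_delta[OF assms] by simp
qed

lemma Fr_expand:
 assumes "finite J" "J <= X" "a : J \<rightarrow> El R"
 shows "(\<Oplus>\<^sub>(Fr X)j\<in>J. a j \<odot>\<^sub>(Fr X) e j) = (%u. if u : J then a u else \<zero>)"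
proof
 fix u
 have cl: "(%j. a j \<odot>\<^sub>(Fr X) e j) : J \<rightarrow> El (Fr X)"
  using assms by (auto intro!: left_module.smult_closed[OF Fr] e_closed simp del: Fr_simps)
 have "(\<Oplus>\<^sub>(Fr X)j\<in>J. a j \<odot>\<^sub>(Fr X) e j) u = (\<Oplus>j\<in>J. a j \<otimes> (if u = j then \<one> else \<zero>))"
  using Fr_finsum_eval[OF cl] by (simp add: e_apply cong: if_cong)
 thus "(\<Oplus>\<^sub>(Fr X)j\<in>J. a j \<odot>\<^sub>(Fr X) e j) u = (if u : J then a u else \<zero>)"
  using finsum_delta[OF assms(1,3)] by simp
qed

abbreviation std :: "ordset => 'r ovi_obj" where "std == std_obj R"
abbreviation Hom :: "ordset => ordset => 'r ovi_arr set" where "Hom S T == ovi_hom R (std S) (std T)"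

lemma std_simps [simp]: "omod (std S) = Fr (fst S)" "oind (std S) = S"
 "i : fst S ==> obas (std S) i = e i"
 by (auto simp: std_obj_def)

lemma std_basis:
 assumes "finite (fst S)"
 shows "is_basis R (Fr (fst S)) (fst S) (obas (std S))"
 unfolding is_basis_def
proof (intro conjI ballI)
 show "obas (std S) : fst S \<rightarrow>\<^sub>E El (Fr (fst S))"
  by (auto simp: std_obj_def e_closed)
 fix x assume x: "x : El (Fr (fst S))"
 have *: "(\<Oplus>\<^sub>(Fr (fst S))i\<in>fst S. c i \<odot>\<^sub>(Fr (fst S)) obas (std S) i) = (%u. if u : fst S then c u else \<zero>)"
  if "c : fst S \<rightarrow>\<^sub>E El R" for c
 proof -
  have c: "c : fst S \<rightarrow> El R" using that by auto
  interpret F: left_module R "Fr (fst S)" by (rule Fr)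
  have "(\<Oplus>\<^sub>(Fr (fst S))i\<in>fst S. c i \<odot>\<^sub>(Fr (fst S)) obas (std S) i) =
   (\<Oplus>\<^sub>(Fr (fst S))i\<in>fst S. c i \<odot>\<^sub>(Fr (fst S)) e i)"
   using c by (intro F.M.finsum_cong')
    (auto intro!: left_module.smult_closed[OF Fr] e_closed simp del: Fr_simps)
  thus ?thesis using Fr_expand[OF assms subset_refl c] by simp
 qed
 show "EX! c. c : fst S \<rightarrow>\<^sub>E El R & x = (\<Oplus>\<^sub>(Fr (fst S))i\<in>fst S. c i \<odot>\<^sub>(Fr (fst S)) obas (std S) i)"
 proof (rule ex1I[of _ "restrict x (fst S)"])
  show "restrict x (fst S) : fst S \<rightarrow>\<^sub>E El R &
   x = (\<Oplus>\<^sub>(Fr (fst S))i\<in>fst S. restrict x (fst S) i \<odot>\<^sub>(Fr (fst S)) obas (std S) i)"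
   using x *[of "restrict x (fst S)"] by (auto simp: Fr_carrier)
  fix c assume c: "c : fst S \<rightarrow>\<^sub>E El R &
   x = (\<Oplus>\<^sub>(Fr (fst S))i\<in>fst S. c i \<odot>\<^sub>(Fr (fst S)) obas (std S) i)"
  hence "x = (%u. if u : fst S then c u else \<zero>)" using * by simp
  thus "c = restrict x (fst S)"
   using c by (auto simp: fun_eq_iff extensional_def)
 qed
qed

lemma std_Ob: "S : Ob OI ==> std S : Ob (OVI R)"
 using std_basis[of S] Fr OI_orderD(1)[of S] by (simp add: OVI_def)

definition mat :: "'r ovi_arr => nat => nat => 'r" where
 "mat x t s = fst x (e s) t"

definition mor :: "ordset => ordset => (nat => nat => 'r) => (nat => nat) => 'r ovi_arr" where
 "mor S T A f = (matrix_map R (fst S) (fst T) A, f)"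

text \<open>Column \<open>s\<close> is the image of basis vector \<open>s\<close>; its last nonzero
  entry is a 1 in row \<open>f s\<close>, called its pivot.\<close>

definition umat :: "ordset => ordset => (nat => nat => 'r) => (nat => nat) => bool" where
 "umat S T A f <-> f : oi_hom S T & (ALL s:fst S. (ALL t:fst T. A t s : El R) & A (f s) s = \<one> &
   (ALL t:fst T. (t, f s) ~: snd T --> A t s = \<zero>))"

lemma mmap_lin:
 assumes fin: "finite S" "finite T" and A: "!!s t. s : S ==> t : T ==> A t s : El R"
 shows "matrix_map R S T A : Lin R (Fr S) (Fr T)"
proof (rule linI)
 have ev: "matrix_map R S T A c t = (if t : T then \<Oplus>s\<in>S. c s \<otimes> A t s else \<zero>)"
  if "c : El (Fr S)" for c t
  using that by (simp add: matrix_map_def)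
 interpret F: left_module R "Fr S" by (rule Fr)
 fix c assume c: "c : El (Fr S)"
 have cl: "(%s. d s \<otimes> A t s) : S \<rightarrow> El R" if "d : El (Fr S)" "t : T" for d t
  using Fr_val[OF that(1)] A that(2) by auto
 show "matrix_map R S T A c : El (Fr T)"
  using c cl[OF c] by (auto simp: Fr_finite[OF fin(2)] ev)
 {
  fix d assume d: "d : El (Fr S)"
  show "matrix_map R S T A (c \<oplus>\<^sub>(Fr S) d) = matrix_map R S T A c \<oplus>\<^sub>(Fr T) matrix_map R S T A d"
  proof
   fix t
   have "(\<Oplus>s\<in>S. (c s \<oplus> d s) \<otimes> A t s) = (\<Oplus>s\<in>S. c s \<otimes> A t s) \<oplus> (\<Oplus>s\<in>S. d s \<otimes> A t s)" if "t : T"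
   proof -
    have "(\<Oplus>s\<in>S. (c s \<oplus> d s) \<otimes> A t s) = (\<Oplus>s\<in>S. c s \<otimes> A t s \<oplus> d s \<otimes> A t s)"
     using cl[OF c that] cl[OF d that] Fr_val[OF c] Fr_val[OF d] A that
     by (intro finsum_cong') (auto simp: l_distr)
    thus ?thesis using finsum_addf[OF cl[OF c that] cl[OF d that]] by simp
   qed
   thus "matrix_map R S T A (c \<oplus>\<^sub>(Fr S) d) t = (matrix_map R S T A c \<oplus>\<^sub>(Fr T) matrix_map R S T A d) t"
    using ev[OF F.M.a_closed[OF c d]] ev[OF c] ev[OF d] by simp
  qed
 }
 fix a assume a: "a : El R"
 show "matrix_map R S T A (a \<odot>\<^sub>(Fr S) c) = a \<odot>\<^sub>(Fr T) matrix_map R S T A c"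
 proof
  fix t
  have "(\<Oplus>s\<in>S. a \<otimes> c s \<otimes> A t s) = a \<otimes> (\<Oplus>s\<in>S. c s \<otimes> A t s)" if "t : T"
  proof -
   have "(\<Oplus>s\<in>S. a \<otimes> c s \<otimes> A t s) = (\<Oplus>s\<in>S. a \<otimes> (c s \<otimes> A t s))"
    using cl[OF c that] Fr_val[OF c] A that a by (intro finsum_cong') (auto simp: m_assoc)
   thus ?thesis using finsum_rdistr[OF fin(1) a cl[OF c that]] by simp
  qed
  thus "matrix_map R S T A (a \<odot>\<^sub>(Fr S) c) t = (a \<odot>\<^sub>(Fr T) matrix_map R S T A c) t"
   using ev[OF F.smult_closed[OF a c]] ev[OF c] a by simp
 qed
qed

lemma mmap_e:
 assumes "finite S" "!!s. s : S ==> A t s : El R" "s : S"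
 shows "matrix_map R S T A (e s) t = (if t : T then A t s else \<zero>)"
by (auto simp: e_apply finsum_delta' e_closed matrix_map_def assms)

lemma Fr_lin_eq:
 assumes D: "LMod R D" and f: "f : Lin R (Fr S) D" and g: "g : Lin R (Fr S) D"
  and eq: "!!s. s : S ==> f (e s) = g (e s)" and c: "c : El (Fr S)"
 shows "f c = g c"
proof (rule lin_eqI[OF RR D f[unfolded free_module_def] g[unfolded free_module_def] _ c[unfolded free_module_def]])
 fix s m assume s: "s : S" and m: "m : El RR"
 have "single RR s m = m \<odot>\<^sub>(Fr S) e s" using m by (auto simp: single_def)
 thus "f (single RR s m) = g (single RR s m)"
  using lin_smult[OF f _ e_closed[OF s], of m] lin_smult[OF g _ e_closed[OF s], of m] m eq[OF s]
  by (simp del: Fr_simps)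
qed

context
 fixes S T :: ordset
 assumes S: "S : Ob OI" and T: "T : Ob OI"
begin

lemma finS: "finite (fst S)" and finT: "finite (fst T)"
 using OI_orderD(1) S T by auto

lemma mat_mor:
 assumes "umat S T A f" "s : fst S" "t : fst T"
 shows "mat (mor S T A f) t s = A t s"
 using mmap_e[OF finS, of A t s "fst T"] assms by (simp add: mat_def mor_def umat_def)

text \<open>The scalars whose existence is demanded in \<open>ovi_hom\<close> can only be the
  entries of the column strictly below the pivot index, so the demand becomes a condition on the
  other entries.\<close>

lemma hom_iff: "x : Hom S T <-> fst x : Lin R (Fr (fst S)) (Fr (fst T)) &
  fst x : extensional (El (Fr (fst S))) & umat S T (mat x) (snd x)"
proof -
 have *: "(EX a:strictly_below T (f i) \<rightarrow> El R. F (e i) = e (f i) \<oplus>\<^sub>(Fr (fst T))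
   (\<Oplus>\<^sub>(Fr (fst T))j\<in>strictly_below T (f i). a j \<odot>\<^sub>(Fr (fst T)) obas (std T) j)) <->
   (ALL t:fst T. F (e i) t : El R) & F (e i) (f i) = \<one> &
   (ALL t:fst T. (t, f i) ~: snd T --> F (e i) t = \<zero>)"
  if F: "F : Lin R (Fr (fst S)) (Fr (fst T))" and f: "f : oi_hom S T" and i: "i : fst S" for F f i
 proof -
  let ?J = "strictly_below T (f i)"
  have J: "finite ?J" "?J <= fst T" "f i ~: ?J" using finT by (auto simp: strictly_below_def)
  have Fi: "F (e i) : El (Fr (fst T))" by (rule lin_cl[OF F e_closed[OF i]])
  have fi: "f i : fst T" using oi_homD(1)[OF f i] .
  interpret F: left_module R "Fr (fst T)" by (rule Fr)
  have sum: "(\<Oplus>\<^sub>(Fr (fst T))j\<in>?J. a j \<odot>\<^sub>(Fr (fst T)) obas (std T) j) = (%u. if u : ?J then a u else \<zero>)"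
   if a: "a : ?J \<rightarrow> El R" for a
  proof -
   have "(\<Oplus>\<^sub>(Fr (fst T))j\<in>?J. a j \<odot>\<^sub>(Fr (fst T)) obas (std T) j) =
     (\<Oplus>\<^sub>(Fr (fst T))j\<in>?J. a j \<odot>\<^sub>(Fr (fst T)) e j)"
    using a J(2) by (intro F.M.finsum_cong')
     (auto intro!: left_module.smult_closed[OF Fr] e_closed simp del: Fr_simps)
   thus ?thesis using Fr_expand[OF J(1,2) a] by simp
  qed
  show ?thesis
  proof
   assume "EX a:?J \<rightarrow> El R. F (e i) = e (f i) \<oplus>\<^sub>(Fr (fst T))
    (\<Oplus>\<^sub>(Fr (fst T))j\<in>?J. a j \<odot>\<^sub>(Fr (fst T)) obas (std T) j)"
   then obtain a where a: "a : ?J \<rightarrow> El R"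
    "F (e i) = e (f i) \<oplus>\<^sub>(Fr (fst T)) (\<Oplus>\<^sub>(Fr (fst T))j\<in>?J. a j \<odot>\<^sub>(Fr (fst T)) obas (std T) j)" by blast
   hence eq: "F (e i) = (%u. e (f i) u \<oplus> (if u : ?J then a u else \<zero>))" using sum[OF a(1)] by simp
   show "(ALL t:fst T. F (e i) t : El R) & F (e i) (f i) = \<one> &
    (ALL t:fst T. (t, f i) ~: snd T --> F (e i) t = \<zero>)"
   proof (intro conjI ballI impI)
    fix t assume "t : fst T" "(t, f i) ~: snd T"
    thus "F (e i) t = \<zero>"
     using OI_orderD(3)[OF T fi] by (auto simp: eq e_apply strictly_below_def)
   qed (use Fr_val[OF Fi] J(3) in \<open>auto simp: eq e_apply\<close>)
  next
   assume h: "(ALL t:fst T. F (e i) t : El R) & F (e i) (f i) = \<one> &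
    (ALL t:fst T. (t, f i) ~: snd T --> F (e i) t = \<zero>)"
   have a: "F (e i) : ?J \<rightarrow> El R" using h J(2) by auto
   have "F (e i) u = e (f i) u \<oplus> (if u : ?J then F (e i) u else \<zero>)" for u
   proof (cases "u : fst T")
    case True
    thus ?thesis using h
     by (auto simp: e_apply strictly_below_def)
   next
    case False
    thus ?thesis using fi Fi by (auto simp: e_apply Fr_carrier)
   qed
   hence "F (e i) = e (f i) \<oplus>\<^sub>(Fr (fst T)) (\<Oplus>\<^sub>(Fr (fst T))j\<in>?J. F (e i) j \<odot>\<^sub>(Fr (fst T)) obas (std T) j)"
    unfolding sum[OF a] by (simp)
   with a show "EX a:?J \<rightarrow> El R. F (e i) = e (f i) \<oplus>\<^sub>(Fr (fst T))
    (\<Oplus>\<^sub>(Fr (fst T))j\<in>?J. a j \<odot>\<^sub>(Fr (fst T)) obas (std T) j)" by blast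
  qed
 qed
 obtain F f where x: "x = (F, f)" by fastforce
 show ?thesis
 proof (cases "F : Lin R (Fr (fst S)) (Fr (fst T)) & f : oi_hom S T")
  case True
  have "x : Hom S T <-> F : extensional (El (Fr (fst S))) &
   (ALL i:fst S. EX a:strictly_below T (f i) \<rightarrow> El R. F (e i) = e (f i) \<oplus>\<^sub>(Fr (fst T))
   (\<Oplus>\<^sub>(Fr (fst T))j\<in>strictly_below T (f i). a j \<odot>\<^sub>(Fr (fst T)) obas (std T) j))"
   using True oi_homD(1)[of f S T] by (simp add: x ovi_hom_def)
  also have "... <-> F : extensional (El (Fr (fst S))) &
   (ALL i:fst S. (ALL t:fst T. F (e i) t : El R) & F (e i) (f i) = \<one> &
    (ALL t:fst T. (t, f i) ~: snd T --> F (e i) t = \<zero>))"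
   using *[of F f] True by (intro conj_cong ball_cong refl) blast
  finally show ?thesis using True by (simp add: x umat_def mat_def)
 next
  case False
  thus ?thesis by (auto simp: x ovi_hom_def umat_def)
 qed
qed

lemma mor_hom:
 assumes "umat S T A f"
 shows "mor S T A f : Hom S T"
 unfolding hom_iff
proof (intro conjI)
 have A: "s : fst S ==> t : fst T ==> A t s : El R" for s t using assms by (simp add: umat_def)
 show "fst (mor S T A f) : Lin R (Fr (fst S)) (Fr (fst T))"
  using mmap_lin[OF finS finT A] by (simp add: mor_def)
 show "fst (mor S T A f) : extensional (El (Fr (fst S)))"
  by (auto simp: mor_def matrix_map_def)
 show "umat S T (mat (mor S T A f)) (snd (mor S T A f))"
  using assms mat_mor[OF assms] oi_homD(1)[of f S T] by (auto simp: umat_def mor_def)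
qed

lemma hom_ext:
 assumes x: "x : Hom S T" and y: "y : Hom S T" and snd: "snd x = snd y"
  and eq: "!!s t. s : fst S ==> t : fst T ==> mat x t s = mat y t s"
 shows "x = y"
proof (rule prod_eqI)
 have fx: "fst x : Lin R (Fr (fst S)) (Fr (fst T))" "fst x : extensional (El (Fr (fst S)))"
  and fy: "fst y : Lin R (Fr (fst S)) (Fr (fst T))" "fst y : extensional (El (Fr (fst S)))"
  using x y by (auto simp: hom_iff)
 have "fst x (e s) = fst y (e s)" if s: "s : fst S" for s
 proof
  fix t
  show "fst x (e s) t = fst y (e s) t"
  proof (cases "t : fst T")
   case True
   thus ?thesis using eq[OF s True] by (simp add: mat_def)
  next
   case False
   thus ?thesis
    using lin_cl[OF fx(1) e_closed[OF s]] lin_cl[OF fy(1) e_closed[OF s]]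
    by (simp add: Fr_carrier)
  qed
 qed
 hence "fst x c = fst y c" if "c : El (Fr (fst S))" for c
  using Fr_lin_eq[OF Fr fx(1) fy(1) _ that] by blast
 thus "fst x = fst y" using fx(2) fy(2) by (rule extensionalityI[rotated 2])
qed (rule snd)

lemma hom_apply:
 assumes x: "x : Hom S T" and c: "c : El (Fr (fst S))" and t: "t : fst T"
 shows "fst x c t = (\<Oplus>s\<in>fst S. c s \<otimes> mat x t s)"
proof -
 have fx: "fst x : Lin R (Fr (fst S)) (Fr (fst T))" and u: "umat S T (mat x) (snd x)"
  using x by (auto simp: hom_iff)
 have A: "s : fst S ==> t : fst T ==> mat x t s : El R" for s t using u by (simp add: umat_def)
 have e: "fst x (e s) = matrix_map R (fst S) (fst T) (mat x) (e s)" if s: "s : fst S" for s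
 proof
  fix t
  show "fst x (e s) t = matrix_map R (fst S) (fst T) (mat x) (e s) t"
   using A s mmap_e[OF finS, of "mat x" t s "fst T"] lin_cl[OF fx e_closed[OF s]]
    e_closed[OF s]
   by (cases "t : fst T") (auto simp: mat_def Fr_carrier[of _ "fst T"] matrix_map_def)
 qed
 have "fst x c = matrix_map R (fst S) (fst T) (mat x) c"
  by (rule Fr_lin_eq[OF Fr fx mmap_lin[OF finS finT A] e c])
 thus ?thesis using c t by (simp add: matrix_map_def)
qed

lemma mat_cl: "x : Hom S T ==> s : fst S ==> t : fst T ==> mat x t s : El R"
 by (simp add: hom_iff umat_def)

lemma hom_col_cl: "x : Hom S T ==> s : fst S ==> fst x (e s) : El (Fr (fst T))"
 using lin_cl[of "fst x" R "Fr (fst S)" "Fr (fst T)" "e s"] by (simp add: hom_iff e_closed)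

lemma snd_hom: "x : Hom S T ==> snd x : oi_hom S T"
 by (simp add: hom_iff umat_def)

lemma mat_pivot: "x : Hom S T ==> s : fst S ==> mat x (snd x s) s = \<one>"
 by (simp add: hom_iff umat_def)

lemma mat_above: "x : Hom S T ==> s : fst S ==> t : fst T ==> (t, snd x s) ~: snd T ==> mat x t s = \<zero>"
 by (simp add: hom_iff umat_def)

end

abbreviation cmp :: "ordset => ordset => ordset => 'r ovi_arr => 'r ovi_arr => 'r ovi_arr" where
 "cmp S T U y x == Comp (OVI R) (std S) (std T) (std U) y x"

lemma snd_comp: "snd (cmp S T U y x) = compose (fst S) (snd y) (snd x)"
 by (simp add: OVI_def)

lemma mat_comp:
 assumes "S : Ob OI" "T : Ob OI" "U : Ob OI" "x : Hom S T" "y : Hom T U"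
  and s: "s : fst S" and u: "u : fst U"
 shows "mat (cmp S T U y x) u s = (\<Oplus>t\<in>fst T. mat x t s \<otimes> mat y u t)"
 using hom_apply[OF assms(2,3,5) hom_col_cl[OF assms(1,2,4) s] u] e_closed[OF s]
 by (simp add: mat_def OVI_def compose_def)

lemma std_arr_mor: "std_arr R S T f = mor S T (%t s. if t = f s then \<one> else \<zero>) f"
 by (simp add: std_arr_def mor_def)

lemma std_umat:
 assumes "S : Ob OI" "T : Ob OI" "f : oi_hom S T"
 shows "umat S T (%t s. if t = f s then \<one> else \<zero>) f"
 using assms OI_orderD(3)[OF assms(2)] by (auto simp: umat_def)

lemma std_arr_hom: "S : Ob OI ==> T : Ob OI ==> f : oi_hom S T ==> std_arr R S T f : Hom S T"
 unfolding std_arr_mor by (intro mor_hom std_umat)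

lemma mat_std_arr:
 assumes "S : Ob OI" "T : Ob OI" "f : oi_hom S T" "s : fst S" "t : fst T"
 shows "mat (std_arr R S T f) t s = (if t = f s then \<one> else \<zero>)"
 unfolding std_arr_mor by (rule mat_mor[OF assms(1,2) std_umat[OF assms(1-3)] assms(4,5)])

lemma snd_std_arr [simp]: "snd (std_arr R S T f) = f"
 by (simp add: std_arr_def)

end

text \<open>The full subcategory on the objects \<open>ob x\<close>, with \<open>x\<close> itself as
  the object. Along \<open>od\<close> this turns natural numbers into objects of OI and of
  OVI(R).\<close>

definition pull_cat :: "('o, 'a) cat => ('s => 'o) => ('s, 'a) cat" where
 "pull_cat C ob = (|Ob = {x. ob x : Ob C}, Arr = (%x y. Arr C (ob x) (ob y)),
   Comp = (%x y z. Comp C (ob x) (ob y) (ob z)), Ident = (%x. Ident C (ob x))|)"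

definition pull_mod :: "('o, 'a, 'k, 'm) cat_mod => ('s => 'o) => ('s, 'a, 'k, 'm) cat_mod" where
 "pull_mod M ob = (|ob_mod = (%x. ob_mod M (ob x)), arr_map = (%x y. arr_map M (ob x) (ob y))|)"

lemma pull_cat_simps [simp]:
 "x : Ob (pull_cat C ob) <-> ob x : Ob C" "Arr (pull_cat C ob) x y = Arr C (ob x) (ob y)"
 "Comp (pull_cat C ob) x y z = Comp C (ob x) (ob y) (ob z)" "Ident (pull_cat C ob) x = Ident C (ob x)"
 "ob_mod (pull_mod M ob) x = ob_mod M (ob x)" "arr_map (pull_mod M ob) x y = arr_map M (ob x) (ob y)"
 by (simp_all add: pull_cat_def pull_mod_def)

lemma pull_category: "category C ==> category (pull_cat C ob)"
 by (simp add: category_def)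

lemma pull_cat_module: "cat_module K C M ==> cat_module K (pull_cat C ob) (pull_mod M ob)"
 by (simp add: cat_module_def cat_module_axioms_def pull_category)

lemma OI_Comp: "Comp OI S T U g f = compose (fst S) g f"
 and OI_Ident: "Ident OI S = (\<lambda>i\<in>fst S. i)"
 by (simp_all add: OI_def)

text \<open>
 The category OVI(R) is a category because the theorem assumes a module over it.
\<close>

locale ovi_cat = ovi_ring R for R :: "('r, 'x) ring_scheme" (structure) +
 assumes cat: "category (OVI R)"
begin

sublocale category "OVI R" by (rule cat)

lemma Arr_OVI: "Arr (OVI R) = ovi_hom R"
 by (simp add: OVI_def)

lemma comp_hom:
 assumes "S : Ob OI" "T : Ob OI" "U : Ob OI" "x : Hom S T" "y : Hom T U"
 shows "cmp S T U y x : Hom S U"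
 using Comp_closed[of "std S" "std T" "std U" x y] assms std_Ob by (simp add: Arr_OVI)

lemma comp_assoc:
 assumes "S : Ob OI" "T : Ob OI" "U : Ob OI" "W : Ob OI" "x : Hom S T" "y : Hom T U" "z : Hom U W"
 shows "cmp S T W (cmp T U W z y) x = cmp S U W z (cmp S T U y x)"
 using Comp_assoc[of "std S" "std T" "std U" "std W" x y z] assms std_Ob by (simp add: Arr_OVI)

lemma Ident_std:
 assumes S: "S : Ob OI"
 shows "Ident (OVI R) (std S) = std_arr R S S (\<lambda>i\<in>fst S. i)"
proof (rule hom_ext[OF S S])
 show "Ident (OVI R) (std S) : Hom S S" using Ident_closed[OF std_Ob[OF S]] by (simp add: Arr_OVI)
 show "std_arr R S S (\<lambda>i\<in>fst S. i) : Hom S S" using S by (intro std_arr_hom oi_hom_id)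
 show "snd (Ident (OVI R) (std S)) = snd (std_arr R S S (\<lambda>i\<in>fst S. i))" by (simp add: OVI_def)
 fix s t assume s: "s : fst S" and t: "t : fst S"
 show "mat (Ident (OVI R) (std S)) t s = mat (std_arr R S S (\<lambda>i\<in>fst S. i)) t s"
  using s t e_closed[OF s] by (simp add: mat_std_arr[OF S S oi_hom_id[OF S]])
   (simp add: OVI_def mat_def e_apply)
qed

lemma std_arr_comp:
 assumes "S : Ob OI" "T : Ob OI" "U : Ob OI" and f: "f : oi_hom S T" and g: "g : oi_hom T U"
 shows "std_arr R S U (compose (fst S) g f) = cmp S T U (std_arr R T U g) (std_arr R S T f)"
proof (rule hom_ext[OF assms(1,3)])
 note o = assms(1-3)
 have gf: "compose (fst S) g f : oi_hom S U" by (rule oi_hom_comp[OF o(1) f g])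
 show "std_arr R S U (compose (fst S) g f) : Hom S U" by (rule std_arr_hom[OF o(1,3) gf])
 show "cmp S T U (std_arr R T U g) (std_arr R S T f) : Hom S U"
  using o f g by (intro comp_hom std_arr_hom)
 show "snd (std_arr R S U (compose (fst S) g f)) = snd (cmp S T U (std_arr R T U g) (std_arr R S T f))"
  by (simp add: snd_comp)
 fix s u assume s: "s : fst S" and u: "u : fst U"
 have fs: "f s : fst T" by (rule oi_homD(1)[OF f s])
 have "(\<Oplus>t\<in>fst T. mat (std_arr R S T f) t s \<otimes> mat (std_arr R T U g) u t) =
  (\<Oplus>t\<in>fst T. (if t = f s then \<one> else \<zero>) \<otimes> (if u = g t then \<one> else \<zero>))"
  using o f g s u by (intro finsum_cong') (auto simp: mat_std_arr)
 also have "... = (if u = g (f s) then \<one> else \<zero>)"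
  using finsum_delta'[OF OI_orderD(1)[OF o(2)], of "%t. if u = g t then \<one> else \<zero>" "f s"] fs by auto
 finally show "mat (std_arr R S U (compose (fst S) g f)) u s =
   mat (cmp S T U (std_arr R T U g) (std_arr R S T f)) u s"
  using mat_comp[OF o std_arr_hom[OF o(1,2) f] std_arr_hom[OF o(2,3) g] s u]
   mat_std_arr[OF o(1,3) gf s u] s by (simp add: compose_def)
qed

lemma U_carrier: "g : El (UT R S) <-> g : Hom S S & (EX h:Hom S S.
  cmp S S S h g = Ident (OVI R) (std S) & cmp S S S g h = Ident (OVI R) (std S))"
 by (auto simp: unitriangular_def aut_group_def Arr_OVI)

lemma U_hom: "g : El (UT R S) ==> g : Hom S S"
 by (simp add: U_carrier)

lemma U_mult: "g \<otimes>\<^sub>(UT R S) h = cmp S S S g h"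
 and U_one: "\<one>\<^sub>(UT R S) = Ident (OVI R) (std S)"
 by (auto simp: unitriangular_def aut_group_def)

lemma U_group: "S : Ob OI ==> group (UT R S)"
 unfolding unitriangular_def by (rule aut_group_group[OF std_Ob])

text \<open>An order-preserving injection of a finite set into itself is bijective, so it preserves
  the number \<open>D s\<close> of elements up to \<open>s\<close>, and this number determines
  \<open>s\<close>.\<close>

lemma oi_endo_id:
 assumes S: "S : Ob OI" and f: "f : oi_hom S S"
 shows "f = (\<lambda>i\<in>fst S. i)"
proof -
 have fixed: "f s = s" if "s : fst S" for s
 proof -
  define D where "D s = card {t : fst S. (t, s) : snd S}" for s
  note o = OI_orderD[OF S]
  have bij: "bij_betw f (fst S) (fst S)"
   using o(1) oi_homD[OF f] by (simp add: bij_betw_def endo_inj_surj image_subset_iff)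
  have "f ` {t : fst S. (t, s) : snd S} = {t : fst S. (t, f s) : snd S}"
  proof (intro equalityI subsetI)
   fix t assume t: "t : {t : fst S. (t, f s) : snd S}"
   then obtain u where u: "u : fst S" "t = f u" using bij by (auto simp: bij_betw_def)
   have "(u, s) : snd S"
   proof (rule ccontr)
    assume "(u, s) ~: snd S"
    hence "(s, u) : snd S" "u ~= s" using o(3,6) u(1) that by blast+
    hence "(f s, f u) : snd S" "f u ~= f s"
     using oi_homD(2,3)[OF f] u(1) that by (auto simp: inj_on_def)
    thus False using t u(2) o(5) by auto
   qed
   thus "t : f ` {t : fst S. (t, s) : snd S}" using u by auto
  qed (use oi_homD[OF f] in auto)
  hence D: "D (f s) = D s"
   unfolding D_def using card_image[of f "{t : fst S. (t, s) : snd S}"] oi_homD(2)[OF f]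
   by (metis (no_types, lifting) inj_on_subset mem_Collect_eq subsetI)
  have fs: "f s : fst S" using oi_homD(1)[OF f that] .
  have lt: "D u < D v" if "(u, v) : snd S" "u ~= v" for u v
   unfolding D_def
  proof (rule psubset_card_mono)
   show "finite {t : fst S. (t, v) : snd S}" using o(1) by simp
   show "{t : fst S. (t, u) : snd S} \<subset> {t : fst S. (t, v) : snd S}"
    using that o(2,3,4,5) by blast
  qed
  thus "f s = s" using o(6)[OF fs that] D by (metis less_irrefl)
 qed
 show ?thesis using fixed oi_homD(4)[OF f] by (auto simp: extensional_def)
qed

lemma endo_snd: "S : Ob OI ==> g : Hom S S ==> snd g = (\<lambda>i\<in>fst S. i)"
 using oi_endo_id snd_hom by blast

subsection \<open>The push-forward homomorphisms\<close>

abbreviation push :: "ordset => ordset => (nat => nat) => 'r ovi_arr => 'r ovi_arr" where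
 "push == unitriangular_push R"

definition pmat :: "ordset => (nat => nat) => 'r ovi_arr => nat => nat => 'r" where
 "pmat S f g = (%a b. if a : f ` fst S & b : f ` fst S
   then mat g (inv_into (fst S) f a) (inv_into (fst S) f b) else if a = b then \<one> else \<zero>)"

lemma push_mor: "push S T f g = mor T T (pmat S f g) (\<lambda>i\<in>fst T. i)"
 by (simp add: unitriangular_push_def mor_def pmat_def matrix_entry_def mat_def cong: if_cong)

context
 fixes S T f
 assumes S: "S : Ob OI" and T: "T : Ob OI" and f: "f : oi_hom S T"
begin

lemma pmat_image: "a : fst S ==> b : fst S ==> pmat S f g (f a) (f b) = mat g a b"
 using oi_homD(2)[OF f] by (simp add: pmat_def)

lemma push_umat:
 assumes g: "g : Hom S S"
 shows "umat T T (pmat S f g) (\<lambda>i\<in>fst T. i)"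
 unfolding umat_def
proof (intro conjI ballI)
 show "(\<lambda>i\<in>fst T. i) : oi_hom T T" using T by (rule oi_hom_id)
 fix b assume b: "b : fst T"
 show "pmat S f g t b : El R" for t
  using mat_cl[OF S S g] by (auto simp: pmat_def inv_into_into)
 show "pmat S f g ((\<lambda>i\<in>fst T. i) b) b = \<one>"
  using b mat_pivot[OF S S g] endo_snd[OF S g] inv_into_into[of b f "fst S"] by (auto simp: pmat_def)
 fix a assume a: "a : fst T"
 show "(a, (\<lambda>i\<in>fst T. i) b) ~: snd T --> pmat S f g a b = \<zero>"
 proof
  assume "(a, (\<lambda>i\<in>fst T. i) b) ~: snd T"
  hence ab: "(a, b) ~: snd T" using b by simp
  hence ne: "a ~= b" using OI_orderD(3)[OF T b] by auto
  show "pmat S f g a b = \<zero>"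
  proof (cases "a : f ` fst S & b : f ` fst S")
   case True
   then obtain a' b' where a': "a' : fst S" "a = f a'" and b': "b' : fst S" "b = f b'" by auto
   hence "(a', b') ~: snd S" using oi_homD(3)[OF f] ab by auto
   thus ?thesis
    using mat_above[OF S S g b'(1) a'(1)] endo_snd[OF S g] a' b' by (simp add: pmat_image)
  qed (use ne in \<open>auto simp: pmat_def\<close>)
 qed
qed

lemma push_hom: "g : Hom S S ==> push S T f g : Hom T T"
 unfolding push_mor by (rule mor_hom[OF T T push_umat])

lemma mat_push: "g : Hom S S ==> a : fst T ==> b : fst T ==> mat (push S T f g) a b = pmat S f g a b"
 unfolding push_mor by (rule mat_mor[OF T T push_umat])

text \<open>This square is what makes the transition maps of a module equivariant along
  \<open>push\<close>.\<close>

lemma push_comp_std: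
 assumes g: "g : Hom S S"
 shows "cmp S T T (push S T f g) (std_arr R S T f) = cmp S S T (std_arr R S T f) g"
proof (rule hom_ext[OF S T])
 note sf = std_arr_hom[OF S T f]
 show "cmp S T T (push S T f g) (std_arr R S T f) : Hom S T" using comp_hom[OF S T T sf push_hom[OF g]] .
 show "cmp S S T (std_arr R S T f) g : Hom S T" using comp_hom[OF S S T g sf] .
 show "snd (cmp S T T (push S T f g) (std_arr R S T f)) = snd (cmp S S T (std_arr R S T f) g)"
  using endo_snd[OF S g] endo_snd[OF T push_hom[OF g]] oi_homD(1,4)[OF f]
  by (auto simp: snd_comp compose_def fun_eq_iff)
 fix s u assume s: "s : fst S" and u: "u : fst T"
 note fs = oi_homD(1)[OF f s]
 have "mat (cmp S T T (push S T f g) (std_arr R S T f)) u s =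
   (\<Oplus>t\<in>fst T. mat (std_arr R S T f) t s \<otimes> mat (push S T f g) u t)"
  by (rule mat_comp[OF S T T sf push_hom[OF g] s u])
 also have "... = (\<Oplus>t\<in>fst T. (if t = f s then \<one> else \<zero>) \<otimes> mat (push S T f g) u t)"
  using mat_cl[OF T T push_hom[OF g] _ u] s by (intro finsum_cong') (auto simp: mat_std_arr[OF S T f])
 also have "... = pmat S f g u (f s)"
  using finsum_delta'[OF OI_orderD(1)[OF T], of "mat (push S T f g) u" "f s"] fs
   mat_cl[OF T T push_hom[OF g] _ u] mat_push[OF g u fs] by auto
 also have "... = (\<Oplus>t\<in>fst S. mat g t s \<otimes> (if u = f t then \<one> else \<zero>))"
 proof (cases "u : f ` fst S")
  case True
  then obtain v where v: "v : fst S" "u = f v" by auto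
  have "(\<Oplus>t\<in>fst S. mat g t s \<otimes> (if u = f t then \<one> else \<zero>)) =
    (\<Oplus>t\<in>fst S. mat g t s \<otimes> (if v = t then \<one> else \<zero>))"
   using v oi_homD(2)[OF f] mat_cl[OF S S g s] by (intro finsum_cong') (auto simp: inj_on_def)
  also have "... = mat g v s"
   using finsum_delta[OF OI_orderD(1)[OF S], of "%t. mat g t s" v] v mat_cl[OF S S g s] by auto
  finally show ?thesis using v s by (simp add: pmat_image)
 next
  case False
  have "(\<Oplus>t\<in>fst S. mat g t s \<otimes> (if u = f t then \<one> else \<zero>)) = (\<Oplus>t\<in>fst S. \<zero>)"
   using False mat_cl[OF S S g s] by (intro finsum_cong') auto
  moreover have "u ~= f s" using False s by auto
  ultimately show ?thesis using False by (simp add: pmat_def)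
 qed
 also have "... = (\<Oplus>t\<in>fst S. mat g t s \<otimes> mat (std_arr R S T f) u t)"
  using u mat_cl[OF S S g s] by (intro finsum_cong') (auto simp: mat_std_arr[OF S T f])
 also have "... = mat (cmp S S T (std_arr R S T f) g) u s"
  by (rule mat_comp[OF S S T g sf s u, symmetric])
 finally show "mat (cmp S T T (push S T f g) (std_arr R S T f)) u s =
   mat (cmp S S T (std_arr R S T f) g) u s" .
qed

lemma push_off_image:
 assumes g: "g : Hom S S" and b: "b : fst T" "b ~: f ` fst S" and a: "a : fst T"
 shows "mat (push S T f g) a b = (if a = b then \<one> else \<zero>)"
 using mat_push[OF g a b(1)] b(2) by (simp add: pmat_def)

text \<open>The columns over the image of \<open>f\<close> are visible after composition with
  \<open>std_arr\<close>. Identities for \<open>push\<close> thereby reduce to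
  \<open>push_comp_std\<close> and to standard columns.\<close>

lemma endo_eqI:
 assumes x: "x : Hom T T" and y: "y : Hom T T"
  and eq: "cmp S T T x (std_arr R S T f) = cmp S T T y (std_arr R S T f)"
  and off: "!!a b. a : fst T ==> b : fst T ==> b ~: f ` fst S ==> mat x a b = mat y a b"
 shows "x = y"
proof (rule hom_ext[OF T T x y])
 show "snd x = snd y" using endo_snd[OF T] x y by simp
 have *: "mat (cmp S T T z (std_arr R S T f)) a s = mat z a (f s)"
  if z: "z : Hom T T" and a: "a : fst T" and s: "s : fst S" for z a s
 proof -
  have "mat (cmp S T T z (std_arr R S T f)) a s =
    (\<Oplus>t\<in>fst T. mat (std_arr R S T f) t s \<otimes> mat z a t)"
   by (rule mat_comp[OF S T T std_arr_hom[OF S T f] z s a])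
  also have "... = (\<Oplus>t\<in>fst T. (if t = f s then \<one> else \<zero>) \<otimes> mat z a t)"
   using mat_cl[OF T T z _ a] s by (intro finsum_cong') (auto simp: mat_std_arr[OF S T f])
  also have "... = mat z a (f s)"
   using finsum_delta'[OF OI_orderD(1)[OF T], of "mat z a" "f s"] oi_homD(1)[OF f s]
    mat_cl[OF T T z _ a] by auto
  finally show ?thesis .
 qed
 fix b a assume b: "b : fst T" and a: "a : fst T"
 show "mat x a b = mat y a b"
 proof (cases "b : f ` fst S")
  case True
  then obtain s where "s : fst S" "b = f s" by auto
  thus ?thesis using *[OF x a] *[OF y a] eq by simp
 qed (use off a b in auto)
qed

end

lemma push_comp:
 assumes S: "S : Ob OI" and T: "T : Ob OI" and f: "f : oi_hom S T" and g: "g : Hom S S" and h: "h : Hom S S"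
 shows "push S T f (cmp S S S g h) = cmp T T T (push S T f g) (push S T f h)"
proof (rule endo_eqI[OF S T f])
 note gh = comp_hom[OF S S S h g] and sf = std_arr_hom[OF S T f]
 note pg = push_hom[OF S T f g] and ph = push_hom[OF S T f h]
 show "push S T f (cmp S S S g h) : Hom T T" using push_hom[OF S T f gh] .
 show "cmp T T T (push S T f g) (push S T f h) : Hom T T" using comp_hom[OF T T T ph pg] .
 show "cmp S T T (push S T f (cmp S S S g h)) (std_arr R S T f) =
   cmp S T T (cmp T T T (push S T f g) (push S T f h)) (std_arr R S T f)"
  unfolding push_comp_std[OF S T f gh] comp_assoc[OF S T T T sf ph pg] push_comp_std[OF S T f h]
   comp_assoc[OF S S S T h g sf, symmetric] comp_assoc[OF S S T T h sf pg, symmetric]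
   push_comp_std[OF S T f g] ..
 fix a b assume a: "a : fst T" and b: "b : fst T" "b ~: f ` fst S"
 have "mat (cmp T T T (push S T f g) (push S T f h)) a b =
   (\<Oplus>t\<in>fst T. mat (push S T f h) t b \<otimes> mat (push S T f g) a t)"
  by (rule mat_comp[OF T T T ph pg b(1) a])
 also have "... = (\<Oplus>t\<in>fst T. (if t = b then \<one> else \<zero>) \<otimes> mat (push S T f g) a t)"
  using mat_cl[OF T T pg _ a] push_off_image[OF S T f h b] by (intro finsum_cong') auto
 also have "... = mat (push S T f g) a b"
  using finsum_delta'[OF OI_orderD(1)[OF T], of "mat (push S T f g) a" b] b(1)
   mat_cl[OF T T pg _ a] by auto
 finally show "mat (push S T f (cmp S S S g h)) a b =
   mat (cmp T T T (push S T f g) (push S T f h)) a b"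
  using push_off_image[OF S T f gh b a] push_off_image[OF S T f g b a] by simp
qed

lemma push_one:
 assumes S: "S : Ob OI" and T: "T : Ob OI" and f: "f : oi_hom S T"
 shows "push S T f (Ident (OVI R) (std S)) = Ident (OVI R) (std T)"
proof (rule endo_eqI[OF S T f])
 note sf = std_arr_hom[OF S T f]
 have i: "Ident (OVI R) (std S) : Hom S S" "Ident (OVI R) (std T) : Hom T T"
  using Ident_closed std_Ob S T by (auto simp: Arr_OVI[symmetric])
 show "push S T f (Ident (OVI R) (std S)) : Hom T T" using push_hom[OF S T f i(1)] .
 show "Ident (OVI R) (std T) : Hom T T" by (rule i(2))
 have "cmp S S T (std_arr R S T f) (Ident (OVI R) (std S)) = std_arr R S T f"
  "cmp S T T (Ident (OVI R) (std T)) (std_arr R S T f) = std_arr R S T f"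
  using Comp_Ident_right[OF std_Ob[OF S] std_Ob[OF T]] Comp_Ident_left[OF std_Ob[OF S] std_Ob[OF T]] sf
  by (auto simp: Arr_OVI)
 thus "cmp S T T (push S T f (Ident (OVI R) (std S))) (std_arr R S T f) =
   cmp S T T (Ident (OVI R) (std T)) (std_arr R S T f)"
  by (simp add: push_comp_std[OF S T f i(1)])
 fix a b assume "a : fst T" "b : fst T" "b ~: f ` fst S"
 thus "mat (push S T f (Ident (OVI R) (std S))) a b = mat (Ident (OVI R) (std T)) a b"
  by (simp add: push_off_image[OF S T f i(1)] Ident_std[OF T] mat_std_arr[OF T T oi_hom_id[OF T]])
qed

lemma push_group_hom:
 assumes S: "S : Ob OI" and T: "T : Ob OI" and f: "f : oi_hom S T"
 shows "push S T f : hom (UT R S) (UT R T)"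
proof (rule homI)
 fix g assume "g : El (UT R S)"
 then obtain h where g: "g : Hom S S" and h: "h : Hom S S"
  "cmp S S S h g = Ident (OVI R) (std S)" "cmp S S S g h = Ident (OVI R) (std S)"
  by (auto simp: U_carrier)
 show "push S T f g : El (UT R T)"
  unfolding U_carrier
  using push_hom[OF S T f g] push_hom[OF S T f h(1)] push_comp[OF S T f g h(1)] push_comp[OF S T f h(1) g]
   h push_one[OF S T f] by auto
next
 fix g h assume "g : El (UT R S)" "h : El (UT R S)"
 thus "push S T f (g \<otimes>\<^sub>(UT R S) h) = push S T f g \<otimes>\<^sub>(UT R T) push S T f h"
  by (simp add: U_mult push_comp[OF S T f] U_hom)
qed

lemma push_id:
 assumes S: "S : Ob OI" and g: "g : Hom S S"
 shows "push S S (\<lambda>i\<in>fst S. i) g = g"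
proof (rule hom_ext[OF S S push_hom[OF S S oi_hom_id[OF S] g] g])
 show "snd (push S S (\<lambda>i\<in>fst S. i) g) = snd g"
  using endo_snd[OF S g] endo_snd[OF S push_hom[OF S S oi_hom_id[OF S] g]] by simp
 fix s t assume "s : fst S" "t : fst S"
 thus "mat (push S S (\<lambda>i\<in>fst S. i) g) t s = mat g t s"
  using pmat_image[OF S S oi_hom_id[OF S], of t s g] mat_push[OF S S oi_hom_id[OF S] g] by simp
qed

lemma push_push:
 assumes S: "S : Ob OI" and T: "T : Ob OI" and U: "U : Ob OI" and f: "f : oi_hom S T" and h: "h : oi_hom T U"
  and g: "g : Hom S S"
 shows "push S U (compose (fst S) h f) g = push T U h (push S T f g)"
proof (rule hom_ext[OF U U])
 note hf = oi_hom_comp[OF S f h] and pg = push_hom[OF S T f g]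
 show a: "push S U (compose (fst S) h f) g : Hom U U" by (rule push_hom[OF S U hf g])
 show b: "push T U h (push S T f g) : Hom U U" by (rule push_hom[OF T U h pg])
 show "snd (push S U (compose (fst S) h f) g) = snd (push T U h (push S T f g))"
  using endo_snd[OF U a] endo_snd[OF U b] by simp
 have im: "compose (fst S) h f ` fst S = h ` f ` fst S" by (auto simp: compose_def)
 have fT: "f ` fst S <= fst T" using oi_homD(1)[OF f] by auto
 fix s t assume st: "s : fst U" "t : fst U"
 show "mat (push S U (compose (fst S) h f) g) t s = mat (push T U h (push S T f g)) t s"
 proof (cases "t : h ` fst T & s : h ` fst T")
  case True
  then obtain t' s' where t': "t' : fst T" "t = h t'" and s': "s' : fst T" "s = h s'" by auto
  have R: "mat (push T U h (push S T f g)) t s = pmat S f g t' s'"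
   using mat_push[OF T U h pg st(2,1)] pmat_image[OF T U h t'(1) s'(1)] t' s'
    mat_push[OF S T f g t'(1) s'(1)] by simp
  have inj: "h u = h v <-> u = v" if "u : fst T" "v : fst T" for u v
   using oi_homD(2)[OF h] that by (auto simp: inj_on_def)
  have mem: "h u : h ` f ` fst S <-> u : f ` fst S" if "u : fst T" for u
   using inj fT that by blast
  have L: "mat (push S U (compose (fst S) h f) g) t s = pmat S (compose (fst S) h f) g t s"
   by (rule mat_push[OF S U hf g st(2,1)])
  show ?thesis
  proof (cases "t' : f ` fst S & s' : f ` fst S")
   case True
   then obtain t'' s'' where "t'' : fst S" "t' = f t''" "s'' : fst S" "s' = f s''" by auto
   thus ?thesis using L R t' s' pmat_image[OF S U hf, of t'' s'' g] pmat_image[OF S T f, of t'' s'' g]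
    by (simp add: compose_def)
  next
   case False
   hence "pmat S (compose (fst S) h f) g t s = (if t = s then \<one> else \<zero>)"
    unfolding pmat_def im using mem t' s' by auto
   moreover have "pmat S f g t' s' = (if t' = s' then \<one> else \<zero>)" using False by (auto simp: pmat_def)
   ultimately show ?thesis using L R inj[OF t'(1) s'(1)] t' s' by simp
  qed
 next
  case False
  hence "\<not> (t : h ` f ` fst S & s : h ` f ` fst S)" using fT by auto
  thus ?thesis
   using mat_push[OF S U hf g st(2,1)] mat_push[OF T U h pg st(2,1)] False im
   unfolding pmat_def by auto
 qed
qed

lemma std_Ob_iff: "std S : Ob (OVI R) <-> S : Ob OI"
proof
 show "std S : Ob (OVI R) ==> S : Ob OI" by (simp add: OVI_def)
qed (rule std_Ob)

lemma hsys_module: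
 fixes M :: "('s, 'r ovi_arr, 'k, 'm) cat_mod" and ob :: "'s => ordset"
 assumes K: "cring K" and M: "cat_module K (pull_cat (OVI R) (%x. std (ob x))) M"
 shows "hsys K (pull_cat OI ob) (%x. UT R (ob x)) (%x y. push (ob x) (ob y))
  (ob_mod M) (%x. arr_map M x x) (%x y f. arr_map M x y (std_arr R (ob x) (ob y) f))"
proof -
 interpret M: cat_module K "pull_cat (OVI R) (%x. std (ob x))" M by (rule M)
 note MC = M.arr_Comp[simplified, unfolded std_Ob_iff Arr_OVI]
  and MLin = M.arr_linear[simplified, unfolded std_Ob_iff Arr_OVI]
  and MI = M.arr_Ident[simplified, unfolded std_Ob_iff]
 have rep: "grp_rep K (UT R (ob x)) (ob_mod M x) (arr_map M x x)"
  if x: "ob x : Ob OI" for x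
 by (auto simp: grp_rep.intro M.ob_lm x std_Ob_iff U_group MLin U_hom MI U_one MC U_mult)
 show ?thesis
 proof (rule hsys.intro; simp?)
  fix x y f assume x: "ob x : Ob OI" and y: "ob y : Ob OI" and "f : Arr OI (ob x) (ob y)"
  hence f: "f : oi_hom (ob x) (ob y)" by (simp add: OI_Arr)
  note sf = std_arr_hom[OF x y f]
  show "rep_map K (UT R (ob x)) (ob_mod M x) (arr_map M x x)
    (UT R (ob y)) (ob_mod M y) (arr_map M y y) (push (ob x) (ob y) f)
    (arr_map M x y (std_arr R (ob x) (ob y) f))"
  proof (intro rep_map.intro rep_map_axioms.intro rep[OF x] rep[OF y])
   show "push (ob x) (ob y) f : hom (UT R (ob x)) (UT R (ob y))"
    by (rule push_group_hom[OF x y f])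
   show "arr_map M x y (std_arr R (ob x) (ob y) f) : Lin K (ob_mod M x) (ob_mod M y)"
    by (rule MLin[OF x y sf])
   fix g m assume "g : El (UT R (ob x))" and m: "m : El (ob_mod M x)"
   hence g: "g : Hom (ob x) (ob x)" by (simp add: U_hom)
   show "arr_map M x y (std_arr R (ob x) (ob y) f) (arr_map M x x g m) =
     arr_map M y y (push (ob x) (ob y) f g) (arr_map M x y (std_arr R (ob x) (ob y) f) m)"
    using MC[OF x x y g sf m] MC[OF x y y sf push_hom[OF x y f g] m] push_comp_std[OF x y f g] by simp
  qed
 next
  fix x m assume x: "ob x : Ob OI" and m: "m : El (ob_mod M x)"
  show "arr_map M x x (std_arr R (ob x) (ob x) (Ident OI (ob x))) m = m"
   using MI[OF x m] by (simp add: Ident_std[OF x] OI_Ident)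
 next
  fix x y z f h m
  assume x: "ob x : Ob OI" and y: "ob y : Ob OI" and z: "ob z : Ob OI"
   and "f : Arr OI (ob x) (ob y)" "h : Arr OI (ob y) (ob z)" and m: "m : El (ob_mod M x)"
  hence f: "f : oi_hom (ob x) (ob y)" and h: "h : oi_hom (ob y) (ob z)" by (auto simp: OI_Arr)
  show "arr_map M x z (std_arr R (ob x) (ob z) (Comp OI (ob x) (ob y) (ob z) h f)) m =
    arr_map M y z (std_arr R (ob y) (ob z) h) (arr_map M x y (std_arr R (ob x) (ob y) f) m)"
   using MC[OF x y z std_arr_hom[OF x y f] std_arr_hom[OF y z h] m] std_arr_comp[OF x y z f h]
   by (simp add: OI_Comp)
 next
  fix x y z f h g
  assume x: "ob x : Ob OI" and y: "ob y : Ob OI" and z: "ob z : Ob OI"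
   and "f : Arr OI (ob x) (ob y)" "h : Arr OI (ob y) (ob z)"
   and g: "g : El (UT R (ob x))"
  hence "f : oi_hom (ob x) (ob y)" "h : oi_hom (ob y) (ob z)" by (auto simp: OI_Arr)
  from push_push[OF x y z this U_hom[OF g]]
  show "push (ob x) (ob z) (Comp OI (ob x) (ob y) (ob z) h f) g =
    push (ob y) (ob z) h (push (ob x) (ob y) f g)"
   by (simp add: OI_Comp)
 next
  fix x g assume x: "ob x : Ob OI" and g: "g : El (UT R (ob x))"
  show "push (ob x) (ob x) (Ident OI (ob x)) g = g"
   using push_id[OF x U_hom[OF g]] by (simp add: OI_Ident)
 qed (use K pull_category[OF OI_cat] rep in auto)
qed

end

section \<open>The skeleton on the objects [n]\<close>

definition od :: "nat => ordset" where
 "od n = ({..<n}, {(i, j). i <= j & j < n})"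

lemma od_simps [simp]: "fst (od n) = {..<n}" "(i, j) : snd (od n) <-> i <= j & j < n"
 by (auto simp: od_def)

lemma od_Ob [simp]: "od n : Ob OI"
 by (auto simp: OI_Ob linear_order_on_def partial_order_on_def preorder_on_def refl_on_def trans_def
   antisym_def total_on_def)

abbreviation oi :: "nat => nat => (nat => nat) set" where "oi d n == oi_hom (od d) (od n)"

lemma oi_iff: "f : oi d n <-> f : {..<d} \<rightarrow>\<^sub>E {..<n} & (ALL i j. i < j --> j < d --> f i < f j)"
proof
 assume f: "f : oi d n"
 have "f i < f j" if "i < j" "j < d" for i j
 proof -
  have "f i <= f j" using oi_homD(3)[OF f, of i j] that by simp
  moreover have "f i ~= f j" using oi_homD(2)[OF f] that by (auto simp: inj_on_def)
  ultimately show ?thesis by simp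
 qed
 thus "f : {..<d} \<rightarrow>\<^sub>E {..<n} & (ALL i j. i < j --> j < d --> f i < f j)"
  using f by (simp add: oi_hom_def)
next
 assume f: "f : {..<d} \<rightarrow>\<^sub>E {..<n} & (ALL i j. i < j --> j < d --> f i < f j)"
 have "inj_on f {..<d}"
 by (metis inj_onI f lessThan_iff nat_neq_iff less_irrefl)
 moreover have "f i <= f j & f j < n" if "i <= j" "j < d" for i j
  using f that by (cases "i = j") (auto intro: less_imp_le)
 ultimately show "f : oi d n" using f by (auto simp: oi_hom_def)
qed

lemma oi_less: "f : oi d n ==> i < d ==> f i < n"
 by (auto simp: oi_iff)

lemma oi_mono: "f : oi d n ==> i < j ==> j < d ==> f i < f j"
 by (auto simp: oi_iff)

lemma oi_inj: "f : oi d n ==> i < d ==> j < d ==> f i = f j <-> i = j"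
 by (metis oi_mono nat_neq_iff less_irrefl)

section \<open>Adjoining a last element\<close>

definition inc :: "nat => nat => nat" where
 "inc n = (\<lambda>i\<in>{..<n}. i)"

definition top_el :: "nat => nat => nat" where
 "top_el n = (\<lambda>i\<in>{..<1}. n)"

definition ext1 :: "nat => nat => (nat => nat) => nat => nat" where
 "ext1 n m f = (\<lambda>i\<in>{..<Suc n}. if i < n then f i else m)"

lemma inc_oi: "inc n : oi n (Suc n)"
 by (auto simp: oi_iff inc_def)

lemma top_oi: "top_el n : oi 1 (Suc n)"
 by (auto simp: oi_iff top_el_def)

lemma ext1_oi: "f : oi n m ==> ext1 n m f : oi (Suc n) (Suc m)"
 by (auto simp: oi_iff ext1_def less_Suc_eq)

lemma inc_apply [simp]: "i < n ==> inc n i = i"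
 by (simp add: inc_def)

lemma top_apply [simp]: "top_el n 0 = n"
 by (simp add: top_el_def)

lemma ext1_apply [simp]: "i < n ==> ext1 n m f i = f i" "ext1 n m f n = m"
 by (simp_all add: ext1_def)

lemma ext1_inc: "f : oi n m ==> compose {..<n} (ext1 n m f) (inc n) = compose {..<n} (inc m) f"
 by (rule ext) (auto simp: compose_def oi_less)

lemma ext1_top: "compose {..<1} (ext1 n m f) (top_el n) = top_el m"
 by (rule ext) (auto simp: compose_def top_el_def)

context ovi_cat
begin

abbreviation HomN :: "nat => nat => 'r ovi_arr set" where "HomN d n == Hom (od d) (od n)"
abbreviation cN :: "nat => nat => nat => 'r ovi_arr => 'r ovi_arr => 'r ovi_arr" where
 "cN d n m y x == cmp (od d) (od n) (od m) y x"
abbreviation sa :: "nat => nat => (nat => nat) => 'r ovi_arr" where "sa n m f == std_arr R (od n) (od m) f"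
abbreviation UU :: "nat => 'r ovi_arr monoid" where "UU n == UT R (od n)"
abbreviation pN :: "nat => nat => (nat => nat) => 'r ovi_arr => 'r ovi_arr" where
 "pN n m f g == push (od n) (od m) f g"

lemma sa_hom: "f : oi n m ==> sa n m f : HomN n m"
 by (rule std_arr_hom) auto

lemma cN_hom: "x : HomN d n ==> y : HomN n m ==> cN d n m y x : HomN d m"
 by (rule comp_hom) auto

lemma cN_assoc: "x : HomN a b ==> y : HomN b c ==> z : HomN c d ==>
  cN a b d (cN b c d z y) x = cN a c d z (cN a b c y x)"
 by (rule comp_assoc) auto

lemma snd_oi: "x : HomN d n ==> snd x : oi d n"
 by (rule snd_hom) auto

lemma HomN_ext:
 assumes "x : HomN d n" "y : HomN d n" "snd x = snd y"
  and "!!s t. s < d ==> t < n ==> mat x t s = mat y t s"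
 shows "x = y"
 by (rule hom_ext[OF od_Ob od_Ob assms(1-3)]) (use assms(4) in auto)

lemma matN_cl: "x : HomN d n ==> s < d ==> t < n ==> mat x t s : El R"
 using mat_cl[OF od_Ob od_Ob, of x d n s t] by simp

lemma matN_pivot: "x : HomN d n ==> s < d ==> mat x (snd x s) s = \<one>"
 using mat_pivot[OF od_Ob od_Ob, of x d n s] by simp

lemma matN_above: "x : HomN d n ==> s < d ==> t < n ==> snd x s < t ==> mat x t s = \<zero>"
 using mat_above[OF od_Ob od_Ob, of x d n s t] by auto

lemma matN_comp: "x : HomN d n ==> y : HomN n m ==> s < d ==> u < m ==>
  mat (cN d n m y x) u s = (\<Oplus>t\<in>{..<n}. mat x t s \<otimes> mat y u t)"
 using mat_comp[OF od_Ob od_Ob od_Ob, of x d n y m s u] by simp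

lemma mat_sa: "f : oi n m ==> s < n ==> t < m ==> mat (sa n m f) t s = (if t = f s then \<one> else \<zero>)"
 using mat_std_arr[OF od_Ob od_Ob, of f n m s t] by simp

lemma mat_sa_right:
 assumes f: "f : oi d n" and y: "y : HomN n m" and s: "s < d" and u: "u < m"
 shows "mat (cN d n m y (sa d n f)) u s = mat y u (f s)"
proof -
 have "(\<Oplus>t\<in>{..<n}. mat (sa d n f) t s \<otimes> mat y u t) = (\<Oplus>t\<in>{..<n}. (if t = f s then \<one> else \<zero>) \<otimes> mat y u t)"
  using matN_cl[OF y _ u] s f by (intro finsum_cong') (auto simp: mat_sa)
 thus ?thesis
  using matN_comp[OF sa_hom[OF f] y s u] finsum_delta'[of "{..<n}" "mat y u" "f s"]
   matN_cl[OF y _ u] oi_less[OF f s] by auto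
qed

lemma mat_sa_left:
 assumes f: "f : oi n m" and x: "x : HomN d n" and s: "s < d"
 shows "t < n ==> mat (cN d n m (sa n m f) x) (f t) s = mat x t s"
  and "u < m ==> u ~: f ` {..<n} ==> mat (cN d n m (sa n m f) x) u s = \<zero>"
proof -
 note xc = matN_cl[OF x s]
 {
  assume t: "t < n"
  hence ft: "f t < m" using oi_less[OF f] by simp
  have "(\<Oplus>t'\<in>{..<n}. mat x t' s \<otimes> mat (sa n m f) (f t) t') =
    (\<Oplus>t'\<in>{..<n}. mat x t' s \<otimes> (if t = t' then \<one> else \<zero>))"
   using xc t ft f oi_inj[OF f t] by (intro finsum_cong') (auto simp: mat_sa)
  thus "mat (cN d n m (sa n m f) x) (f t) s = mat x t s"
   using matN_comp[OF x sa_hom[OF f] s ft] finsum_delta[of "{..<n}" "%t'. mat x t' s" t] xc t by auto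
 next
  assume u: "u < m" "u ~: f ` {..<n}"
  have "(\<Oplus>t'\<in>{..<n}. mat x t' s \<otimes> mat (sa n m f) u t') = (\<Oplus>t'\<in>{..<n}. \<zero>)"
   using xc u f by (intro finsum_cong') (auto simp: mat_sa)
  thus "mat (cN d n m (sa n m f) x) u s = \<zero>" using matN_comp[OF x sa_hom[OF f] s u(1)] by simp
 }
qed

lemma snd_cN: "x : HomN d n ==> snd (cN d n m y x) = compose {..<d} (snd y) (snd x)"
 by (simp add: snd_comp)

lemma sa_cancel:
 assumes f: "f : oi n m" and x: "x : HomN d n" and y: "y : HomN d n"
  and eq: "cN d n m (sa n m f) x = cN d n m (sa n m f) y"
 shows "x = y"
proof (rule HomN_ext[OF x y])
 have eq': "compose {..<d} f (snd x) = compose {..<d} f (snd y)" using snd_cN[OF x] snd_cN[OF y] eq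
  by (metis snd_std_arr)
 have "f (snd x i) = f (snd y i)" if "i < d" for i
  using fun_cong[OF eq', of i] that by (simp add: compose_def)
 hence "snd x i = snd y i" if "i < d" for i
  using that oi_inj[OF f oi_less[OF snd_oi[OF x] that] oi_less[OF snd_oi[OF y] that]] by simp
 thus "snd x = snd y" using snd_oi[OF x] snd_oi[OF y] by (intro PiE_ext[of _ "{..<d}"]) (auto simp: oi_iff)
 show "mat x t s = mat y t s" if "s < d" "t < n" for s t
  using mat_sa_left(1)[OF f x that] mat_sa_left(1)[OF f y that] eq by simp
qed

lemma sa_comp: "f : oi a b ==> g : oi b c ==> cN a b c (sa b c g) (sa a b f) = sa a c (compose {..<a} g f)"
 using std_arr_comp[OF od_Ob od_Ob od_Ob, of f a b g c] by simp

definition idN :: "nat => 'r ovi_arr" where "idN n = Ident (OVI R) (std (od n))"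

lemma idN: "idN n : HomN n n" "x : HomN d n ==> cN d n n (idN n) x = x" "x : HomN n m ==> cN n n m x (idN n) = x"
 unfolding idN_def
 using Ident_closed[OF std_Ob[OF od_Ob]] Comp_Ident_left[OF std_Ob[OF od_Ob] std_Ob[OF od_Ob]]
  Comp_Ident_right[OF std_Ob[OF od_Ob] std_Ob[OF od_Ob]] by (auto simp: Arr_OVI)

lemma snd_endo: "g : HomN n n ==> snd g = (\<lambda>i\<in>{..<n}. i)"
 using endo_snd[OF od_Ob, of g n] by simp

text \<open>
 Given \<^term>\<open>W\<close> with pivots \<^term>\<open>p\<close> and \<^term>\<open>W'\<close> with pivots \<^term>\<open>\<psi> \<circ> p\<close>, the columns of a
 morphism carrying \<^term>\<open>W\<close> to \<^term>\<open>W'\<close> are determined recursively at the pivots, and may be taken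
 to be standard elsewhere.
\<close>

lemma extension_exists:
 assumes W: "W : HomN d n" and W': "W' : HomN d m" and \<psi>: "\<psi> : oi n m"
  and p: "!!i. i < d ==> snd W' i = \<psi> (snd W i)"
 shows "\<exists>\<Phi>\<in>HomN n m. snd \<Phi> = \<psi> & cN d n m \<Phi> W = W' &
  (ALL t<n. t ~: snd W ` {..<d} --> (ALL r<m. mat \<Phi> r t = (if r = \<psi> t then \<one> else \<zero>)))"
proof -
 define p where "p = snd W"
 have p_oi: "p : oi d n" unfolding p_def by (rule snd_oi[OF W])
 define ix where "ix t = (THE i. i < d & p i = t)" for t
 have ix: "ix (p i) = i" if "i < d" for i
  unfolding ix_def using oi_inj[OF p_oi] that by (intro the_equality) auto
 \<comment> \<open>The equation for column \<open>i\<close> of \<open>W'\<close> is solved for the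
   unknown column at the pivot \<open>p i\<close>. The pivot entry of \<open>W\<close> is 1, so no
   division occurs, and only earlier columns enter; the inner condition \<open>t' < t\<close> makes
   this visible to the recursion principle.\<close>
 define P where "P \<phi> t col <-> col = (if t : p ` {..<d} then
   (%r. mat W' r (ix t) \<ominus> (\<Oplus>t'\<in>{..<t}. mat W t' (ix t) \<otimes> (if t' < t then \<phi> t' r else \<zero>)))
   else (%r. if r = \<psi> t then \<one> else \<zero>))" for \<phi> :: "nat => nat => 'r" and t col
 have "\<exists>\<phi>. ALL t. P \<phi> t (\<phi> t)"
 proof (rule dependent_wellorder_choice)
  fix col \<phi> \<phi>' and t :: nat assume "!!t'. t' < t ==> \<phi> t' = (\<phi>' t' :: nat => 'r)"
  hence "(%t'. mat W t' (ix t) \<otimes> (if t' < t then \<phi> t' r else \<zero>)) =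
    (%t'. mat W t' (ix t) \<otimes> (if t' < t then \<phi>' t' r else \<zero>))" for r
   by auto
  thus "P \<phi> t col = P \<phi>' t col" by (simp only: P_def)
 qed (auto simp: P_def)
 then obtain \<phi> where \<phi>: "!!t. P \<phi> t (\<phi> t)" by blast
 have np: "\<phi> t r = (if r = \<psi> t then \<one> else \<zero>)" if "t ~: p ` {..<d}" for t r
  using \<phi>[of t] that by (simp add: P_def)
 have \<phi>p: "\<phi> (p i) r = mat W' r i \<ominus> (\<Oplus>t'\<in>{..<p i}. mat W t' i \<otimes> (if t' < p i then \<phi> t' r else \<zero>))"
  if "i < d" for i r
  using \<phi>[of "p i"] that ix[OF that] by (simp add: P_def)
 have clos: "\<phi> t r : El R" if "t < n" "r < m" for t r
  using that(1)
 proof (induction t rule: less_induct)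
  case (less t)
  show ?case
  proof (cases "t : p ` {..<d}")
   case False
   thus ?thesis using np by auto
  next
   case True
   then obtain i where i: "i < d" "t = p i" by auto
   have "(\<Oplus>t'\<in>{..<p i}. mat W t' i \<otimes> (if t' < p i then \<phi> t' r else \<zero>)) : El R"
    using matN_cl[OF W i(1)] less i by (intro finsum_closed) auto
   thus ?thesis unfolding i(2) \<phi>p[OF i(1)] using matN_cl[OF W' i(1) that(2)] by simp
  qed
 qed
 have "!!r. r < m ==> \<phi> t r : El R & (\<psi> t < r --> \<phi> t r = \<zero>) & (r = \<psi> t --> \<phi> t r = \<one>) &
   (ALL i<d. p i = t --> (\<Oplus>t'\<in>{..<n}. mat W t' i \<otimes> \<phi> t' r) = mat W' r i)" if "t < n" for t
  using that
 proof (induction t rule: less_induct)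
  case (less t)
  show ?case
  proof (cases "t : p ` {..<d}")
   case False
   thus ?thesis using np by auto
  next
   case True
   then obtain i where i: "i < d" "t = p i" by auto
   have IH: "\<phi> t' r : El R" "\<psi> t' < r ==> \<phi> t' r = \<zero>" if "t' < t" for t'
    using less.IH[OF that, of r] less.prems that by auto
   let ?s = "\<Oplus>t'\<in>{..<t}. mat W t' i \<otimes> \<phi> t' r"
   have "(\<Oplus>t'\<in>{..<t}. mat W t' i \<otimes> (if t' < t then \<phi> t' r else \<zero>)) = ?s"
    using IH matN_cl[OF W i(1)] less.prems(2) by (intro finsum_cong') auto
   hence \<phi>t: "\<phi> t r = mat W' r i \<ominus> ?s"
    using \<phi>p[OF i(1), of r] i(2) by simp
   have Wc: "mat W t' i : El R" if "t' < n" for t' using matN_cl[OF W i(1) that] .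
   have sc: "?s : El R" using IH Wc less.prems(2) by (intro finsum_closed) auto
   have W'c: "mat W' r i : El R" using matN_cl[OF W' i(1) less.prems(1)] .
   have cl: "\<phi> t r : El R" using \<phi>t sc W'c by simp
   \<comment> \<open>Columns before \<open>t\<close> have their pivots before
     \<open>\<psi> t\<close> and vanish in all later rows. From row \<open>\<psi> t\<close> on, the
     new column therefore inherits the entries of \<open>W'\<close>.\<close>
   have s0: "?s = \<zero>" if "\<psi> t <= r"
   proof -
    have "?s = (\<Oplus>t'\<in>{..<t}. \<zero>)"
    proof (rule finsum_cong')
     fix t' assume "t' : {..<t}"
     hence "t' < t" by simp
     hence "\<psi> t' < r" using oi_mono[OF \<psi> _ less.prems(2)] that by fastforce
     thus "mat W t' i \<otimes> \<phi> t' r = \<zero>"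
      using IH[OF `t' < t`] Wc less.prems(2) \<open>t' < t\<close> by simp
    qed auto
    thus ?thesis by simp
   qed
   have piv: "snd W' i = \<psi> t" using p[OF i(1)] i(2) by (simp add: p_def)
   have up: "\<phi> t r = \<zero>" if "\<psi> t < r"
    using \<phi>t s0 that matN_above[OF W' i(1) less.prems(1)] piv by simp
   have one: "\<phi> t r = \<one>" if "r = \<psi> t"
    using \<phi>t s0 that matN_pivot[OF W' i(1)] piv by (simp add: a_minus_def)
   have cl_all: "mat W t' i \<otimes> \<phi> t' r : El R" if "t' < n" for t'
    using that Wc clos less.prems(1) by simp
   have "(\<Oplus>t'\<in>{..<n}. mat W t' i \<otimes> \<phi> t' r) = (\<Oplus>t'\<in>{..t}. mat W t' i \<otimes> \<phi> t' r)"
   proof (rule add.finprod_mono_neutral_cong_right)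
    show "{..t} <= {..<n}" using less.prems(2) by auto
    fix t' assume t': "t' : {..<n} - {..t}"
    hence "mat W t' i = \<zero>" using matN_above[OF W i(1), of t'] i(2) by (auto simp: p_def)
    thus "mat W t' i \<otimes> \<phi> t' r = \<zero>"
     using clos[of t' r] t' less.prems(1) by simp
   qed (use cl_all less.prems(2) in auto)
   also have "{..t} = insert t {..<t}" by auto
   also have "(\<Oplus>t'\<in>insert t {..<t}. mat W t' i \<otimes> \<phi> t' r) = mat W t i \<otimes> \<phi> t r \<oplus> ?s"
    by (rule finsum_insert) (use cl_all less.prems(2) in auto)
   also have "mat W t i = \<one>" using matN_pivot[OF W i(1)] i(2) by (simp add: p_def)
   also have "\<one> \<otimes> \<phi> t r \<oplus> ?s = mat W' r i"
    using \<phi>t sc W'c by (simp add: a_minus_def a_assoc l_neg)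
   finally have "(\<Oplus>t'\<in>{..<n}. mat W t' i \<otimes> \<phi> t' r) = mat W' r i" .
   thus ?thesis using cl up one i oi_inj[OF p_oi] by auto
  qed
 qed
 note props = this
 let ?\<Phi> = "mor (od n) (od m) (%r t. \<phi> t r) \<psi>"
 have um: "umat (od n) (od m) (%r t. \<phi> t r) \<psi>"
  unfolding umat_def using \<psi> props oi_less[OF \<psi>] by auto
 have H: "?\<Phi> : HomN n m" by (rule mor_hom[OF od_Ob od_Ob um])
 have mt: "mat ?\<Phi> r t = \<phi> t r" if "t < n" "r < m" for t r
  using mat_mor[OF od_Ob od_Ob um] that by simp
 have "cN d n m ?\<Phi> W = W'"
 proof (rule HomN_ext[OF cN_hom[OF W H] W'])
  have "snd (cN d n m ?\<Phi> W) i = snd W' i" for i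
   using snd_cN[OF W] p snd_oi[OF W'] by (cases "i < d") (auto simp: mor_def compose_def oi_iff PiE_iff extensional_def)
  thus "snd (cN d n m ?\<Phi> W) = snd W'" by auto
  fix i r assume i: "i < d" and r: "r < m"
  have "mat (cN d n m ?\<Phi> W) r i = (\<Oplus>t\<in>{..<n}. mat W t i \<otimes> mat ?\<Phi> r t)" by (rule matN_comp[OF W H i r])
  also have "... = (\<Oplus>t\<in>{..<n}. mat W t i \<otimes> \<phi> t r)"
   using matN_cl[OF W i] props r mt by (intro finsum_cong') auto
  also have "... = mat W' r i" using props[of "p i" r] oi_less[OF p_oi i] i r by blast
  finally show "mat (cN d n m ?\<Phi> W) r i = mat W' r i" .
 qed
 moreover have "ALL t<n. t ~: snd W ` {..<d} --> (ALL r<m. mat ?\<Phi> r t = (if r = \<psi> t then \<one> else \<zero>))"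
  using mt np by (simp add: p_def)
 ultimately show ?thesis using H by (auto simp: mor_def intro!: bexI[of _ ?\<Phi>])
qed

text \<open>Extending the identity along \<open>g\<close> gives a left inverse \<open>h\<close>. It
  has a left inverse in turn, which must be \<open>g\<close>.\<close>

lemma U_all: "El (UU n) = HomN n n"
proof
 have left_inv: "EX h:HomN n n. cN n n n h g = idN n" if g: "g : HomN n n" for g
  using extension_exists[OF g idN(1), of "\<lambda>i\<in>{..<n}. i"] snd_endo[OF g] snd_endo[OF idN(1)]
   oi_hom_id[OF od_Ob, of n] by auto
 show "HomN n n <= El (UU n)"
 proof
  fix g assume g: "g : HomN n n"
  obtain h where h: "h : HomN n n" "cN n n n h g = idN n" using left_inv[OF g] by blast
  obtain k where k: "k : HomN n n" "cN n n n k h = idN n" using left_inv[OF h(1)] by blast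
  have "cN n n n (cN n n n k h) g = cN n n n k (cN n n n h g)" by (rule cN_assoc[OF g h(1) k(1)])
  hence "k = g" using h k idN(2)[OF g] idN(3)[OF k(1)] by simp
  thus "g : El (UU n)" unfolding U_carrier using g h k by (auto simp: idN_def)
 qed
qed (auto simp: U_hom)

text \<open>\<open>extension_exists\<close> applied to the standard morphism and \<open>x\<close>,
  which have the same pivots; the morphisms with given pivots thus form one orbit.\<close>

lemma HomN_transitive:
 assumes x: "x : HomN d n"
 shows "EX g:HomN n n. x = cN d n n g (sa d n (snd x))"
proof -
 have "\<exists>\<Phi>\<in>HomN n n. snd \<Phi> = (\<lambda>i\<in>{..<n}. i) & cN d n n \<Phi> (sa d n (snd x)) = x &
  (ALL t<n. t ~: snd (sa d n (snd x)) ` {..<d} -->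
   (ALL r<n. mat \<Phi> r t = (if r = (\<lambda>i\<in>{..<n}. i) t then \<one> else \<zero>)))"
  by (rule extension_exists[OF sa_hom[OF snd_oi[OF x]] x])
    (use oi_hom_id[OF od_Ob, of n] oi_less[OF snd_oi[OF x]] in auto)
 thus ?thesis by metis
qed

subsection \<open>Splitting off the last basis vector\<close>

text \<open>The block sum of \<open>x\<close> with the identity of rank one. It is characterised by
  \<open>plus1_iota\<close> and \<open>plus1_kappa\<close>.\<close>

definition plus1 :: "nat => nat => 'r ovi_arr => 'r ovi_arr" where
 "plus1 d n x = mor (od (Suc d)) (od (Suc n))
   (%t s. if s < d then (if t < n then mat x t s else \<zero>) else if t = n then \<one> else \<zero>) (ext1 d n (snd x))"

abbreviation "iota n == sa n (Suc n) (inc n)"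
abbreviation "kappa n == sa 1 (Suc n) (top_el n)"

lemma iota_hom: "iota n : HomN n (Suc n)" and kappa_hom: "kappa n : HomN 1 (Suc n)"
 by (rule sa_hom[OF inc_oi], rule sa_hom[OF top_oi])

text \<open>\<open>iota d\<close> exposes the first \<open>d\<close> columns and
  \<open>kappa d\<close> the last one. Identities for \<open>plus1\<close> can then be derived from
  commuting squares instead of matrix products.\<close>

lemma joint_epi:
 assumes a: "a : HomN (Suc d) n" and b: "b : HomN (Suc d) n"
  and i: "cN d (Suc d) n a (iota d) = cN d (Suc d) n b (iota d)"
  and k: "cN 1 (Suc d) n a (kappa d) = cN 1 (Suc d) n b (kappa d)"
 shows "a = b"
proof (rule HomN_ext[OF a b])
 have "snd a j = snd b j" if "j < Suc d" for j
 proof (cases "j = d")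
  case True
  have "compose {..<1} (snd a) (top_el d) 0 = compose {..<1} (snd b) (top_el d) 0"
   using arg_cong[OF k, of snd] snd_cN[OF kappa_hom] by simp
  thus ?thesis using True by (simp add: compose_def)
 next
  case False
  hence "j < d" using that by simp
  moreover have "compose {..<d} (snd a) (inc d) j = compose {..<d} (snd b) (inc d) j"
   using arg_cong[OF i, of snd] snd_cN[OF iota_hom] by simp
  ultimately show ?thesis by (simp add: compose_def)
 qed
 thus "snd a = snd b" using snd_oi[OF a] snd_oi[OF b] by (intro PiE_ext[of _ "{..<Suc d}"]) (auto simp: oi_iff)
 fix s t assume s: "s < Suc d" and t: "t < n"
 show "mat a t s = mat b t s"
 proof (cases "s = d")
  case True
  thus ?thesis using mat_sa_right[OF top_oi a _ t, of 0] mat_sa_right[OF top_oi b _ t, of 0] k by simp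
 next
  case False
  hence "s < d" using s by simp
  thus ?thesis using mat_sa_right[OF inc_oi a _ t, of s] mat_sa_right[OF inc_oi b _ t, of s] i by simp
 qed
qed

context
 fixes d n x
 assumes x: "x : HomN d n"
begin

lemma plus1_umat: "umat (od (Suc d)) (od (Suc n))
   (%t s. if s < d then (if t < n then mat x t s else \<zero>) else if t = n then \<one> else \<zero>) (ext1 d n (snd x))"
 unfolding umat_def
proof (intro conjI ballI)
 show "ext1 d n (snd x) : oi (Suc d) (Suc n)" by (rule ext1_oi[OF snd_oi[OF x]])
qed (use matN_cl[OF x] matN_pivot[OF x] matN_above[OF x] oi_less[OF snd_oi[OF x]] in
 \<open>auto simp: less_Suc_eq\<close>)

lemma plus1_hom: "plus1 d n x : HomN (Suc d) (Suc n)"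
 unfolding plus1_def by (rule mor_hom[OF od_Ob od_Ob plus1_umat])

lemma snd_plus1: "snd (plus1 d n x) = ext1 d n (snd x)"
 by (simp add: plus1_def mor_def)

lemma mat_plus1: "s < Suc d ==> t < Suc n ==> mat (plus1 d n x) t s =
  (if s < d then (if t < n then mat x t s else \<zero>) else if t = n then \<one> else \<zero>)"
 unfolding plus1_def using mat_mor[OF od_Ob od_Ob plus1_umat] by simp

lemma plus1_iota: "cN d (Suc d) (Suc n) (plus1 d n x) (iota d) = cN d n (Suc n) (iota n) x"
proof (rule HomN_ext[OF cN_hom[OF iota_hom plus1_hom] cN_hom[OF x iota_hom]])
 show "snd (cN d (Suc d) (Suc n) (plus1 d n x) (iota d)) = snd (cN d n (Suc n) (iota n) x)"
  using snd_cN[OF iota_hom] snd_cN[OF x] snd_plus1 ext1_inc[OF snd_oi[OF x]] by simp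
 fix s t assume s: "s < d" and t: "t < Suc n"
 show "mat (cN d (Suc d) (Suc n) (plus1 d n x) (iota d)) t s = mat (cN d n (Suc n) (iota n) x) t s"
  using mat_sa_right[OF inc_oi plus1_hom s t] mat_plus1[of s t] s t
   mat_sa_left(1)[OF inc_oi x s, of t] mat_sa_left(2)[OF inc_oi x s t]
  by (cases "t < n") (auto simp: less_Suc_eq)
qed

lemma plus1_kappa: "cN 1 (Suc d) (Suc n) (plus1 d n x) (kappa d) = kappa n"
proof (rule HomN_ext[OF cN_hom[OF kappa_hom plus1_hom] kappa_hom])
 show "snd (cN 1 (Suc d) (Suc n) (plus1 d n x) (kappa d)) = snd (kappa n)"
  using snd_cN[OF kappa_hom] snd_plus1 ext1_top by simp
 fix s t :: nat assume s: "s < 1" and t: "t < Suc n"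
 thus "mat (cN 1 (Suc d) (Suc n) (plus1 d n x) (kappa d)) t s = mat (kappa n) t s"
  using mat_sa_right[OF top_oi plus1_hom s t] mat_plus1[of d t] mat_sa[OF top_oi s t] by auto
qed

end

lemma plus1_inj: "x : HomN d n ==> y : HomN d n ==> plus1 d n x = plus1 d n y ==> x = y"
 using sa_cancel[OF inc_oi] plus1_iota by metis

lemma push_kappa:
 assumes g: "g : HomN n n"
 shows "cN 1 (Suc n) (Suc n) (pN n (Suc n) (inc n) g) (kappa n) = kappa n"
proof -
 note pg = push_hom[OF od_Ob od_Ob inc_oi g]
 have nin: "n ~: inc n ` {..<n}" by auto
 show ?thesis
 proof (rule HomN_ext[OF cN_hom[OF kappa_hom pg] kappa_hom])
  show "snd (cN 1 (Suc n) (Suc n) (pN n (Suc n) (inc n) g) (kappa n)) = snd (kappa n)"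
   using snd_cN[OF kappa_hom] snd_endo[OF pg] by (auto simp: compose_def top_el_def)
  fix s t :: nat assume s: "s < 1" and t: "t < Suc n"
  thus "mat (cN 1 (Suc n) (Suc n) (pN n (Suc n) (inc n) g) (kappa n)) t s = mat (kappa n) t s"
   using mat_sa_right[OF top_oi pg s t] push_off_image[OF od_Ob od_Ob inc_oi g, of n t]
    mat_sa[OF top_oi s t] by simp
 qed
qed

lemma push_iota: "g : HomN n n ==> cN n (Suc n) (Suc n) (pN n (Suc n) (inc n) g) (iota n) =
  cN n n (Suc n) (iota n) g"
 by (rule push_comp_std[OF od_Ob od_Ob inc_oi])

lemma push_inj: "g : HomN n n ==> h : HomN n n ==> pN n (Suc n) (inc n) g = pN n (Suc n) (inc n) h ==> g = h"
 using sa_cancel[OF inc_oi] push_iota by metis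

lemma plus1_push:
 assumes x: "x : HomN d n" and g: "g : HomN n n"
 shows "plus1 d n (cN d n n g x) = cN (Suc d) (Suc n) (Suc n) (pN n (Suc n) (inc n) g) (plus1 d n x)"
proof (rule joint_epi[OF plus1_hom[OF cN_hom[OF x g]]])
 note px = plus1_hom[OF x] and pg = push_hom[OF od_Ob od_Ob inc_oi g]
 show "cN (Suc d) (Suc n) (Suc n) (pN n (Suc n) (inc n) g) (plus1 d n x) : HomN (Suc d) (Suc n)"
  by (rule cN_hom[OF px pg])
 show "cN d (Suc d) (Suc n) (plus1 d n (cN d n n g x)) (iota d) =
   cN d (Suc d) (Suc n) (cN (Suc d) (Suc n) (Suc n) (pN n (Suc n) (inc n) g) (plus1 d n x)) (iota d)"
  unfolding plus1_iota[OF cN_hom[OF x g]] cN_assoc[OF iota_hom px pg] plus1_iota[OF x]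
   cN_assoc[OF x iota_hom pg, symmetric] push_iota[OF g] cN_assoc[OF x g iota_hom] ..
 show "cN 1 (Suc d) (Suc n) (plus1 d n (cN d n n g x)) (kappa d) =
   cN 1 (Suc d) (Suc n) (cN (Suc d) (Suc n) (Suc n) (pN n (Suc n) (inc n) g) (plus1 d n x)) (kappa d)"
  unfolding plus1_kappa[OF cN_hom[OF x g]] cN_assoc[OF kappa_hom px pg] plus1_kappa[OF x]
   push_kappa[OF g] ..
qed

lemma plus1_sa:
 assumes x: "x : HomN d n" and f: "f : oi n m"
 shows "plus1 d m (cN d n m (sa n m f) x) =
  cN (Suc d) (Suc n) (Suc m) (sa (Suc n) (Suc m) (ext1 n m f)) (plus1 d n x)"
proof (rule joint_epi[OF plus1_hom[OF cN_hom[OF x sa_hom[OF f]]]])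
 note px = plus1_hom[OF x] and sf = sa_hom[OF f] and se = sa_hom[OF ext1_oi[OF f]]
 show "cN (Suc d) (Suc n) (Suc m) (sa (Suc n) (Suc m) (ext1 n m f)) (plus1 d n x) : HomN (Suc d) (Suc m)"
  by (rule cN_hom[OF px se])
 have "cN n (Suc n) (Suc m) (sa (Suc n) (Suc m) (ext1 n m f)) (iota n) = cN n m (Suc m) (iota m) (sa n m f)"
  using sa_comp[OF inc_oi ext1_oi[OF f]] sa_comp[OF f inc_oi] ext1_inc[OF f] by simp
 thus "cN d (Suc d) (Suc m) (plus1 d m (cN d n m (sa n m f) x)) (iota d) =
   cN d (Suc d) (Suc m) (cN (Suc d) (Suc n) (Suc m) (sa (Suc n) (Suc m) (ext1 n m f)) (plus1 d n x)) (iota d)"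
  unfolding plus1_iota[OF cN_hom[OF x sf]] cN_assoc[OF iota_hom px se] plus1_iota[OF x]
   cN_assoc[OF x iota_hom se, symmetric] cN_assoc[OF x sf iota_hom, symmetric] by simp
 have "cN 1 (Suc n) (Suc m) (sa (Suc n) (Suc m) (ext1 n m f)) (kappa n) = kappa m"
  using sa_comp[OF top_oi ext1_oi[OF f]] ext1_top by simp
 thus "cN 1 (Suc d) (Suc m) (plus1 d m (cN d n m (sa n m f) x)) (kappa d) =
   cN 1 (Suc d) (Suc m) (cN (Suc d) (Suc n) (Suc m) (sa (Suc n) (Suc m) (ext1 n m f)) (plus1 d n x)) (kappa d)"
  unfolding plus1_kappa[OF cN_hom[OF x sf]] cN_assoc[OF kappa_hom px se] plus1_kappa[OF x] by simp
qed

text \<open>If the last row contains no pivot, all its entries lie past the pivots of their columns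
  and vanish, so the row can be deleted.\<close>

lemma factor_iota:
 assumes x: "x : HomN d (Suc n)" and avoid: "n ~: snd x ` {..<d}"
 shows "EX x':HomN d n. x = cN d n (Suc n) (iota n) x'"
proof -
 have lt: "snd x s < n" if "s < d" for s
  using oi_less[OF snd_oi[OF x] that] avoid that by (metis imageI lessThan_iff less_SucE)
 have um: "umat (od d) (od n) (mat x) (snd x)"
  unfolding umat_def
  using matN_cl[OF x] matN_pivot[OF x] matN_above[OF x] snd_oi[OF x] lt
  by (auto simp: oi_iff PiE_iff)
 let ?x = "mor (od d) (od n) (mat x) (snd x)"
 have H: "?x : HomN d n" by (rule mor_hom[OF od_Ob od_Ob um])
 have "x = cN d n (Suc n) (iota n) ?x"
 proof (rule HomN_ext[OF x cN_hom[OF H iota_hom]])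
  show "snd x = snd (cN d n (Suc n) (iota n) ?x)"
   unfolding snd_cN[OF H] using snd_oi[OF x] lt
   by (auto simp: mor_def compose_def fun_eq_iff oi_iff PiE_iff extensional_def)
  fix s t assume s: "s < d" and t: "t < Suc n"
  show "mat x t s = mat (cN d n (Suc n) (iota n) ?x) t s"
  proof (cases "t < n")
   case True
   thus ?thesis using mat_sa_left(1)[OF inc_oi H s True] mat_mor[OF od_Ob od_Ob um, of s t] s by simp
  next
   case False
   thus ?thesis using mat_sa_left(2)[OF inc_oi H s t] matN_above[OF x s t] lt[OF s] by auto
  qed
 qed
 thus ?thesis using H by blast
qed

text \<open>Take for \<open>c\<close> the unitriangular matrix with the last column of
  \<open>x\<close> and standard columns elsewhere. It fixes \<open>iota n\<close>, through which the
  first \<open>d\<close> columns of \<open>x\<close> factor because they avoid the last row.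
  Together with \<open>plus1_stabilizer\<close> this shows that the morphisms hitting the last basis
  vector are induced from \<open>U_n\<close> to \<open>U_(n+1)\<close>.\<close>

lemma factor_plus1:
 assumes x: "x : HomN (Suc d) (Suc n)" and last: "snd x d = n"
 shows "EX c:HomN (Suc n) (Suc n). EX x':HomN d n. x = cN (Suc d) (Suc n) (Suc n) c (plus1 d n x')"
proof -
 have av: "n ~: compose {..<d} (snd x) (inc d) ` {..<d}"
  using oi_mono[OF snd_oi[OF x], of _ d] last by (force simp: compose_def)
 obtain x' where x': "x' : HomN d n" "cN d (Suc d) (Suc n) x (iota d) = cN d n (Suc n) (iota n) x'"
  using factor_iota[OF cN_hom[OF iota_hom x]] av snd_cN[OF iota_hom] by (metis snd_std_arr)
 note xk = cN_hom[OF kappa_hom x]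
 have "EX c:HomN (Suc n) (Suc n). snd c = (\<lambda>i\<in>{..<Suc n}. i) &
  cN 1 (Suc n) (Suc n) c (kappa n) = cN 1 (Suc d) (Suc n) x (kappa d) &
  (ALL t<Suc n. t ~: snd (kappa n) ` {..<1} -->
   (ALL r<Suc n. mat c r t = (if r = (\<lambda>i\<in>{..<Suc n}. i) t then \<one> else \<zero>)))"
 proof (rule extension_exists[OF kappa_hom xk])
  show "(\<lambda>i\<in>{..<Suc n}. i) : oi (Suc n) (Suc n)" using oi_hom_id[OF od_Ob, of "Suc n"] by simp
  show "snd (cN 1 (Suc d) (Suc n) x (kappa d)) i = (\<lambda>i\<in>{..<Suc n}. i) (snd (kappa n) i)" if "i < 1" for i
   using that last by (simp add: snd_cN[OF kappa_hom] compose_def del: One_nat_def)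
 qed
 then obtain c where c: "c : HomN (Suc n) (Suc n)" "snd c = (\<lambda>i\<in>{..<Suc n}. i)"
  "cN 1 (Suc n) (Suc n) c (kappa n) = cN 1 (Suc d) (Suc n) x (kappa d)"
  "!!t r. t < Suc n ==> t ~: snd (kappa n) ` {..<1} ==> r < Suc n ==>
   mat c r t = (if r = (\<lambda>i\<in>{..<Suc n}. i) t then \<one> else \<zero>)" by blast
 have ci: "cN n (Suc n) (Suc n) c (iota n) = iota n"
 proof (rule HomN_ext[OF cN_hom[OF iota_hom c(1)] iota_hom])
  show "snd (cN n (Suc n) (Suc n) c (iota n)) = snd (iota n)"
   unfolding snd_cN[OF iota_hom] c(2) by (auto simp: compose_def inc_def)
  fix s t assume s: "s < n" and t: "t < Suc n"
  moreover have "s ~: snd (kappa n) ` {..<1}" using s by auto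
  ultimately show "mat (cN n (Suc n) (Suc n) c (iota n)) t s = mat (iota n) t s"
   using mat_sa_right[OF inc_oi c(1) s t] mat_sa[OF inc_oi s t] c(4)[of s t] by auto
 qed
 note px = plus1_hom[OF x'(1)]
 have "x = cN (Suc d) (Suc n) (Suc n) c (plus1 d n x')"
  by (rule joint_epi[OF x cN_hom[OF px c(1)]])
    (simp_all add: cN_assoc[OF iota_hom px c(1)] cN_assoc[OF kappa_hom px c(1)] plus1_iota[OF x'(1)]
     plus1_kappa[OF x'(1)] c(3) x'(2) cN_assoc[OF x'(1) iota_hom c(1), symmetric] ci del: One_nat_def)
 thus ?thesis using c(1) x'(1) by blast
qed

text \<open>Such a \<open>c\<close> fixes \<open>kappa n\<close>, so its last column is standard;
  the other columns have no pivot in the last row and form the matrix \<open>g\<close>.\<close>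

lemma plus1_stabilizer:
 assumes y: "y : HomN d n" and y': "y' : HomN d n" and c: "c : HomN (Suc n) (Suc n)"
  and eq: "cN (Suc d) (Suc n) (Suc n) c (plus1 d n y) = plus1 d n y'"
 shows "EX g:HomN n n. c = pN n (Suc n) (inc n) g"
proof -
 note py = plus1_hom[OF y]
 have "cN 1 (Suc d) (Suc n) (cN (Suc d) (Suc n) (Suc n) c (plus1 d n y)) (kappa d) = kappa n"
  unfolding eq by (rule plus1_kappa[OF y'])
 hence ck: "cN 1 (Suc n) (Suc n) c (kappa n) = kappa n"
  unfolding cN_assoc[OF kappa_hom py c] plus1_kappa[OF y] .
 have "n ~: snd (cN n (Suc n) (Suc n) c (iota n)) ` {..<n}"
  using snd_endo[OF c] by (auto simp: snd_cN[OF iota_hom] compose_def)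
 then obtain g where g: "g : HomN n n" "cN n (Suc n) (Suc n) c (iota n) = cN n n (Suc n) (iota n) g"
  using factor_iota[OF cN_hom[OF iota_hom c]] by blast
 have "c = pN n (Suc n) (inc n) g"
  by (rule joint_epi[OF c push_hom[OF od_Ob od_Ob inc_oi g(1)]])
    (simp_all add: ck push_kappa[OF g(1)] g(2) push_iota[OF g(1)] del: One_nat_def)
 thus ?thesis using g(1) by blast
qed

end

section \<open>Well-quasi-orders\<close>

text \<open>The name stands for almost full.\<close>

definition af :: "'a set => ('a => 'a => bool) => bool" where
 "af A P <-> (\<forall>f :: nat => 'a. (ALL i. f i : A) --> (EX i j. i < j & P (f i) (f j)))"

lemma afD: "af A P ==> (!!i. f i : A) ==> \<exists>i j :: nat. i < j & P (f i) (f j)"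
 by (auto simp: af_def)

text \<open>Ramsey's theorem for the colouring of pairs of indices by \<open>P\<close>: a
  homogeneous set of the other colour would be a sequence without a good pair.\<close>

lemma af_subseq:
 assumes P: "af A P" and f: "!!i. f i : A"
 shows "\<exists>g :: nat => nat. strict_mono g & (ALL i j. i < j --> P (f (g i)) (f (g j)))"
proof -
 define col where "col X = (if P (f (Min X)) (f (Max X)) then 0 else 1 :: nat)" for X
 have "EX Y t. Y <= UNIV & infinite Y & t < 2 & (ALL x:Y. ALL y:Y. x ~= y --> col {x, y} = t)"
  by (rule Ramsey2[OF infinite_UNIV_nat]) (simp add: col_def)
 then obtain Y t where Y1: "infinite Y" and Y2: "ALL x:Y. ALL y:Y. x ~= y --> col {x, y} = t" by metis
 have Y: "infinite Y" "!!x y. x : Y ==> y : Y ==> x ~= y ==> col {x, y} = t"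
  using Y1 Y2 by simp_all
 let ?g = "enumerate Y"
 have sm: "strict_mono ?g" using strict_mono_enumerate[OF Y(1)] .
 have c: "col {?g i, ?g j} = (if P (f (?g i)) (f (?g j)) then 0 else 1)" if "i < j" for i j
  using strict_monoD[OF sm that] by (simp add: col_def)
 have eq: "col {?g i, ?g j} = t" if "i < j" for i j
  using Y(2)[OF enumerate_in_set[OF Y(1)] enumerate_in_set[OF Y(1)]] strict_monoD[OF sm that]
  by simp
 have "EX i j. i < j & P (f (?g i)) (f (?g j))" by (rule afD[OF P]) (rule f)
 then obtain i j where ij: "i < j" "P (f (?g i)) (f (?g j))" by blast
 hence "t = 0" using c[OF ij(1)] eq[OF ij(1)] by simp
 hence "P (f (?g i)) (f (?g j))" if "i < j" for i j
  using c[OF that] eq[OF that] by (metis zero_neq_one)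
 with sm show ?thesis by metis
qed

lemma af_nat: "af UNIV ((<=) :: nat => nat => bool)"
 unfolding af_def
proof (intro allI impI)
 fix f :: "nat => nat"
 obtain i where "!!j. f i <= f j" using ex_has_least_nat[of "%_. True" 0 f] by auto
 thus "EX i j. i < j & f i <= f j" by (intro exI[of _ i] exI[of _ "Suc i"]) auto
qed

lemma af_finite_eq:
 assumes "finite A"
 shows "af A (=)"
 unfolding af_def
proof (intro allI impI)
 fix f :: "nat => 'a" assume "ALL i. f i : A"
 hence "range f <= A" by auto
 hence "finite (range f)" using assms by (rule finite_subset)
 hence "\<not> inj f" using finite_imageD[of f UNIV] infinite_UNIV_nat by metis
 thus "EX i j. i < j & f i = f j" unfolding inj_def by (metis nat_neq_iff)
qed

text \<open>Dickson's lemma: pass to a subsequence with weakly increasing heads, then compare the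
  tails by induction.\<close>

lemma af_vectors: "af {xs :: nat list. length xs = n} (list_all2 (<=))"
proof (induction n)
 case 0
 show ?case
  unfolding af_def
 by auto
next
 case (Suc n)
 show ?case
  unfolding af_def
 proof (intro allI impI)
  fix f :: "nat => nat list" assume f: "ALL i. f i : {xs. length xs = Suc n}"
  have "\<exists>g :: nat => nat. strict_mono g & (ALL i j. i < j --> hd (f (g i)) <= hd (f (g j)))"
   by (rule af_subseq[OF af_nat]) simp
  then obtain g :: "nat => nat" where g: "strict_mono g" "ALL i j. i < j --> hd (f (g i)) <= hd (f (g j))"
   by blast
  have "EX i j. i < j & list_all2 (<=) (tl (f (g i))) (tl (f (g j)))"
   by (rule afD[OF Suc]) (use f in simp)
  then obtain i j where ij: "i < j" "list_all2 (<=) (tl (f (g i))) (tl (f (g j)))"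
   by blast
  have split: "f k = hd (f k) # tl (f k)" for k using f[rule_format, of k] by (cases "f k") auto
  have "list_all2 (<=) (hd (f (g i)) # tl (f (g i))) (hd (f (g j)) # tl (f (g j)))"
   using ij g(2) by simp
  hence "list_all2 (<=) (f (g i)) (f (g j))"
   unfolding split[symmetric] .
  hence "g i < g j & list_all2 (<=) (f (g i)) (f (g j))" using strict_monoD[OF g(1) ij(1)] by simp
  thus "EX i j. i < j & list_all2 (<=) (f i) (f j)" by (intro exI)
 qed
qed

text \<open>Higman's lemma, by Nash-Williams' minimal bad sequence argument.\<close>

theorem af_lists:
 assumes P: "af A P"
 shows "af (lists A) (list_emb P)"
proof (rule ccontr)
 define bad where "bad f <-> (ALL i. f i : lists A) & (ALL i j. i < j --> \<not> list_emb P (f i) (f j))"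
  for f :: "nat => 'a list"
 assume "\<not> af (lists A) (list_emb P)"
 then obtain f where f: "bad f" unfolding af_def bad_def by blast
 \<comment> \<open>\<open>Q m k r\<close> says that \<open>r\<close> is a shortest possible
   \<open>k\<close>-th member among the bad sequences that begin with the first \<open>k\<close>
   members of \<open>m\<close>.\<close>
 define Q where "Q m k r <-> (EX g. bad g & (ALL i<k. g i = m i) & g k = r) &
   (ALL g. bad g & (ALL i<k. g i = m i) --> length r <= length (g k))" for m :: "nat => 'a list" and k r
 have "EX m. ALL k. Q m k (m k)"
 proof (rule dependent_wellorder_choice)
  fix m m' :: "nat => 'a list" and k r assume "!!i. i < k ==> m i = m' i"
  thus "Q m k r = Q m' k r" by (simp add: Q_def)
 next
  fix k and m :: "nat => 'a list" assume IH: "!!i. i < k ==> Q m i (m i)"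
  have "EX g. bad g & (ALL i<k. g i = m i)"
  proof (cases k)
   case 0
   thus ?thesis using f by auto
  next
   case (Suc k')
   then obtain g where "bad g" "ALL i<k'. g i = m i" "g k' = m k'" using IH[of k'] by (auto simp: Q_def)
   thus ?thesis using Suc by (auto simp: less_Suc_eq)
  qed
  then obtain g where "bad g & (ALL i<k. g i = m i)"
   "!!h. bad h & (ALL i<k. h i = m i) ==> length (g k) <= length (h k)"
   using ex_has_least_nat[of "%g. bad g & (ALL i<k. g i = m i)" _ "%g. length (g k)"] by blast
  thus "EX r. Q m k r" unfolding Q_def by blast
 qed
 then obtain m where m: "!!k. Q m k (m k)" by blast
 have mbad: "m i : lists A" "i < j ==> \<not> list_emb P (m i) (m j)" for i j
 proof -
  obtain g where "bad g" "ALL k<i. g k = m k" "g i = m i" using m[of i] by (auto simp: Q_def)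
  thus "m i : lists A" unfolding bad_def by metis
  assume ij: "i < j"
  obtain g where "bad g" "ALL k<j. g k = m k" "g j = m j" using m[of j] by (auto simp: Q_def)
  thus "\<not> list_emb P (m i) (m j)" using ij unfolding bad_def by metis
 qed
 have ne: "m k ~= []" for k using mbad(2)[of k "Suc k"] by auto
 have hdA: "hd (m k) : A" and tlA: "tl (m k) : lists A" for k
  using mbad(1)[of k] ne[of k] by (cases "m k"; auto)+
 have "\<exists>g :: nat => nat. strict_mono g & (ALL i j. i < j --> P (hd (m (g i))) (hd (m (g j))))"
  by (rule af_subseq[OF P]) (rule hdA)
 then obtain g :: "nat => nat" where g: "strict_mono g" "ALL i j. i < j --> P (hd (m (g i))) (hd (m (g j)))"
  by blast
 \<comment> \<open>The members before index \<open>g 0\<close> are kept and followed by the tails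
   along the subsequence whose heads are comparable. The member at \<open>g 0\<close> gets shorter,
   so a proof that \<open>h\<close> is bad contradicts minimality.\<close>
 define h where "h i = (if i < g 0 then m i else tl (m (g (i - g 0))))" for i
 have Cons: "m k = hd (m k) # tl (m k)" for k using ne by simp
 have ge: "g 0 <= g k" for k using strict_mono_leD[OF g(1), of 0 k] by simp
 have "bad h"
  unfolding bad_def
 proof (intro conjI allI impI)
  show "h i : lists A" for i using mbad(1) tlA by (simp add: h_def)
  fix i j :: nat assume ij: "i < j"
  show "\<not> list_emb P (h i) (h j)"
  proof
   assume emb: "list_emb P (h i) (h j)"
   consider "j < g 0" | "i < g 0" "g 0 <= j" | "g 0 <= i" by linarith
   thus False
   proof cases
    case 1
    thus False using emb ij mbad(2)[OF ij] by (simp add: h_def)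
   next
    case 2
    let ?k = "g (j - g 0)"
    have "list_emb P (m i) (tl (m ?k))" using 2 emb by (simp add: h_def)
    hence "list_emb P (m i) (m ?k)" using Cons[of ?k] by (metis list_emb_Cons)
    thus False using mbad(2)[of i ?k] 2 ge[of "j - g 0"] by simp
   next
    case 3
    let ?k = "i - g 0" and ?l = "j - g 0"
    have kl: "?k < ?l" using 3 ij by simp
    have "list_emb P (tl (m (g ?k))) (tl (m (g ?l)))" using 3 ij emb by (simp add: h_def)
    hence "list_emb P (m (g ?k)) (m (g ?l))"
     using g(2)[rule_format, OF kl] Cons[of "g ?k"] Cons[of "g ?l"] by (metis list_emb_Cons2)
    thus False using mbad(2)[OF strict_monoD[OF g(1) kl]] by simp
   qed
  qed
 qed
 moreover have "ALL i<g 0. h i = m i" by (simp add: h_def)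
 ultimately have "length (m (g 0)) <= length (h (g 0))" using m[of "g 0"] unfolding Q_def by blast
 thus False using ne[of "g 0"] by (cases "m (g 0)") (auto simp: h_def)
qed

lemma list_emb_embedding:
 assumes "list_emb P xs ys"
 shows "\<exists>\<psi>. (ALL i<length xs. \<psi> i < length ys & P (xs ! i) (ys ! \<psi> i)) &
  (ALL i j. i < j --> j < length xs --> \<psi> i < \<psi> j)"
 using assms
proof induction
 case (list_emb_Nil ys)
 show ?case by simp
next
 case (list_emb_Cons xs ys y)
 then obtain \<psi> where "ALL i<length xs. \<psi> i < length ys & P (xs ! i) (ys ! \<psi> i)"
  "ALL i j. i < j --> j < length xs --> \<psi> i < \<psi> j" by blast
 thus ?case by (intro exI[of _ "%i. Suc (\<psi> i)"]) auto
next
 case (list_emb_Cons2 x y xs ys)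
 then obtain \<psi> where \<psi>: "ALL i<length xs. \<psi> i < length ys & P (xs ! i) (ys ! \<psi> i)"
  "ALL i j. i < j --> j < length xs --> \<psi> i < \<psi> j" by blast
 let ?\<psi> = "%i. case i of 0 => 0 | Suc i => Suc (\<psi> i)"
 have "ALL i<length (x # xs). ?\<psi> i < length (y # ys) & P ((x # xs) ! i) ((y # ys) ! ?\<psi> i)"
  using \<psi>(1) list_emb_Cons2(1) by (auto split: nat.splits)
 moreover have "ALL i j. i < j --> j < length (x # xs) --> ?\<psi> i < ?\<psi> j"
  using \<psi>(2) by (auto split: nat.splits)
 ultimately show ?case by blast
qed

section \<open>A Groebner criterion for finite generation\<close>

lemma submod_regular_ideal:
 assumes K: "cring K" and I: "submod K (Reg K) I"
 shows "ideal I K"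
proof -
 interpret cring K by fact
 note s = subD[OF I, simplified]
 have IK: "x : El K" if "x : I" for x using s(1) that by auto
 have neg: "\<ominus>\<^sub>K x : I" if "x : I" for x
  using s(4)[OF a_inv_closed[OF one_closed] that] IK[OF that] by (simp add: l_minus)
 show ?thesis
 proof (rule idealI[OF ring_axioms])
  show "subgroup I (add_monoid K)"
   by (rule subgroup.intro) (use s neg in \<open>auto simp: a_inv_def[symmetric]\<close>)
  fix a x assume "a : I" "x : El K"
  thus "x \<otimes>\<^sub>K a : I" "a \<otimes>\<^sub>K x : I" using s(4)[of x a] IK m_comm by auto
 qed
qed

text \<open>The ideals generated by the initial segments form a chain, so their union is one of them
  and contains the next member of the sequence.\<close>

lemma noetherian_sequence:
 assumes K: "noetherian_ring K" and c: "!!i. c i : El K"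
 shows "\<exists>b :: nat. c b : Idl\<^bsub>K\<^esub> (c ` {..<b})"
proof -
 interpret noetherian_ring K by fact
 let ?I = "%b. Idl\<^bsub>K\<^esub> (c ` {..<b})"
 have cs: "c ` {..<b} <= El K" for b using c by auto
 have mono: "?I a <= ?I b" if "a <= b" for a b
  by (rule subset_Idl_subset[OF cs]) (use that in auto)
 have "\<Union>(range ?I) : range ?I"
 proof (rule ideal_chain_is_trivial)
  show "subset.chain {I. ideal I K} (range ?I)"
   unfolding subset_chain_def
  proof (intro conjI ballI)
   show "range ?I <= {I. ideal I K}" using genideal_ideal[OF cs] by auto
   fix X Y assume "X : range ?I" "Y : range ?I"
   then obtain a b where "X = ?I a" "Y = ?I b" by auto
   thus "X <= Y \<or> Y <= X" using mono[of a b] mono[of b a] nat_le_linear[of a b] by auto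
  qed
 qed auto
 then obtain b where "\<Union>(range ?I) = ?I b" by blast
 moreover have "c b : ?I (Suc b)" using genideal_self[OF cs, of "Suc b"] by auto
 ultimately show ?thesis by blast
qed

text \<open>Monomials are replaced by words, which may be several names of one element: the elements
  \<open>\<pi> n w\<close> span modulo \<open>B\<close> but need not be independent, and a key
  belongs to a word. Leading terms are therefore replaced by the filtrations \<open>low\<close> and
  \<open>upto\<close>. The relation \<open>le\<close> plays the part of divisibility, and
  \<open>move\<close> says that it is realised by a morphism that respects smaller words.\<close>

locale groebner = cat_module K C M for K :: "('k, 'y) ring_scheme" and C :: "('o, 'a) cat"
  and M :: "('o, 'a, 'k, 'm) cat_mod" +
 fixes W :: "'o => 'w set" and \<pi> :: "'o => 'w => 'm" and key :: "'o => 'w => 'q" and rel :: "('q \<times> 'q) set"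
  and le :: "'o \<times> 'w => 'o \<times> 'w => bool" and S B :: "'o => 'm set"
 assumes K: "cring K" and noeth: "noetherian_ring K"
  and wf: "wf rel" and trans: "trans rel"
  and total: "n : Ob C ==> u : W n ==> w : W n ==>
   key n u = key n w \<or> (key n u, key n w) : rel \<or> (key n w, key n u) : rel"
  and key_eq: "n : Ob C ==> u : W n ==> w : W n ==> key n u = key n w ==> \<pi> n u = \<pi> n w"
  and \<pi>_closed: "n : Ob C ==> w : W n ==> \<pi> n w : El (ob_mod M n)"
  and S: "subfam K C M S" and B: "subfam K C M B" and BS: "n : Ob C ==> B n <= S n"
  and span: "n : Ob C ==> S n <= cspan K (ob_mod M n) (\<pi> n ` W n \<union> B n)"
  and wqo: "af {(n, w). n : Ob C & w : W n} le"
  and move: "n : Ob C ==> m : Ob C ==> w : W n ==> w' : W m ==> le (n, w) (m, w') ==>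
   \<exists>\<phi>\<in>Arr C n m. arr_map M n m \<phi> (\<pi> n w) = \<pi> m w' &
    (ALL u:W n. (key n u, key n w) : rel -->
     (EX u':W m. (key m u', key m w') : rel & arr_map M n m \<phi> (\<pi> n u) = \<pi> m u'))"
begin

definition low :: "'o => 'q => 'm set" where
 "low n k = cspan K (ob_mod M n) (\<pi> n ` {u : W n. (key n u, k) : rel} \<union> B n)"

definition upto :: "'o => 'w => 'm set" where
 "upto n w = cspan K (ob_mod M n) (\<pi> n ` {u : W n. key n u = key n w \<or> (key n u, key n w) : rel} \<union> B n)"

context
 fixes n assumes n: "n : Ob C"
begin

interpretation M: left_module K "ob_mod M n" by (rule ob_lm[OF n])

lemma B_cl: "B n <= El (ob_mod M n)"
 using subD(1)[OF famD(1)[OF B n]] .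

lemma gens_cl: "W' <= W n ==> \<pi> n ` W' \<union> B n <= El (ob_mod M n)"
 using \<pi>_closed[OF n] B_cl by auto

lemma low_sub: "submod K (ob_mod M n) (low n k)"
 unfolding low_def by (rule cspan_sub[OF ob_lm[OF n] gens_cl]) auto

lemma upto_sub: "submod K (ob_mod M n) (upto n w)"
 unfolding upto_def by (rule cspan_sub[OF ob_lm[OF n] gens_cl]) auto

lemma upto_mono: "key n u = key n w \<or> (key n u, key n w) : rel ==> upto n u <= upto n w"
 unfolding upto_def by (rule cspan_mono) (use transD[OF trans] in auto)

lemma B_upto: "B n <= upto n w"
 unfolding upto_def by (auto intro: cspan_base)

text \<open>Keys are linearly ordered, so among finitely many words one bounds the others; a
  combination without words lies in \<open>B\<close>.\<close>

lemma span_upto: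
 assumes W': "W' <= W n" and x: "x : cspan K (ob_mod M n) (\<pi> n ` W' \<union> B n)"
 shows "x : B n \<or> (EX w:W'. x : upto n w)"
 using x
proof induction
 note Bs = subD[OF famD(1)[OF B n]] and us = subD[OF upto_sub]
 case cspan_zero
 thus ?case using Bs(2) by simp
next
 case (cspan_base x)
 thus ?case
  using W' by (auto simp: upto_def intro!: cspan.cspan_base)
next
 note Bs = subD[OF famD(1)[OF B n]] and us = subD[OF upto_sub]
 case (cspan_smult a x)
 thus ?case using Bs(4) us(4) by blast
next
 note Bs = subD[OF famD(1)[OF B n]] and us = subD[OF upto_sub]
 case (cspan_add x y)
 consider "x : B n" "y : B n" | w where "w : W'" "x : upto n w" "y : upto n w"
 proof -
  have "EX w:W'. x : upto n w & y : upto n w" if "\<not> (x : B n & y : B n)"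
  proof (cases "x : B n \<or> y : B n")
   case True
   thus ?thesis using that cspan_add.IH B_upto by blast
  next
   case False
   then obtain u w where u: "u : W'" "x : upto n u" and w: "w : W'" "y : upto n w"
    using cspan_add.IH by blast
   then consider "upto n u <= upto n w" | "upto n w <= upto n u"
    using total[OF n, of u w] upto_mono[of u w] upto_mono[of w u] W' by auto
   thus ?thesis using u w by cases blast+
  qed
  thus thesis using that by blast
 qed
 thus ?case using Bs(3) us(3) by cases blast+
qed

lemma upto_decomp:
 assumes w: "w : W n" and x: "x : upto n w"
 shows "EX c:El K. EX y:low n (key n w). x = (c \<odot>\<^sub>(ob_mod M n) \<pi> n w) \<oplus>\<^sub>(ob_mod M n) y"
proof -
 note ls = subD[OF low_sub] and pw = \<pi>_closed[OF n w]
 note lc = subsetD[OF ls(1)]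
 let ?N = "{x. EX c:El K. EX y:low n (key n w). x = (c \<odot>\<^sub>(ob_mod M n) \<pi> n w) \<oplus>\<^sub>(ob_mod M n) y}"
 have lowN: "y : ?N" if "y : low n (key n w)" for y
  using that lc[OF that] pw by (auto intro!: bexI[of _ "\<zero>\<^sub>K"] bexI[of _ y] simp: M.smult_l_null)
 have "upto n w <= ?N"
  unfolding upto_def
 proof (rule cspan_least)
  show "submod K (ob_mod M n) ?N"
  proof (rule submodI)
   show "?N <= El (ob_mod M n)" using lc pw M.smult_closed by auto
   show "\<zero>\<^sub>(ob_mod M n) : ?N" using lowN ls(2) by blast
  next
   fix x x' assume "x : ?N" "x' : ?N"
   then obtain c y c' y' where c: "c : El K" "y : low n (key n w)"
    "x = (c \<odot>\<^sub>(ob_mod M n) \<pi> n w) \<oplus>\<^sub>(ob_mod M n) y"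
    "c' : El K" "y' : low n (key n w)" "x' = (c' \<odot>\<^sub>(ob_mod M n) \<pi> n w) \<oplus>\<^sub>(ob_mod M n) y'" by blast
   have "x \<oplus>\<^sub>(ob_mod M n) x' = ((c \<oplus>\<^sub>K c') \<odot>\<^sub>(ob_mod M n) \<pi> n w) \<oplus>\<^sub>(ob_mod M n) (y \<oplus>\<^sub>(ob_mod M n) y')"
    using c lc[OF c(2)] lc[OF c(5)] pw M.smult_closed by (simp add: M.smult_l_distr M.M.a_ac)
   thus "x \<oplus>\<^sub>(ob_mod M n) x' : ?N" using c ls(3) by blast
  next
   fix a x assume a: "a : El K" and "x : ?N"
   then obtain c y where c: "c : El K" "y : low n (key n w)"
    "x = (c \<odot>\<^sub>(ob_mod M n) \<pi> n w) \<oplus>\<^sub>(ob_mod M n) y" by blast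
   have "a \<odot>\<^sub>(ob_mod M n) x = ((a \<otimes>\<^sub>K c) \<odot>\<^sub>(ob_mod M n) \<pi> n w) \<oplus>\<^sub>(ob_mod M n) (a \<odot>\<^sub>(ob_mod M n) y)"
    using a c lc[OF c(2)] pw M.smult_closed by (simp add: M.smult_r_distr M.smult_assoc1)
   thus "a \<odot>\<^sub>(ob_mod M n) x : ?N" using a c ls(4) by blast
  qed
  show "\<pi> n ` {u : W n. key n u = key n w \<or> (key n u, key n w) : rel} \<union> B n <= ?N"
  proof (intro Un_least image_subsetI)
   fix u assume u: "u : {u : W n. key n u = key n w \<or> (key n u, key n w) : rel}"
   show "\<pi> n u : ?N"
   proof (cases "key n u = key n w")
    case True
    hence "\<pi> n u = (\<one>\<^sub>K \<odot>\<^sub>(ob_mod M n) \<pi> n w) \<oplus>\<^sub>(ob_mod M n) \<zero>\<^sub>(ob_mod M n)"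
     using key_eq[OF n _ w True] u pw by (simp add: M.smult_one)
    thus ?thesis using ls(2) by blast
   next
    case False
    thus ?thesis using u by (intro lowN) (auto simp: low_def intro: cspan_base)
   qed
  next
   show "B n <= ?N" using lowN by (auto simp: low_def intro: cspan_base)
  qed
 qed
 thus ?thesis using x by blast
qed

text \<open>Choose the least key for which \<open>upto\<close> contains an element of
  \<open>S\<close> outside \<open>G\<close>. By \<open>span_upto\<close> an element of
  \<open>S\<close> that lies in \<open>low\<close> is bounded by a smaller word, so it is in
  \<open>G\<close> by minimality.\<close>

lemma minimal_remainder:
 assumes G: "submod K (ob_mod M n) G" "B n <= G" and ex: "\<not> S n <= G"
 shows "EX w:W n. EX c:El K. EX y:low n (key n w).
  (c \<odot>\<^sub>(ob_mod M n) \<pi> n w) \<oplus>\<^sub>(ob_mod M n) y : S n - G & S n \<inter> low n (key n w) <= G"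
proof -
 define Q where "Q = {key n w |w. w : W n & (EX x:S n - G. x : upto n w)}"
 obtain x where x: "x : S n" "x ~: G" using ex by blast
 have "x : B n \<or> (EX w:W n. x : upto n w)" using span_upto[OF subset_refl] span[OF n] x(1) by blast
 then obtain w0 where "w0 : W n" "x : upto n w0" using x G(2) by blast
 hence k0: "key n w0 : Q" using x unfolding Q_def by blast
 obtain k where k: "k : Q" "!!k'. (k', k) : rel ==> k' ~: Q"
  using wfE_min[OF wf k0] by metis
 then obtain w x where w: "w : W n" "k = key n w" "x : S n - G" "x : upto n w"
  unfolding Q_def by blast
 obtain c y where c: "c : El K" "y : low n (key n w)"
  "x = (c \<odot>\<^sub>(ob_mod M n) \<pi> n w) \<oplus>\<^sub>(ob_mod M n) y"
  using upto_decomp[OF w(1,4)] by blast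
 have "S n \<inter> low n (key n w) <= G"
 proof
  fix z assume z: "z : S n \<inter> low n (key n w)"
  show "z : G"
  proof (rule ccontr)
   assume "z ~: G"
   moreover have "z : B n \<or> (EX u:{u : W n. (key n u, key n w) : rel}. z : upto n u)"
    by (rule span_upto) (use z in \<open>auto simp: low_def\<close>)
   ultimately obtain u where "u : W n" "(key n u, k) : rel" "z : upto n u" using G(2) w(2) by blast
   thus False using k(2)[of "key n u"] z \<open>z ~: G\<close> unfolding Q_def by blast
  qed
 qed
 thus ?thesis using w c by blast
qed

end

text \<open>Otherwise there are infinitely many elements \<open>c_k \<pi> w_k + lower\<close>, each
  outside the span of its predecessors and minimal in the sense of \<open>minimal_remainder\<close>.
  Along a subsequence the words increase for \<open>le\<close>, and some \<open>c_b\<close> lies in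
  the ideal of the earlier coefficients. By \<open>move\<close> the earlier elements can be brought
  to the word \<open>w_b\<close>, so some generated element of \<open>S\<close> has the same leading
  coefficient as the \<open>b\<close>-th one. The difference is lower, hence generated.\<close>

theorem groebner_fin_gen: "fin_gen K C M S B"
proof (rule ccontr)
 assume not: "\<not> fin_gen K C M S B"
 let ?G = "%F. gspan K C M F B"
 define ok where "ok F <-> finite F & (ALL (x, m):F. x : Ob C & m : S x)" for F
 note SC = subD(1)[OF famD(1)[OF S]]
 have okC: "x : Ob C & m : El (ob_mod M x)" if "ok F" "(x, m) : F" for F x m
 proof -
  have "x : Ob C" "m : S x" using that by (auto simp: ok_def)
  thus ?thesis using SC by auto
 qed
 have GF: "subfam K C M (?G F)" if "ok F" for F
  by (rule gspan_subfam[OF okC[OF that] B_cl]) (use famD(2)[OF B] in auto)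
 define P where "P F n w c y x <-> n : Ob C & w : W n & c : El K & y : low n (key n w) &
  x = (c \<odot>\<^sub>(ob_mod M n) \<pi> n w) \<oplus>\<^sub>(ob_mod M n) y & x : S n & x ~: ?G F n & S n \<inter> low n (key n w) <= ?G F n"
  for F n w c y x
 have exP: "EX v. case v of (n, w, c, y, x) => P F n w c y x" if F: "ok F" for F
 proof -
  obtain n where n: "n : Ob C" "\<not> S n <= ?G F n" using not F unfolding fin_gen_def ok_def by blast
  have "B n <= ?G F n" by (auto intro: gspan_B)
  from minimal_remainder[OF n(1) famD(1)[OF GF[OF F] n(1)] this n(2)] n(1)
  show ?thesis unfolding P_def by auto
 qed
 define ch where "ch F = (SOME v. case v of (n, w, c, y, x) => P F n w c y x)" for F
 have ch: "case ch F of (n, w, c, y, x) => P F n w c y x" if "ok F" for F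
  unfolding ch_def by (rule someI_ex[OF exP[OF that]])
 define step where "step F = (case ch F of (n, w, c, y, x) => insert (n, x) F)" for F
 define Fs where "Fs k = (step ^^ k) {}" for k
 have Fs_Suc: "Fs (Suc k) = step (Fs k)" for k by (simp add: Fs_def)
 have okF: "ok (Fs k)" for k
 proof (induction k)
  case 0
  show ?case by (simp add: Fs_def ok_def)
 next
  case (Suc k)
  thus ?case using ch[OF Suc] by (auto simp: Fs_Suc step_def ok_def P_def split: prod.splits)
 qed
 define nn where "nn k = fst (ch (Fs k))" for k
 define ww where "ww k = fst (snd (ch (Fs k)))" for k
 define cc where "cc k = fst (snd (snd (ch (Fs k))))" for k
 define yy where "yy k = fst (snd (snd (snd (ch (Fs k)))))" for k
 define xx where "xx k = snd (snd (snd (snd (ch (Fs k)))))" for k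
 have PP: "P (Fs k) (nn k) (ww k) (cc k) (yy k) (xx k)" for k
  using ch[OF okF, of k] by (simp add: nn_def ww_def cc_def yy_def xx_def split: prod.splits)
 have ins: "Fs (Suc k) = insert (nn k, xx k) (Fs k)" for k
  by (simp add: Fs_Suc step_def nn_def xx_def split: prod.splits)
 have mem: "(nn k, xx k) : Fs l" if "k < l" for k l
  using that by (induction l) (auto simp: ins less_Suc_eq)
 have "\<exists>g :: nat => nat. strict_mono g &
   (ALL i j. i < j --> le (nn (g i), ww (g i)) (nn (g j), ww (g j)))"
  by (rule af_subseq[OF wqo]) (use PP in \<open>auto simp: P_def\<close>)
 then obtain g :: "nat => nat" where g: "strict_mono g"
  "ALL i j. i < j --> le (nn (g i), ww (g i)) (nn (g j), ww (g j))"
  by blast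
 obtain b where b: "cc (g b) : Idl\<^bsub>K\<^esub> ((%i. cc (g i)) ` {..<b})"
  using noetherian_sequence[OF noeth, of "%i. cc (g i)"] PP unfolding P_def by blast
 define n where "n = nn (g b)"
 define w where "w = ww (g b)"
 define F where "F = Fs (g b)"
 have Pb: "P F n w (cc (g b)) (yy (g b)) (xx (g b))" using PP[of "g b"] by (simp add: n_def w_def F_def)
 hence n: "n : Ob C" and w: "w : W n" by (auto simp: P_def)
 interpret M: left_module K "ob_mod M n" by (rule ob_lm[OF n])
 note pw = \<pi>_closed[OF n w]
 have Fok: "ok F" unfolding F_def by (rule okF)
 note Gs = subD[OF famD(1)[OF GF[OF Fok] n]] and Ss = subD[OF famD(1)[OF S n]]
  and ls = subD[OF low_sub[OF n]]
 \<comment> \<open>The leading coefficients, at the word \<open>w\<close>, of those elements of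
   \<open>S\<close> that are already generated.\<close>
 let ?I = "{c : El K. EX z:low n (key n w). (c \<odot>\<^sub>(ob_mod M n) \<pi> n w) \<oplus>\<^sub>(ob_mod M n) z : ?G F n \<inter> S n}"
 have "submod K (Reg K) ?I"
 proof (rule submodI)
  show "\<zero>\<^sub>(Reg K) : ?I"
   using ls(2) Gs(2) Ss(2) pw by (auto intro!: bexI[of _ "\<zero>\<^sub>(ob_mod M n)"] simp: M.smult_l_null)
 next
  fix c c' assume "c : ?I" "c' : ?I"
  then obtain z z' where z: "c : El K" "z : low n (key n w)"
   "(c \<odot>\<^sub>(ob_mod M n) \<pi> n w) \<oplus>\<^sub>(ob_mod M n) z : ?G F n \<inter> S n"
   "c' : El K" "z' : low n (key n w)" "(c' \<odot>\<^sub>(ob_mod M n) \<pi> n w) \<oplus>\<^sub>(ob_mod M n) z' : ?G F n \<inter> S n"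
   by blast
  have zc: "z : El (ob_mod M n)" "z' : El (ob_mod M n)" using z ls(1) by auto
  have "((c \<odot>\<^sub>(ob_mod M n) \<pi> n w) \<oplus>\<^sub>(ob_mod M n) z) \<oplus>\<^sub>(ob_mod M n) ((c' \<odot>\<^sub>(ob_mod M n) \<pi> n w) \<oplus>\<^sub>(ob_mod M n) z') =
   ((c \<oplus>\<^sub>K c') \<odot>\<^sub>(ob_mod M n) \<pi> n w) \<oplus>\<^sub>(ob_mod M n) (z \<oplus>\<^sub>(ob_mod M n) z')"
   using z(1,4) zc pw M.smult_closed by (simp add: M.smult_l_distr M.M.a_ac)
  moreover have "((c \<odot>\<^sub>(ob_mod M n) \<pi> n w) \<oplus>\<^sub>(ob_mod M n) z) \<oplus>\<^sub>(ob_mod M n)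
    ((c' \<odot>\<^sub>(ob_mod M n) \<pi> n w) \<oplus>\<^sub>(ob_mod M n) z') : ?G F n \<inter> S n"
   using z(3,6) Gs(3) Ss(3) by blast
  ultimately show "c \<oplus>\<^sub>(Reg K) c' : ?I" using z(1,4) ls(3)[OF z(2,5)] by auto
 next
  fix a c assume a: "a : El K" and "c : ?I"
  then obtain z where z: "c : El K" "z : low n (key n w)"
   "(c \<odot>\<^sub>(ob_mod M n) \<pi> n w) \<oplus>\<^sub>(ob_mod M n) z : ?G F n \<inter> S n" by blast
  have zc: "z : El (ob_mod M n)" using z ls(1) by auto
  have "a \<odot>\<^sub>(ob_mod M n) ((c \<odot>\<^sub>(ob_mod M n) \<pi> n w) \<oplus>\<^sub>(ob_mod M n) z) =
   ((a \<otimes>\<^sub>K c) \<odot>\<^sub>(ob_mod M n) \<pi> n w) \<oplus>\<^sub>(ob_mod M n) (a \<odot>\<^sub>(ob_mod M n) z)"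
   using a z(1) zc pw M.smult_closed by (simp add: M.smult_r_distr M.smult_assoc1)
  moreover have "a \<odot>\<^sub>(ob_mod M n) ((c \<odot>\<^sub>(ob_mod M n) \<pi> n w) \<oplus>\<^sub>(ob_mod M n) z) : ?G F n \<inter> S n"
   using a z(3) Gs(4) Ss(4) by blast
  ultimately show "a \<odot>\<^sub>(Reg K) c : ?I" using a z(1) ls(4)[OF a z(2)] by auto
 qed auto
 hence I: "ideal ?I K" by (rule submod_regular_ideal[OF K])
 have "cc (g i) : ?I" if i: "i < b" for i
 proof -
  let ?n = "nn (g i)" and ?w = "ww (g i)" and ?x = "xx (g i)"
  have Pi: "P (Fs (g i)) ?n ?w (cc (g i)) (yy (g i)) ?x" by (rule PP)
  hence ni: "?n : Ob C" "?w : W ?n" "cc (g i) : El K" "yy (g i) : low ?n (key ?n ?w)"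
   "?x = (cc (g i) \<odot>\<^sub>(ob_mod M ?n) \<pi> ?n ?w) \<oplus>\<^sub>(ob_mod M ?n) yy (g i)" "?x : S ?n"
   by (auto simp: P_def)
  obtain \<phi> where \<phi>: "\<phi> : Arr C ?n n" "arr_map M ?n n \<phi> (\<pi> ?n ?w) = \<pi> n w"
   "!!u. u : W ?n ==> (key ?n u, key ?n ?w) : rel ==>
    EX u':W n. (key n u', key n w) : rel & arr_map M ?n n \<phi> (\<pi> ?n u) = \<pi> n u'"
   using move[OF ni(1) n ni(2) w] g(2)[rule_format, OF i] unfolding n_def w_def by blast
  interpret N: left_module K "ob_mod M ?n" by (rule ob_lm[OF ni(1)])
  note lin = arr_linear[OF ni(1) n \<phi>(1)]
  have yc: "yy (g i) : El (ob_mod M ?n)" using ni(4) subD(1)[OF low_sub[OF ni(1)]] by auto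
  have z: "arr_map M ?n n \<phi> (yy (g i)) : low n (key n w)"
   unfolding low_def
  proof (rule cspan_image[OF ob_lm[OF ni(1)] ob_lm[OF n] lin _ ni(4)[unfolded low_def]])
   show "\<pi> ?n ` {u : W ?n. (key ?n u, key ?n ?w) : rel} \<union> B ?n <= El (ob_mod M ?n)"
    by (rule gens_cl[OF ni(1)]) auto
   show "arr_map M ?n n \<phi> ` (\<pi> ?n ` {u : W ?n. (key ?n u, key ?n ?w) : rel} \<union> B ?n) <=
    cspan K (ob_mod M n) (\<pi> n ` {u : W n. (key n u, key n w) : rel} \<union> B n)"
   proof (intro image_subsetI)
    fix v assume "v : \<pi> ?n ` {u : W ?n. (key ?n u, key ?n ?w) : rel} \<union> B ?n"
    thus "arr_map M ?n n \<phi> v : cspan K (ob_mod M n) (\<pi> n ` {u : W n. (key n u, key n w) : rel} \<union> B n)"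
    proof
     assume "v : \<pi> ?n ` {u : W ?n. (key ?n u, key ?n ?w) : rel}"
     then obtain u where "u : W ?n" "(key ?n u, key ?n ?w) : rel" "v = \<pi> ?n u" by blast
     then obtain u' where "u' : W n" "(key n u', key n w) : rel" "arr_map M ?n n \<phi> v = \<pi> n u'"
      using \<phi>(3) by blast
     thus ?thesis by (intro cspan_base) auto
    next
     assume "v : B ?n"
     thus ?thesis using famD(2)[OF B ni(1) n \<phi>(1)] by (intro cspan_base) auto
    qed
   qed
  qed
  have "arr_map M ?n n \<phi> ?x =
   (cc (g i) \<odot>\<^sub>(ob_mod M n) \<pi> n w) \<oplus>\<^sub>(ob_mod M n) arr_map M ?n n \<phi> (yy (g i))"
   using lin_add[OF lin N.smult_closed[OF ni(3) \<pi>_closed[OF ni(1,2)]] yc]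
    lin_smult[OF lin ni(3) \<pi>_closed[OF ni(1,2)]] ni(5) \<phi>(2) by simp
  moreover have "arr_map M ?n n \<phi> ?x : ?G F n"
   using gspan_arr[OF mem[OF strict_monoD[OF g(1) i]] \<phi>(1)] by (simp add: F_def)
  moreover have "arr_map M ?n n \<phi> ?x : S n" by (rule famD(2)[OF S ni(1) n \<phi>(1) ni(6)])
  ultimately show ?thesis using z ni(3) by auto
 qed
 hence "cc (g b) : ?I"
  using ring.genideal_minimal[OF cring.axioms(1)[OF K] I, of "(%i. cc (g i)) ` {..<b}"] b by blast
 then obtain z where z: "z : low n (key n w)"
  "(cc (g b) \<odot>\<^sub>(ob_mod M n) \<pi> n w) \<oplus>\<^sub>(ob_mod M n) z : ?G F n \<inter> S n" by blast
 let ?v = "(cc (g b) \<odot>\<^sub>(ob_mod M n) \<pi> n w) \<oplus>\<^sub>(ob_mod M n) z"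
 have q: "cc (g b) : El K" "yy (g b) : low n (key n w)"
  "xx (g b) = (cc (g b) \<odot>\<^sub>(ob_mod M n) \<pi> n w) \<oplus>\<^sub>(ob_mod M n) yy (g b)" "xx (g b) : S n" "xx (g b) ~: ?G F n"
  "S n \<inter> low n (key n w) <= ?G F n"
  using Pb by (auto simp: P_def)
 note cw = M.smult_closed[OF q(1) pw]
 have zc: "z : El (ob_mod M n)" and yc: "yy (g b) : El (ob_mod M n)" using z q ls(1) by auto
 \<comment> \<open>The leading terms cancel, so the difference lies in \<open>low\<close> and in
   \<open>S\<close>; minimality puts it into the span.\<close>
 have d: "xx (g b) \<ominus>\<^sub>(ob_mod M n) ?v = yy (g b) \<ominus>\<^sub>(ob_mod M n) z"
  using cw zc yc q(3) by (simp add: a_minus_def M.M.minus_add M.M.a_ac M.M.r_neg M.M.r_neg1 M.M.r_neg2)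
 have "xx (g b) \<ominus>\<^sub>(ob_mod M n) ?v : S n"
  using submod_diff[OF ob_lm[OF n] famD(1)[OF S n] q(4)] z(2) by blast
 moreover have "xx (g b) \<ominus>\<^sub>(ob_mod M n) ?v : low n (key n w)"
  unfolding d by (rule submod_diff[OF ob_lm[OF n] low_sub[OF n] q(2) z(1)])
 ultimately have "xx (g b) \<ominus>\<^sub>(ob_mod M n) ?v : ?G F n" using q(6) by blast
 hence "(xx (g b) \<ominus>\<^sub>(ob_mod M n) ?v) \<oplus>\<^sub>(ob_mod M n) ?v : ?G F n" using Gs(3) z(2) by blast
 moreover have "(xx (g b) \<ominus>\<^sub>(ob_mod M n) ?v) \<oplus>\<^sub>(ob_mod M n) ?v = xx (g b)"
  using q(4) Ss(1) cw zc by (auto simp: a_minus_def M.M.a_assoc M.M.l_neg)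
 ultimately show False using q(5) by simp
qed

end

section \<open>Noetherianity of OVI(R)-modules\<close>

lemma lex_nth: "(xs, ys) : lex r <-> length xs = length ys &
  (EX k<length xs. (xs ! k, ys ! k) : r & (ALL i<k. xs ! i = ys ! i))"
proof (induction xs arbitrary: ys)
 case (Cons x xs)
 show ?case
 proof (cases ys)
  case (Cons y ys')
  show ?thesis
   unfolding Cons Cons_in_lex Cons.IH length_Cons Ex_less_Suc2 All_less_Suc2 by auto
 qed simp
qed simp

lemma lex_upt: "(map f [0..<N], map g [0..<N]) : lex r <-> (EX k<N. (f k, g k) : r & (ALL i<k. f i = g i))"
 unfolding lex_nth by (simp cong: conj_cong)

text \<open>In reversed order the first difference of the lists is the largest index at which the
  functions differ.\<close>

lemma lex_rev_upt: "(map f (rev [0..<N]), map g (rev [0..<N])) : lex r <->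
  (EX k<N. (f k, g k) : r & (ALL i. k < i --> i < N --> f i = g i))"
proof (induction N)
 case (Suc N)
 have "(map f (rev [0..<Suc N]), map g (rev [0..<Suc N])) : lex r <->
  (f N, g N) : r \<or> f N = g N & (EX k<N. (f k, g k) : r & (ALL i. k < i --> i < N --> f i = g i))"
  by (simp add: Suc.IH)
 also have "... <-> (EX k<Suc N. (f k, g k) : r & (ALL i. k < i --> i < Suc N --> f i = g i))"
  by (auto simp: less_Suc_eq)
 finally show ?case .
qed simp

lemma lex_total:
 assumes "length xs = length ys" "xs ~= ys"
  and "!!x y. x : set xs ==> y : set ys ==> x ~= y ==> (x, y) : r \<or> (y, x) : r"
 shows "(xs, ys) : lex r \<or> (ys, xs) : lex r"
 using assms
proof (induction xs ys rule: list_induct2)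
 case (Cons x xs y ys)
 show ?case
 by (use Cons.IH Cons.prems Cons.hyps in \<open>auto\<close>)
qed simp

context ovi_cat
begin

abbreviation "NC == pull_cat (OVI R) (%n. std (od n))"
abbreviation "NI == pull_cat OI od"

lemma NC_simps [simp]: "n : Ob NC" "Arr NC d n = HomN d n"
 using std_Ob by (auto simp: Arr_OVI)

lemma NI_simps [simp]: "n : Ob NI" "Arr NI d n = oi d n"
 by (auto simp: OI_Arr)

context
 fixes K :: "('k, 'y) ring_scheme" and M :: "(nat, 'r ovi_arr, 'k, 'm) cat_mod"
 assumes M: "cat_module K NC M"
begin

lemma NC_lin: "\<phi> : HomN d n ==> arr_map M d n \<phi> : Lin K (ob_mod M d) (ob_mod M n)"
 using cat_module.arr_linear[OF M NC_simps(1) NC_simps(1)] by (simp only: NC_simps(2))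

lemma NC_ob: "LMod K (ob_mod M n)"
 by (rule cat_module.ob_lm[OF M NC_simps(1)])

lemma NC_comp: "y : HomN d n ==> \<phi> : HomN n m ==> v : El (ob_mod M d) ==>
  arr_map M d m (cN d n m \<phi> y) v = arr_map M n m \<phi> (arr_map M d n y v)"
 using cat_module.arr_Comp[OF M NC_simps(1) NC_simps(1) NC_simps(1), of y d n \<phi> m v]
 by (simp only: NC_simps(2)) (simp)

end

end

text \<open>
 The additive group of R is generated as a monoid by the finitely many elements
 \<^term>\<open>ge c\<close>, so matrix entries lift to vectors of natural numbers.
\<close>

locale ovi_fg = ovi_cat R for R :: "('r, 'x) ring_scheme" (structure) +
 fixes L :: nat and ge :: "nat => 'r"
 assumes ge: "c < L ==> ge c : El R"
  and ge_span: "r : El R ==> \<exists>a :: nat => nat. r = (\<Oplus>c\<in>{..<L}. [a c] \<cdot> ge c)"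
begin

section \<open>Words that lift the matrix entries\<close>

definition val :: "(nat => nat) => 'r" where
 "val a = (\<Oplus>c\<in>{..<L}. [a c] \<cdot> ge c)"

lemma val_cl: "val a : El R"
 unfolding val_def using ge by (intro finsum_closed) auto

lemma val_cong: "(!!c. c < L ==> a c = b c) ==> val a = val b"
 unfolding val_def using ge by (intro finsum_cong') auto

lemma val_add: "val (%c. a c + b c) = val a \<oplus> val b"
proof -
 have "val (%c. a c + b c) = (\<Oplus>c\<in>{..<L}. [a c] \<cdot> ge c \<oplus> [b c] \<cdot> ge c)"
  unfolding val_def using ge by (intro finsum_cong') (auto simp: add.nat_pow_mult)
 thus ?thesis unfolding val_def using ge by (subst finsum_addf[symmetric]) auto
qed

type_synonym word = "(nat => nat) \<times> (nat => nat => nat => nat)"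

text \<open>Pivots together with lifts of the entries to multiplicities of the generators. The lifts
  are zero at and past the pivots, so that the comparison of keys sees free entries only.\<close>

definition words :: "nat => nat => word set" where
 "words d n = {(p, a). p : oi d n & (ALL s<d. ALL t. p s <= t --> a t s = (%_. 0))}"

definition wmat :: "word => nat => nat => 'r" where
 "wmat w t s = (if t = fst w s then \<one> else if t < fst w s then val (snd w t s) else \<zero>)"

definition wmor :: "nat => nat => word => 'r ovi_arr" where
 "wmor d n w = mor (od d) (od n) (wmat w) (fst w)"

lemma word_umat: "w : words d n ==> umat (od d) (od n) (wmat w) (fst w)"
 by (auto simp: umat_def words_def wmat_def val_cl oi_less)

lemma wmor_hom: "w : words d n ==> wmor d n w : HomN d n"
 unfolding wmor_def by (intro mor_hom[OF od_Ob od_Ob] word_umat)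

lemma mat_wmor: "w : words d n ==> s < d ==> t < n ==> mat (wmor d n w) t s = wmat w t s"
 unfolding wmor_def using mat_mor[OF od_Ob od_Ob word_umat, of w d n s t] by simp

lemma snd_wmor [simp]: "snd (wmor d n w) = fst w"
 by (simp add: wmor_def mor_def)

text \<open>Lifts can be prescribed at the positions marked by \<open>D\<close> and chosen at will
  elsewhere; \<open>move_lower\<close> rests on this freedom.\<close>

lemma word_lift:
 assumes x: "x : HomN d n"
  and D: "!!s t. D t s ==> s < d & t < snd x s & mat x t s = val (b t s)"
 shows "EX a. (snd x, a) : words d n & wmor d n (snd x, a) = x & (ALL t s. D t s --> a t s = b t s)"
proof -
 have "EX v. mat x t s = val v" if "s < d" "t < snd x s" for s t
  using ge_span[OF matN_cl[OF x that(1), of t]] that oi_less[OF snd_oi[OF x] that(1)]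
  unfolding val_def by simp
 then obtain v where v: "!!s t. s < d ==> t < snd x s ==> mat x t s = val (v s t)" by metis
 define a where "a t s = (if D t s then b t s else if s < d & t < snd x s then v s t else (%_. 0))" for t s
 have w: "(snd x, a) : words d n"
  using snd_oi[OF x] D by (fastforce simp: words_def a_def)
 have "wmor d n (snd x, a) = x"
 proof (rule HomN_ext[OF wmor_hom[OF w] x])
  fix s t assume s: "s < d" and t: "t < n"
  show "mat (wmor d n (snd x, a)) t s = mat x t s"
   using mat_wmor[OF w s t] matN_pivot[OF x s] matN_above[OF x s t] v[OF s, of t] D[of t s] s
   by (auto simp: wmat_def a_def)
 qed simp
 thus ?thesis using w by (auto simp: a_def)
qed

text \<open>Pivots come first, then the columns in order, each read from its last row to its first.
  After composition with \<open>\<Phi>\<close> row \<open>r\<close> involves only rows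
  \<open>t\<close> with \<open>r \<le> snd \<Phi> t\<close>, so the last row in which two columns
  differ is carried to its image, and the rows beyond remain equal.\<close>

definition wkey :: "nat => nat => word => nat list \<times> nat list list list" where
 "wkey d n w = (map (fst w) [0..<d],
   map (%s. map (%t. map (snd w t s) [0..<L]) (rev [0..<n])) [0..<d])"

definition klt :: "((nat list \<times> nat list list list) \<times> (nat list \<times> nat list list list)) set" where
 "klt = lex less_than <*lex*> lex (lex (lex less_than))"

lemma wf_klt: "wf klt"
 unfolding klt_def by (intro wf_lex_prod wf_lex wf_less_than)

lemma trans_klt: "trans klt"
 unfolding klt_def by (intro trans_lex_prod lex_transI trans_less_than)

lemma klt_total: "wkey d n u = wkey d n w \<or> (wkey d n u, wkey d n w) : klt \<or> (wkey d n w, wkey d n u) : klt"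
proof -
 obtain p a q b where k: "wkey d n u = (p, a)" "wkey d n w = (q, b)" by (metis prod.exhaust)
 have len: "length p = length q" "length a = length b" "length x = length y" "length l = length l'"
  if "x : set a" "y : set b" "l : set x" "l' : set y" for x y l l'
  using k that by (auto simp: wkey_def)
 have len': "length p = length q" "length a = length b" "!!x y. x : set a ==> y : set b ==> length x = length y"
  using k by (auto simp: wkey_def)
 have nt: "(x, y) : less_than \<or> (y, x) : less_than" if "x ~= y" for x y
  using that by (auto)
 consider "p ~= q" | "p = q" "a = b" | "p = q" "a ~= b" by blast
 thus ?thesis
 proof cases
  case 1
  thus ?thesis using lex_total[OF len'(1) _ nt] k by (auto simp: klt_def)
 next
  case 2
  thus ?thesis using k by simp
 next
  case 3
  have "(a, b) : lex (lex (lex less_than)) \<or> (b, a) : lex (lex (lex less_than))"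
  proof (rule lex_total[OF len'(2) 3(2)])
   fix x y assume x: "x : set a" "y : set b" "x ~= y"
   show "(x, y) : lex (lex less_than) \<or> (y, x) : lex (lex less_than)"
    by (rule lex_total[OF len'(3)[OF x(1,2)] x(3)], rule lex_total[OF len(4)[OF x(1,2)] _ nt])
  qed
  thus ?thesis using 3 k by (auto simp: klt_def)
 qed
qed

lemma wkey_eq:
 assumes u: "u : words d n" and w: "w : words d n" and eq: "wkey d n u = wkey d n w"
 shows "wmor d n u = wmor d n w"
proof (rule HomN_ext[OF wmor_hom[OF u] wmor_hom[OF w]])
 have p: "fst u s = fst w s" if "s < d" for s using eq that by (simp add: wkey_def)
 show "snd (wmor d n u) = snd (wmor d n w)"
   using p u w by (intro PiE_ext[of _ "{..<d}"]) (auto simp: words_def oi_iff)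
 fix s t assume s: "s < d" and t: "t < n"
 have "snd u t s c = snd w t s c" if "c < L" for c
  using eq s t that by (simp add: wkey_def)
 hence "val (snd u t s) = val (snd w t s)" by (rule val_cong)
 thus "mat (wmor d n u) t s = mat (wmor d n w) t s"
  using s t p by (simp add: mat_wmor[OF u] mat_wmor[OF w] wmat_def)
qed

lemma klt_same_pivots: "((wkey d n (p, a)), (wkey d n (p, b))) : klt <->
  (EX s<d. EX t<n. EX c<L. a t s c < b t s c & (ALL c'<c. a t s c' = b t s c') &
   (ALL t'. t < t' --> t' < n --> (ALL c'<L. a t' s c' = b t' s c')) &
   (ALL s'<s. ALL t'<n. ALL c'<L. a t' s' c' = b t' s' c'))"
by (auto simp: wf_lex wf_less_than klt_def wkey_def lex_upt lex_rev_upt Ball_def)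

lemma klt_diff_pivots: "fst u i ~= fst w i ==> i < d ==> (wkey d n u, wkey d n w) : klt <->
  (EX k<d. fst u k < fst w k & (ALL i<k. fst u i = fst w i))"
 by (auto simp: klt_def wkey_def lex_upt)

section \<open>The embedding order on words\<close>

definition wle :: "nat => nat => nat => word => word => bool" where
 "wle d n m w w' <-> (\<exists>\<psi>\<in>oi n m. (ALL i<d. fst w' i = \<psi> (fst w i)) &
   (ALL t<n. ALL s<d. ALL c<L. snd w t s c <= snd w' (\<psi> t) s c))"

text \<open>
 The \<^term>\<open>t\<close>-th letter records which columns have their pivot in row \<^term>\<open>t\<close>, and the
 lifted entries of that row.
\<close>

definition letter :: "nat => word => nat => nat list" where
 "letter d w t = map (%i. if t = fst w i then 1 else 0) [0..<d] @
   map (%(s, c). snd w t s c) (List.product [0..<d] [0..<L])"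

lemma letter_le: "list_all2 (<=) (letter d w t) (letter d w' t') <->
  (ALL i<d. t = fst w i --> t' = fst w' i) & (ALL s<d. ALL c<L. snd w t s c <= snd w' t' s c)"
 unfolding letter_def by (simp add: list_all2_append list.rel_map list_all2_same) auto

lemma wle_letters:
 assumes w: "w : words d n" and w': "w' : words d m"
  and emb: "list_emb (list_all2 (<=)) (map (letter d w) [0..<n]) (map (letter d w') [0..<m])"
 shows "wle d n m w w'"
proof -
 obtain \<psi> where \<psi>: "!!t. t < n ==> \<psi> t < m & list_all2 (<=) (letter d w t) (letter d w' (\<psi> t))"
  and mono: "!!i j. i < j ==> j < n ==> \<psi> i < \<psi> j"
  using list_emb_embedding[OF emb] by (metis (no_types, lifting) add_0 length_map length_upt minus_nat.diff_0 nth_map_upt)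
 have 1: "restrict \<psi> {..<n} : oi n m" using \<psi> mono by (auto simp: oi_iff)
 have 2: "fst w i < n" if "i < d" for i using w oi_less[OF _ that] by (auto simp: words_def)
 have 3: "fst w' i = \<psi> (fst w i)" if "i < d" for i using \<psi>[OF 2[OF that], unfolded letter_le] that by simp
 have 4: "snd w t s c <= snd w' (\<psi> t) s c" if "t < n" "s < d" "c < L" for t s c
  using \<psi>[OF that(1), unfolded letter_le] that by blast
 show ?thesis unfolding wle_def
  by (intro bexI[of _ "restrict \<psi> {..<n}"] conjI allI impI) (simp_all add: 1 2 3 4)
qed

lemma words_wqo:
 fixes J :: nat
 shows "af {(n, j, w). j < J & w : words (dd j) n}
  (%(n, j, w) (m, j', w'). j = j' & wle (dd j) n m w w')"
 unfolding af_def
proof (intro allI impI)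
 fix f :: "nat => nat \<times> nat \<times> word"
 assume f: "ALL i. f i : {(n, j, w). j < J & w : words (dd j) n}"
 define ns js ws where "ns i = fst (f i)" and "js i = fst (snd (f i))" and "ws i = snd (snd (f i))" for i
 have f_eq: "f i = (ns i, js i, ws i)" for i by (simp add: ns_def js_def ws_def)
 have js: "js i : {..<J}" and ws: "ws i : words (dd (js i)) (ns i)" for i
  using f by (auto simp: f_eq)
 \<comment> \<open>There are finitely many tags \<open>j\<close>. Once the tag is constant, one
   alphabet of vectors of length \<open>d + d * L\<close> serves all words.\<close>
 obtain g where g: "strict_mono (g :: nat => nat)" "!!i j. i < j ==> js (g i) = js (g j)"
  using af_subseq[where f = js, OF af_finite_eq[of "{..<J}"] js] by auto
 define d where "d = dd (js (g 0))"
 have jg: "js (g i) = js (g 0)" for i using g(2)[of 0 i] by (cases "i = 0") auto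
 let ?code = "%i. map (letter d (ws (g i))) [0..<ns (g i)]"
 have "EX i j. i < j & list_emb (list_all2 (<=)) (?code i) (?code j)"
  by (rule afD[OF af_lists[OF af_vectors[of "d + d * L"]]])
    (auto simp: letter_def)
 then obtain i j where ij: "i < j" "list_emb (list_all2 (<=)) (?code i) (?code j)" by blast
 have "wle d (ns (g i)) (ns (g j)) (ws (g i)) (ws (g j))"
  by (rule wle_letters[OF _ _ ij(2)]) (use ws[of "g i"] ws[of "g j"] jg[of i] jg[of j] d_def in auto)
 thus "EX i j. i < j & (%(n, j, w) (m, j', w'). j = j' & wle (dd j) n m w w') (f i) (f j)"
  using strict_monoD[OF g(1) ij(1)] jg[of i] jg[of j]
  by (intro exI[of _ "g i"] exI[of _ "g j"]) (simp add: f_eq d_def)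
qed

text \<open>If the pivots differ, the strictly increasing \<open>\<psi>\<close> preserves the
  comparison. If they agree, let the keys first differ in column \<open>s0\<close> and row
  \<open>t0\<close>. The composites with \<open>\<Phi>\<close> agree in the earlier columns and, in
  column \<open>s0\<close>, past row \<open>\<psi> t0\<close>, since column \<open>t\<close> of
  \<open>\<Phi>\<close> vanishes past row \<open>\<psi> t\<close>. In row \<open>\<psi> t0\<close>
  they differ only by the two entries at \<open>t0\<close>, because \<open>\<Phi>\<close> has a 1
  there. A smaller lift than that of \<open>w'\<close> is then found by correcting the lift of
  \<open>w'\<close>.\<close>

lemma move_lower:
 assumes w: "w : words d n" and w': "w' : words d m" and u: "u : words d n"
  and \<Phi>: "\<Phi> : HomN n m" and \<Phi>w: "cN d n m \<Phi> (wmor d n w) = wmor d m w'"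
  and le: "!!t s c. t < n ==> s < d ==> c < L ==> snd w t s c <= snd w' (snd \<Phi> t) s c"
  and lt: "(wkey d n u, wkey d n w) : klt"
 shows "EX u':words d m. (wkey d m u', wkey d m w') : klt & wmor d m u' = cN d n m \<Phi> (wmor d n u)"
proof -
 define \<psi> where "\<psi> = snd \<Phi>"
 have \<psi>: "\<psi> : oi n m" unfolding \<psi>_def by (rule snd_oi[OF \<Phi>])
 note uh = wmor_hom[OF u] and wh = wmor_hom[OF w]
 define x where "x = cN d n m \<Phi> (wmor d n u)"
 have x: "x : HomN d m" unfolding x_def by (rule cN_hom[OF uh \<Phi>])
 have oi: "fst u : oi d n" "fst w : oi d n" "fst w' : oi d m" using u w w' by (auto simp: words_def)
 have sx: "snd x i = \<psi> (fst u i)" if "i < d" for i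
  using that by (simp add: x_def snd_cN[OF uh] compose_def \<psi>_def)
 have pw': "fst w' i = \<psi> (fst w i)" if "i < d" for i
  using arg_cong[OF \<Phi>w, of snd] that by (simp add: snd_cN[OF wh] compose_def \<psi>_def fun_eq_iff) metis
 show ?thesis
 proof (cases "EX i<d. fst u i ~= fst w i")
  case True
  then obtain i where i: "i < d" "fst u i ~= fst w i" by blast
  obtain k where k: "k < d" "fst u k < fst w k" "ALL i<k. fst u i = fst w i"
   using lt klt_diff_pivots[OF i(2,1)] by blast
  \<comment> \<open>The keys are decided by the pivots alone, so any lift of the entries will
    do.\<close>
  obtain a where a: "(snd x, a) : words d m" "wmor d m (snd x, a) = x"
   using word_lift[OF x, of "%_ _. False"] by blast
  have "\<psi> (fst u k) < \<psi> (fst w k)" using oi_mono[OF \<psi> k(2) oi_less[OF oi(2) k(1)]] .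
  hence kk: "snd x k < fst w' k" "ALL i<k. snd x i = fst w' i"
   using sx pw' k by auto
  hence "(wkey d m (snd x, a), wkey d m w') : klt"
   using klt_diff_pivots[of "(snd x, a)" k w' d m] k(1) by auto
  thus ?thesis using a unfolding x_def[symmetric] by blast
 next
  case False
  hence p: "fst u i = fst w i" if "i < d" for i using that by blast
  hence fu: "fst u = fst w" using oi(1,2) by (intro PiE_ext[of _ "{..<d}"]) (auto simp: oi_iff)
  have fw': "fst w' = snd x"
   using oi(3) snd_oi[OF x] sx pw' p by (intro PiE_ext[of _ "{..<d}"]) (auto simp: oi_iff)
  \<comment> \<open>The first difference of the keys: the first column, in it the last row, and
    there the first generator.\<close>
  obtain s0 t0 c0 where 0: "s0 < d" "t0 < n" "c0 < L" "snd u t0 s0 c0 < snd w t0 s0 c0"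
    "!!c. c < c0 ==> snd u t0 s0 c = snd w t0 s0 c"
   and row: "!!t c. t0 < t ==> t < n ==> c < L ==> snd u t s0 c = snd w t s0 c"
   and col: "!!s t c. s < s0 ==> t < n ==> c < L ==> snd u t s c = snd w t s c"
   using lt klt_same_pivots[of d n "fst w" "snd u" "snd w"] fu by (metis prod.collapse)
  have t0p: "t0 < fst w s0"
   using w 0(1,4) by (cases "fst w s0 <= t0") (auto simp: words_def)
  have wcl: "wmat v t s : El R" for v s t by (auto simp: wmat_def val_cl)
  have \<Phi>c: "mat \<Phi> r t : El R" if "t < n" "r < m" for r t using matN_cl[OF \<Phi> that] .
  have matx: "mat x r s = (\<Oplus>t\<in>{..<n}. wmat u t s \<otimes> mat \<Phi> r t)" if "s < d" "r < m" for r s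
   unfolding x_def matN_comp[OF uh \<Phi> that] using wcl \<Phi>c that mat_wmor[OF u that(1)]
   by (intro finsum_cong') auto
  have matw: "wmat w' r s = (\<Oplus>t\<in>{..<n}. wmat w t s \<otimes> mat \<Phi> r t)" if "s < d" "r < m" for r s
   unfolding mat_wmor[OF w' that, symmetric] \<Phi>w[symmetric] matN_comp[OF wh \<Phi> that]
   using wcl \<Phi>c that mat_wmor[OF w that(1)] by (intro finsum_cong') auto
  have same: "wmat u t s = wmat w t s" if "!!c. c < L ==> snd u t s c = snd w t s c" for s t
   using val_cong[OF that] by (simp add: wmat_def fu)
  have \<Phi>0: "mat \<Phi> r t = \<zero>" if "t < n" "r < m" "\<psi> t < r" for r t
   using matN_above[OF \<Phi> that(1,2)] that(3) by (simp add: \<psi>_def)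
  have colx: "mat x r s = wmat w' r s" if "s < s0" "r < m" for s r
   using that 0(1) col same matx[of s r] matw[of s r] by (auto intro!: finsum_cong' m_closed wcl \<Phi>c)
  have rowx: "mat x r s0 = wmat w' r s0" if r: "\<psi> t0 < r" "r < m" for r
  proof -
   have "wmat u t s0 \<otimes> mat \<Phi> r t = wmat w t s0 \<otimes> mat \<Phi> r t" if t: "t < n" for t
   proof (cases "t <= t0")
    case True
    hence "\<psi> t < r" using oi_mono[OF \<psi>, of t t0] 0(2) r(1) by (cases "t = t0") auto
    thus ?thesis using \<Phi>0[OF t r(2)] wcl by simp
   next
    case False
    thus ?thesis using same[OF row[OF _ t]] by simp
   qed
   thus ?thesis unfolding matx[OF 0(1) r(2)] matw[OF 0(1) r(2)]
    using wcl \<Phi>c r(2) by (intro finsum_cong') auto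
  qed
  define r0 where "r0 = \<psi> t0"
  have r0: "r0 < m" "r0 < fst w' s0"
   using oi_less[OF \<psi> 0(2)] oi_mono[OF \<psi> t0p oi_less[OF oi(2) 0(1)]] pw'[OF 0(1)] by (auto simp: r0_def)
  have \<Phi>1: "mat \<Phi> r0 t0 = \<one>" using matN_pivot[OF \<Phi> 0(2)] by (simp add: r0_def \<psi>_def)
  have split: "(\<Oplus>t\<in>{..<n}. wmat v t s0 \<otimes> mat \<Phi> r0 t) =
    val (snd v t0 s0) \<oplus> (\<Oplus>t\<in>{..<n} - {t0}. wmat v t s0 \<otimes> mat \<Phi> r0 t)" if "fst v = fst w" for v
  proof -
   have "{..<n} = insert t0 ({..<n} - {t0})" using 0(2) by auto
   hence "(\<Oplus>t\<in>{..<n}. wmat v t s0 \<otimes> mat \<Phi> r0 t) =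
     (\<Oplus>t\<in>insert t0 ({..<n} - {t0}). wmat v t s0 \<otimes> mat \<Phi> r0 t)" by simp
   also have "... = wmat v t0 s0 \<otimes> mat \<Phi> r0 t0 \<oplus> (\<Oplus>t\<in>{..<n} - {t0}. wmat v t s0 \<otimes> mat \<Phi> r0 t)"
    by (rule finsum_insert) (use wcl \<Phi>c r0(1) 0(2) in auto)
   finally show ?thesis using t0p that by (simp add: \<Phi>1 wmat_def val_cl)
  qed
  define e where "e = (\<Oplus>t\<in>{..<n} - {t0}. wmat w t s0 \<otimes> mat \<Phi> r0 t)"
  have e: "e : El R" unfolding e_def using wcl \<Phi>c r0(1) by (intro finsum_closed) auto
  have eu: "(\<Oplus>t\<in>{..<n} - {t0}. wmat u t s0 \<otimes> mat \<Phi> r0 t) = e"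
   unfolding e_def
  proof (rule finsum_cong')
   fix t assume "t : {..<n} - {t0}"
   hence t: "t < n" "t ~= t0" by auto
   show "wmat u t s0 \<otimes> mat \<Phi> r0 t = wmat w t s0 \<otimes> mat \<Phi> r0 t"
   proof (cases "t < t0")
    case True
    thus ?thesis using \<Phi>0[OF t(1) r0(1)] oi_mono[OF \<psi> True 0(2)] wcl by (simp add: r0_def)
   next
    case False
    thus ?thesis using same[OF row[OF _ t(1)]] t by simp
   qed
  qed (use wcl \<Phi>c r0(1) in auto)
  \<comment> \<open>A lift of the entry of the composite in row \<open>r0\<close>: the contribution
    of \<open>w\<close> at \<open>t0\<close> is replaced by that of \<open>u\<close>. The
    subtraction stays within natural numbers because the lift of \<open>w\<close> is bounded by that
    of \<open>w'\<close>, and at \<open>c0\<close> the result is smaller than the lift of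
    \<open>w'\<close>.\<close>
  let ?b = "%c. snd w' r0 s0 c - snd w t0 s0 c + snd u t0 s0 c"
  have "val (%c. ?b c + snd w t0 s0 c) = val (%c. snd w' r0 s0 c + snd u t0 s0 c)"
  proof (rule val_cong)
   fix c assume "c < L"
   hence "snd w t0 s0 c <= snd w' r0 s0 c" using le[OF 0(2,1)] by (simp add: r0_def \<psi>_def)
   thus "?b c + snd w t0 s0 c = snd w' r0 s0 c + snd u t0 s0 c" by linarith
  qed
  hence "val ?b \<oplus> val (snd w t0 s0) = (val (snd w t0 s0) \<oplus> e) \<oplus> val (snd u t0 s0)"
   unfolding val_add using matw[OF 0(1) r0(1)] split[of w] r0(2) by (simp add: wmat_def e_def)
  hence "val ?b \<oplus> val (snd w t0 s0) = (val (snd u t0 s0) \<oplus> e) \<oplus> val (snd w t0 s0)"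
   using e val_cl by (simp add: a_ac)
  hence b0: "mat x r0 s0 = val ?b"
   using matx[OF 0(1) r0(1)] split[OF fu] eu e val_cl by simp
  \<comment> \<open>These positions decide the comparison with \<open>w'\<close>; the remaining
    lifts are left to \<open>word_lift\<close>.\<close>
  define D where "D r s <-> r < snd x s & (s < s0 \<or> s = s0 & r0 <= r)" for r s
  define b where "b r s = (if s = s0 & r = r0 then ?b else snd w' r s)" for r s
  have "EX a. (snd x, a) : words d m & wmor d m (snd x, a) = x & (ALL r s. D r s --> a r s = b r s)"
  proof (rule word_lift[OF x])
   fix s r assume D: "D r s"
   hence s: "s < d" using 0(1) by (auto simp: D_def)
   hence r: "r < m" using oi_less[OF snd_oi[OF x] s] D by (auto simp: D_def)
   have "wmat w' r s = val (snd w' r s)" using D by (simp add: wmat_def fw' D_def)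
   hence "mat x r s = val (b r s)"
    using D colx[OF _ r, of s] rowx[OF _ r] b0 by (auto simp: D_def b_def r0_def)
   thus "s < d & r < snd x s & mat x r s = val (b r s)" using s D by (simp add: D_def)
  qed
  then obtain a where a: "(snd x, a) : words d m" "wmor d m (snd x, a) = x"
   and aD: "!!r s. D r s ==> a r s = b r s" by blast
  have off: "a r s = snd w' r s" if "s < d" "snd x s <= r" for r s
   using a(1) w' that fw' by (cases w') (simp add: words_def)
  have a_eq: "a r s = snd w' r s" if "s < s0 \<or> s = s0 & r0 < r" for r s
   using aD[of r s] off[of s r] that 0(1) by (cases "r < snd x s") (auto simp: D_def b_def)
  have a0: "a r0 s0 = ?b" using aD[of r0 s0] r0(2) by (simp add: D_def b_def fw')
  have "(wkey d m (snd x, a), wkey d m (snd x, snd w')) : klt"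
   unfolding klt_same_pivots
  proof (rule exI[of _ s0], intro conjI 0(1), rule exI[of _ r0], intro conjI r0(1), rule exI[of _ c0],
    intro conjI 0(3))
   have le': "snd w t0 s0 c <= snd w' r0 s0 c" if "c < L" for c
    using le[OF 0(2,1) that] by (simp add: r0_def \<psi>_def)
   show "a r0 s0 c0 < snd w' r0 s0 c0" using 0(4) le'[OF 0(3)] unfolding a0 by linarith
   show "ALL c'<c0. a r0 s0 c' = snd w' r0 s0 c'" using 0(3,5) le' by (auto simp: a0)
  qed (use a_eq in auto)
  thus ?thesis using a fw' unfolding x_def[symmetric] by (metis prod.collapse)
 qed
qed

text \<open>A word carries the tag \<open>j\<close> of the generator to which it is applied. The tag
  is the most significant part of the key, and the order on words compares equal tags only. For
  \<open>move\<close>, \<open>extension_exists\<close> supplies the morphism and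
  \<open>move_lower\<close> its effect on smaller words. The relative form with \<open>B\<close> is
  there for the boundaries.\<close>

theorem ovi_noetherian:
 assumes M: "cat_module K NC M" and K: "cring K" "noetherian_ring K"
  and S: "subfam K NC M S" and B: "subfam K NC M B" and BS: "!!n. B n <= S n"
  and Gs: "finite Gs" "!!n m. (n, m) : Gs ==> m : El (ob_mod M n)"
  and span: "!!n. S n <= gspan K NC M Gs B n"
 shows "fin_gen K NC M S B"
proof -
 interpret M: cat_module K NC M by (rule M)
 obtain gl where gl: "set gl = Gs" using finite_list[OF Gs(1)] by blast
 define J where "J = length gl"
 define dd where "dd j = fst (gl ! j)" for j
 define x where "x j = snd (gl ! j)" for j
 have x: "x j : El (ob_mod M (dd j))" if "j < J" for j
  using that Gs(2)[of "dd j" "x j"] gl by (auto simp: J_def dd_def x_def)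
 interpret groebner K NC M "%n. {(j, w). j < J & w : words (dd j) n}"
  "%n (j, w). arr_map M (dd j) n (wmor (dd j) n w) (x j)" "%n (j, w). (j, wkey (dd j) n w)"
  "less_than <*lex*> klt" "%(n, j, w) (m, j', w'). j = j' & wle (dd j) n m w w'" S B
 proof (rule groebner.intro[OF M], rule groebner_axioms.intro)
  show "cring K" "noetherian_ring K" "subfam K NC M S" "subfam K NC M B" by fact+
  show "B n <= S n" for n by (rule BS)
  show "wf (less_than <*lex*> klt)" "trans (less_than <*lex*> klt)"
   by (intro wf_lex_prod wf_less_than wf_klt trans_lex_prod trans_less_than trans_klt)+
  show "af {(n, w). n : Ob NC & w : {(j, w). j < J & w : words (dd j) n}}
    (%(n, j, w) (m, j', w'). j = j' & wle (dd j) n m w w')"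
   using words_wqo[of J dd] by (simp add: std_Ob)
  fix n
  show "S n <= cspan K (ob_mod M n) ((%(j, w). arr_map M (dd j) n (wmor (dd j) n w) (x j)) `
    {(j, w). j < J & w : words (dd j) n} \<union> B n)"
  proof (rule order_trans[OF span])
   show "gspan K NC M Gs B n <= cspan K (ob_mod M n) ((%(j, w). arr_map M (dd j) n (wmor (dd j) n w) (x j)) `
     {(j, w). j < J & w : words (dd j) n} \<union> B n)"
    unfolding gspan_def
   proof (rule cspan_mono, safe)
    fix d v \<phi> assume v: "(d, v) : Gs" and \<phi>: "\<phi> : Arr NC d n"
     and nB: "arr_map M d n \<phi> v ~: B n"
    obtain j where j: "j < J" "gl ! j = (d, v)" using v gl by (metis J_def in_set_conv_nth)
    obtain w where "w : words d n" "wmor d n w = \<phi>"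
     using word_lift[of \<phi> d n "%_ _. False"] \<phi>[unfolded NC_simps] by blast
    thus "arr_map M d n \<phi> v : (%(j, w). arr_map M (dd j) n (wmor (dd j) n w) (x j)) `
     {(j, w). j < J & w : words (dd j) n}"
     using j by (intro image_eqI[of _ _ "(j, w)"]) (auto simp: dd_def x_def)
   qed
  qed
 next
  fix n and u w :: "nat \<times> word"
  obtain j u' j' w' where "u = (j, u')" "w = (j', w')" by (cases u; cases w)
  thus "(case u of (j, w) => (j, wkey (dd j) n w)) = (case w of (j, w) => (j, wkey (dd j) n w)) \<or>
    (case u of (j, w) => (j, wkey (dd j) n w), case w of (j, w) => (j, wkey (dd j) n w)) : less_than <*lex*> klt \<or>
    (case w of (j, w) => (j, wkey (dd j) n w), case u of (j, w) => (j, wkey (dd j) n w)) : less_than <*lex*> klt"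
   using klt_total[of "dd j" n u' w'] by (cases "j = j'") (auto)
 next
  fix n u w
  assume "u : {(j, w). j < J & w : words (dd j) n}" "w : {(j, w). j < J & w : words (dd j) n}"
   "(case u of (j, w) => (j, wkey (dd j) n w)) = (case w of (j, w) => (j, wkey (dd j) n w))"
  thus "(case u of (j, w) => arr_map M (dd j) n (wmor (dd j) n w) (x j)) =
    (case w of (j, w) => arr_map M (dd j) n (wmor (dd j) n w) (x j))"
   by (auto dest: wkey_eq)
 next
  fix n w assume "w : {(j, w). j < J & w : words (dd j) n}"
  thus "(case w of (j, w) => arr_map M (dd j) n (wmor (dd j) n w) (x j)) : El (ob_mod M n)"
   using lin_cl[OF NC_lin[OF M wmor_hom] x] by auto
 next
  fix n m v v'
  assume v: "v : {(j, w). j < J & w : words (dd j) n}" and v': "v' : {(j, w). j < J & w : words (dd j) m}"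
   and le: "(case (n, v) of (n, j, w) => %(m, j', w'). j = j' & wle (dd j) n m w w') (m, v')"
  obtain j w w' where vv: "v = (j, w)" "v' = (j, w')" using le by (cases v; cases v') auto
  have j: "j < J" and w: "w : words (dd j) n" and w': "w' : words (dd j) m" and le: "wle (dd j) n m w w'"
   using v v' le vv by auto
  note wh = wmor_hom[OF w] and wh' = wmor_hom[OF w']
  obtain \<psi> where \<psi>: "\<psi> : oi n m" "!!i. i < dd j ==> snd (wmor (dd j) m w') i = \<psi> (snd (wmor (dd j) n w) i)"
   "!!t s c. t < n ==> s < dd j ==> c < L ==> snd w t s c <= snd w' (\<psi> t) s c"
   using le by (auto simp: wle_def)
  obtain \<Phi> where \<Phi>: "\<Phi> : HomN n m" "snd \<Phi> = \<psi>" "cN (dd j) n m \<Phi> (wmor (dd j) n w) = wmor (dd j) m w'"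
   using extension_exists[OF wh wh' \<psi>(1,2)] by blast
  note lower = move_lower[OF w w' _ \<Phi>(1,3) \<psi>(3)[folded \<Phi>(2)]]
  note act = NC_comp[OF M _ \<Phi>(1), symmetric]
  show "\<exists>\<phi>\<in>Arr NC n m. arr_map M n m \<phi> (case v of (j, w) => arr_map M (dd j) n (wmor (dd j) n w) (x j)) =
    (case v' of (j, w) => arr_map M (dd j) m (wmor (dd j) m w) (x j)) &
   (ALL u:{(j, w). j < J & w : words (dd j) n}.
    (case u of (j, w) => (j, wkey (dd j) n w), case v of (j, w) => (j, wkey (dd j) n w)) : less_than <*lex*> klt -->
    (EX u':{(j, w). j < J & w : words (dd j) m}.
     (case u' of (j, w) => (j, wkey (dd j) m w), case v' of (j, w) => (j, wkey (dd j) m w)) : less_than <*lex*> klt &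
     arr_map M n m \<phi> (case u of (j, w) => arr_map M (dd j) n (wmor (dd j) n w) (x j)) =
     (case u' of (j, w) => arr_map M (dd j) m (wmor (dd j) m w) (x j))))"
  proof (intro bexI[of _ \<Phi>] conjI ballI impI)
   show "arr_map M n m \<Phi> (case v of (j, w) => arr_map M (dd j) n (wmor (dd j) n w) (x j)) =
    (case v' of (j, w) => arr_map M (dd j) m (wmor (dd j) m w) (x j))"
    by (simp add: vv act[OF wh x[OF j]] \<Phi>(3))
   fix u assume "u : {(j, w). j < J & w : words (dd j) n}"
    "(case u of (j, w) => (j, wkey (dd j) n w), case v of (j, w) => (j, wkey (dd j) n w)) : less_than <*lex*> klt"
   then obtain k u1 where u: "u = (k, u1)" "k < J" "u1 : words (dd k) n"
    "k < j \<or> k = j & (wkey (dd j) n u1, wkey (dd j) n w) : klt" by (auto simp: vv)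
   have "EX u2:words (dd k) m. (k < j \<or> k = j & (wkey (dd j) m u2, wkey (dd j) m w') : klt) &
     wmor (dd k) m u2 = cN (dd k) n m \<Phi> (wmor (dd k) n u1)"
   proof (cases "k = j")
    case True
    thus ?thesis using lower[of u1] u by simp
   next
    case False
    \<comment> \<open>A smaller tag remains smaller whatever lift of the composite is
      chosen.\<close>
    thus ?thesis using u(4) word_lift[OF cN_hom[OF wmor_hom[OF u(3)] \<Phi>(1)], of "%_ _. False"] by blast
   qed
   then obtain u2 where u2: "u2 : words (dd k) m" "k < j \<or> k = j & (wkey (dd j) m u2, wkey (dd j) m w') : klt"
     "wmor (dd k) m u2 = cN (dd k) n m \<Phi> (wmor (dd k) n u1)" by blast
   thus "EX u':{(j, w). j < J & w : words (dd j) m}.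
     (case u' of (j, w) => (j, wkey (dd j) m w), case v' of (j, w) => (j, wkey (dd j) m w)) : less_than <*lex*> klt &
     arr_map M n m \<Phi> (case u of (j, w) => arr_map M (dd j) n (wmor (dd j) n w) (x j)) =
     (case u' of (j, w) => arr_map M (dd j) m (wmor (dd j) m w) (x j))"
    using u by (intro bexI[of _ "(k, u2)"]) (auto simp: vv act[OF wmor_hom[OF u(3)] x[OF u(2)]])
  qed (use \<Phi>(1) in \<open>simp add: Arr_OVI\<close>)
 qed
 show ?thesis by (rule groebner_fin_gen)
qed

text \<open>OI-modules are OVI(R)-modules through the functor taking a morphism to its pivots.\<close>

theorem oi_noetherian:
 fixes M :: "(nat, nat => nat, 'k, 'm) cat_mod"
 assumes M: "cat_module K NI M" and K: "cring K" "noetherian_ring K"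
  and S: "subfam K NI M S" and B: "subfam K NI M B" and BS: "!!n. B n <= S n"
  and Gs: "finite Gs" "!!n m. (n, m) : Gs ==> m : El (ob_mod M n)"
  and span: "!!n. S n <= gspan K NI M Gs B n"
 shows "fin_gen K NI M S B"
proof -
 interpret M: cat_module K NI M by (rule M)
 define N :: "(nat, 'r ovi_arr, 'k, 'm) cat_mod" where "N = (|ob_mod = ob_mod M, arr_map = %n m a. arr_map M n m (snd a)|)"
 have oN: "ob_mod N = ob_mod M" and aN: "arr_map N n m a = arr_map M n m (snd a)" for n m a
  by (simp_all add: N_def)
 have N: "cat_module K NC N"
 proof (rule cat_module.intro, rule pull_category[OF category_axioms], rule cat_module_axioms.intro;
   (unfold NC_simps oN aN)?)
  show "module K (ob_mod M n)" for n by (rule M.ob_module[OF NI_simps(1)])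
  show "arr_map M n m (snd a) : Lin K (ob_mod M n) (ob_mod M m)" if "a : HomN n m" for n m a
   by (rule M.arr_linear[OF NI_simps(1) NI_simps(1)]) (use snd_oi[OF that] in \<open>simp add: OI_Arr\<close>)
  show "arr_map M n n (snd (Ident NC n)) m = m" if "m : El (ob_mod M n)" for n m
   using M.arr_Ident[OF NI_simps(1) that] by (simp add: pull_cat_simps idN_def[symmetric] snd_endo[OF idN(1)] OI_Ident)
  show "arr_map M n l (snd (Comp NC n m l b a)) v = arr_map M m l (snd b) (arr_map M n m (snd a) v)"
   if "a : HomN n m" "b : HomN m l" "v : El (ob_mod M n)" for n m l a b v
   using M.arr_Comp[of n m l "snd a" "snd b" v, OF NI_simps(1) NI_simps(1) NI_simps(1) _ _ that(3)]
    snd_oi[OF that(1)] snd_oi[OF that(2)] snd_cN[OF that(1), of l b]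
   by (simp add: pull_cat_simps OI_Arr OI_Comp)
 qed
 have sub: "subfam K NC N T" if T: "subfam K NI M T" for T
  unfolding subfam_def
  using famD(1)[OF T NI_simps(1)] famD(2)[OF T NI_simps(1) NI_simps(1), unfolded NI_simps] snd_oi
  unfolding NC_simps oN aN by blast
 have gs: "gspan K NC N H B n = gspan K NI M H B n" for H n
 proof -
  have "{arr_map N d n a m |d m a. (d, m) : H & a : Arr NC d n} =
    {arr_map M d n a m |d m a. (d, m) : H & a : Arr NI d n}"
   unfolding NC_simps NI_simps aN using snd_oi sa_hom snd_std_arr by (smt (verit) Collect_cong)
  thus ?thesis unfolding gspan_def oN by simp
 qed
 have "fin_gen K NC N S B"
  by (rule ovi_noetherian[OF N K sub[OF S] sub[OF B] BS Gs(1)]) (use Gs(2) span in \<open>auto simp: oN gs\<close>)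
 thus ?thesis unfolding fin_gen_def gs by (simp add: std_Ob Ball_def)
qed

end

section \<open>Chains of UT groups\<close>

locale nc_mod = ovi_cat R for R :: "('r, 'x) ring_scheme" (structure) +
 fixes K :: "('k, 'y) ring_scheme" and M :: "(nat, 'r ovi_arr, 'k, 'm) cat_mod"
 assumes K: "cring K" and M: "cat_module K NC M"
begin

abbreviation "C i n == FS (ob_mod M n) (tuples (UU n) i)"
abbreviation "bd i n == bar_boundary (UU n) (ob_mod M n) (arr_map M n n) i"
abbreviation "tr i n m f == finsupp_map (ob_mod M n) (ob_mod M m) (tuples (UU m) i) (map (pN n m f))
 (arr_map M n m (sa n m f))"
abbreviation "zeroc n == (%_. \<zero>\<^sub>(ob_mod M n))"

sublocale hs: hsys K NI UU pN "ob_mod M" "%n. arr_map M n n" "%n m f. arr_map M n m (sa n m f)"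
 using hsys_module[OF K M] .

abbreviation "chs == hs.chains"
abbreviation "Z == hs.cyc"
abbreviation "B == hs.bnd"

lemma chs_simps [simp]: "ob_mod (chs i) n = C i n" "arr_map (chs i) n m f = tr i n m f"
 by (simp_all add: hs.chains_def)

lemma chs: "cat_module K NI (chs i)"
 by (rule hs.chains_cat_module)

lemma ob: "LMod K (ob_mod M n)"
 by (rule NC_ob[OF M])

lemma rep: "grp_rep K (UU n) (ob_mod M n) (arr_map M n n)"
 by (rule hs.rep[OF NI_simps(1)])

lemma map_rep: "f : oi n m ==> rep_map K (UU n) (ob_mod M n) (arr_map M n n) (UU m) (ob_mod M m) (arr_map M m m)
  (pN n m f) (arr_map M n m (sa n m f))"
 using hs.map[OF NI_simps(1) NI_simps(1)] by (simp only: NI_simps)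

lemma C_left: "LMod K (C i n)"
 by (rule fs_lm[OF ob])

lemma bd_lin: "bd (Suc i) n : Lin K (C (Suc i) n) (C i n)"
 by (rule grp_rep.bar_bd_lin[OF rep])

lemma bd_bd: "c : El (C (Suc (Suc i)) n) ==> bd (Suc i) n (bd (Suc (Suc i)) n c) = zeroc n"
 by (rule grp_rep.bar_bd_bar_bd[OF rep])

lemma tr_lin: "f : oi n m ==> tr i n m f : Lin K (C i n) (C i m)"
 by (rule rep_map.ch_lin[OF map_rep])

lemma bd_tr: "f : oi n m ==> c : El (C (Suc i) n) ==>
  bd (Suc i) m (tr (Suc i) n m f c) = tr i n m f (bd (Suc i) n c)"
 by (rule rep_map.ch_boundary[OF map_rep])

lemma Z_Suc: "z : Z (Suc i) n <-> z : El (C (Suc i) n) & bd (Suc i) n z = zeroc n"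
 unfolding hs.cyc_def grp_rep.bar_cycles_Suc[OF rep] by simp

lemma Z_0: "Z 0 n = El (C 0 n)"
 unfolding hs.cyc_def by (rule grp_rep.bar_cycles_0[OF rep])

lemma B_def: "B i n = bd (Suc i) n ` El (C (Suc i) n)"
 unfolding hs.bnd_def bar_boundaries_def bar_chains_def ..

lemma Z_sub: "subfam K NI (chs i) (Z i)" and B_sub: "subfam K NI (chs i) (B i)"
 by (rule hs.cyc_subfam, rule hs.bnd_subfam)

lemma Z_submod: "submod K (C i n) (Z i n)" and B_submod: "submod K (C i n) (B i n)"
 using famD(1)[OF Z_sub NI_simps(1)] famD(1)[OF B_sub NI_simps(1)] by (simp_all only: chs_simps)

lemma tr_Z: "f : oi n m ==> z : Z i n ==> tr i n m f z : Z i m"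
 and tr_B: "f : oi n m ==> z : B i n ==> tr i n m f z : B i m"
 using famD(2)[OF Z_sub NI_simps(1) NI_simps(1)] famD(2)[OF B_sub NI_simps(1) NI_simps(1)]
 by (simp_all only: chs_simps NI_simps)

lemma B_Z: "B i n <= Z i n"
 by (rule hs.bnd_cyc[OF NI_simps(1)])

lemma Z_C: "z : Z i n ==> z : El (C i n)"
 using subD(1)[OF Z_submod] by blast

definition hspan :: "(nat \<times> ('r ovi_arr list => 'm)) set => nat => nat => ('r ovi_arr list => 'm) set" where
 "hspan Gs i n = gspan K NI (chs i) Gs (B i) n"

text \<open>Finite generation of the \<open>i\<close>-th homology in terms of cycles;
  \<open>homol_fg\<close> passes to the quotient.\<close>

definition hfg :: "nat => bool" where
 "hfg i <-> fin_gen K NI (chs i) (Z i) (B i)"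

lemma hfg_iff: "hfg i <-> (EX Gs. finite Gs & (ALL n z. (n, z) : Gs --> z : Z i n) & (ALL n. Z i n <= hspan Gs i n))"
 unfolding hfg_def fin_gen_def hspan_def by (simp add: Ball_def)

lemma hspan_B: "B i n <= hspan Gs i n"
 unfolding hspan_def by (auto intro: gspan_B)

lemma hspan_arr: "(m, z) : Gs ==> f : oi m n ==> tr i m n f z : hspan Gs i n"
 unfolding hspan_def using gspan_arr[where C = NI and K = K and M = "chs i" and B = "B i"] by (simp only: chs_simps NI_simps)

lemma hspan_base: "(n, z) : Gs ==> z : El (C i n) ==> z : hspan Gs i n"
 unfolding hspan_def by (rule cat_module.gspan_base[OF chs]) simp_all

lemma hspan_least:
 assumes "submod K (C i n) N" "B i n <= N" "!!m z f. (m, z) : Gs ==> f : oi m n ==> tr i m n f z : N"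
 shows "hspan Gs i n <= N"
 unfolding hspan_def
 by (rule gspan_least) (use assms in \<open>simp_all only: chs_simps NI_simps\<close>)

context
 fixes Gs i
 assumes Gs: "!!n z. (n, z) : Gs ==> z : El (C i n)"
begin

lemma hspan_family: "subfam K NI (chs i) (hspan Gs i)"
 unfolding hspan_def
proof (rule cat_module.gspan_subfam[OF chs])
 show "n : Ob NI & z : El (ob_mod (chs i) n)" if "(n, z) : Gs" for n z using Gs[OF that] by simp
 show "B i n <= El (ob_mod (chs i) n)" for n using subD(1)[OF B_submod] by simp
 show "arr_map (chs i) n m f z : B i m" if "f : Arr NI n m" "z : B i n" for n m f z
  using that tr_B by (simp only: chs_simps NI_simps)
qed

lemma hspan_sub: "submod K (C i n) (hspan Gs i n)"
 using famD(1)[OF hspan_family NI_simps(1)] by (simp only: chs_simps)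

lemma hspan_tr: "f : oi n m ==> z : hspan Gs i n ==> tr i n m f z : hspan Gs i m"
 using famD(2)[OF hspan_family NI_simps(1) NI_simps(1)] by (simp only: chs_simps NI_simps)

end

end

locale nc_map = P: nc_mod R K P + M: nc_mod R K M
 for R :: "('r, 'x) ring_scheme" (structure) and K :: "('k, 'y) ring_scheme"
  and P :: "(nat, 'r ovi_arr, 'k, 'p) cat_mod" and M :: "(nat, 'r ovi_arr, 'k, 'm) cat_mod" +
 fixes p :: "nat => 'p => 'm"
 assumes p_linear: "p n : Lin K (ob_mod P n) (ob_mod M n)"
  and p_nat: "\<phi> : P.HomN n m ==> v : El (ob_mod P n) ==> p m (arr_map P n m \<phi> v) = arr_map M n m \<phi> (p n v)"
begin

abbreviation "pc n c == (%gs. p n (c gs))"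

lemma pc_lin: "pc n : Lin K (P.C i n) (M.C i n)"
 by (rule values_lin[OF P.ob M.ob p_linear])

lemma pc_bd:
 assumes c: "c : El (P.C (Suc i) n)"
 shows "M.bd (Suc i) n (pc n c) = pc n (P.bd (Suc i) n c)"
proof -
 have "p n (arr_map P n n g v) = arr_map M n n g (p n v)"
  if "g : El (P.UU n)" "v : El (ob_mod P n)" for g v
  by (rule p_nat[OF P.U_hom[OF that(1)] that(2)])
 thus ?thesis
  by (intro rep_map_values[where u = "p n", OF P.rep M.rep p_linear _ c])
qed

lemma pc_tr:
 assumes f: "f : oi n m" and c: "c : El (P.C i n)"
 shows "M.tr i n m f (pc n c) = pc m (P.tr i n m f c)"
proof (rule lin_eqI[OF P.ob M.C_left lin_comp[OF pc_lin M.tr_lin[OF f]]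
   lin_comp[OF P.tr_lin[OF f] pc_lin] _ c])
 fix gs v assume gs: "gs : tuples (P.UU n) i" and v: "v : El (ob_mod P n)"
 show "M.tr i n m f (pc n (single (ob_mod P n) gs v)) = pc m (P.tr i n m f (single (ob_mod P n) gs v))"
  using rep_map.ch_single[OF P.map_rep[OF f] gs v] rep_map.ch_single[OF M.map_rep[OF f] gs lin_cl[OF p_linear v]]
  by (simp add: values_single[OF P.ob M.ob p_linear] p_nat[OF P.sa_hom[OF f] v])
qed

lemma pc_Z: "z : P.Z (Suc i) n ==> pc n z : M.Z (Suc i) n"
 unfolding P.Z_Suc M.Z_Suc
 by (elim conjE, intro conjI, erule lin_cl[OF pc_lin]) (simp add: pc_bd lin_zero[OF P.ob M.ob p_linear])

lemma pc_B: "z : P.B i n ==> pc n z : M.B i n"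
 unfolding P.B_def M.B_def by (elim imageE, rule image_eqI[OF _ lin_cl[OF pc_lin]]) (simp_all add: pc_bd)

lemma pc_hspan:
 assumes "!!m z. (m, z) : Gs ==> z : El (P.C i m) & (m, pc m z) : Hs"
  and Hs: "!!m z. (m, z) : Hs ==> z : El (M.C i m)"
  and z: "z : P.hspan Gs i n"
 shows "pc n z : M.hspan Hs i n"
proof -
 have "P.hspan Gs i n <= {z : El (P.C i n). pc n z : M.hspan Hs i n}"
 proof (rule P.hspan_least)
  show "submod K (P.C i n) {z : El (P.C i n). pc n z : M.hspan Hs i n}"
   by (rule submod_vimage[OF P.C_left M.C_left pc_lin M.hspan_sub[OF Hs]])
  show "P.B i n <= {z : El (P.C i n). pc n z : M.hspan Hs i n}"
   using subsetD[OF M.hspan_B pc_B] subsetD[OF subD(1)[OF P.B_submod]] by blast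
  fix m z f assume mz: "(m, z) : Gs" and f: "f : oi m n"
  have z: "z : El (P.C i m)" "(m, pc m z) : Hs" using assms(1)[OF mz] by simp_all
  show "P.tr i m n f z : {z : El (P.C i n). pc n z : M.hspan Hs i n}"
   using M.hspan_arr[OF z(2) f, of i, unfolded pc_tr[OF f z(1)]] lin_cl[OF P.tr_lin[OF f] z(1)] by simp
 qed
 thus ?thesis using z by blast
qed

end

section \<open>Extensions\<close>

definition sub_mod :: "('o, 'a, 'k, 'm) cat_mod => ('o => 'm set) => ('o, 'a, 'k, 'm) cat_mod" where
 "sub_mod M S = (|ob_mod = (%x. (ob_mod M x)(|carrier := S x|)), arr_map = arr_map M|)"

lemma sub_mod_simps [simp]:
 "ob_mod (sub_mod M S) x = (ob_mod M x)(|carrier := S x|)" "arr_map (sub_mod M S) = arr_map M"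
 by (simp_all add: sub_mod_def)

lemma sub_cat_module:
 assumes K: "cring K" and M: "cat_module K C M" and S: "subfam K C M S"
 shows "cat_module K C (sub_mod M S)"
proof (rule cat_module.intro[OF cat_module.axioms(1)[OF M]], rule cat_module_axioms.intro)
 interpret M: cat_module K C M by (rule M)
 have SM: "m : El (ob_mod M x)" if "x : Ob C" "m : S x" for x m
  using subD(1)[OF famD(1)[OF S that(1)]] that(2) by blast
 show "module K (ob_mod (sub_mod M S) x)" if "x : Ob C" for x
  using lm_module[OF K submod_lm[OF M.ob_lm[OF that] famD(1)[OF S that]]]
  by simp
 show "arr_map (sub_mod M S) x y a : Lin K (ob_mod (sub_mod M S) x) (ob_mod (sub_mod M S) y)"
  if o: "x : Ob C" "y : Ob C" "a : Arr C x y" for x y a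
  using famD(2)[OF S o] lin_add[OF M.arr_linear[OF o] SM[OF o(1)] SM[OF o(1)]]
   lin_smult[OF M.arr_linear[OF o] _ SM[OF o(1)]]
  by (intro linI) simp_all
qed (use M[THEN cat_module.arr_Ident] M[THEN cat_module.arr_Comp] subD(1)[OF famD(1)[OF S]] in
  \<open>simp_all add: subset_iff\<close>)

lemma (in nc_mod) sub_nc_mod: "subfam K NC M S ==> nc_mod R K (sub_mod M S)"
 by (intro nc_mod.intro nc_mod_axioms.intro ovi_cat_axioms K sub_cat_module M)

lemma (in nc_mod) sub_nc_map:
 assumes S: "subfam K NC M S"
 shows "nc_map R K (sub_mod M S) M (%_ v. v)"
proof (intro nc_map.intro nc_map_axioms.intro sub_nc_mod S nc_mod_axioms)
 show "(%v. v) : Lin K (ob_mod (sub_mod M S) n) (ob_mod M n)" for n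
  by (simp add: submod_incl_lin[OF ob subD(1)[OF famD(1)[OF S NC_simps(1)]]])
qed simp

text \<open>Used in \<open>hfg_extension\<close> for \<open>z = a + b\<close> with \<open>a\<close>
  from \<open>P\<close> and \<open>b\<close> from \<open>S\<close>, corrected by an element
  \<open>a' + b'\<close> of the span.\<close>

lemma (in abelian_group) split_differences:
 assumes "a : El G" "b : El G" "a' : El G" "b' : El G"
 shows "a \<oplus> b = (b \<ominus> b') \<oplus> ((a' \<oplus> b') \<oplus> (a \<ominus> a'))"
  and "b \<ominus> b' = (a \<oplus> b) \<ominus> ((a' \<oplus> b') \<oplus> (a \<ominus> a'))"
proof -
 have "(b \<ominus> b') \<oplus> ((a' \<oplus> b') \<oplus> (a \<ominus> a')) = (a \<oplus> b) \<oplus> ((b' \<ominus> b') \<oplus> (a' \<ominus> a'))"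
  using assms by (simp add: a_minus_def a_ac)
 thus 1: "a \<oplus> b = (b \<ominus> b') \<oplus> ((a' \<oplus> b') \<oplus> (a \<ominus> a'))" using assms by (simp add: a_minus_def r_neg)
 show "b \<ominus> b' = (a \<oplus> b) \<ominus> ((a' \<oplus> b') \<oplus> (a \<ominus> a'))"
  unfolding 1 using assms by (simp add: a_minus_def a_assoc r_neg)
qed

context nc_map
begin

context
 fixes S
 assumes S: "subfam K P.NC M S"
  and cover: "!!n v. v : El (ob_mod M n) ==> EX y:El (ob_mod P n). EX w:S n. v = p n y \<oplus>\<^sub>(ob_mod M n) w"
begin

abbreviation "SC i n == FS ((ob_mod M n)(|carrier := S n|)) (tuples (P.UU n) i)"

definition "kern n = {v : El (ob_mod P n). p n v : S n}"

text \<open>The connecting map, on chains, of \<open>0 -> kern -> P + S -> M -> 0\<close>, where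
  \<open>v\<close> in \<open>kern\<close> goes to \<open>(v, - p v)\<close> and
  \<open>(y, w)\<close> to \<open>p y + w\<close>. For \<open>X\<close> the cycles of
  \<open>M\<close>, the boundary of \<open>y\<close> represents the image of the class of the cycle
  that \<open>(y, w)\<close> lifts.\<close>

definition bds :: "nat => (nat => ('r ovi_arr list => 'm) set) => nat => ('r ovi_arr list => 'p) set" where
 "bds i X n = {P.bd (Suc i) n y |y w. y : El (P.C (Suc i) n) & w : El (SC (Suc i) n) &
   pc n y \<oplus>\<^sub>(M.C (Suc i) n) w : X n}"

interpretation S: nc_mod R K "sub_mod M S" by (rule M.sub_nc_mod[OF S])
interpretation iS: nc_map R K "sub_mod M S" M "%_ v. v" by (rule M.sub_nc_map[OF S])

lemma S_sub: "submod K (ob_mod M n) (S n)"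
 by (rule famD(1)[OF S P.NC_simps(1)])

lemma SC_C: "w : El (SC i n) ==> w : El (M.C i n)"
 using submod_fs[OF S_sub] by blast

lemma kern_sub: "subfam K P.NC P kern"
 unfolding subfam_def
proof (intro conjI ballI)
 show "submod K (ob_mod P n) (kern n)" for n
  unfolding kern_def by (rule submod_vimage[OF P.ob M.ob p_linear S_sub])
 fix n m \<phi> v assume "\<phi> : Arr P.NC n m" and v: "v : kern n"
 hence \<phi>: "\<phi> : P.HomN n m" by (simp only: P.NC_simps)
 show "arr_map P n m \<phi> v : kern m"
  using v lin_cl[OF P.NC_lin[OF P.M \<phi>]] p_nat[OF \<phi>] famD(2)[OF S P.NC_simps(1) P.NC_simps(1), of \<phi>]
  unfolding kern_def P.NC_simps using \<phi> by auto
qed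

interpretation N: nc_mod R K "sub_mod P kern" by (rule P.sub_nc_mod[OF kern_sub])
interpretation iN: nc_map R K "sub_mod P kern" P "%_ v. v" by (rule P.sub_nc_map[OF kern_sub])

lemma NC_iff: "c : El (N.C i n) <-> c : El (P.C i n) & pc n c : El (SC i n)"
 (is "_ <-> ?rhs")
proof
 assume c: "c : El (N.C i n)"
 have cP: "c : El (P.C i n)" using lin_cl[OF iN.pc_lin c] by simp
 have "p n (c gs) : S n" for gs
 by (use fs_val N.ob c kern_def in \<open>fastforce\<close>)
 thus ?rhs using cP lin_cl[OF pc_lin cP] by (auto simp: fs_iff)
next
 assume c: ?rhs
 hence "c gs : El (ob_mod P n)" "p n (c gs) : S n" for gs
  using fs_val[OF P.ob] fs_val[OF S.ob, of "pc n c" n] by auto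
 thus "c : El (N.C i n)" using c by (auto simp: fs_iff kern_def)
qed

lemma bds_sub:
 assumes X: "submod K (M.C (Suc i) n) (X n)"
 shows "submod K (P.C i n) (bds i X n)"
proof -
 interpret C: left_module K "M.C (Suc i) n" by (rule M.C_left)
 interpret PC: left_module K "P.C (Suc i) n" by (rule P.C_left)
 interpret SC: left_module K "SC (Suc i) n" using S.C_left by simp
 note pl = pc_lin[of n "Suc i"]
 let ?Y = "{y : El (P.C (Suc i) n). EX w:El (SC (Suc i) n). pc n y \<oplus>\<^sub>(M.C (Suc i) n) w : X n}"
 have "submod K (P.C (Suc i) n) ?Y"
 proof (rule submodI)
  show "\<zero>\<^sub>(P.C (Suc i) n) : ?Y"
   using subD(2)[OF X] PC.zero_closed lin_zero[OF P.ob M.ob p_linear] C.l_zero[OF C.zero_closed]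
   by (auto intro!: bexI[of _ "\<zero>\<^sub>(SC (Suc i) n)"])
 next
  fix x y assume "x : ?Y" "y : ?Y"
  then obtain v w where v: "x : El (P.C (Suc i) n)" "v : El (SC (Suc i) n)" "pc n x \<oplus>\<^sub>(M.C (Suc i) n) v : X n"
   and w: "y : El (P.C (Suc i) n)" "w : El (SC (Suc i) n)" "pc n y \<oplus>\<^sub>(M.C (Suc i) n) w : X n" by blast
  have "pc n (x \<oplus>\<^sub>(P.C (Suc i) n) y) \<oplus>\<^sub>(M.C (Suc i) n) (v \<oplus>\<^sub>(M.C (Suc i) n) w) =
   (pc n x \<oplus>\<^sub>(M.C (Suc i) n) v) \<oplus>\<^sub>(M.C (Suc i) n) (pc n y \<oplus>\<^sub>(M.C (Suc i) n) w)"
   unfolding lin_add[OF pl v(1) w(1)]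
   using lin_cl[OF pl v(1)] lin_cl[OF pl w(1)] SC_C[OF v(2)] SC_C[OF w(2)]
   by (simp add: C.a_ac del: fs_simps)
  hence "pc n (x \<oplus>\<^sub>(P.C (Suc i) n) y) \<oplus>\<^sub>(M.C (Suc i) n) (v \<oplus>\<^sub>(SC (Suc i) n) w) : X n"
   using subD(3)[OF X v(3) w(3)] by simp
  thus "x \<oplus>\<^sub>(P.C (Suc i) n) y : ?Y"
   using PC.add.m_closed[OF v(1) w(1)] SC.add.m_closed[OF v(2) w(2)] by blast
 next
  fix a x assume a: "a : El K" and "x : ?Y"
  then obtain v where v: "x : El (P.C (Suc i) n)" "v : El (SC (Suc i) n)" "pc n x \<oplus>\<^sub>(M.C (Suc i) n) v : X n"
   by blast
  have "pc n (a \<odot>\<^sub>(P.C (Suc i) n) x) \<oplus>\<^sub>(M.C (Suc i) n) (a \<odot>\<^sub>(M.C (Suc i) n) v) =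
    a \<odot>\<^sub>(M.C (Suc i) n) (pc n x \<oplus>\<^sub>(M.C (Suc i) n) v)"
   unfolding lin_smult[OF pl a v(1)]
   using lin_cl[OF pl v(1)] SC_C[OF v(2)] a by (simp add: C.smult_r_distr del: fs_simps)
  hence "pc n (a \<odot>\<^sub>(P.C (Suc i) n) x) \<oplus>\<^sub>(M.C (Suc i) n) (a \<odot>\<^sub>(SC (Suc i) n) v) : X n"
   using subD(4)[OF X a v(3)] by simp
  thus "a \<odot>\<^sub>(P.C (Suc i) n) x : ?Y"
   using PC.smult_closed[OF a v(1)] SC.smult_closed[OF a v(2)] by blast
 qed auto
 moreover have "bds i X n = P.bd (Suc i) n ` ?Y" unfolding bds_def by blast
 ultimately show ?thesis using submod_image[OF P.C_left P.C_left P.bd_lin] by simp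
qed

lemma bds_tr:
 assumes f: "f : oi n m" and X: "!!z. z : X n ==> M.tr (Suc i) n m f z : X m" and t: "t : bds i X n"
 shows "P.tr i n m f t : bds i X m"
proof -
 obtain y w where y: "y : El (P.C (Suc i) n)" and w: "w : El (SC (Suc i) n)"
  and yw: "pc n y \<oplus>\<^sub>(M.C (Suc i) n) w : X n" and t: "t = P.bd (Suc i) n y"
  using t unfolding bds_def by blast
 have "M.tr (Suc i) n m f w = S.tr (Suc i) n m f w"
  using iS.pc_tr[OF f, of w "Suc i"] w by simp
 moreover have "S.tr (Suc i) n m f w : El (SC (Suc i) m)"
  using lin_cl[OF S.tr_lin[OF f], of w "Suc i"] w by simp
 moreover have "pc m (P.tr (Suc i) n m f y) \<oplus>\<^sub>(M.C (Suc i) m) M.tr (Suc i) n m f w : X m"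
  using X[OF yw] unfolding lin_add[OF M.tr_lin[OF f] lin_cl[OF pc_lin y] SC_C[OF w]] pc_tr[OF f y] .
 ultimately show ?thesis
  unfolding bds_def t using P.bd_tr[OF f y] lin_cl[OF P.tr_lin[OF f] y] by force
qed

text \<open>For a chain \<open>y\<close> of the kernel take \<open>w\<close> to be the negative of
  \<open>p y\<close>; then \<open>(y, w)\<close> lifts zero.\<close>

lemma bds_B:
 assumes X: "(%_. \<zero>\<^sub>(ob_mod M n)) : X n"
 shows "N.B i n <= bds i X n"
proof
 fix b assume "b : N.B i n"
 then obtain y where yN: "y : El (N.C (Suc i) n)" and b: "b = N.bd (Suc i) n y" unfolding N.B_def by blast
 have y: "y : El (P.C (Suc i) n)" "pc n y : El (SC (Suc i) n)" using yN NC_iff by blast+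
 interpret SC: left_module K "SC (Suc i) n" using S.C_left by simp
 have "pc n y \<oplus>\<^sub>(M.C (Suc i) n) (\<ominus>\<^sub>(SC (Suc i) n) pc n y) : X n"
  using SC.r_neg[OF y(2)] X by simp
 moreover have "b = P.bd (Suc i) n y" unfolding b using iN.pc_bd[OF yN] by simp
 ultimately show "b : bds i X n" unfolding bds_def
  using y(1) SC.add.inv_closed[OF y(2)] by blast
qed

text \<open>Exactness of \<open>H_(i+1)(P) + H_(i+1)(S) -> H_(i+1)(M) -> H_i(kern)\<close>. The
  image of the second map is represented by \<open>T\<close>, which lies between the boundaries and
  the cycles of \<open>kern\<close>, so noetherianity of OI-modules gives finitely many generators
  of it.\<close>

theorem hfg_extension:
 assumes F: "ovi_fg R L ge" and noeth: "noetherian_ring K"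
  and hN: "nc_mod.hfg R K (sub_mod P kern) i" and hP: "P.hfg (Suc i)"
  and hS: "nc_mod.hfg R K (sub_mod M S) (Suc i)"
 shows "M.hfg (Suc i)"
proof -
 define T where "T = bds i (M.Z (Suc i))"
 have TZ: "T n <= N.Z i n" for n
 proof
  fix t assume "t : T n"
  then obtain y w where y: "y : El (P.C (Suc i) n)" and w: "w : El (SC (Suc i) n)"
   and yw: "pc n y \<oplus>\<^sub>(M.C (Suc i) n) w : M.Z (Suc i) n" and t: "t = P.bd (Suc i) n y"
   unfolding T_def bds_def by blast
  interpret C: left_module K "M.C i n" by (rule M.C_left)
  interpret SC: left_module K "SC i n" using S.C_left by simp
  have bw: "M.bd (Suc i) n w = S.bd (Suc i) n w" "S.bd (Suc i) n w : El (SC i n)"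
   using iS.pc_bd[of w n i] lin_cl[OF S.bd_lin, of w n i] w by simp_all
  have tC: "t : El (P.C i n)" unfolding t by (rule lin_cl[OF P.bd_lin y])
  have "pc n t \<oplus>\<^sub>(M.C i n) M.bd (Suc i) n w = \<zero>\<^sub>(M.C i n)"
   using yw lin_add[OF M.bd_lin lin_cl[OF pc_lin y] SC_C[OF w]] pc_bd[OF y]
   unfolding M.Z_Suc t by simp
  hence "pc n t = \<ominus>\<^sub>(M.C i n) S.bd (Suc i) n w"
   using C.minus_equality lin_cl[OF pc_lin tC] SC_C[OF bw(2)] unfolding bw(1) by metis
  also have "... = \<ominus>\<^sub>(SC i n) S.bd (Suc i) n w"
   using fs_a_inv[OF M.ob SC_C[OF bw(2)]] fs_a_inv[OF S.ob, of "S.bd (Suc i) n w"] bw(2)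
    submod_a_inv[OF M.ob S_sub] fs_val[OF S.ob, of "S.bd (Suc i) n w" n] by simp
  finally have "pc n t : El (SC i n)" using SC.add.inv_closed[OF bw(2)] by simp
  hence tN: "t : El (N.C i n)" using tC NC_iff by blast
  show "t : N.Z i n"
  proof (cases i)
   case 0
   thus ?thesis using tN N.Z_0 by simp
  next
   case (Suc j)
   hence "N.bd (Suc j) n t = P.bd (Suc j) n t" using iN.pc_bd tN by simp
   thus ?thesis using P.bd_bd y t tN unfolding Suc N.Z_Suc by simp
  qed
 qed
 have Tsub: "subfam K P.NI (N.chs i) T"
  unfolding subfam_def
 proof (intro conjI ballI)
  fix n
  have "submod K (P.C i n) (T n)" unfolding T_def by (rule bds_sub) (rule M.Z_submod)
  moreover have "T n <= El (N.C i n)" using TZ N.Z_C by blast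
  ultimately show "submod K (ob_mod (N.chs i) n) (T n)"
   unfolding N.chs_simps by (simp add: submod_def)
  fix m f t assume "f : Arr P.NI n m" and t: "t : T n"
  hence f: "f : oi n m" by (simp only: P.NI_simps)
  have "P.tr i n m f t : T m"
   unfolding T_def by (rule bds_tr[where X = "M.Z (Suc i)", OF f M.tr_Z[OF f] t[unfolded T_def]])
  moreover have "N.tr i n m f t = P.tr i n m f t" using iN.pc_tr[OF f N.Z_C[OF subsetD[OF TZ t]]] by simp
  ultimately show "arr_map (N.chs i) n m f t : T m" by (simp only: N.chs_simps)
 qed
 have BT: "N.B i n <= T n" for n
  unfolding T_def by (rule bds_B) (use subD(2)[OF M.Z_submod] in simp)
 obtain Gn where Gn: "finite Gn" "!!n z. (n, z) : Gn ==> z : N.Z i n" "!!n. N.Z i n <= N.hspan Gn i n"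
  using hN unfolding N.hfg_iff by blast
 have "fin_gen K P.NI (N.chs i) T (N.B i)"
 proof (rule ovi_fg.oi_noetherian[OF F N.chs M.K noeth Tsub N.B_sub BT Gn(1)])
  show "z : El (ob_mod (N.chs i) n)" if "(n, z) : Gn" for n z
   unfolding N.chs_simps by (rule N.Z_C[OF Gn(2)[OF that]])
  show "T n <= gspan K P.NI (N.chs i) Gn (N.B i) n" for n
   using order_trans[OF TZ Gn(3)] unfolding N.hspan_def .
 qed
 then obtain Gt where Gt: "finite Gt" "!!n t. (n, t) : Gt ==> t : T n" "!!n. T n <= N.hspan Gt i n"
  unfolding fin_gen_def N.hspan_def using P.NI_simps(1) by blast
 define Q where "Q n t y w <-> y : El (P.C (Suc i) n) & w : El (SC (Suc i) n) &
   pc n y \<oplus>\<^sub>(M.C (Suc i) n) w : M.Z (Suc i) n & t = P.bd (Suc i) n y" for n t y w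
 have "ALL n t. EX y w. (n, t) : Gt --> Q n t y w"
  using Gt(2) unfolding T_def bds_def Q_def by blast
 then obtain Y W where "ALL n t. (n, t) : Gt --> Q n t (Y n t) (W n t)" by metis
 hence YW: "Y n t : El (P.C (Suc i) n) & W n t : El (SC (Suc i) n) &
   pc n (Y n t) \<oplus>\<^sub>(M.C (Suc i) n) W n t : M.Z (Suc i) n & t = P.bd (Suc i) n (Y n t)" if "(n, t) : Gt" for n t
  using that unfolding Q_def by blast
 obtain Gp where Gp: "finite Gp" "!!n z. (n, z) : Gp ==> z : P.Z (Suc i) n" "!!n. P.Z (Suc i) n <= P.hspan Gp (Suc i) n"
  using hP unfolding P.hfg_iff by blast
 obtain Gs where Gs: "finite Gs" "!!n z. (n, z) : Gs ==> z : S.Z (Suc i) n" "!!n. S.Z (Suc i) n <= S.hspan Gs (Suc i) n"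
  using hS unfolding S.hfg_iff by blast
 \<comment> \<open>Cycles of three kinds: lifts to \<open>M\<close> of the generators of
   \<open>T\<close>, and the images of generators for \<open>P\<close> and for
   \<open>S\<close>.\<close>
 define Hs where "Hs = (%(n, t). (n, pc n (Y n t) \<oplus>\<^sub>(M.C (Suc i) n) W n t)) ` Gt \<union> (%(n, z). (n, pc n z)) ` Gp \<union> Gs"
 have HZ: "z : M.Z (Suc i) n" if "(n, z) : Hs" for n z
 proof -
  have "(EX t. (n, t) : Gt & z = pc n (Y n t) \<oplus>\<^sub>(M.C (Suc i) n) W n t) \<or> (EX z'. (n, z') : Gp & z = pc n z') \<or> (n, z) : Gs"
   using that by (auto simp: Hs_def simp del: fs_simps)
  then consider t where "(n, t) : Gt" "z = pc n (Y n t) \<oplus>\<^sub>(M.C (Suc i) n) W n t"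
   | z' where "(n, z') : Gp" "z = pc n z'" | "(n, z) : Gs" by metis
  thus ?thesis
  proof cases
   case 1
   thus ?thesis using YW[OF 1(1)] by blast
  next
   case 2
   thus ?thesis using pc_Z[OF Gp(2)[OF 2(1)]] by blast
  next
   case 3
   thus ?thesis using iS.pc_Z[OF Gs(2)[OF 3]] by blast
  qed
 qed
 note HC = M.Z_C[OF HZ]
 let ?H = "M.hspan Hs (Suc i)"
 note Hsub = M.hspan_sub[of Hs "Suc i", OF HC]
 have HsubZ: "?H n <= M.Z (Suc i) n" for n
  by (rule M.hspan_least[OF M.Z_submod M.B_Z M.tr_Z]) (auto intro: HZ)
 have A: "N.hspan Gt i n <= bds i ?H n" for n
 proof (rule order_trans[of _ "bds i ?H n \<inter> El (N.C i n)"], rule N.hspan_least)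
  have "submod K (P.C i n) (bds i ?H n)" by (rule bds_sub) (rule Hsub)
  thus "submod K (N.C i n) (bds i ?H n \<inter> El (N.C i n))"
   using submod_carrier[OF N.C_left, of n i] by (auto simp: submod_def)
  show "N.B i n <= bds i ?H n \<inter> El (N.C i n)"
   using bds_B[of n ?H i] subD(2)[OF Hsub, of n] subD(1)[OF N.B_submod, of i n] by simp
  fix m t f assume mt: "(m, t) : Gt" and f: "f : oi m n"
  have tN: "t : El (N.C i m)" using Gt(2)[OF mt] TZ N.Z_C by blast
  have "pc m (Y m t) \<oplus>\<^sub>(M.C (Suc i) m) W m t : ?H m"
   by (rule M.hspan_base) (use mt YW[OF mt] M.Z_C in \<open>force simp: Hs_def\<close>)+
  hence "t : bds i ?H m" unfolding bds_def using YW[OF mt] by blast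
  hence "P.tr i m n f t : bds i ?H n"
   by (intro bds_tr[OF f]) (rule M.hspan_tr[OF HC f])
  thus "N.tr i m n f t : bds i ?H n \<inter> El (N.C i n)"
   using iN.pc_tr[OF f tN] lin_cl[OF N.tr_lin[OF f] tN] by simp
 qed auto
 have Bc: "pc n z : ?H n" if "z : P.Z (Suc i) n" for n z
 proof (rule pc_hspan[OF _ HC subsetD[OF Gp(3) that]])
  fix m z assume mz: "(m, z) : Gp"
  hence "(m, pc m z) : Hs" by (force simp: Hs_def)
  thus "z : El (P.C (Suc i) m) & (m, pc m z) : Hs" using P.Z_C[OF Gp(2)[OF mz]] by blast
 qed
 have Cc: "z : ?H n" if "z : S.Z (Suc i) n" for n z
 proof -
  have "z : El (S.C (Suc i) m) & (m, z) : Hs" if "(m, z) : Gs" for m z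
   using S.Z_C[OF Gs(2)[OF that]] that by (simp add: Hs_def)
  from iS.pc_hspan[OF this HC subsetD[OF Gs(3) that]] show ?thesis .
 qed
 have "M.Z (Suc i) n <= ?H n" for n
 proof
  fix z assume z: "z : M.Z (Suc i) n"
  interpret C: left_module K "M.C (Suc i) n" by (rule M.C_left)
  interpret PC: left_module K "P.C (Suc i) n" by (rule P.C_left)
  interpret PC': left_module K "P.C i n" by (rule P.C_left)
  interpret SC: left_module K "SC (Suc i) n" using S.C_left by simp
  have "EX y:El (P.C (Suc i) n). EX w:El (SC (Suc i) n). z = (%x. p n (y x) \<oplus>\<^sub>(ob_mod M n) w x)"
   by (rule values_surj[OF P.ob M.ob p_linear S_sub M.Z_C[OF z] M.ob refl refl cover])
  then obtain y w where y: "y : El (P.C (Suc i) n)" and w: "w : El (SC (Suc i) n)"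
   and zyw: "z = pc n y \<oplus>\<^sub>(M.C (Suc i) n) w" by auto
  have "P.bd (Suc i) n y : T n" unfolding T_def bds_def using y w z zyw by blast
  hence "P.bd (Suc i) n y : bds i ?H n" using Gt(3) A by blast
  \<comment> \<open>An element of the span with the same image under the connecting map as
    \<open>z\<close>. Then \<open>y - y'\<close> is a cycle of \<open>P\<close>, and what is left of
    \<open>z\<close> after subtracting the generated part is the cycle \<open>w - w'\<close> of
    \<open>S\<close>.\<close>
  then obtain y' w' where y': "y' : El (P.C (Suc i) n)" and w': "w' : El (SC (Suc i) n)"
   and yw': "pc n y' \<oplus>\<^sub>(M.C (Suc i) n) w' : ?H n" and eq: "P.bd (Suc i) n y = P.bd (Suc i) n y'"
   unfolding bds_def by blast
  have "y \<ominus>\<^sub>(P.C (Suc i) n) y' : P.Z (Suc i) n"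
   using lin_diff[OF P.C_left P.C_left P.bd_lin y y'] PC'.r_neg[OF lin_cl[OF P.bd_lin y']] PC.minus_closed[OF y y']
   unfolding P.Z_Suc eq by (simp add: a_minus_def)
  from Bc[OF this] have d: "pc n y \<ominus>\<^sub>(M.C (Suc i) n) pc n y' : ?H n"
   unfolding lin_diff[OF P.C_left M.C_left pc_lin y y'] .
  note cl = lin_cl[OF pc_lin y] SC_C[OF w] lin_cl[OF pc_lin y'] SC_C[OF w']
  note h = subD(3)[OF Hsub yw' d]
  have "w \<ominus>\<^sub>(M.C (Suc i) n) w' : M.Z (Suc i) n"
   unfolding C.split_differences(2)[OF cl] zyw[symmetric]
   by (rule submod_diff[OF M.C_left M.Z_submod z subsetD[OF HsubZ h]])
  moreover have dS: "w \<ominus>\<^sub>(SC (Suc i) n) w' = w \<ominus>\<^sub>(M.C (Suc i) n) w'"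
   using fs_a_inv[OF M.ob SC_C[OF w']] fs_a_inv[OF S.ob, of w'] w'
    submod_a_inv[OF M.ob S_sub] fs_val[OF S.ob, of w' n] by (simp add: a_minus_def)
  moreover have "w \<ominus>\<^sub>(SC (Suc i) n) w' : El (SC (Suc i) n)" by (rule SC.minus_closed[OF w w'])
  ultimately have "w \<ominus>\<^sub>(M.C (Suc i) n) w' : S.Z (Suc i) n"
   using iS.pc_bd[of "w \<ominus>\<^sub>(M.C (Suc i) n) w'" n i] unfolding S.Z_Suc M.Z_Suc by simp
  from subD(3)[OF Hsub Cc[OF this] h] show "z : ?H n"
   unfolding zyw C.split_differences(1)[OF cl] .
 qed
 thus ?thesis unfolding M.hfg_iff
  using HZ Gt(1) Gp(1) Gs(1) by (intro exI[of _ Hs]) (auto simp: Hs_def)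
qed

end

end

section \<open>Principal projectives\<close>

lemma restr_twice [simp]: "V(|carrier := A|)(|carrier := B|) = V(|carrier := B|)" for V :: "('r, 'a) module"
 by simp

lemma cspan_restr: "cspan R (V(|carrier := N|)) X = cspan R V X" for V :: "('r, 'a) module"
proof (intro equalityI subsetI)
 fix x assume "x : cspan R (V(|carrier := N|)) X"
 thus "x : cspan R V X"
  by induction (auto intro: cspan.intros)
next
 fix x assume "x : cspan R V X"
 thus "x : cspan R (V(|carrier := N|)) X"
 proof induction
  case cspan_zero
  show ?case using cspan.cspan_zero[of "V(|carrier := N|)"] by simp
 next
  case (cspan_add x y)
  thus ?case using cspan.cspan_add[of x R "V(|carrier := N|)" X y] by simp
 next
  case (cspan_smult a x)
  thus ?case using cspan.cspan_smult[of a R x "V(|carrier := N|)" X] by simp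
 qed (rule cspan.cspan_base)
qed

lemma submod_trans: "submod R (V(|carrier := N|)) X ==> N <= El V ==> submod R V X" for V :: "('r, 'a) module"
 by (auto simp: submod_def)

lemma submod_image_sum:
 assumes V: "LMod R V" and W: "LMod R W" and f: "f : Lin R V W"
  and N: "submod R W N"
 shows "submod R W {f y \<oplus>\<^sub>W w |y w. y : El V & w : N}"
proof -
 interpret V: left_module R V by (rule V)
 interpret W: left_module R W by (rule W)
 note s = subD[OF N] and NW = subsetD[OF subD(1)[OF N]]
 show ?thesis
 proof (rule submodI)
  show "{f y \<oplus>\<^sub>W w |y w. y : El V & w : N} <= El W" using lin_cl[OF f] NW by auto
  have "\<zero>\<^sub>W = f \<zero>\<^sub>V \<oplus>\<^sub>W \<zero>\<^sub>W" by (simp add: lin_zero[OF V W f])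
  thus "\<zero>\<^sub>W : {f y \<oplus>\<^sub>W w |y w. y : El V & w : N}" using s(2) by blast
 next
  fix a b assume "a : {f y \<oplus>\<^sub>W w |y w. y : El V & w : N}" "b : {f y \<oplus>\<^sub>W w |y w. y : El V & w : N}"
  then obtain y w y' w' where y: "y : El V" "w : N" "a = f y \<oplus>\<^sub>W w" "y' : El V" "w' : N" "b = f y' \<oplus>\<^sub>W w'"
   by blast
  hence "a \<oplus>\<^sub>W b = f (y \<oplus>\<^sub>V y') \<oplus>\<^sub>W (w \<oplus>\<^sub>W w')"
   using lin_cl[OF f] NW by (simp add: lin_add[OF f] W.a_ac)
  thus "a \<oplus>\<^sub>W b : {f y \<oplus>\<^sub>W w |y w. y : El V & w : N}"
   using y s(3) by blast
 next
  fix k a assume k: "k : El R" and "a : {f y \<oplus>\<^sub>W w |y w. y : El V & w : N}"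
  then obtain y w where y: "y : El V" "w : N" "a = f y \<oplus>\<^sub>W w" by blast
  hence "k \<odot>\<^sub>W a = f (k \<odot>\<^sub>V y) \<oplus>\<^sub>W (k \<odot>\<^sub>W w)"
   using lin_cl[OF f] NW k by (simp add: lin_smult[OF f] W.smult_r_distr)
  thus "k \<odot>\<^sub>W a : {f y \<oplus>\<^sub>W w |y w. y : El V & w : N}"
   using y s(4)[OF k] V.smult_closed[OF k] by blast
 qed
qed

lemma free_module_eq_on:
 assumes K: "ring K" and D: "LMod K D"
  and f: "f : Lin K (free_module K X) D" and g: "g : Lin K (free_module K X) D"
  and "!!x k. x : X ==> k : El K ==> f (single (Reg K) x k) = g (single (Reg K) x k)"
  and c: "c : El (free_module K X)"
 shows "f c = g c"
 by (rule lin_eqI[OF regular_lm[OF K] D f[unfolded free_module_def] g[unfolded free_module_def]])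
   (use assms in \<open>auto simp: free_module_def\<close>)

lemma free_single_cl: "ring K ==> x : X ==> k : El K ==> single (Reg K) x k : El (free_module K X)"
 unfolding free_module_def by (rule single_cl[OF regular_lm]) auto

section \<open>Linear maps out of free modules\<close>

definition free_lift :: "('k, 'y) ring_scheme => ('k, 'd) module => ('i => 'd) => ('i => 'k) => 'd" where
 "free_lift K D v = lsupp (Reg K) D (%x k. k \<odot>\<^sub>D v x)"

context
 fixes K :: "('k, 'y) ring_scheme" and D :: "('k, 'd) module" and v :: "'i => 'd" and X
 assumes K: "ring K" and D: "LMod K D" and v: "!!x. x : X ==> v x : El D"
begin

lemma free_lift_F: "x : X ==> (%k. k \<odot>\<^sub>D v x) : Lin K (Reg K) D"
 using v left_module.smult_closed[OF D] left_module.smult_l_distr[OF D] left_module.smult_assoc1[OF D]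
 by (intro linI) auto

lemma free_lift_lin: "free_lift K D v : Lin K (free_module K X) D"
 unfolding free_lift_def free_module_def
 by (rule lsupp_lin[OF regular_lm[OF K] D free_lift_F])

lemma free_lift_single: "x : X ==> k : El K ==> free_lift K D v (single (Reg K) x k) = k \<odot>\<^sub>D v x"
 unfolding free_lift_def
 using lsupp_single[OF regular_lm[OF K] D free_lift_F, where x = x and X = X and m = k] by simp

end

lemma pp_ob: "ob_mod (PPr K C x) y = free_module K (Arr C x y)"
 by (simp add: principal_projective_def)

context
 fixes K :: "('k, 'y) ring_scheme" and C :: "('o, 'a) cat"
 assumes K: "cring K" and C: "category C"
begin

lemma K_ring: "ring K"
 using K by (rule cring.axioms(1))

lemma pp_single: "x : Ob C ==> y : Ob C ==> z : Ob C ==> a : Arr C y z ==> b : Arr C x y ==> k : El K ==>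
  arr_map (PPr K C x) y z a (single (Reg K) b k) =
  single (Reg K) (Comp C x y z a b) k"
 unfolding principal_projective_def cat_mod.select_convs
 by (rule fsm_single[OF regular_lm[OF K_ring] regular_lm[OF K_ring]
   category.Comp_closed[OF C] lin_id]) simp_all

lemma pp_cat_module:
 assumes x: "x : Ob C"
 shows "cat_module K C (PPr K C x)"
proof (rule cat_module.intro[OF C], rule cat_module_axioms.intro)
 note Kr = regular_lm[OF K_ring] and fl = free_lm[OF K_ring]
 show "module K (ob_mod (PPr K C x) y)" for y
  unfolding pp_ob by (rule lm_module[OF K fl])
 show lin: "arr_map (PPr K C x) y z a \<in>
   Lin K (ob_mod (PPr K C x) y) (ob_mod (PPr K C x) z)"
  if "y : Ob C" "z : Ob C" "a : Arr C y z" for y z a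
  unfolding pp_ob free_module_def principal_projective_def cat_mod.select_convs
  by (rule fsm_lin[OF Kr Kr _ lin_id]) (rule category.Comp_closed[OF C x that(1,2) _ that(3)])
 show "arr_map (PPr K C x) y y (Ident C y) m = m"
  if y: "y : Ob C" and m: "m : El (ob_mod (PPr K C x) y)" for y m
  by (rule free_module_eq_on[OF K_ring fl lin[OF y y category.Ident_closed[OF C y], unfolded pp_ob] lin_id _ m[unfolded pp_ob]])
    (simp add: pp_single[OF x y y] category.Ident_closed[OF C y] category.Comp_Ident_left[OF C x y])
 show "arr_map (PPr K C x) y w (Comp C y z w b a) m =
   arr_map (PPr K C x) z w b (arr_map (PPr K C x) y z a m)"
  if o: "y : Ob C" "z : Ob C" "w : Ob C" and a: "a : Arr C y z" and b: "b : Arr C z w"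
   and m: "m : El (ob_mod (PPr K C x) y)" for y z w a b m
 proof (rule free_module_eq_on[OF K_ring fl _ _ _ m[unfolded pp_ob]])
  show "arr_map (PPr K C x) y w (Comp C y z w b a) \<in>
    Lin K (free_module K (Arr C x y)) (free_module K (Arr C x w))"
   using lin[OF o(1,3) category.Comp_closed[OF C o a b]] unfolding pp_ob .
  show "(%m. arr_map (PPr K C x) z w b (arr_map (PPr K C x) y z a m)) \<in>
    Lin K (free_module K (Arr C x y)) (free_module K (Arr C x w))"
   using lin_comp[OF lin[OF o(1,2) a] lin[OF o(2,3) b]] unfolding pp_ob .
  fix c k assume c: "c : Arr C x y" and k: "k : El K"
  show "arr_map (PPr K C x) y w (Comp C y z w b a) (single (Reg K) c k) =
    arr_map (PPr K C x) z w b (arr_map (PPr K C x) y z a (single (Reg K) c k))"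
   using c k o x a b category.Comp_closed[OF C] category.Comp_assoc[OF C x o c a b] by (simp add: pp_single)
 qed
qed

text \<open>The Yoneda lemma: elements of \<^term>\<open>ob_mod M x\<close> are maps out of the principal projective.\<close>

context
 fixes M :: "('o, 'a, 'k, 'm) cat_mod" and x m
 assumes M: "cat_module K C M" and x: "x : Ob C" and m: "m : El (ob_mod M x)"
begin

interpretation M: cat_module K C M by (rule M)
interpretation P: cat_module K C "PPr K C x" by (rule pp_cat_module[OF x])

definition "pp_lift y = free_lift K (ob_mod M y) (%a. arr_map M x y a m)"

lemma pp_lift_lin:
 assumes y: "y : Ob C"
 shows "pp_lift y : Lin K (free_module K (Arr C x y)) (ob_mod M y)"
 unfolding pp_lift_def by (rule free_lift_lin[OF K_ring M.ob_lm[OF y] M.arr_cl[OF x y _ m]])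

lemma pp_lift_single:
 assumes y: "y : Ob C" and "a : Arr C x y" "k : El K"
 shows "pp_lift y (single (Reg K) a k) = k \<odot>\<^sub>(ob_mod M y) arr_map M x y a m"
 unfolding pp_lift_def
 by (rule free_lift_single[where X = "Arr C x y", OF K_ring M.ob_lm[OF y] M.arr_cl[OF x y _ m] assms(2,3)])

lemma pp_lift_nat:
 assumes y: "y : Ob C" and z: "z : Ob C" and a: "a : Arr C y z" and c: "c : El (free_module K (Arr C x y))"
 shows "pp_lift z (arr_map (PPr K C x) y z a c) = arr_map M y z a (pp_lift y c)"
proof (rule free_module_eq_on[OF K_ring M.ob_lm[OF z] _ _ _ c])
 show "(%c. pp_lift z (arr_map (PPr K C x) y z a c)) \<in>
   Lin K (free_module K (Arr C x y)) (ob_mod M z)"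
  using lin_comp[OF P.arr_linear[OF y z a, unfolded pp_ob] pp_lift_lin[OF z]] .
 show "(%c. arr_map M y z a (pp_lift y c)) : Lin K (free_module K (Arr C x y)) (ob_mod M z)"
  using lin_comp[OF pp_lift_lin[OF y] M.arr_linear[OF y z a]] .
 fix b k assume b: "b : Arr C x y" and k: "k : El K"
 show "pp_lift z (arr_map (PPr K C x) y z a (single (Reg K) b k)) =
  arr_map M y z a (pp_lift y (single (Reg K) b k))"
  by (simp add: pp_single[OF x y z a b k] pp_lift_single[OF z category.Comp_closed[OF C x y z b a] k]
    pp_lift_single[OF y b k] M.arr_Comp[OF x y z b a m]
    lin_smult[OF M.arr_linear[OF y z a] k M.arr_cl[OF x y b m]])
qed

end

lemma pp_generated:
 assumes x: "x : Ob C" and y: "y : Ob C"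
 shows "El (free_module K (Arr C x y)) <=
  gspan K C (PPr K C x) {(x, single (Reg K) (Ident C x) \<one>\<^sub>K)} B y"
proof
 interpret K: ring K by (rule K_ring)
 let ?P = "PPr K C x" and ?S = "gspan K C (PPr K C x) {(x, single (Reg K) (Ident C x) \<one>\<^sub>K)} B y"
 fix c assume "c : El (free_module K (Arr C x y))"
 thus "c : ?S"
  unfolding free_module_def
 proof (induction rule: fs_induct[OF regular_lm[OF K_ring], consumes 1, case_names zero add])
  case zero
  show ?case unfolding gspan_def using cspan.cspan_zero[of "ob_mod ?P y"] by (simp add: pp_ob free_module_def)
 next
  case (add b k c)
  have k: "k : El K" using add by simp
  have "arr_map ?P x y b (single (Reg K) (Ident C x) \<one>\<^sub>K) : ?S"
   by (rule gspan_arr) (use add in auto)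
  hence "single (Reg K) b \<one>\<^sub>K : ?S"
   using pp_single[OF x x y add(1) category.Ident_closed[OF C x] K.one_closed] category.Comp_Ident_right[OF C x y add(1)]
   by simp
  hence "k \<odot>\<^sub>(ob_mod ?P y) single (Reg K) b \<one>\<^sub>K : ?S"
   unfolding gspan_def by (rule cspan.cspan_smult[OF k])
  moreover have "k \<odot>\<^sub>(ob_mod ?P y) single (Reg K) b \<one>\<^sub>K = single (Reg K) b k"
   using k by (auto simp: pp_ob free_module_def single_def)
  ultimately have "single (Reg K) b k \<oplus>\<^sub>(ob_mod ?P y) c : ?S"
   using add.IH unfolding gspan_def by (simp add: cspan.cspan_add)
  thus ?case by (simp add: pp_ob free_module_def)
 qed
qed

end

definition fg :: "('k, 'y) ring_scheme => ('o, 'a) cat => ('o, 'a, 'k, 'm) cat_mod => bool" where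
 "fg K C M <-> fin_gen K C M (%x. El (ob_mod M x)) (%x. {\<zero>\<^sub>(ob_mod M x)})"

lemma fg_sub_mod: "fin_gen K C M S (%x. {\<zero>\<^sub>(ob_mod M x)}) ==> fg K C (sub_mod M S)"
 by (simp add: fg_def fin_gen_def gspan_def cspan_restr)

section \<open>Homology in degree zero\<close>

text \<open>In degree zero the group acts trivially on classes. By \<open>HomN_transitive\<close> a
  morphism is a group element after a standard arrow, so the images of the generators under standard
  arrows already generate.\<close>

lemma (in nc_mod) hfg_0:
 assumes "fg K NC M"
 shows "hfg 0"
proof -
 obtain Gs where Gs: "finite Gs" "!!n m. (n, m) : Gs ==> m : El (ob_mod M n)"
  "!!n. El (ob_mod M n) <= gspan K NC M Gs (%n. {\<zero>\<^sub>(ob_mod M n)}) n"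
  using assms NC_simps(1) unfolding fg_def fin_gen_def by blast
 define Hs where "Hs = (%(n, m). (n, single (ob_mod M n) ([] :: 'r ovi_arr list) m)) ` Gs"
 have nil: "[] : tuples (UU n) 0" for n by (simp)
 have HC: "z : El (C 0 n)" if "(n, z) : Hs" for n z
  using that single_cl[OF ob nil Gs(2)] by (auto simp: Hs_def)
 have single_H: "single (ob_mod M n) [] v : hspan Hs 0 n" if "v : El (ob_mod M n)" for n v
 proof -
  interpret r: grp_rep K "UU n" "ob_mod M n" "arr_map M n n" by (rule rep)
  interpret C0: left_module K "C 0 n" by (rule C_left)
  let ?V = "{v : El (ob_mod M n). single (ob_mod M n) [] v : hspan Hs 0 n}"
  have Vs: "submod K (ob_mod M n) ?V"
   by (rule submod_vimage[OF ob C_left single_lin[OF ob nil] hspan_sub[OF HC]])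
  have "gspan K NC M Gs (%n. {\<zero>\<^sub>(ob_mod M n)}) n <= ?V"
  proof (rule gspan_least[OF Vs])
   show "{\<zero>\<^sub>(ob_mod M n)} <= ?V" using subD(2)[OF Vs] by blast
   fix d m a assume dm: "(d, m) : Gs" and "a : Arr NC d n"
   hence a: "a : HomN d n" by (simp only: NC_simps)
   note m = Gs(2)[OF dm]
   obtain g where g: "g : HomN n n" "a = cN d n n g (sa d n (snd a))" using HomN_transitive[OF a] by blast
   note f = snd_oi[OF a]
   define v where "v = arr_map M d n (sa d n (snd a)) m"
   have v: "v : El (ob_mod M n)" unfolding v_def by (rule lin_cl[OF NC_lin[OF M sa_hom[OF f]] m])
   have av: "arr_map M d n a m = arr_map M n n g v"
    unfolding v_def by (subst g(2)) (rule NC_comp[OF M sa_hom[OF f] g(1) m])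
   have gU: "g : El (UU n)" using g(1) U_all by blast
   have gv: "arr_map M n n g v : El (ob_mod M n)" by (rule r.act_cl[OF gU v])
   have "tr 0 d n (snd a) (single (ob_mod M d) [] m) : hspan Hs 0 n"
    by (rule hspan_arr[OF _ f]) (use dm in \<open>force simp: Hs_def\<close>)
   hence vH: "single (ob_mod M n) [] v : hspan Hs 0 n"
    using rep_map.ch_single[OF map_rep[OF f] nil m] by (simp add: v_def)
   \<comment> \<open>Face 0 acts by the inverse of the entry, so the boundary of \<open>v[h]\<close>
     is \<open>g v - v\<close>.\<close>
   define h where "h = inv\<^bsub>UU n\<^esub> g"
   have h: "h : El (UU n)" "inv\<^bsub>UU n\<^esub> h = g" using gU by (simp_all add: h_def)
   have ht: "[h] : tuples (UU n) 1" using h by (simp)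
   have "bd 1 n (single (ob_mod M n) [h] v) = single (ob_mod M n) [] (arr_map M n n g v) \<ominus>\<^sub>(C 0 n) single (ob_mod M n) [] v"
   proof -
    define F where "F j = signed (C 0 n) j (bar_face (UU n) (ob_mod M n) (arr_map M n n) j [h] v)" for j
    have F: "F 0 = single (ob_mod M n) [] (arr_map M n n g v)" "F (Suc 0) = \<ominus>\<^sub>(C 0 n) single (ob_mod M n) [] v"
     by (simp_all add: F_def signed_def bar_face_def h(2))
    have Fc: "F 0 : El (C 0 n)" "F (Suc 0) : El (C 0 n)"
     unfolding F using single_cl[OF ob nil v] single_cl[OF ob nil gv] by simp_all
    have "bd 1 n (single (ob_mod M n) [h] v) = (\<Oplus>\<^sub>(C 0 n)j\<in>{..Suc 0}. F j)"
     using r.bar_bd_single[of "[h]" 0 v] ht v by (simp add: F_def atLeast0AtMost del: fs_simps)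
    also have "... = F (Suc 0) \<oplus>\<^sub>(C 0 n) F 0"
    proof -
     have "F : {..Suc 0} \<rightarrow> El (C 0 n)" using Fc by (auto simp: atMost_Suc)
     thus ?thesis using Fc(1) by (simp del: fs_simps)
    qed
    also have "... = \<ominus>\<^sub>(C 0 n) single (ob_mod M n) [] v \<oplus>\<^sub>(C 0 n) single (ob_mod M n) [] (arr_map M n n g v)"
     unfolding F ..
    finally show ?thesis
     using single_cl[OF ob nil v] single_cl[OF ob nil gv] C0.a_comm by (simp add: a_minus_def del: fs_simps)
   qed
   moreover have "bd 1 n (single (ob_mod M n) [h] v) : B 0 n"
    unfolding B_def using single_cl[OF ob ht v] by simp
   ultimately have "single (ob_mod M n) [] (arr_map M n n g v) \<ominus>\<^sub>(C 0 n) single (ob_mod M n) [] v : hspan Hs 0 n"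
    using hspan_B by auto
   from subD(3)[OF hspan_sub[OF HC] this vH]
   have "single (ob_mod M n) [] (arr_map M n n g v) : hspan Hs 0 n"
    using single_cl[OF ob nil v] single_cl[OF ob nil gv]
    by (simp add: a_minus_def C0.a_assoc C0.l_neg del: fs_simps)
   thus "arr_map M d n a m : ?V" using av gv by simp
  qed
  thus ?thesis using Gs(3) that by blast
 qed
 have "El (C 0 n) <= hspan Hs 0 n" for n
 proof
  fix c assume c: "c : El (C 0 n)"
  hence "c = single (ob_mod M n) [] (c [])"
   by (auto simp: single_def fs_iff)
  thus "c : hspan Hs 0 n" using single_H[OF fs_val[OF ob c]] by metis
 qed
 thus ?thesis unfolding hfg_iff Z_0 using HC Gs(1) by (intro exI[of _ Hs]) (auto simp: Hs_def)
qed

section \<open>Induction on the number of generators\<close>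

lemma (in ovi_cat) pp_nc_mod: "cring K ==> nc_mod R K (PPr K NC d)"
 by (intro nc_mod.intro nc_mod_axioms.intro ovi_cat_axioms pp_cat_module pull_category category_axioms NC_simps)

lemma (in ovi_cat) pp_fg:
 assumes K: "cring K"
 shows "fg K NC (PPr K NC d)"
proof -
 note C = pull_category[OF category_axioms, of "%n. std (od n)"]
 have "single (Reg K) (Ident NC d) \<one>\<^sub>K : El (free_module K (Arr NC d d))"
  by (rule free_single_cl[OF K_ring[OF K C] category.Ident_closed[OF C NC_simps(1)]])
   (rule monoid.one_closed[OF ring.is_monoid[OF K_ring[OF K C]]])
 thus ?thesis
  unfolding fg_def fin_gen_def pp_ob
  using pp_generated[OF K C NC_simps(1) NC_simps(1)] NC_simps(1)
  by (intro exI[of _ "{(d, single (Reg K) (Ident NC d) \<one>\<^sub>K)}"]) blast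
qed

lemma subfam_restr:
 assumes "subfam K C M S" "!!x. x : Ob C ==> S x <= S' x"
 shows "subfam K C (sub_mod M S') S"
 using assms by (auto simp: subfam_def submod_def)

text \<open>This is \<open>ovi_noetherian\<close> with \<open>B\<close> zero and the identity of
  \<open>d\<close> as the generator of \<open>P_d\<close>.\<close>

lemma (in ovi_fg) sub_pp_fg:
 assumes K: "cring K" and noeth: "noetherian_ring K" and S: "subfam K NC (PPr K NC d) S"
 shows "fg K NC (sub_mod (PPr K NC d) S)"
proof (rule fg_sub_mod)
 let ?P = "PPr K NC d"
 interpret P: nc_mod R K ?P by (rule pp_nc_mod[OF K])
 obtain Gs where Gs: "finite Gs" "!!n m. (n, m) : Gs ==> m : El (ob_mod ?P n)"
  "!!n. El (ob_mod ?P n) <= gspan K NC ?P Gs (%n. {\<zero>\<^sub>(ob_mod ?P n)}) n"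
  using pp_fg[OF K, of d] NC_simps(1) unfolding fg_def fin_gen_def by blast
 show "fin_gen K NC ?P S (%n. {\<zero>\<^sub>(ob_mod ?P n)})"
 proof (rule ovi_noetherian[OF P.M K noeth S cat_module.zero_subfam[OF P.M] _ Gs(1,2)])
  show "{\<zero>\<^sub>(ob_mod ?P n)} <= S n" for n
   using subD(2)[OF famD(1)[OF S NC_simps(1)]] by blast
  show "S n <= gspan K NC ?P Gs (%n. {\<zero>\<^sub>(ob_mod ?P n)}) n" for n
   using subD(1)[OF famD(1)[OF S NC_simps(1)]] Gs(3) by blast
 qed
qed

text \<open>A new generator at \<open>d\<close> adds the image of a map out of \<open>P_d\<close> to
  the submodule generated so far, and \<open>hfg_extension\<close> applies. Degree \<open>i\<close>
  enters only through the kernel, a submodule of some \<open>P_d\<close>; hence \<open>IH\<close> is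
  stated at the value type of \<open>P_d\<close> and not at that of \<open>M\<close>.\<close>

lemma (in ovi_fg) hfg_Suc:
 fixes K :: "('k, 'y) ring_scheme" and M :: "(nat, 'r ovi_arr, 'k, 'm) cat_mod"
 assumes K: "cring K" and noeth: "noetherian_ring K"
  and IH: "!!N :: (nat, 'r ovi_arr, 'k, 'r ovi_arr => 'k) cat_mod. nc_mod R K N ==> fg K NC N ==> nc_mod.hfg R K N i"
  and P: "!!d. nc_mod.hfg R K (PPr K NC d) (Suc i)"
  and M: "nc_mod R K M" and fg: "fg K NC M"
 shows "nc_mod.hfg R K M (Suc i)"
proof -
 interpret M: nc_mod R K M by (rule M)
 let ?S = "%G n. gspan K NC M G (%n. {\<zero>\<^sub>(ob_mod M n)}) n"
 note zs = cat_module.zero_subfam[OF M.M]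
 have Ssub: "subfam K NC M (?S G)" if "!!n m. (n, m) : G ==> m : El (ob_mod M n)" for G
  by (rule cat_module.gspan_subfam[OF M.M])
   (use that NC_simps(1) famD(2)[OF zs] subD(1)[OF famD(1)[OF zs]] in auto)
 have main: "nc_mod.hfg R K (sub_mod M (?S G)) (Suc i)"
  if "finite G" "!!n m. (n, m) : G ==> m : El (ob_mod M n)" for G
  using that
 proof (induction G rule: finite_induct)
  case empty
  interpret S: nc_mod R K "sub_mod M (?S {})" by (rule M.sub_nc_mod[OF Ssub]) simp
  have "?S {} n <= {\<zero>\<^sub>(ob_mod M n)}" for n
   by (rule gspan_least[OF submod_zero[OF M.ob]]) auto
  hence "c = (%_. \<zero>\<^sub>(ob_mod M n))" if "c : El (S.C (Suc i) n)" for c n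
   using fs_val[OF S.ob that] by auto
  hence "S.Z (Suc i) n <= S.hspan {} (Suc i) n" for n
   using S.Z_C[of _ "Suc i" n] subD(2)[OF S.hspan_sub[of "{}" "Suc i" n]] by auto
  thus ?case unfolding S.hfg_iff by (intro exI[of _ "{}"]) simp
 next
  case (insert q G)
  obtain d x where q: "q = (d, x)" by fastforce
  have x: "x : El (ob_mod M d)" and G: "!!n m. (n, m) : G ==> m : El (ob_mod M n)"
   using insert.prems q by auto
  let ?M' = "sub_mod M (?S (insert q G))"
  have S'sub: "subfam K NC M (?S (insert q G))" by (rule Ssub[OF insert.prems])
  interpret M': nc_mod R K ?M' by (rule M.sub_nc_mod[OF S'sub])
  interpret P: nc_mod R K "PPr K NC d" by (rule pp_nc_mod[OF K])
  let ?P = "PPr K NC d" and ?p = "pp_lift K ?M' d x"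
  note C = pull_category[OF category_axioms, of "%n. std (od n)"]
  have xM': "x : El (ob_mod ?M' d)"
   using cat_module.gspan_base[OF M.M _ NC_simps(1) x, of "insert q G"] q by simp
  note lift = K C M'.M NC_simps(1) xM' NC_simps(1)
  have pl: "?p n : Lin K (ob_mod ?P n) (ob_mod ?M' n)" for n
   unfolding pp_ob by (rule pp_lift_lin[OF lift])
  have "nc_map R K ?P ?M' ?p"
  proof (intro nc_map.intro nc_map_axioms.intro P.nc_mod_axioms M'.nc_mod_axioms pl)
   show "?p m (arr_map ?P n m \<phi> v) = arr_map ?M' n m \<phi> (?p n v)"
    if "\<phi> : HomN n m" "v : El (ob_mod ?P n)" for n m \<phi> v
    by (rule pp_lift_nat[OF lift NC_simps(1)]) (use that in \<open>simp_all only: NC_simps pp_ob\<close>)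
  qed
  then interpret p: nc_map R K ?P ?M' ?p .
  have SS: "?S G n <= ?S (insert q G) n" for n by (rule gspan_mono) blast
  have Gsub: "subfam K NC M (?S G)" by (rule Ssub[OF G])
  have S: "subfam K NC ?M' (?S G)" by (rule subfam_restr[OF Gsub SS])
  have cover: "EX y:El (ob_mod ?P n). EX w:?S G n. v = ?p n y \<oplus>\<^sub>(ob_mod ?M' n) w"
   if v: "v : El (ob_mod ?M' n)" for n v
  proof -
   let ?X = "{?p n y \<oplus>\<^sub>(ob_mod ?M' n) w |y w. y : El (ob_mod ?P n) & w : ?S G n}"
   interpret Mn: left_module K "ob_mod M n" by (rule M.ob)
   interpret Pn: left_module K "ob_mod ?P n" by (rule P.ob)
   note Sn = famD(1)[OF S NC_simps(1)] and S'n = famD(1)[OF S'sub NC_simps(1)]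
   have X': "submod K (ob_mod ?M' n) ?X" by (rule submod_image_sum[OF P.ob M'.ob pl Sn])
   have X: "submod K (ob_mod M n) ?X"
    by (rule submod_trans[OF _ subD(1)[OF S'n]]) (use X' in \<open>simp only: sub_mod_simps\<close>)
   have X0: "?S G n <= ?X"
   proof
    fix w assume w: "w : ?S G n"
    have "w : El (ob_mod M n)" using w subD(1)[OF famD(1)[OF Gsub NC_simps(1)]] by blast
    hence "w = ?p n \<zero>\<^sub>(ob_mod ?P n) \<oplus>\<^sub>(ob_mod ?M' n) w"
     by (simp add: lin_zero[OF P.ob M'.ob pl])
    thus "w : ?X" using w Pn.zero_closed by blast
   qed
   have "?S (insert q G) n <= ?X"
   proof (rule gspan_least[OF X])
    show "{\<zero>\<^sub>(ob_mod M n)} <= ?X" using subD(2)[OF X] by blast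
    fix d' m a assume dm: "(d', m) : insert q G" and a: "a : Arr NC d' n"
    show "arr_map M d' n a m : ?X"
    proof (cases "(d', m) : G")
     case True
     thus ?thesis using gspan_arr[OF True a] X0 by blast
    next
     case False
     hence [simp]: "d' = d" "m = x" using dm q by auto
     let ?s = "single (Reg K) a \<one>\<^sub>K"
     have s: "?s : El (ob_mod ?P n)"
      unfolding pp_ob by (rule free_single_cl[OF Mn.R.ring_axioms]) (use a in auto)
     have "?p n ?s = \<one>\<^sub>K \<odot>\<^sub>(ob_mod ?M' n) arr_map ?M' d n a x"
      by (rule pp_lift_single[OF lift]) (use a in auto)
     hence "?p n ?s = arr_map M d n a x"
      using Mn.smult_one[of "arr_map M d n a x"] cat_module.arr_cl[OF M.M NC_simps(1) NC_simps(1) _ x] a by simp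
     moreover have "\<zero>\<^sub>(ob_mod M n) : ?S G n" by (rule gspan_B) simp
     moreover have "arr_map M d n a x = arr_map M d n a x \<oplus>\<^sub>(ob_mod ?M' n) \<zero>\<^sub>(ob_mod M n)"
      using cat_module.arr_cl[OF M.M NC_simps(1) NC_simps(1) _ x] a by simp
     ultimately show ?thesis using s by simp metis
    qed
   qed
   moreover have "v : ?S (insert q G) n" using v by simp
   ultimately show ?thesis by blast
  qed
  have kern: "subfam K NC ?P (p.kern (?S G))" by (rule p.kern_sub[OF S cover])
  have "nc_mod.hfg R K (sub_mod ?P (p.kern (?S G))) i"
   by (rule IH[OF P.sub_nc_mod[OF kern] sub_pp_fg[OF K noeth kern]])
  moreover have "sub_mod ?M' (?S G) = sub_mod M (?S G)" by (simp add: sub_mod_def)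
  ultimately show ?case
   using p.hfg_extension[OF S cover ovi_fg_axioms noeth _ P] insert.IH[OF G] by simp
 qed
 obtain Gs where Gs: "finite Gs" "!!n m. (n, m) : Gs ==> m : El (ob_mod M n)"
  "!!n. El (ob_mod M n) <= ?S Gs n"
  using fg NC_simps(1) unfolding fg_def fin_gen_def by blast
 have "?S Gs n = El (ob_mod M n)" for n
  using Gs(3) subD(1)[OF famD(1)[OF Ssub[OF Gs(2)] NC_simps(1)]] by blast
 hence "sub_mod M (?S Gs) = M" by (simp add: sub_mod_def)
 thus ?thesis using main[OF Gs(1,2)] by simp
qed

section \<open>Homology with coefficients in principal projectives\<close>

lemma eval_lin: "(%c. c y) : Lin K (FS W Y) W" if "LMod K W"
 by (rule linI) (use fs_val[OF that] in auto)

lemma fsm_inj_val: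
 assumes V: "LMod K V" and W: "LMod K W"
  and \<phi>: "!!x. x : X ==> \<phi> x : Y" and inj: "inj_on \<phi> X" and u: "u : Lin K V W"
  and c: "c : El (FS V X)" and x: "x : X"
 shows "finsupp_map V W Y \<phi> u c (\<phi> x) = u (c x)"
proof (rule lin_eqI[OF V W lin_comp[OF fsm_lin[OF V W \<phi> u] eval_lin[OF W]]
   lin_comp[OF eval_lin[OF V] u] _ c])
 fix x' m assume x': "x' : X" and m: "m : El V"
 have "\<phi> x' = \<phi> x <-> x' = x" using inj x x' by (auto simp: inj_on_def)
 thus "finsupp_map V W Y \<phi> u (single V x' m) (\<phi> x) = u (single V x' m x)"
  using fsm_single[OF V W \<phi> u x' m] lin_zero[OF V W u] by (auto simp: single_def)
qed

lemma lin_into_sub: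
 assumes V: "LMod K V" and W: "LMod K W" and f: "f : Lin K (FS V X) W"
  and N: "submod K W N" and "!!x m. x : X ==> m : El V ==> f (single V x m) : N"
  and c: "c : El (FS V X)"
 shows "f c : N"
 using c
proof (induction rule: fs_induct[OF V, consumes 1, case_names zero add])
 case zero
 show ?case using lin_zero[OF fs_lm[OF V] W f] subD(2)[OF N] by simp
next
 case (add x m c)
 have "f (single V x m \<oplus>\<^sub>(FS V X) c) = f (single V x m) \<oplus>\<^sub>W f c"
  by (rule lin_add[OF f single_cl[OF V add(1,2)] add(3)])
 thus ?case using subD(3)[OF N assms(5)[OF add(1,2)] add.IH] by simp
qed

locale pp_homol = ovi_fg R L ge for R :: "('r, 'x) ring_scheme" (structure) and L ge +
 fixes K :: "('k, 'y) ring_scheme"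
 assumes K: "cring K" and noeth: "noetherian_ring K"
begin

abbreviation "PP d == PPr K NC d"
abbreviation "V d n == ob_mod (PP d) n"
abbreviation "s == single (Reg K)"

sublocale P: nc_mod R K "PP d" for d
 by (rule pp_nc_mod[OF K])

lemma NC_cat: "category NC"
 by (rule pull_category[OF category_axioms])

lemma KR: "ring K"
 by (rule K_ring[OF K NC_cat])

lemma Kr: "LMod K (Reg K)"
 by (rule regular_lm[OF KR])

lemma V_eq: "V d n = free_module K (HomN d n)"
 unfolding pp_ob NC_simps ..

lemma V_eq': "V d n = FS (Reg K) (HomN d n)"
 unfolding V_eq free_module_def ..

lemma s_cl: "x : HomN d n ==> k : El K ==> s x k : El (V d n)"
 unfolding V_eq by (rule free_single_cl[OF KR])

lemma arr_s: "x : HomN d n ==> \<phi> : HomN n m ==> k : El K ==> arr_map (PP d) n m \<phi> (s x k) = s (cN d n m \<phi> x) k"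
 using pp_single[OF K NC_cat NC_simps(1) NC_simps(1) NC_simps(1), unfolded NC_simps] by (simp)

lemma V_eq_on:
 assumes "LMod K D" "f : Lin K (V d n) D" "g : Lin K (V d n) D"
  and "!!x k. x : HomN d n ==> k : El K ==> f (s x k) = g (s x k)" and "v : El (V d n)"
 shows "f v = g v"
 using free_module_eq_on[OF KR assms(1), of f "HomN d n" g v] assms(2-5) unfolding V_eq by blast

lemma CC_eq_on:
 assumes D: "LMod K D" and f: "f : Lin K (P.C d i n) D" and g: "g : Lin K (P.C d i n) D"
  and eq: "!!gs x k. gs : tuples (UU n) i ==> x : HomN d n ==> k : El K ==>
   f (single (V d n) gs (s x k)) = g (single (V d n) gs (s x k))" and c: "c : El (P.C d i n)"
 shows "f c = g c"
proof (rule lin_eqI[OF P.ob D f g _ c])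
 fix gs m assume gs: "gs : tuples (UU n) i" and m: "m : El (V d n)"
 show "f (single (V d n) gs m) = g (single (V d n) gs m)"
  by (rule V_eq_on[OF D lin_comp[OF single_lin[OF P.ob gs] f] lin_comp[OF single_lin[OF P.ob gs] g] eq[OF gs] m])
qed

lemma CC_into:
 assumes D: "LMod K D" and f: "f : Lin K (P.C d i n) D" and N: "submod K D N"
  and eq: "!!gs x k. gs : tuples (UU n) i ==> x : HomN d n ==> k : El K ==>
   f (single (V d n) gs (s x k)) : N" and c: "c : El (P.C d i n)"
 shows "f c : N"
proof (rule lin_into_sub[OF P.ob D f N _ c])
 fix gs m assume gs: "gs : tuples (UU n) i" and m: "m : El (V d n)"
 have lin: "(%m. f (single (V d n) gs m)) : Lin K (FS (Reg K) (HomN d n)) D"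
  unfolding V_eq'[symmetric] by (rule lin_comp[OF single_lin[OF P.ob gs] f])
 have m': "m : El (FS (Reg K) (HomN d n))" using m unfolding V_eq' .
 show "f (single (V d n) gs m) : N"
  by (rule lin_into_sub[OF Kr D lin N _ m']) (use eq[OF gs] in simp)
qed

subsection \<open>Partially defined maps of bases\<close>

text \<open>The maps needed below send a basis morphism to a basis morphism or to zero: the
  projections \<open>last_part\<close> and \<open>low_part\<close>, the restriction
  \<open>lam\<close>, and the lift along it.\<close>

definition pm :: "nat => nat => ('r ovi_arr => bool) => ('r ovi_arr => 'r ovi_arr) => ('r ovi_arr => 'k) => 'r ovi_arr => 'k" where
 "pm l m A \<theta> = free_lift K (V l m) (%x. if A x then s (\<theta> x) \<one>\<^sub>K else \<zero>\<^sub>(V l m))"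

abbreviation pmc :: "nat => nat => ('r ovi_arr => bool) => ('r ovi_arr => 'r ovi_arr) =>
  ('r ovi_arr list => 'r ovi_arr => 'k) => 'r ovi_arr list => 'r ovi_arr => 'k" where
 "pmc l m A \<theta> c == (%gs. pm l m A \<theta> (c gs))"

context
 fixes d n l m A \<theta>
 assumes \<theta>: "!!x. x : HomN d n ==> A x ==> \<theta> x : HomN l m"
begin

lemma pm_F: "x : HomN d n ==> (if A x then s (\<theta> x) \<one>\<^sub>K else \<zero>\<^sub>(V l m)) : El (V l m)"
proof -
 interpret V: left_module K "V l m" by (rule P.ob)
 assume "x : HomN d n"
 thus ?thesis using s_cl[OF \<theta> V.R.one_closed] by simp
qed

lemma pm_lin: "pm l m A \<theta> : Lin K (V d n) (V l m)"
 unfolding pm_def V_eq[of d n] by (rule free_lift_lin[OF KR P.ob pm_F])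

lemma pm_s: "x : HomN d n ==> k : El K ==> pm l m A \<theta> (s x k) = (if A x then s (\<theta> x) k else \<zero>\<^sub>(V l m))"
proof -
 interpret V: left_module K "V l m" by (rule P.ob)
 assume x: "x : HomN d n" and k: "k : El K"
 have "pm l m A \<theta> (s x k) = k \<odot>\<^sub>(V l m) (if A x then s (\<theta> x) \<one>\<^sub>K else \<zero>\<^sub>(V l m))"
  unfolding pm_def by (rule free_lift_single[OF KR P.ob pm_F x k])
 also have "... = (if A x then s (\<theta> x) k else \<zero>\<^sub>(V l m))"
  using k by (auto simp: V_eq' single_def)
 finally show ?thesis .
qed

lemma pmc_lin:
 assumes "n = m"
 shows "pmc l m A \<theta> : Lin K (P.C d i n) (P.C l i m)"
 using values_lin[OF P.ob P.ob pm_lin] unfolding assms .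

lemma pmc_single:
 assumes "x : HomN d n" "k : El K"
 shows "pmc l m A \<theta> (single (V d n) gs (s x k)) =
  (if A x then single (V l m) gs (s (\<theta> x) k) else (%_. \<zero>\<^sub>(V l m)))"
 using values_single[OF P.ob P.ob pm_lin, where m = "s x k" and x = gs] pm_s[OF assms] by (simp add: single_zero[OF P.ob])

lemma pmc_bd:
 assumes nm: "n = m" and A: "!!g x. g : HomN n n ==> x : HomN d n ==> A (cN d n n g x) = A x"
  and eq: "!!g x. g : HomN n n ==> x : HomN d n ==> A x ==> \<theta> (cN d n n g x) = cN l n n g (\<theta> x)"
  and c: "c : El (P.C d (Suc i) n)"
 shows "P.bd l (Suc i) m (pmc l m A \<theta> c) = pmc l m A \<theta> (P.bd d (Suc i) n c)"
 unfolding nm[symmetric]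
proof (rule rep_map_values[where u = "pm l n A \<theta>", OF P.rep P.rep _ _ c])
 note [simp] = nm[symmetric]
 show lin: "pm l n A \<theta> : Lin K (V d n) (V l n)" using pm_lin by simp
 fix g v assume "g : El (UU n)" and v: "v : El (V d n)"
 hence g: "g : HomN n n" by (simp add: U_hom)
 show "pm l n A \<theta> (arr_map (PP d) n n g v) = arr_map (PP l) n n g (pm l n A \<theta> v)"
 proof (rule V_eq_on[OF P.ob lin_comp[OF NC_lin[OF P.M g] lin] lin_comp[OF lin NC_lin[OF P.M g]] _ v])
  fix x k assume x: "x : HomN d n" and k: "k : El K"
  show "pm l n A \<theta> (arr_map (PP d) n n g (s x k)) = arr_map (PP l) n n g (pm l n A \<theta> (s x k))"
  proof (cases "A x")
   case True
   have "\<theta> x : HomN l n" using \<theta>[OF x True] by simp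
   thus ?thesis
    using arr_s[OF x g k] pm_s[OF x k] pm_s[OF cN_hom[OF x g] k] A[OF g x] eq[OF g x] arr_s[OF _ g k] True by simp
  next
   case False
   thus ?thesis
    using arr_s[OF x g k] pm_s[OF x k] pm_s[OF cN_hom[OF x g] k] A[OF g x]
     lin_zero[OF P.ob P.ob NC_lin[OF P.M g]] by simp
  qed
 qed
qed

end

subsection \<open>Shapiro's lemma for the maps hitting the last basis vector\<close>

definition p1 :: "nat => nat => ('r ovi_arr => 'k) => 'r ovi_arr => 'k" where
 "p1 d n = finsupp_map (Reg K) (Reg K) (HomN (Suc d) (Suc n)) (plus1 d n) (%k. k)"

abbreviation pc1 :: "nat => nat => nat => ('r ovi_arr list => 'r ovi_arr => 'k) => 'r ovi_arr list => 'r ovi_arr => 'k" where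
 "pc1 d i n == finsupp_map (V d n) (V (Suc d) (Suc n)) (tuples (UU (Suc n)) i) (map (pN n (Suc n) (inc n))) (p1 d n)"

lemma p1_lin: "p1 d n : Lin K (V d n) (V (Suc d) (Suc n))"
 unfolding p1_def V_eq' by (rule fsm_lin[OF Kr Kr plus1_hom lin_id])

lemma p1_s: "x : HomN d n ==> k : El K ==> p1 d n (s x k) = s (plus1 d n x) k"
 unfolding p1_def by (rule fsm_single[OF Kr Kr plus1_hom lin_id]) simp_all

lemma p1_val:
 assumes "v : El (V d n)" "x : HomN d n"
 shows "p1 d n v (plus1 d n x) = v x"
 unfolding p1_def
 by (rule fsm_inj_val[OF Kr Kr plus1_hom _ lin_id]) (use assms plus1_inj in \<open>auto simp: V_eq' inj_on_def\<close>)

lemma p1_rep: "rep_map K (UU n) (V d n) (arr_map (PP d) n n) (UU (Suc n)) (V (Suc d) (Suc n))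
  (arr_map (PP (Suc d)) (Suc n) (Suc n)) (pN n (Suc n) (inc n)) (p1 d n)"
proof (intro rep_map.intro rep_map_axioms.intro P.rep)
 show "pN n (Suc n) (inc n) : hom (UU n) (UU (Suc n))" by (rule push_group_hom[OF od_Ob od_Ob inc_oi])
 show "p1 d n : Lin K (V d n) (V (Suc d) (Suc n))" by (rule p1_lin)
 fix g v assume "g : El (UU n)" and v: "v : El (V d n)"
 hence g: "g : HomN n n" by (simp add: U_hom)
 note pg = push_hom[OF od_Ob od_Ob inc_oi g]
 show "p1 d n (arr_map (PP d) n n g v) = arr_map (PP (Suc d)) (Suc n) (Suc n) (pN n (Suc n) (inc n) g) (p1 d n v)"
  by (rule V_eq_on[OF P.ob lin_comp[OF NC_lin[OF P.M g] p1_lin] lin_comp[OF p1_lin NC_lin[OF P.M pg]] _ v])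
    (simp add: arr_s[OF _ g] p1_s cN_hom[OF _ g] arr_s[OF plus1_hom pg] plus1_push[OF _ g])
qed

lemma pc1_lin: "pc1 d i n : Lin K (P.C d i n) (P.C (Suc d) i (Suc n))"
 by (rule rep_map.ch_lin[OF p1_rep])

lemma pc1_bd: "c : El (P.C d (Suc i) n) ==>
  P.bd (Suc d) (Suc i) (Suc n) (pc1 d (Suc i) n c) = pc1 d i n (P.bd d (Suc i) n c)"
 by (rule rep_map.ch_boundary[OF p1_rep])

lemma pc1_single: "gs : tuples (UU n) i ==> x : HomN d n ==> k : El K ==>
  pc1 d i n (single (V d n) gs (s x k)) =
   single (V (Suc d) (Suc n)) (map (pN n (Suc n) (inc n)) gs) (s (plus1 d n x) k)"
 using rep_map.ch_single[OF p1_rep _ s_cl] by (simp add: p1_s)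

text \<open>Both \<open>plus1\<close> and \<open>push\<close> along \<open>inc n\<close> are
  injective. This is used to recognise cycles through \<open>pc1\<close>.\<close>

lemma pc1_zero:
 assumes c: "c : El (P.C d i n)" and zero: "pc1 d i n c = (%_. \<zero>\<^sub>(V (Suc d) (Suc n)))"
 shows "c = (%_. \<zero>\<^sub>(V d n))"
proof
 fix gs
 show "c gs = \<zero>\<^sub>(V d n)"
 proof (cases "gs : tuples (UU n) i")
  case True
  have inj: "inj_on (map (pN n (Suc n) (inc n))) (tuples (UU n) i)"
  proof (rule inj_onI)
   fix gs hs assume gh: "gs : tuples (UU n) i" "hs : tuples (UU n) i"
    and eq: "map (pN n (Suc n) (inc n)) gs = map (pN n (Suc n) (inc n)) hs"
   have "inj_on (pN n (Suc n) (inc n)) (El (UU n))" by (rule inj_onI, rule push_inj[OF U_hom U_hom])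
   hence "inj_on (pN n (Suc n) (inc n)) (set gs \<union> set hs)"
    by (rule inj_on_subset) (use gh in \<open>simp add: tup_iff\<close>)
   thus "gs = hs" by (rule map_inj_on[OF eq])
  qed
  have "pc1 d i n c (map (pN n (Suc n) (inc n)) gs) = p1 d n (c gs)"
  proof (rule fsm_inj_val[where X = "tuples (UU n) i", OF P.ob P.ob _ inj p1_lin c True])
   show "map (pN n (Suc n) (inc n)) gs : tuples (UU (Suc n)) i" if "gs : tuples (UU n) i" for gs
    using rep_map.map_\<phi>_tuples[OF p1_rep that] .
  qed
  hence "p1 d n (c gs) = \<zero>\<^sub>(V (Suc d) (Suc n))" using zero by simp
  hence "c gs x = \<zero>\<^sub>K" if "x : HomN d n" for x
   using p1_val[OF fs_val[OF P.ob c] that, of gs] by (simp add: V_eq')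
  thus ?thesis
   using fs_val[OF P.ob c, of gs] unfolding V_eq' fs_iff fs_simps regular_module_simps
   by (intro ext) metis
 next
  case False
  thus ?thesis using c by (simp add: fs_iff)
 qed
qed

text \<open>Pivots increase, so the last basis vector is hit exactly if it is the pivot of the last
  column. The condition is invariant because automorphisms leave pivots unchanged.\<close>

abbreviation last_part :: "nat => nat => ('r ovi_arr list => 'r ovi_arr => 'k) => 'r ovi_arr list => 'r ovi_arr => 'k" where
 "last_part d n == pmc (Suc d) (Suc n) (%x. snd x d = n) (%x. x)"

lemma last_part_lin: "last_part d n : Lin K (P.C (Suc d) i (Suc n)) (P.C (Suc d) i (Suc n))"
 by (rule pmc_lin) simp_all

lemma snd_act: "g : HomN n n ==> x : HomN d n ==> j < d ==> snd (cN d n n g x) j = snd x j"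
 using oi_less[OF snd_oi] by (simp add: snd_cN snd_endo compose_def)

lemma last_part_bd: "c : El (P.C (Suc d) (Suc i) (Suc n)) ==>
  P.bd (Suc d) (Suc i) (Suc n) (last_part d n c) = last_part d n (P.bd (Suc d) (Suc i) (Suc n) c)"
 by (rule pmc_bd) (simp_all add: snd_act)

text \<open>By \<open>factor_plus1\<close> and \<open>plus1_stabilizer\<close> the morphisms hitting
  the last basis vector are induced from \<open>U_n\<close>. Moving vertices by suitable coset
  representatives keeps the class and forces all bar entries into the image of \<open>U_n\<close>
  and all coefficients into the image of \<open>plus1\<close>, so that the moved chain comes from
  \<open>pc1\<close>.\<close>

theorem shapiro:
 assumes z: "z : P.Z (Suc d) (Suc i) (Suc n)"
 shows "EX z':P.Z d (Suc i) n. EX b:El (P.C (Suc d) (Suc (Suc i)) (Suc n)).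
  P.bd (Suc d) (Suc (Suc i)) (Suc n) b = pc1 d (Suc i) n z' \<ominus>\<^sub>(P.C (Suc d) (Suc i) (Suc n)) last_part d n z"
proof -
 let ?X = "HomN (Suc d) (Suc n)" and ?G = "UU (Suc n)"
 let ?mv = "%g x. cN (Suc d) (Suc n) (Suc n) g x"
 have GX: "g : El ?G <-> g : HomN (Suc n) (Suc n)" for g using U_all by simp
 interpret G: group ?G using U_group[OF od_Ob] .
 have mv_mult: "?mv (g \<otimes>\<^sub>?G h) x = ?mv g (?mv h x)"
  if "g : El ?G" "h : El ?G" "x : ?X" for g h x
  using cN_assoc[OF that(3)] that(1,2) by (simp add: U_mult GX)
 have mv_one: "?mv \<one>\<^sub>?G x = x" if "x : ?X" for x
  using idN(2)[OF that] by (simp add: U_one idN_def)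
 have mv_X: "?mv g x : ?X" if "g : El ?G" "x : ?X" for g x
  using cN_hom[OF that(2)] that(1) by (simp add: GX)
 have "ALL x. EX c x'. x : ?X & snd x d = n --> c : El ?G & x' : HomN d n & x = ?mv c (plus1 d n x')"
  using factor_plus1 GX by meson
 then obtain cf xf where cf: "!!x. x : ?X ==> snd x d = n ==>
   cf x : El ?G & xf x : HomN d n & x = ?mv (cf x) (plus1 d n (xf x))" by metis
 have cf': "?mv (inv\<^bsub>?G\<^esub> cf x) x = plus1 d n (xf x)" if "x : ?X" "snd x d = n" for x
 proof -
  note c = cf[OF that]
  have "?mv (inv\<^bsub>?G\<^esub> cf x) (?mv (cf x) (plus1 d n (xf x))) = plus1 d n (xf x)"
   using mv_mult[of "inv\<^bsub>?G\<^esub> cf x" "cf x" "plus1 d n (xf x)"] mv_one plus1_hom c by simp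
  thus ?thesis using c by simp
 qed
 \<comment> \<open>Vertex \<open>g\<close> is multiplied on the right by the element chosen for
   \<open>g^-1 x\<close>, so that the inverse of the new vertex carries \<open>x\<close> into the
   image of \<open>plus1\<close>. Using \<open>g^-1 x\<close> makes \<open>\<rho>\<close>
   equivariant. Morphisms that miss the last basis vector keep their vertices.\<close>
 define \<rho> where "\<rho> x g = (if snd x d = n then g \<otimes>\<^sub>?G cf (?mv (inv\<^bsub>?G\<^esub> g) x) else g)" for x g
 have last_mv: "snd (?mv g x) d = n <-> snd x d = n" if "g : El ?G" "x : ?X" for g x
  using snd_act[of g "Suc n" x "Suc d" d] that by (simp add: GX)
 interpret perm_rep K ?G ?X "arr_map (PP (Suc d)) (Suc n) (Suc n)" ?mv \<rho>
 proof (intro perm_rep.intro perm_rep_axioms.intro)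
  show "grp_rep K ?G (free_module K ?X) (arr_map (PP (Suc d)) (Suc n) (Suc n))"
   using P.rep[of "Suc n" "Suc d"] unfolding V_eq .
  show "arr_map (PP (Suc d)) (Suc n) (Suc n) g (s x k) = s (?mv g x) k"
   if "g : El ?G" "x : ?X" "k : El K" for g x k
   using arr_s[OF that(2) _ that(3)] that(1) GX by blast
  show "?mv g x : ?X" if "g : El ?G" "x : ?X" for g x by (rule mv_X[OF that])
  show "\<rho> x g : El ?G" if "x : ?X" "g : El ?G" for x g
   using that cf[OF mv_X[of "inv\<^bsub>?G\<^esub> g" x]] last_mv[of "inv\<^bsub>?G\<^esub> g" x] by (auto simp: \<rho>_def)
  show "\<rho> (?mv g x) (g \<otimes>\<^sub>?G h) = g \<otimes>\<^sub>?G \<rho> x h" if "x : ?X" "g : El ?G" "h : El ?G" for x g h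
  proof -
   have "?mv (inv\<^bsub>?G\<^esub> (g \<otimes>\<^sub>?G h)) (?mv g x) = ?mv (inv\<^bsub>?G\<^esub> h) x"
    using that mv_mult[of "inv\<^bsub>?G\<^esub> (g \<otimes>\<^sub>?G h)" g x] by (simp add: G.inv_mult_group G.m_assoc)
   thus ?thesis
    using that last_mv[of g x] last_mv[of "inv\<^bsub>?G\<^esub> h" x] cf[OF mv_X[of "inv\<^bsub>?G\<^esub> h" x]] by (auto simp: \<rho>_def G.m_assoc)
  qed
 qed
 have inv_\<rho>: "?mv (inv\<^bsub>?G\<^esub> \<rho> x h) x = plus1 d n (xf (?mv (inv\<^bsub>?G\<^esub> h) x)) & xf (?mv (inv\<^bsub>?G\<^esub> h) x) : HomN d n"
  if x: "x : ?X" "snd x d = n" and h: "h : El ?G" for x h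
 by (use mv_X last_mv x h mv_mult cf \<rho>_def G.inv_mult_group cf' in \<open>auto\<close>)
 \<comment> \<open>The inverses of two moved vertices both carry \<open>x\<close> into the image of
   \<open>plus1\<close>, so their quotient takes one such morphism to another and comes from
   \<open>U_n\<close>.\<close>
 have stab: "EX g:El (UU n). inv\<^bsub>?G\<^esub> \<rho> x h \<otimes>\<^sub>?G \<rho> x h' = pN n (Suc n) (inc n) g"
  if x: "x : ?X" "snd x d = n" and h: "h : El ?G" "h' : El ?G" for x h h'
 proof -
  note i = inv_\<rho>[OF x h(1)] and i' = inv_\<rho>[OF x h(2)]
  have \<rho>c: "\<rho> x h : El ?G" "\<rho> x h' : El ?G" using \<rho>_closed x h by auto
  have "?mv (inv\<^bsub>?G\<^esub> \<rho> x h \<otimes>\<^sub>?G \<rho> x h') (?mv (inv\<^bsub>?G\<^esub> \<rho> x h') x) = ?mv (inv\<^bsub>?G\<^esub> \<rho> x h) x"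
   using mv_mult[of "inv\<^bsub>?G\<^esub> \<rho> x h \<otimes>\<^sub>?G \<rho> x h'" "inv\<^bsub>?G\<^esub> \<rho> x h'" x] \<rho>c x by (simp add: G.m_assoc)
  hence "?mv (inv\<^bsub>?G\<^esub> \<rho> x h \<otimes>\<^sub>?G \<rho> x h') (plus1 d n (xf (?mv (inv\<^bsub>?G\<^esub> h') x))) = plus1 d n (xf (?mv (inv\<^bsub>?G\<^esub> h) x))"
   using i i' by simp
  from plus1_stabilizer[OF conjunct2[OF i'] conjunct2[OF i] _ this]
  show ?thesis using \<rho>c U_all[of n] GX by (metis G.inv_closed G.m_closed)
 qed
 have quots_image: "EX gs':tuples (UU n) (length gs - 1). quots gs = map (pN n (Suc n) (inc n)) gs'"
  if "x : ?X" "snd x d = n" "set gs <= \<rho> x ` El ?G" for x gs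
  using that(3)
 proof (induction gs rule: quots.induct)
  note st = stab[OF that(1,2)]
  case (1 a b l)
  then obtain gs' where gs': "gs' : tuples (UU n) (length (b # l) - 1)" "quots (b # l) = map (pN n (Suc n) (inc n)) gs'"
   by auto
  obtain h h' where "h : El ?G" "h' : El ?G" "a = \<rho> x h" "b = \<rho> x h'" using 1(2) by auto
  then obtain g where "g : El (UU n)" "inv\<^bsub>?G\<^esub> a \<otimes>\<^sub>?G b = pN n (Suc n) (inc n) g" using st by blast
  thus ?case using gs' by (intro bexI[of _ "g # gs'"]) (auto)
 qed (auto simp: tup_iff)
 define F where "F z = qmap (Suc i) (vmap' (Suc (Suc i)) (smap (Suc i) z))" for z
 have F_linear: "F : Lin K (P.C (Suc d) (Suc i) (Suc n)) (P.C (Suc d) (Suc i) (Suc n))"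
  unfolding F_def V_eq by (rule perm_homotopy_lin)
 let ?I = "pc1 d (Suc i) n ` El (P.C d (Suc i) n)"
 note zC = P.Z_C[OF z]
 have "F (last_part d n z) : ?I"
 proof (rule CC_into[OF P.C_left lin_comp[OF last_part_lin F_linear] _ _ zC])
  show "submod K (P.C (Suc d) (Suc i) (Suc n)) ?I"
   by (rule submod_image[OF P.C_left P.C_left pc1_lin submod_carrier[OF P.C_left]])
  hence zero: "\<zero>\<^sub>(P.C (Suc d) (Suc i) (Suc n)) : ?I" by (rule subD(2))
  fix gs x k assume gs: "gs : tuples ?G (Suc i)" and x: "x : ?X" and k: "k : El K"
  note lp = pmc_single[of "Suc d" "Suc n" "%x. snd x d = n" "%x. x" "Suc d" "Suc n" x k gs, OF _ x k]
  show "F (last_part d n (single (V (Suc d) (Suc n)) gs (s x k))) : ?I"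
  proof (cases "snd x d = n")
   case False
   thus ?thesis using lp lin_zero[OF P.C_left P.C_left F_linear] zero by simp
  next
   case True
   have pp: "pprods \<one>\<^sub>?G gs : tuples ?G (Suc (Suc i))" by (rule pprods_tuples[OF G.one_closed gs])
   hence "set (map (\<rho> x) (pprods \<one>\<^sub>?G gs)) <= \<rho> x ` El ?G" by (auto simp: tup_iff)
   then obtain gs' where gs': "gs' : tuples (UU n) (Suc i)"
     "quots (map (\<rho> x) (pprods \<one>\<^sub>?G gs)) = map (pN n (Suc n) (inc n)) gs'"
    using quots_image[OF x True, of "map (\<rho> x) (pprods \<one>\<^sub>?G gs)"] pp by (auto simp: tup_iff)
   obtain y where y: "y : HomN d n" "?mv (inv\<^bsub>?G\<^esub> \<rho> x \<one>\<^sub>?G) x = plus1 d n y"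
    using inv_\<rho>[OF x True G.one_closed] by blast
   have "F (single (V (Suc d) (Suc n)) gs (s x k)) = pc1 d (Suc i) n (single (V d n) gs' (s y k))"
    unfolding F_def V_eq perm_homotopy_single[OF gs x k]
    unfolding pc1_single[OF gs'(1) y(1) k, unfolded V_eq] gs'(2) y(2) ..
   thus ?thesis using lp True single_cl[OF P.ob gs'(1) s_cl[OF y(1) k]] by simp
  qed
 qed
 then obtain z' where z': "z' : El (P.C d (Suc i) n)" "F (last_part d n z) = pc1 d (Suc i) n z'" by blast
 have lz: "last_part d n z : El (P.C (Suc d) (Suc i) (Suc n))" by (rule lin_cl[OF last_part_lin zC])
 have lb: "P.bd (Suc d) (Suc i) (Suc n) (last_part d n z) = (%_. \<zero>\<^sub>(V (Suc d) (Suc n)))"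
  using last_part_bd[OF zC] z lin_zero[OF P.C_left P.C_left last_part_lin] unfolding P.Z_Suc by simp
 obtain b where b: "b : El (P.C (Suc d) (Suc (Suc i)) (Suc n))"
  "P.bd (Suc d) (Suc (Suc i)) (Suc n) b = pc1 d (Suc i) n z' \<ominus>\<^sub>(P.C (Suc d) (Suc i) (Suc n)) last_part d n z"
  using perm_homotopy[of "last_part d n z" i, folded V_eq F_def, OF lz lb, unfolded z'(2)] by blast
 interpret C: left_module K "P.C (Suc d) i (Suc n)" by (rule P.C_left)
 note pz = lin_cl[OF pc1_lin z'(1)]
 have "P.bd (Suc d) (Suc i) (Suc n) (pc1 d (Suc i) n z') \<ominus>\<^sub>(P.C (Suc d) i (Suc n)) \<zero>\<^sub>(P.C (Suc d) i (Suc n)) =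
   \<zero>\<^sub>(P.C (Suc d) i (Suc n))"
  using P.bd_bd[OF b(1)] unfolding b(2) lin_diff[OF P.C_left P.C_left P.bd_lin pz lz] lb fs_simps(1) .
 hence "P.bd (Suc d) (Suc i) (Suc n) (pc1 d (Suc i) n z') = \<zero>\<^sub>(P.C (Suc d) i (Suc n))"
  unfolding a_minus_def trans[OF C.M.l_zero[OF C.M.a_inv_closed[OF C.M.zero_closed], symmetric] C.M.r_neg[OF C.M.zero_closed]] C.M.r_zero[OF lin_cl[OF P.bd_lin pz]] .
 \<comment> \<open>\<open>pc1\<close> commutes with the boundary and is injective, so
   \<open>z'\<close> is itself a cycle.\<close>
 hence "pc1 d i n (P.bd d (Suc i) n z') = (%_. \<zero>\<^sub>(V (Suc d) (Suc n)))" unfolding pc1_bd[OF z'(1)] by simp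
 hence "z' : P.Z d (Suc i) n"
  using pc1_zero[OF lin_cl[OF P.bd_lin z'(1)]] z'(1) unfolding P.Z_Suc by blast
 thus ?thesis using b by blast
qed

end

context pp_homol
begin

subsection \<open>Comparing neighbouring principal projectives\<close>

definition lam :: "nat => nat => ('r ovi_arr => 'k) => 'r ovi_arr => 'k" where
 "lam d n = pm d n (%x. Suc (snd x d) = n) (%x. cN d (Suc d) n x (iota d))"

abbreviation lc :: "nat => nat => ('r ovi_arr list => 'r ovi_arr => 'k) => 'r ovi_arr list => 'r ovi_arr => 'k" where
 "lc d n c == (%gs. lam d n (c gs))"

lemma lam_lin: "lam d n : Lin K (V (Suc d) n) (V d n)"
 unfolding lam_def by (rule pm_lin) (rule cN_hom[OF iota_hom])

lemma lam_s: "x : HomN (Suc d) n ==> k : El K ==>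
  lam d n (s x k) = (if Suc (snd x d) = n then s (cN d (Suc d) n x (iota d)) k else \<zero>\<^sub>(V d n))"
 unfolding lam_def by (rule pm_s) (rule cN_hom[OF iota_hom])

lemma lc_lin: "lc d n : Lin K (P.C (Suc d) i n) (P.C d i n)"
 by (rule values_lin[OF P.ob P.ob lam_lin])

lemma lc_bd:
 assumes c: "c : El (P.C (Suc d) (Suc i) n)"
 shows "P.bd d (Suc i) n (lc d n c) = lc d n (P.bd (Suc d) (Suc i) n c)"
 unfolding lam_def
 by (rule pmc_bd[OF _ refl _ _ c]) (simp_all add: snd_act cN_hom[OF iota_hom] cN_assoc[OF iota_hom])

text \<open>The last pivot of the composite lies in the last row exactly if that of the given
  morphism does and \<open>\<phi>\<close> preserves the last index. So \<open>lam\<close> is natural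
  only up to replacing the result by zero, which still makes its kernel stable under all
  \<open>\<phi>\<close>.\<close>

lemma lam_nat:
 assumes \<phi>: "\<phi> : HomN n m" and v: "v : El (V (Suc d) n)"
 shows "lam d m (arr_map (PP (Suc d)) n m \<phi> v) =
  (if 0 < n & Suc (snd \<phi> (n - 1)) = m then arr_map (PP d) n m \<phi> (lam d n v) else \<zero>\<^sub>(V d m))"
proof -
 have last: "Suc (snd (cN (Suc d) n m \<phi> x) d) = m <-> (0 < n & Suc (snd \<phi> (n - 1)) = m) & Suc (snd x d) = n"
  if x: "x : HomN (Suc d) n" for x
 proof -
  have xd: "snd x d < n" using oi_less[OF snd_oi[OF x]] by simp
  have "snd \<phi> (snd x d) <= snd \<phi> (n - 1)"
  proof (cases "snd x d = n - 1")
   case False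
   hence "snd x d < n - 1" using xd by linarith
   thus ?thesis using oi_mono[OF snd_oi[OF \<phi>], of "snd x d" "n - 1"] xd by simp
  qed simp
  moreover have "snd \<phi> (snd x d) = snd \<phi> (n - 1) <-> snd x d = n - 1"
   using oi_inj[OF snd_oi[OF \<phi>] xd, of "n - 1"] xd by simp
  moreover have "snd \<phi> (n - 1) < m" using oi_less[OF snd_oi[OF \<phi>], of "n - 1"] xd by simp
  ultimately show ?thesis using xd by (simp add: snd_cN[OF x] compose_def) linarith
 qed
 note l = lin_comp[OF NC_lin[OF P.M \<phi>] lam_lin]
 note zero = lin_zero[OF P.ob P.ob NC_lin[OF P.M \<phi>]]
 show ?thesis
 proof (cases "0 < n & Suc (snd \<phi> (n - 1)) = m")
  case True
  have "lam d m (arr_map (PP (Suc d)) n m \<phi> v) = arr_map (PP d) n m \<phi> (lam d n v)"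
   by (rule V_eq_on[OF P.ob l lin_comp[OF lam_lin NC_lin[OF P.M \<phi>]] _ v])
     (use True in \<open>simp add: arr_s[OF _ \<phi>] lam_s cN_hom[OF _ \<phi>] last cN_hom[OF iota_hom] cN_assoc[OF iota_hom _ \<phi>] zero\<close>)
  thus ?thesis using True by simp
 next
  case False
  have "lam d m (arr_map (PP (Suc d)) n m \<phi> v) = \<zero>\<^sub>(V d m)"
   by (rule V_eq_on[OF P.ob l lin_0[OF P.ob P.ob] _ v])
     (use False in \<open>auto simp: arr_s[OF _ \<phi>] lam_s cN_hom[OF _ \<phi>] last\<close>)
  thus ?thesis unfolding if_not_P[OF False] .
 qed
qed

lemma lc_tr:
 assumes f: "f : oi n m" and c: "c : El (P.C (Suc d) i n)"
 shows "lc d m (P.tr (Suc d) i n m f c) =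
  (if 0 < n & Suc (f (n - 1)) = m then P.tr d i n m f (lc d n c) else \<zero>\<^sub>(P.C d i m))"
proof -
 note l = lin_comp[OF P.tr_lin[OF f] lc_lin]
 have single: "lc d m (P.tr (Suc d) i n m f (single (V (Suc d) n) gs v)) =
   (if 0 < n & Suc (f (n - 1)) = m then P.tr d i n m f (lc d n (single (V (Suc d) n) gs v)) else \<zero>\<^sub>(P.C d i m))"
  if gs: "gs : tuples (UU n) i" and v: "v : El (V (Suc d) n)" for gs v
  using rep_map.ch_single[OF P.map_rep[OF f] gs v] rep_map.ch_single[OF P.map_rep[OF f] gs lin_cl[OF lam_lin v]]
   lam_nat[OF sa_hom[OF f] v] by (simp add: values_single[OF P.ob P.ob lam_lin] single_zero[OF P.ob])
 show ?thesis
 proof (cases "0 < n & Suc (f (n - 1)) = m")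
  case True
  have "lc d m (P.tr (Suc d) i n m f c) = P.tr d i n m f (lc d n c)"
   by (rule lin_eqI[OF P.ob P.C_left l lin_comp[OF lc_lin P.tr_lin[OF f]] _ c])
     (rule single[unfolded if_P[OF True]])
  thus ?thesis using True by simp
 next
  case False
  have "lc d m (P.tr (Suc d) i n m f c) = \<zero>\<^sub>(P.C d i m)"
   by (rule lin_eqI[OF P.ob P.C_left l lin_0[OF P.C_left P.C_left] _ c])
     (rule single[unfolded if_not_P[OF False]])
  thus ?thesis unfolding if_not_P[OF False] .
 qed
qed

text \<open>The first \<open>d\<close> columns of \<open>plus1 d n x\<close> are those of
  \<open>x\<close> with a zero row added. Thus what \<open>lam\<close> sees of a class from
  Shapiro's lemma was already present at \<open>n\<close>.\<close>

lemma lc_pc1: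
 assumes c: "c : El (P.C d i n)"
 shows "lc d (Suc n) (pc1 d i n c) = P.tr d i n (Suc n) (inc n) c"
proof (rule CC_eq_on[OF P.C_left lin_comp[OF pc1_lin lc_lin] P.tr_lin[OF inc_oi] _ c])
 fix gs x k assume gs: "gs : tuples (UU n) i" and x: "x : HomN d n" and k: "k : El K"
 have "Suc (snd (plus1 d n x) d) = Suc n" by (simp add: snd_plus1[OF x])
 thus "lc d (Suc n) (pc1 d i n (single (V d n) gs (s x k))) =
   P.tr d i n (Suc n) (inc n) (single (V d n) gs (s x k))"
  using pc1_single[OF gs x k] rep_map.ch_single[OF P.map_rep[OF inc_oi] gs s_cl[OF x k]]
   lam_s[OF plus1_hom[OF x] k] plus1_iota[OF x] arr_s[OF x iota_hom k]
  by (simp add: values_single[OF P.ob P.ob lam_lin])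
qed

lemma pc1_tr:
 assumes f: "f : oi n m" and c: "c : El (P.C d i n)"
 shows "pc1 d i m (P.tr d i n m f c) = P.tr (Suc d) i (Suc n) (Suc m) (ext1 n m f) (pc1 d i n c)"
proof (rule CC_eq_on[OF P.C_left lin_comp[OF P.tr_lin[OF f] pc1_lin]
   lin_comp[OF pc1_lin P.tr_lin[OF ext1_oi[OF f]]] _ c])
 fix gs x k assume gs: "gs : tuples (UU n) i" and x: "x : HomN d n" and k: "k : El K"
 have fgs: "map (pN n m f) gs : tuples (UU m) i" and igs: "map (pN n (Suc n) (inc n)) gs : tuples (UU (Suc n)) i"
  using rep_map.map_\<phi>_tuples[OF P.map_rep[OF f, of d] gs] rep_map.map_\<phi>_tuples[OF p1_rep[of n d] gs] by auto
 have "pN m (Suc m) (inc m) (pN n m f g) = pN (Suc n) (Suc m) (ext1 n m f) (pN n (Suc n) (inc n) g)"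
  if "g : set gs" for g
 proof -
  have g: "g : HomN n n" using that gs by (auto simp: tup_iff intro: U_hom)
  show ?thesis
   using push_push[OF od_Ob od_Ob od_Ob f inc_oi g] push_push[OF od_Ob od_Ob od_Ob inc_oi ext1_oi[OF f] g]
    ext1_inc[OF f] by simp
 qed
 hence eq: "map (pN m (Suc m) (inc m)) (map (pN n m f) gs) =
   map (pN (Suc n) (Suc m) (ext1 n m f)) (map (pN n (Suc n) (inc n)) gs)" by simp
 note px = plus1_hom[OF x] and sx = cN_hom[OF x sa_hom[OF f]]
 show "pc1 d i m (P.tr d i n m f (single (V d n) gs (s x k))) =
   P.tr (Suc d) i (Suc n) (Suc m) (ext1 n m f) (pc1 d i n (single (V d n) gs (s x k)))"
  unfolding pc1_single[OF gs x k] rep_map.ch_single[OF P.map_rep[OF f] gs s_cl[OF x k]]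
   rep_map.ch_single[OF P.map_rep[OF ext1_oi[OF f]] igs s_cl[OF px k]]
   arr_s[OF x sa_hom[OF f] k] arr_s[OF px sa_hom[OF ext1_oi[OF f]] k]
   pc1_single[OF fgs sx k] plus1_sa[OF x f] eq ..
qed

lemma pc1_Z: "z : P.Z d (Suc i) n ==> pc1 d (Suc i) n z : P.Z (Suc d) (Suc i) (Suc n)"
 unfolding P.Z_Suc using lin_cl[OF pc1_lin] pc1_bd lin_zero[OF P.C_left P.C_left pc1_lin] by simp

lemma pc1_B: "z : P.B d i n ==> pc1 d i n z : P.B (Suc d) i (Suc n)"
 unfolding P.B_def by (elim imageE, rule image_eqI[OF _ lin_cl[OF pc1_lin]]) (simp_all add: pc1_bd)

abbreviation low_part :: "nat => nat => ('r ovi_arr list => 'r ovi_arr => 'k) => 'r ovi_arr list => 'r ovi_arr => 'k" where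
 "low_part d n == pmc d (Suc n) (%x. n ~: snd x ` {..<d}) (%x. x)"

lemma low_part_lin: "low_part d n : Lin K (P.C d i (Suc n)) (P.C d i (Suc n))"
 by (rule pmc_lin) simp_all

lemma low_part_bd: "c : El (P.C d (Suc i) (Suc n)) ==>
  P.bd d (Suc i) (Suc n) (low_part d n c) = low_part d n (P.bd d (Suc i) (Suc n) c)"
 by (rule pmc_bd) (simp_all add: snd_act)

lemma low_part_0: "c : El (P.C 0 i (Suc n)) ==> low_part 0 n c = c"
 by (rule CC_eq_on[OF P.C_left low_part_lin lin_id]) (simp_all add: pmc_single)

lemma low_last: "c : El (P.C (Suc d) i (Suc n)) ==>
  c = last_part d n c \<oplus>\<^sub>(P.C (Suc d) i (Suc n)) low_part (Suc d) n c"
proof (rule CC_eq_on[OF P.C_left lin_id lin_sum[OF P.C_left P.C_left last_part_lin low_part_lin]])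
 fix gs x k assume gs: "gs : tuples (UU (Suc n)) i" and x: "x : HomN (Suc d) (Suc n)" and k: "k : El K"
 interpret C: left_module K "P.C (Suc d) i (Suc n)" by (rule P.C_left)
 have "n : snd x ` {..<Suc d} <-> snd x d = n"
  using oi_mono[OF snd_oi[OF x], of _ d] oi_less[OF snd_oi[OF x], of d] by (force simp: less_Suc_eq)
 thus "single (V (Suc d) (Suc n)) gs (s x k) =
   last_part d n (single (V (Suc d) (Suc n)) gs (s x k)) \<oplus>\<^sub>(P.C (Suc d) i (Suc n))
   low_part (Suc d) n (single (V (Suc d) (Suc n)) gs (s x k))"
  using fun_cong[OF pmc_single[of "Suc d" "Suc n" "%x. snd x d = n" "%x. x" "Suc d" "Suc n" x k gs, OF _ x k]]
   fun_cong[OF pmc_single[of "Suc d" "Suc n" "%x. n ~: snd x ` {..<Suc d}" "%x. x" "Suc d" "Suc n" x k gs, OF _ x k]]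
   fun_cong[OF C.l_zero[OF single_cl[OF P.ob gs s_cl[OF x k]]]]
   fun_cong[OF C.r_zero[OF single_cl[OF P.ob gs s_cl[OF x k]]]]
  by (cases "snd x d = n") (simp_all add: fun_eq_iff[where f = "single (V (Suc d) (Suc n)) gs (s x k)"])
qed

text \<open>A morphism that misses the last basis vector is \<open>iota n\<close> after some
  \<open>x'\<close>, and \<open>plus1 d n x'\<close> restricts to it. The lift \<open>\<mu>\<close>
  is only linear and is not claimed to commute with boundaries; the boundary of a lifted cycle is
  what the kernel has to account for.\<close>

lemma low_part_lc:
 "\<exists>\<mu>. (ALL i. \<mu> : Lin K (P.C d i (Suc n)) (P.C (Suc d) i (Suc n))) &
  (ALL i. ALL c:El (P.C d i (Suc n)). lc d (Suc n) (\<mu> c) = low_part d n c)"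
proof -
 let ?A = "%x. n ~: snd x ` {..<d}"
 have "ALL x. EX x'. x : HomN d (Suc n) & ?A x --> x' : HomN d n & x = cN d n (Suc n) (iota n) x'"
  using factor_iota by blast
 then obtain xi where "ALL x. x : HomN d (Suc n) & ?A x --> xi x : HomN d n & x = cN d n (Suc n) (iota n) (xi x)"
  by metis
 hence xi: "xi x : HomN d n" "x = cN d n (Suc n) (iota n) (xi x)" if "x : HomN d (Suc n)" "?A x" for x
  using that by blast+
 let ?\<mu> = "pmc (Suc d) (Suc n) ?A (%x. plus1 d n (xi x))"
 have \<theta>: "plus1 d n (xi x) : HomN (Suc d) (Suc n)" if "x : HomN d (Suc n)" "?A x" for x
  by (rule plus1_hom[OF xi(1)[OF that]])
 have \<mu>: "?\<mu> : Lin K (P.C d i (Suc n)) (P.C (Suc d) i (Suc n))" for i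
  by (rule pmc_lin[OF \<theta> refl])
 moreover have "lc d (Suc n) (?\<mu> c) = low_part d n c" if c: "c : El (P.C d i (Suc n))" for c i
 proof (rule CC_eq_on[OF P.C_left lin_comp[OF \<mu> lc_lin] low_part_lin _ c])
  fix gs x k assume gs: "gs : tuples (UU (Suc n)) i" and x: "x : HomN d (Suc n)" and k: "k : El K"
  note 1 = fun_cong[OF pmc_single[of d "Suc n" ?A "%x. plus1 d n (xi x)" "Suc d" "Suc n" x k gs, OF \<theta> x k]]
  note 2 = fun_cong[OF pmc_single[of d "Suc n" ?A "%x. x" d "Suc n" x k gs, OF _ x k]]
  show "lc d (Suc n) (?\<mu> (single (V d (Suc n)) gs (s x k))) = low_part d n (single (V d (Suc n)) gs (s x k))"
  proof (cases "?A x")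
   case True
   have "Suc (snd (plus1 d n (xi x)) d) = Suc n" by (simp add: snd_plus1[OF xi(1)[OF x True]])
   thus ?thesis
    using 1 2 True lam_s[OF \<theta>[OF x True] k] plus1_iota[OF xi(1)[OF x True]] xi(2)[OF x True]
    by (simp add: values_single[OF P.ob P.ob lam_lin])
  next
   case False
   thus ?thesis using 1 2 lin_zero[OF P.ob P.ob lam_lin] by simp
  qed
 qed
 ultimately show ?thesis by blast
qed

end

lemma (in abelian_group) diff_diff_cancel: "a : El G ==> b : El G ==> a \<ominus> (a \<ominus> b) = b"
 by (simp add: a_minus_def minus_add a_assoc[symmetric] r_neg)

context pp_homol
begin

lemma lc_last:
 assumes c: "c : El (P.C (Suc d) i (Suc n))"
 shows "lc d (Suc n) (last_part d n c) = lc d (Suc n) c"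
proof (rule CC_eq_on[OF P.C_left lin_comp[OF last_part_lin lc_lin] lc_lin _ c])
 fix gs x k assume gs: "gs : tuples (UU (Suc n)) i" and x: "x : HomN (Suc d) (Suc n)" and k: "k : El K"
 note 1 = fun_cong[OF pmc_single[of "Suc d" "Suc n" "%x. snd x d = n" "%x. x" "Suc d" "Suc n" x k gs, OF _ x k]]
 show "lc d (Suc n) (last_part d n (single (V (Suc d) (Suc n)) gs (s x k))) =
   lc d (Suc n) (single (V (Suc d) (Suc n)) gs (s x k))"
 proof (cases "snd x d = n")
  case True
  thus ?thesis using 1 by simp
 next
  case False
  thus ?thesis
   using 1 lam_s[OF x k] lin_zero[OF P.ob P.ob lam_lin] by (simp add: values_single[OF P.ob P.ob lam_lin] single_zero[OF P.ob])
 qed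
qed

section \<open>The kernel of restriction and the step from one principal projective to the
  next\<close>

context
 fixes d i :: nat
 assumes IH: "!!N :: (nat, 'r ovi_arr, 'k, 'r ovi_arr => 'k) cat_mod. nc_mod R K N ==> fg K NC N ==> nc_mod.hfg R K N i"
  and prev: "0 < d ==> P.hfg (d - 1) (Suc i)"
begin

definition "lker n = {v : El (V (Suc d) n). lam d n v = \<zero>\<^sub>(V d n)}"

lemma lker_sub: "subfam K NC (PP (Suc d)) lker"
 unfolding subfam_def
proof (intro conjI ballI)
 show "submod K (V (Suc d) n) (lker n)" for n
  using submod_vimage[OF P.ob P.ob lam_lin submod_zero[OF P.ob], of d n] by (simp add: lker_def)
 fix n m \<phi> v assume "\<phi> : Arr NC n m" and v: "v : lker n"
 hence \<phi>: "\<phi> : HomN n m" by (simp only: NC_simps)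
 have "v : El (V (Suc d) n)" "lam d n v = \<zero>\<^sub>(V d n)" using v by (auto simp: lker_def)
 thus "arr_map (PP (Suc d)) n m \<phi> v : lker m"
  using lam_nat[OF \<phi>, of v d] lin_cl[OF NC_lin[OF P.M \<phi>], of v "Suc d"] lin_zero[OF P.ob P.ob NC_lin[OF P.M \<phi>], of d]
  unfolding lker_def by simp
qed

interpretation N: nc_mod R K "sub_mod (PP (Suc d)) lker" by (rule P.sub_nc_mod[OF lker_sub])
interpretation iN: nc_map R K "sub_mod (PP (Suc d)) lker" "PP (Suc d)" "%_ v. v" by (rule P.sub_nc_map[OF lker_sub])

lemma N_C_iff: "c : El (N.C j n) <-> c : El (P.C (Suc d) j n) & lc d n c = (%_. \<zero>\<^sub>(V d n))"
 (is "_ <-> ?rhs")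
proof
 assume c: "c : El (N.C j n)"
 have cP: "c : El (P.C (Suc d) j n)" using lin_cl[OF iN.pc_lin c] by simp
 have "lam d n (c gs) = \<zero>\<^sub>(V d n)" for gs
 by (use fs_val N.ob c lker_def in \<open>fastforce\<close>)
 thus ?rhs using cP by simp
next
 assume c: ?rhs
 hence "c gs : lker n" for gs
  using fs_val[OF P.ob, of c "Suc d" n] fun_cong[of "lc d n c" _ gs] by (auto simp: lker_def)
 thus "c : El (N.C j n)" using c by (auto simp: fs_iff)
qed

text \<open>The connecting map on chains of the sequence with kernel \<open>lker\<close>, middle
  term \<open>P_(d+1)\<close> and quotient the image of \<open>lam\<close>; compare
  \<open>bds\<close>.\<close>

definition "lbds X n = P.bd (Suc d) (Suc i) n ` {y : El (P.C (Suc d) (Suc i) n). lc d n y : X n}"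

lemma lbds_sub: "submod K (P.C d (Suc i) n) (X n) ==> submod K (P.C (Suc d) i n) (lbds X n)"
 unfolding lbds_def
 by (rule submod_image[OF P.C_left P.C_left P.bd_lin submod_vimage[OF P.C_left P.C_left lc_lin]])

lemma lbds_tr:
 assumes f: "f : oi n m" and X: "!!z. z : X n ==> P.tr d (Suc i) n m f z : X m" and X0: "(%_. \<zero>\<^sub>(V d m)) : X m"
  and t: "t : lbds X n"
 shows "P.tr (Suc d) i n m f t : lbds X m"
proof -
 obtain y where y: "y : El (P.C (Suc d) (Suc i) n)" "lc d n y : X n" "t = P.bd (Suc d) (Suc i) n y"
  using t unfolding lbds_def by blast
 \<comment> \<open>By \<open>lc_tr\<close> this is the transported chain or zero, whence the
   assumption \<open>X0\<close>.\<close>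
 have "lc d m (P.tr (Suc d) (Suc i) n m f y) : X m"
  unfolding lc_tr[OF f y(1)] using X[OF y(2)] X0 by simp
 thus ?thesis
  unfolding lbds_def y(3) P.bd_tr[OF f y(1), symmetric] using lin_cl[OF P.tr_lin[OF f] y(1)] by blast
qed

lemma lbds_B:
 assumes X0: "(%_. \<zero>\<^sub>(V d n)) : X n"
 shows "N.B i n <= lbds X n"
proof
 fix b assume "b : N.B i n"
 then obtain y where y: "y : El (N.C (Suc i) n)" "b = N.bd (Suc i) n y" unfolding N.B_def by blast
 hence "y : El (P.C (Suc d) (Suc i) n)" "lc d n y = (%_. \<zero>\<^sub>(V d n))" "b = P.bd (Suc d) (Suc i) n y"
  using N_C_iff iN.pc_bd[OF y(1)] by auto
 thus "b : lbds X n" unfolding lbds_def using X0 by auto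
qed

text \<open>
 Cycles for \<^term>\<open>d\<close> not involving the last basis vector lift along \<^term>\<open>lam\<close>; the boundaries of
 the lifts form a submodule of the chains of the kernel, and hence are finitely generated.
\<close>

theorem hfg_pp_step: "P.hfg d (Suc i)"
proof -
 define T where "T = lbds (P.Z d (Suc i))"
 have TZ: "T n <= N.Z i n" for n
 proof
  fix t assume "t : T n"
  then obtain y where y: "y : El (P.C (Suc d) (Suc i) n)" "lc d n y : P.Z d (Suc i) n"
   and t: "t = P.bd (Suc d) (Suc i) n y" unfolding T_def lbds_def by blast
  have tC: "t : El (P.C (Suc d) i n)" unfolding t by (rule lin_cl[OF P.bd_lin y(1)])
  \<comment> \<open>\<open>lam\<close> takes this boundary to the boundary of a cycle, so it lies in
    the kernel.\<close>
  have "lc d n t = (%_. \<zero>\<^sub>(V d n))" unfolding t lc_bd[OF y(1), symmetric] using y(2) P.Z_Suc by blast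
  hence tN: "t : El (N.C i n)" using tC N_C_iff by blast
  show "t : N.Z i n"
  proof (cases i)
   case 0
   thus ?thesis using tN N.Z_0 by simp
  next
   case (Suc j)
   hence "N.bd (Suc j) n t = P.bd (Suc d) (Suc j) n t" using iN.pc_bd tN by simp
   thus ?thesis using P.bd_bd y(1) t tN unfolding Suc N.Z_Suc by simp
  qed
 qed
 have Z0: "(%_. \<zero>\<^sub>(V d n)) : P.Z d (Suc i) n" for n using subD(2)[OF P.Z_submod[of d n "Suc i"]] by simp
 have Tsub: "subfam K NI (N.chs i) T"
  unfolding subfam_def
 proof (intro conjI ballI)
  fix n
  have "submod K (P.C (Suc d) i n) (T n)" unfolding T_def by (rule lbds_sub) (rule P.Z_submod)
  moreover have "T n <= El (N.C i n)" using TZ N.Z_C by blast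
  ultimately show "submod K (ob_mod (N.chs i) n) (T n)"
   unfolding N.chs_simps by (simp add: submod_def)
  fix m f t assume "f : Arr NI n m" and t: "t : T n"
  hence f: "f : oi n m" by (simp only: NI_simps)
  have "P.tr (Suc d) i n m f t : T m"
   unfolding T_def by (rule lbds_tr[where X = "P.Z d (Suc i)", OF f P.tr_Z[OF f] Z0 t[unfolded T_def]])
  moreover have "N.tr i n m f t = P.tr (Suc d) i n m f t" using iN.pc_tr[OF f N.Z_C[OF subsetD[OF TZ t]]] by simp
  ultimately show "arr_map (N.chs i) n m f t : T m" by (simp only: N.chs_simps)
 qed
 have BT: "N.B i n <= T n" for n unfolding T_def by (rule lbds_B) (rule Z0)
 have "N.hfg i" by (rule IH[OF N.nc_mod_axioms sub_pp_fg[OF K noeth lker_sub]])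
 then obtain Gn where Gn: "finite Gn" "!!n z. (n, z) : Gn ==> z : N.Z i n" "!!n. N.Z i n <= N.hspan Gn i n"
  unfolding N.hfg_iff by blast
 have "fin_gen K NI (N.chs i) T (N.B i)"
 proof (rule oi_noetherian[OF N.chs K noeth Tsub N.B_sub BT Gn(1)])
  show "z : El (ob_mod (N.chs i) n)" if "(n, z) : Gn" for n z
   unfolding N.chs_simps by (rule N.Z_C[OF Gn(2)[OF that]])
  show "T n <= gspan K NI (N.chs i) Gn (N.B i) n" for n
   using order_trans[OF TZ Gn(3)] unfolding N.hspan_def .
 qed
 then obtain Gt where Gt: "finite Gt" "!!n t. (n, t) : Gt ==> t : T n" "!!n. T n <= N.hspan Gt i n"
  unfolding fin_gen_def N.hspan_def using NI_simps(1) by blast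
 define Q where "Q n t y <-> y : El (P.C (Suc d) (Suc i) n) & lc d n y : P.Z d (Suc i) n &
   t = P.bd (Suc d) (Suc i) n y" for n t y
 have "ALL n t. EX y. (n, t) : Gt --> Q n t y" using Gt(2) unfolding T_def lbds_def Q_def by blast
 then obtain Y where "ALL n t. (n, t) : Gt --> Q n t (Y n t)" by metis
 hence Y: "Y n t : El (P.C (Suc d) (Suc i) n) & lc d n (Y n t) : P.Z d (Suc i) n &
   t = P.bd (Suc d) (Suc i) n (Y n t)" if "(n, t) : Gt" for n t
  using that unfolding Q_def by blast
 \<comment> \<open>For \<open>d = 0\<close> there is no predecessor, and no morphism out of rank
   zero hits the last basis vector; the empty set is taken.\<close>
 have "EX Gp. finite Gp & (ALL n z. (n, z) : Gp --> 0 < d & z : P.Z (d - 1) (Suc i) n) &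
   (0 < d --> (ALL n. P.Z (d - 1) (Suc i) n <= P.hspan (d - 1) Gp (Suc i) n))"
 proof (cases "0 < d")
  case True
  thus ?thesis using prev[OF True] unfolding P.hfg_iff by blast
 next
  case False
  thus ?thesis by (intro exI[of _ "{}"]) simp
 qed
 then obtain Gp where Gp: "finite Gp" "!!n z. (n, z) : Gp ==> 0 < d & z : P.Z (d - 1) (Suc i) n"
  "!!n. 0 < d ==> P.Z (d - 1) (Suc i) n <= P.hspan (d - 1) Gp (Suc i) n" by blast
 \<comment> \<open>Cycles of two kinds: the images under \<open>lam\<close> of lifts belonging to
   the generators of \<open>T\<close>, and the generators for \<open>P_(d-1)\<close> carried by
   \<open>pc1\<close> from \<open>n\<close> to \<open>n+1\<close>.\<close>
 define Hs where "Hs = (%(n, t). (n, lc d n (Y n t))) ` Gt \<union> (%(n, z). (Suc n, pc1 (d - 1) (Suc i) n z)) ` Gp"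
 have HZ: "z : P.Z d (Suc i) n" if nz: "(n, z) : Hs" for n z
 proof -
  have "(EX t. (n, t) : Gt & z = lc d n (Y n t)) \<or> (EX m w. n = Suc m & (m, w) : Gp & z = pc1 (d - 1) (Suc i) m w)"
   using nz by (auto simp: Hs_def)
  then consider t where "(n, t) : Gt" "z = lc d n (Y n t)"
   | m w where "n = Suc m" "(m, w) : Gp" "z = pc1 (d - 1) (Suc i) m w" by metis
  thus ?thesis
  proof cases
   case 1
   thus ?thesis using Y[OF 1(1)] by blast
  next
   case 2
   have d: "Suc (d - 1) = d" and w: "w : P.Z (d - 1) (Suc i) m" using Gp(2)[OF 2(2)] by simp_all
   show ?thesis using pc1_Z[OF w] unfolding d 2(1,3) .
  qed
 qed
 note HC = P.Z_C[OF HZ]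
 let ?H = "P.hspan d Hs (Suc i)"
 note Hsub = P.hspan_sub[of Hs d "Suc i", OF HC]
 have H0: "(%_. \<zero>\<^sub>(V d n)) : ?H n" for n using subD(2)[OF Hsub, of n] by simp
 have A: "N.hspan Gt i n <= lbds ?H n" for n
 proof (rule order_trans[of _ "lbds ?H n \<inter> El (N.C i n)"], rule N.hspan_least)
  have "submod K (P.C (Suc d) i n) (lbds ?H n)" by (rule lbds_sub) (rule Hsub)
  thus "submod K (N.C i n) (lbds ?H n \<inter> El (N.C i n))"
   using submod_carrier[OF N.C_left, of n i] by (auto simp: submod_def)
  show "N.B i n <= lbds ?H n \<inter> El (N.C i n)"
   using lbds_B[of n ?H] H0 subD(1)[OF N.B_submod, of i n] by blast
  fix m t f assume mt: "(m, t) : Gt" and f: "f : oi m n"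
  have tN: "t : El (N.C i m)" using Gt(2)[OF mt] TZ N.Z_C by blast
  have "lc d m (Y m t) : ?H m"
   by (rule P.hspan_base) (use mt Y[OF mt] P.Z_C in \<open>force simp: Hs_def\<close>)+
  hence "t : lbds ?H m" unfolding lbds_def using Y[OF mt] by blast
  hence "P.tr (Suc d) i m n f t : lbds ?H n"
   by (intro lbds_tr[OF f]) (rule P.hspan_tr[OF HC f], assumption+, rule H0)
  thus "N.tr i m n f t : lbds ?H n \<inter> El (N.C i n)"
   using iN.pc_tr[OF f tN] lin_cl[OF N.tr_lin[OF f] tN] by simp
 qed auto
 have "P.Z d (Suc i) n <= ?H n" for n
 proof (induction n)
  case 0
  \<comment> \<open>The induction starts at the trivial group \<open>U_0\<close>, where cycles of
    positive degree are boundaries.\<close>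
  have "x = idN 0" if x: "x : HomN 0 0" for x
   by (rule HomN_ext[OF x idN(1)]) (simp_all add: snd_endo[OF x] snd_endo[OF idN(1)])
  hence "HomN 0 0 = {idN 0}" using idN(1)[of 0] by blast
  hence triv: "El (UU 0) = {\<one>\<^sub>(UU 0)}" unfolding U_all U_one idN_def .
  show ?case
  by (use P.Z_Suc grp_rep.trivial_group_bds P.rep triv P.B_def P.hspan_B in \<open>fastforce\<close>)
 next
  case (Suc n)
  interpret CP: left_module K "P.C (Suc d) (Suc i) (Suc n)" by (rule P.C_left)
  interpret CP': left_module K "P.C (Suc d) i (Suc n)" by (rule P.C_left)
  interpret C: left_module K "P.C d (Suc i) (Suc n)" by (rule P.C_left)
  have last: "pc1 d' (Suc i) n z' \<ominus>\<^sub>(P.C (Suc d') (Suc i) (Suc n)) P.bd (Suc d') (Suc (Suc i)) (Suc n) b = last_part d' n z"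
   if "z' : P.Z d' (Suc i) n" "z : P.Z (Suc d') (Suc i) (Suc n)"
    "P.bd (Suc d') (Suc (Suc i)) (Suc n) b = pc1 d' (Suc i) n z' \<ominus>\<^sub>(P.C (Suc d') (Suc i) (Suc n)) last_part d' n z"
   for d' z' z b
  proof -
   interpret left_module K "P.C (Suc d') (Suc i) (Suc n)" by (rule P.C_left)
   show ?thesis
    unfolding that(3)
    by (rule diff_diff_cancel[OF lin_cl[OF pc1_lin P.Z_C[OF that(1)]] lin_cl[OF last_part_lin P.Z_C[OF that(2)]]])
  qed
  \<comment> \<open>Up to a boundary the last part of \<open>y\<close> is \<open>pc1\<close> of a
    cycle \<open>z'\<close> of \<open>P_d\<close> at \<open>n\<close>. Its image under
    \<open>lam\<close> is the transition of \<open>z'\<close> along \<open>inc n\<close>, and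
    \<open>z'\<close> is generated by the induction hypothesis on \<open>n\<close>.\<close>
  have b: "lc d (Suc n) y : ?H (Suc n)" if y: "y : P.Z (Suc d) (Suc i) (Suc n)" for y
  proof -
   obtain z' b where z': "z' : P.Z d (Suc i) n" and b: "b : El (P.C (Suc d) (Suc (Suc i)) (Suc n))"
    and eq: "P.bd (Suc d) (Suc (Suc i)) (Suc n) b = pc1 d (Suc i) n z' \<ominus>\<^sub>(P.C (Suc d) (Suc i) (Suc n)) last_part d n y"
    using shapiro[OF y] by blast
   have "lc d (Suc n) y = lc d (Suc n) (last_part d n y)"
    by (rule lc_last[OF P.Z_C[OF y], symmetric])
   also have "... = lc d (Suc n) (pc1 d (Suc i) n z' \<ominus>\<^sub>(P.C (Suc d) (Suc i) (Suc n)) P.bd (Suc d) (Suc (Suc i)) (Suc n) b)"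
    by (simp only: last[OF z' y eq])
   also have "... = P.tr d (Suc i) n (Suc n) (inc n) z' \<ominus>\<^sub>(P.C d (Suc i) (Suc n)) P.bd d (Suc (Suc i)) (Suc n) (lc d (Suc n) b)"
    unfolding lin_diff[OF P.C_left P.C_left lc_lin lin_cl[OF pc1_lin P.Z_C[OF z']]
     lin_cl[OF P.bd_lin b]] lc_pc1[OF P.Z_C[OF z']] lc_bd[OF b] ..
   also have "... : ?H (Suc n)"
   proof (rule submod_diff[OF P.C_left Hsub])
    show "P.tr d (Suc i) n (Suc n) (inc n) z' : ?H (Suc n)"
     by (rule P.hspan_tr[OF HC inc_oi subsetD[OF Suc.IH z']])
    show "P.bd d (Suc (Suc i)) (Suc n) (lc d (Suc n) b) : ?H (Suc n)"
     using P.hspan_B[of d "Suc i" "Suc n" Hs] lin_cl[OF lc_lin b] unfolding P.B_def by blast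
   qed
   finally show ?thesis .
  qed
  show ?case
  proof
   fix z assume z: "z : P.Z d (Suc i) (Suc n)"
   note zC = P.Z_C[OF z]
   \<comment> \<open>The low part is \<open>lam\<close> of the lift \<open>\<mu> z\<close>, whose
     boundary lies in \<open>T\<close>. Subtracting a chain \<open>y'\<close> with the same boundary
     and generated image leaves a cycle of \<open>P_(d+1)\<close>, to which \<open>b\<close>
     applies.\<close>
   have low: "low_part d n z : ?H (Suc n)"
   proof -
    obtain \<mu> where \<mu>: "!!i. \<mu> : Lin K (P.C d i (Suc n)) (P.C (Suc d) i (Suc n))"
     "!!i c. c : El (P.C d i (Suc n)) ==> lc d (Suc n) (\<mu> c) = low_part d n c"
     using low_part_lc[of d n] by blast
    have y: "\<mu> z : El (P.C (Suc d) (Suc i) (Suc n))" by (rule lin_cl[OF \<mu>(1) zC])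
    have "low_part d n z : P.Z d (Suc i) (Suc n)"
     using low_part_bd[OF zC] z lin_zero[OF P.C_left P.C_left low_part_lin, of d n i] lin_cl[OF low_part_lin zC]
     unfolding P.Z_Suc by simp
    hence "P.bd (Suc d) (Suc i) (Suc n) (\<mu> z) : T (Suc n)"
     unfolding T_def lbds_def using y \<mu>(2)[OF zC] by (intro imageI) simp
    hence "P.bd (Suc d) (Suc i) (Suc n) (\<mu> z) : lbds ?H (Suc n)" using Gt(3) A by blast
    then obtain y' where y': "y' : El (P.C (Suc d) (Suc i) (Suc n))" "lc d (Suc n) y' : ?H (Suc n)"
     and eq: "P.bd (Suc d) (Suc i) (Suc n) (\<mu> z) = P.bd (Suc d) (Suc i) (Suc n) y'"
     unfolding lbds_def by blast
    have "\<mu> z \<ominus>\<^sub>(P.C (Suc d) (Suc i) (Suc n)) y' : P.Z (Suc d) (Suc i) (Suc n)"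
     using lin_diff[OF P.C_left P.C_left P.bd_lin y y'(1)] CP'.r_neg[OF lin_cl[OF P.bd_lin y'(1)]]
      CP.minus_closed[OF y y'(1)] unfolding P.Z_Suc eq by (simp add: a_minus_def)
    from b[OF this] have "lc d (Suc n) (\<mu> z) \<ominus>\<^sub>(P.C d (Suc i) (Suc n)) lc d (Suc n) y' : ?H (Suc n)"
     unfolding lin_diff[OF P.C_left P.C_left lc_lin y y'(1)] .
    from subD(3)[OF Hsub this y'(2)] show ?thesis
     using lin_cl[OF lc_lin y] lin_cl[OF lc_lin y'(1)]
     by (simp add: a_minus_def C.a_assoc C.l_neg \<mu>(2)[OF zC] del: fs_simps)
   qed
   show "z : ?H (Suc n)"
   proof (cases d)
    case 0
    thus ?thesis using low low_part_0 zC by simp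
   next
    case (Suc d')
    note z' = z[unfolded Suc] and Hsub' = Hsub[unfolded Suc] and HC' = HC[unfolded Suc]
    obtain w b where w: "w : P.Z d' (Suc i) n" and b: "b : El (P.C (Suc d') (Suc (Suc i)) (Suc n))"
     and eq: "P.bd (Suc d') (Suc (Suc i)) (Suc n) b = pc1 d' (Suc i) n w \<ominus>\<^sub>(P.C (Suc d') (Suc i) (Suc n)) last_part d' n z"
     using shapiro[OF z'] by blast
    let ?H' = "P.hspan (Suc d') Hs (Suc i)"
    \<comment> \<open>For the last part Shapiro's lemma leads to cycles of \<open>P_(d-1)\<close> at
      \<open>n\<close>. By \<open>pc1_tr\<close> a transition along \<open>f\<close> becomes one
      along \<open>ext1\<close>, so finitely many shifted generators suffice for all
      \<open>n\<close>.\<close>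
    have "P.hspan d' Gp (Suc i) n <= {c : El (P.C d' (Suc i) n). pc1 d' (Suc i) n c : ?H' (Suc n)}"
    proof (rule P.hspan_least[OF submod_vimage[OF P.C_left P.C_left pc1_lin Hsub']])
     show "P.B d' (Suc i) n <= {c : El (P.C d' (Suc i) n). pc1 d' (Suc i) n c : ?H' (Suc n)}"
      using subsetD[OF P.hspan_B pc1_B] subsetD[OF subD(1)[OF P.B_submod]] by blast
     fix m v f assume mv: "(m, v) : Gp" and f: "f : oi m n"
     have v: "v : El (P.C d' (Suc i) m)" using Gp(2)[OF mv] P.Z_C Suc by simp
     have "(Suc m, pc1 d' (Suc i) m v) : Hs" using mv Suc by (force simp: Hs_def)
     from P.hspan_arr[OF this ext1_oi[OF f], of "Suc d'" "Suc i"]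
     show "P.tr d' (Suc i) m n f v : {c : El (P.C d' (Suc i) n). pc1 d' (Suc i) n c : ?H' (Suc n)}"
      unfolding pc1_tr[OF f v, symmetric] using lin_cl[OF P.tr_lin[OF f] v] by simp
    qed
    moreover have "w : P.hspan d' Gp (Suc i) n" using Gp(3)[of n] w Suc by auto
    ultimately have pw: "pc1 d' (Suc i) n w : ?H' (Suc n)" by blast
    have "P.bd (Suc d') (Suc (Suc i)) (Suc n) b : ?H' (Suc n)"
     using P.hspan_B[of "Suc d'" "Suc i" "Suc n" Hs] b unfolding P.B_def by blast
    from submod_diff[OF P.C_left Hsub' pw this] have "last_part d' n z : ?H' (Suc n)"
     unfolding last[OF w z' eq] .
    from subD(3)[OF Hsub' this low[unfolded Suc]] show ?thesis
     using low_last[OF P.Z_C[OF z']] unfolding Suc by simp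
   qed
  qed
 qed
 thus ?thesis unfolding P.hfg_iff
  using HZ Gt(1) Gp(1) by (intro exI[of _ Hs]) (auto simp: Hs_def)
qed

end

lemma hfg_pp:
 assumes "!!N :: (nat, 'r ovi_arr, 'k, 'r ovi_arr => 'k) cat_mod. nc_mod R K N ==> fg K NC N ==> nc_mod.hfg R K N i"
 shows "P.hfg d (Suc i)"
proof (induction d)
 case 0
 show ?case by (rule hfg_pp_step, erule (1) assms) simp
next
 case (Suc d)
 show ?case by (rule hfg_pp_step, erule (1) assms) (simp add: Suc)
qed

text \<open>An induction hypothesis lives at a fixed type. The induction on the degree is therefore
  carried out for modules with the value type of \<open>P_d\<close>, which contains the kernels that
  occur; a module with other values is reached by one more use of \<open>hfg_Suc\<close>.\<close>

theorem hfg_fg: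
 fixes M :: "(nat, 'r ovi_arr, 'k, 'm) cat_mod"
 assumes M: "nc_mod R K M" "fg K NC M"
 shows "nc_mod.hfg R K M i"
proof -
 have free: "nc_mod.hfg R K N i" if "nc_mod R K N" "fg K NC N"
  for N :: "(nat, 'r ovi_arr, 'k, 'r ovi_arr => 'k) cat_mod" and i
  using that
 proof (induction i arbitrary: N)
  case 0
  thus ?case by (rule nc_mod.hfg_0)
 next
  case (Suc i)
  have "P.hfg d (Suc i)" for d by (rule hfg_pp) (rule Suc.IH)
  from hfg_Suc[where i = i, OF K noeth _ this Suc.prems] show ?case using Suc.IH by blast
 qed
 show ?thesis
 proof (cases i)
  case 0
  thus ?thesis using nc_mod.hfg_0[OF M] by simp
 next
  case (Suc j)
  have "P.hfg d (Suc j)" for d by (rule hfg_pp) (rule free)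
  from hfg_Suc[where i = j, OF K noeth _ this M] show ?thesis unfolding Suc using free by blast
 qed
qed

end

section \<open>Passage to the skeleton\<close>

lemma fgI:
 assumes "finite Gs" "!!x m. (x, m) : Gs ==> x : Ob C & m : El (ob_mod M x)"
  and "!!y. y : Ob C ==> El (ob_mod M y) <= gspan K C M Gs (%x. {\<zero>\<^sub>(ob_mod M x)}) y"
 shows "fg K C M"
 unfolding fg_def fin_gen_def using assms by (intro exI[of _ Gs]) auto

lemma fgE:
 assumes "fg K C M"
 obtains Gs where "finite Gs" "!!x m. (x, m) : Gs ==> x : Ob C & m : El (ob_mod M x)"
  "!!y. y : Ob C ==> El (ob_mod M y) <= gspan K C M Gs (%x. {\<zero>\<^sub>(ob_mod M x)}) y"
 using assms unfolding fg_def fin_gen_def by blast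

lemma (in cat_module) gspan_zero_sub:
 "(!!x m. (x, m) : Gs ==> x : Ob C & m : El (ob_mod M x)) ==> y : Ob C ==>
  submod K (ob_mod M y) (gspan K C M Gs (%x. {\<zero>\<^sub>(ob_mod M x)}) y)"
 by (rule gspan_sub) (use subD(1)[OF famD(1)[OF zero_subfam]] in auto)

text \<open>As \<open>b\<close> after \<open>a\<close> is the identity, a generator \<open>m\<close>
  is recovered by \<open>b\<close> from its image under \<open>a\<close>, which sits at an object
  \<open>ob s\<close>. Conversely every element at \<open>y\<close> is the image under
  \<open>b\<close> of an element at some \<open>ob s\<close>.\<close>

lemma fg_pull:
 assumes M: "cat_module K C M"
  and retr: "!!x. x : Ob C ==> EX s a b. ob s : Ob C & a : Arr C x (ob s) & b : Arr C (ob s) x &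
   Comp C x (ob s) x b a = Ident C x"
 shows "fg K C M <-> fg K (pull_cat C ob) (pull_mod M ob)"
proof
 interpret M: cat_module K C M by (rule M)
 interpret P: cat_module K "pull_cat C ob" "pull_mod M ob" by (rule pull_cat_module[OF M])
 have id: "arr_map M (ob s) x b (arr_map M x (ob s) a m) = m"
  if "x : Ob C" "ob s : Ob C" "a : Arr C x (ob s)" "b : Arr C (ob s) x" "Comp C x (ob s) x b a = Ident C x"
   "m : El (ob_mod M x)" for x s a b m
  using M.arr_Comp[OF that(1,2,1,3,4,6)] M.arr_Ident[OF that(1,6)] that(5) by simp
 {
  assume "fg K C M"
  then obtain Gs where Gs: "finite Gs" "!!x m. (x, m) : Gs ==> x : Ob C & m : El (ob_mod M x)"
   "!!y. y : Ob C ==> El (ob_mod M y) <= gspan K C M Gs (%x. {\<zero>\<^sub>(ob_mod M x)}) y" by (rule fgE) (rule that)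
  obtain s a b where sab: "!!x. x : Ob C ==> ob (s x) : Ob C & a x : Arr C x (ob (s x)) & b x : Arr C (ob (s x)) x &
   Comp C x (ob (s x)) x (b x) (a x) = Ident C x" using retr by metis
  let ?Hs = "(%(x, m). (s x, arr_map M x (ob (s x)) (a x) m)) ` Gs"
  have H: "t : Ob (pull_cat C ob) & m : El (ob_mod (pull_mod M ob) t)" if tm: "(t, m) : ?Hs" for t m
  by (use tm Gs(2) sab M.arr_cl in \<open>auto\<close>)
  show "fg K (pull_cat C ob) (pull_mod M ob)"
  proof (rule fgI[OF _ H])
   show "finite ?Hs" using Gs(1) by simp
   fix t assume t: "t : Ob (pull_cat C ob)"
   let ?N = "gspan K (pull_cat C ob) (pull_mod M ob) ?Hs (%x. {\<zero>\<^sub>(ob_mod (pull_mod M ob) x)}) t"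
   have "gspan K C M Gs (%x. {\<zero>\<^sub>(ob_mod M x)}) (ob t) <= ?N"
   proof (rule gspan_least)
    show N: "submod K (ob_mod M (ob t)) ?N" using P.gspan_zero_sub[OF H t] by simp
    show "{\<zero>\<^sub>(ob_mod M (ob t))} <= ?N" using subD(2)[OF N] by simp
    fix x m \<phi> assume xm: "(x, m) : Gs" and \<phi>: "\<phi> : Arr C x (ob t)"
    have x: "x : Ob C" "m : El (ob_mod M x)" using Gs(2)[OF xm] by auto
    have st: "ob (s x) : Ob C" "a x : Arr C x (ob (s x))" "b x : Arr C (ob (s x)) x"
     "Comp C x (ob (s x)) x (b x) (a x) = Ident C x" using sab[OF x(1)] by auto
    have ot: "ob t : Ob C" using t by simp
    let ?\<psi> = "Comp C (ob (s x)) x (ob t) \<phi> (b x)"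
    have \<psi>: "?\<psi> : Arr C (ob (s x)) (ob t)" by (rule M.Comp_closed[OF st(1) x(1) ot st(3) \<phi>])
    have "arr_map M x (ob t) \<phi> m = arr_map M (ob (s x)) (ob t) ?\<psi> (arr_map M x (ob (s x)) (a x) m)"
     using M.arr_Comp[OF st(1) x(1) ot st(3) \<phi> M.arr_cl[OF x(1) st(1,2) x(2)]] id[OF x(1) st x(2)] by simp
    moreover have "arr_map (pull_mod M ob) (s x) t ?\<psi> (arr_map M x (ob (s x)) (a x) m) : ?N"
     by (rule gspan_arr) (use xm \<psi> in \<open>force+\<close>)
    ultimately show "arr_map M x (ob t) \<phi> m : ?N" by simp
   qed
   thus "El (ob_mod (pull_mod M ob) t) <= ?N" using Gs(3)[of "ob t"] t by simp
  qed
 next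
  assume "fg K (pull_cat C ob) (pull_mod M ob)"
  then obtain Gs where Gs: "finite Gs"
   "!!x m. (x, m) : Gs ==> x : Ob (pull_cat C ob) & m : El (ob_mod (pull_mod M ob) x)"
   "!!y. y : Ob (pull_cat C ob) ==> El (ob_mod (pull_mod M ob) y) <=
    gspan K (pull_cat C ob) (pull_mod M ob) Gs (%x. {\<zero>\<^sub>(ob_mod (pull_mod M ob) x)}) y" by (rule fgE) (rule that)
  let ?Hs = "(%(s, m). (ob s, m)) ` Gs"
  have H: "x : Ob C & m : El (ob_mod M x)" if xm: "(x, m) : ?Hs" for x m
  by (use xm Gs(2) in \<open>auto\<close>)
  show "fg K C M"
  proof (rule fgI[OF _ H])
   show "finite ?Hs" using Gs(1) by simp
   fix y assume y: "y : Ob C"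
   let ?N = "gspan K C M ?Hs (%x. {\<zero>\<^sub>(ob_mod M x)}) y"
   have N: "submod K (ob_mod M y) ?N" by (rule M.gspan_zero_sub[OF H y])
   obtain s a b where s: "ob s : Ob C" "a : Arr C y (ob s)" "b : Arr C (ob s) y" "Comp C y (ob s) y b a = Ident C y"
    using retr[OF y] by blast
   have "gspan K (pull_cat C ob) (pull_mod M ob) Gs (%x. {\<zero>\<^sub>(ob_mod (pull_mod M ob) x)}) s <=
     {w : El (ob_mod M (ob s)). arr_map M (ob s) y b w : ?N}"
   proof (rule gspan_least)
    have "submod K (ob_mod M (ob s)) {w : El (ob_mod M (ob s)). arr_map M (ob s) y b w : ?N}"
     by (rule submod_vimage[OF M.ob_lm[OF s(1)] M.ob_lm[OF y] M.arr_linear[OF s(1) y s(3)] N])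
    thus *: "submod K (ob_mod (pull_mod M ob) s) {w : El (ob_mod M (ob s)). arr_map M (ob s) y b w : ?N}"
     by simp
    show "{\<zero>\<^sub>(ob_mod (pull_mod M ob) s)} <= {w : El (ob_mod M (ob s)). arr_map M (ob s) y b w : ?N}"
     using subD(2)[OF *] by blast
    fix t m \<phi> assume tm: "(t, m) : Gs" and "\<phi> : Arr (pull_cat C ob) t s"
    hence \<phi>: "\<phi> : Arr C (ob t) (ob s)" and t: "ob t : Ob C" "m : El (ob_mod M (ob t))"
     using Gs(2)[OF tm] by simp_all
    have "arr_map M (ob t) y (Comp C (ob t) (ob s) y b \<phi>) m : ?N"
     by (rule gspan_arr) (use tm M.Comp_closed[OF t(1) s(1) y \<phi> s(3)] in \<open>force+\<close>)
    thus "arr_map (pull_mod M ob) t s \<phi> m : {w : El (ob_mod M (ob s)). arr_map M (ob s) y b w : ?N}"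
     using M.arr_Comp[OF t(1) s(1) y \<phi> s(3) t(2)] M.arr_cl[OF t(1) s(1) \<phi> t(2)] by simp
   qed
   moreover have "El (ob_mod M (ob s)) <=
     gspan K (pull_cat C ob) (pull_mod M ob) Gs (%x. {\<zero>\<^sub>(ob_mod (pull_mod M ob) x)}) s" using Gs(3)[of s] s(1) by simp
   ultimately have sub: "arr_map M (ob s) y b w : ?N" if "w : El (ob_mod M (ob s))" for w using that by blast
   show "El (ob_mod M y) <= ?N"
    using sub[OF M.arr_cl[OF y s(1,2)]] id[OF y s] by auto
  qed
 }
qed

section \<open>Finite generation by principal projectives\<close>

lemma dsum_lm:
 assumes K: "ring K" and V: "!!i. i : I ==> LMod K (V i)"
 shows "LMod K (finite_dsum I V)"
proof -
 note a = left_module.axioms(2)[OF V] and m = abelian_group.axioms(1)[OF left_module.axioms(2)[OF V]]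
 show ?thesis
 proof (rule lmI[OF K])
  fix x assume x: "x : El (finite_dsum I V)"
  show "EX y:El (finite_dsum I V). y \<oplus>\<^sub>(finite_dsum I V) x = \<zero>\<^sub>(finite_dsum I V)"
   by (rule bexI[of _ "\<lambda>i\<in>I. \<ominus>\<^sub>(V i) x i"])
    (use x in \<open>auto simp: finite_dsum_def PiE_iff abelian_group.l_neg[OF a] abelian_group.a_inv_closed[OF a]\<close>)
 qed (auto simp: finite_dsum_def PiE_iff extensional_def fun_eq_iff abelian_monoid.a_closed[OF m] abelian_monoid.zero_closed[OF m]
   abelian_monoid.a_assoc[OF m] abelian_monoid.a_comm[OF m] abelian_monoid.a_lcomm[OF m] abelian_monoid.l_zero[OF m] abelian_monoid.r_zero[OF m]
   left_module.smult_closed[OF V] left_module.smult_l_distr[OF V] left_module.smult_r_distr[OF V]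
   left_module.smult_assoc1[OF V] left_module.smult_one[OF V])
qed

lemma fds_simps:
 "El (finite_dsum I V) = (\<Pi>\<^sub>E i\<in>I. El (V i))" "c \<oplus>\<^sub>(finite_dsum I V) d = (\<lambda>i\<in>I. c i \<oplus>\<^sub>(V i) d i)"
 "a \<odot>\<^sub>(finite_dsum I V) c = (\<lambda>i\<in>I. a \<odot>\<^sub>(V i) c i)" "\<zero>\<^sub>(finite_dsum I V) = (\<lambda>i\<in>I. \<zero>\<^sub>(V i))"
 by (simp_all add: finite_dsum_def)

definition dinj :: "'i set => ('i => ('k, 'v) module) => 'i => 'v => 'i => 'v" where
 "dinj I V i v = (\<lambda>j\<in>I. if j = i then v else \<zero>\<^sub>(V j))"

lemma dinj_lin:
 assumes V: "!!i. i : I ==> LMod K (V i)" and i: "i : I"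
 shows "dinj I V i : Lin K (V i) (finite_dsum I V)"
proof (rule linI)
 fix x y a assume x: "x : El (V i)"
 show "dinj I V i x : El (finite_dsum I V)"
  using x abelian_monoid.zero_closed[OF abelian_group.axioms(1)[OF left_module.axioms(2)[OF V]]]
  by (auto simp: dinj_def fds_simps)
 show "dinj I V i (x \<oplus>\<^sub>(V i) y) = dinj I V i x \<oplus>\<^sub>(finite_dsum I V) dinj I V i y" if "y : El (V i)"
  using abelian_monoid.l_zero[OF abelian_group.axioms(1)[OF left_module.axioms(2)[OF V]]]
   abelian_monoid.zero_closed[OF abelian_group.axioms(1)[OF left_module.axioms(2)[OF V]]]
  by (auto simp: dinj_def fds_simps)
 show "dinj I V i (a \<odot>\<^sub>(V i) x) = a \<odot>\<^sub>(finite_dsum I V) dinj I V i x" if "a : El K"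
  using left_module.smult_r_null[OF V that] by (auto simp: dinj_def fds_simps)
qed

text \<open>Induction on the number of leading components kept, the others being set to
  zero.\<close>

lemma dsum_into:
 assumes V: "!!i. i < n ==> LMod K (V i)" and W: "LMod K W"
  and f: "f : Lin K (finite_dsum {..<n :: nat} V) W" and N: "submod K W N"
  and fN: "!!i v. i < n ==> v : El (V i) ==> f (dinj {..<n} V i v) : N"
  and c: "c : El (finite_dsum {..<n} V)"
 shows "f c : N"
proof -
 have V': "!!i. i : {..<n} ==> LMod K (V i)" using V by simp
 have zc: "\<zero>\<^sub>(V i) : El (V i)" if "i < n" for i
  using abelian_monoid.zero_closed[OF abelian_group.axioms(1)[OF left_module.axioms(2)[OF V[OF that]]]] .
 have lz: "\<zero>\<^sub>(V i) \<oplus>\<^sub>(V i) v = v" "v \<oplus>\<^sub>(V i) \<zero>\<^sub>(V i) = v" if "i < n" "v : El (V i)" for i v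
  using abelian_group.axioms(1)[OF left_module.axioms(2)[OF V[OF that(1)]]] that(2)
  by (simp_all add: abelian_monoid.l_zero abelian_monoid.r_zero)
 have D: "LMod K (finite_dsum {..<n} V)"
  by (rule dsum_lm[OF left_module.axioms(1)[OF W] V'])
 have cl: "c i : El (V i)" if "i < n" for i
  using PiE_mem[OF c[unfolded fds_simps(1)], of i] that by simp
 have "k <= n ==> f (\<lambda>i\<in>{..<n}. if i < k then c i else \<zero>\<^sub>(V i)) : N" for k
 proof (induction k)
  case 0
  show ?case using lin_zero[OF D W f] subD(2)[OF N] by (simp add: fds_simps restrict_def)
 next
  case (Suc k)
  let ?c = "\<lambda>i\<in>{..<n}. if i < k then c i else \<zero>\<^sub>(V i)"
  have ck: "c k : El (V k)" using cl[of k] Suc.prems by simp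
  have cc: "?c : El (finite_dsum {..<n} V)"
   unfolding fds_simps(1) by (intro restrict_PiE_iff[THEN iffD2] ballI) (simp add: cl zc)
  have dk: "dinj {..<n} V k (c k) : El (finite_dsum {..<n} V)"
   by (rule lin_cl[OF dinj_lin[where V = V and i = k, OF V'] ck]) (use Suc.prems in auto)
  have "(\<lambda>i\<in>{..<n}. if i < Suc k then c i else \<zero>\<^sub>(V i)) = ?c \<oplus>\<^sub>(finite_dsum {..<n} V) dinj {..<n} V k (c k)"
  proof
   fix i
   show "(\<lambda>i\<in>{..<n}. if i < Suc k then c i else \<zero>\<^sub>(V i)) i = (?c \<oplus>\<^sub>(finite_dsum {..<n} V) dinj {..<n} V k (c k)) i"
   by (auto simp: lz cl zc fds_simps dinj_def)
  qed
  moreover have "f ?c \<oplus>\<^sub>W f (dinj {..<n} V k (c k)) : N"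
   by (rule subD(3)[OF N Suc.IH fN[OF _ ck]]) (use Suc.prems in simp_all)
  ultimately show ?case using lin_add[OF f cc dk] by metis
 qed
 moreover have "(\<lambda>i\<in>{..<n}. if i < n then c i else \<zero>\<^sub>(V i)) = c"
 proof
  fix i show "(\<lambda>i\<in>{..<n}. if i < n then c i else \<zero>\<^sub>(V i)) i = c i"
   using PiE_arb[OF c[unfolded fds_simps(1)], of i] by (cases "i < n") simp_all
 qed
 ultimately show ?thesis by (metis order_refl)
qed

lemma fg_cat_module_iff:
 fixes M :: "('o, 'a, 'k, 'm) cat_mod"
 assumes K: "cring K" and M: "cat_module K C M"
 shows "fg_cat_module K C M <-> fg K C M"
proof
 interpret M: cat_module K C M by (rule M)
 interpret K: ring K by (rule K_ring[OF K M.category_axioms])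
 note C = M.category_axioms
 let ?pp = "PPr K C"
 have Pl: "LMod K (ob_mod (?pp x) y)" for x y
  unfolding pp_ob by (rule free_lm[OF K.ring_axioms])
 let ?s = "single (Reg K)"
 {
  assume "fg_cat_module K C M"
  hence "\<exists>(n :: nat) x. (ALL i<n. x i : Ob C) &
    (\<exists>\<eta>\<in>cat_module_homs K C (cat_mod_dsum {..<n} (%i. ?pp (x i))) M.
     ALL y:Ob C. \<eta> y ` El (ob_mod (cat_mod_dsum {..<n} (%i. ?pp (x i))) y) = El (ob_mod M y))"
   unfolding fg_cat_module_def Let_def by (rule conjunct2)
  then obtain n :: nat and x \<eta> where x': "ALL i<n. x i : Ob C"
   and \<eta>: "\<eta> : cat_module_homs K C (cat_mod_dsum {..<n} (%i. ?pp (x i))) M"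
   and surj': "ALL y:Ob C. \<eta> y ` El (ob_mod (cat_mod_dsum {..<n} (%i. ?pp (x i))) y) = El (ob_mod M y)"
   by (elim exE conjE bexE) (rule that)
  note x = x'[rule_format] and surj = bspec[OF surj']
  let ?D = "%y. finite_dsum {..<n} (%i. ob_mod (?pp (x i)) y)"
  let ?j = "%y. dinj {..<n} (%i. ob_mod (?pp (x i)) y)"
  have Dob: "ob_mod (cat_mod_dsum {..<n} (%i. ?pp (x i))) y = ?D y" for y by (simp add: cat_mod_dsum_def)
  have \<eta>l: "\<eta> y : Lin K (?D y) (ob_mod M y)" if "y : Ob C" for y
   using \<eta> that unfolding cat_module_homs_def Dob by blast
  have jl: "?j y i : Lin K (ob_mod (?pp (x i)) y) (?D y)" if "i < n" for i y
   by (rule dinj_lin[OF Pl]) (use that in simp)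
  \<comment> \<open>The Yoneda elements: images of the identities in the summands.\<close>
  define m where "m i = \<eta> (x i) (?j (x i) i (?s (Ident C (x i)) \<one>\<^sub>K))" for i
  have s1: "?s (Ident C (x i)) \<one>\<^sub>K : El (ob_mod (?pp (x i)) (x i))" if "i < n" for i
   unfolding pp_ob by (rule free_single_cl[OF K.ring_axioms M.Ident_closed[OF x[OF that]] K.one_closed])
  have m: "m i : El (ob_mod M (x i))" if "i < n" for i
   unfolding m_def by (rule lin_cl[OF \<eta>l[OF x[OF that]] lin_cl[OF jl[OF that] s1[OF that]]])
  let ?Gs = "(%i. (x i, m i)) ` {..<n}"
  have G: "z : Ob C & v : El (ob_mod M z)" if "(z, v) : ?Gs" for z v using that x m by auto
  show "fg K C M"
  proof (rule fgI[OF _ G])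
   fix y assume y: "y : Ob C"
   let ?N = "gspan K C M ?Gs (%x. {\<zero>\<^sub>(ob_mod M x)}) y"
   have N: "submod K (ob_mod M y) ?N" by (rule M.gspan_zero_sub[OF G y])
   have "\<eta> y (?j y i v) : ?N" if i: "i < n" and v: "v : El (ob_mod (?pp (x i)) y)" for i v
   proof (rule lin_into_sub[where f = "%v. \<eta> y (?j y i v)", OF regular_lm[OF K.ring_axioms]
     M.ob_lm[OF y] _ N])
    show "v : El (FS (Reg K) (Arr C (x i) y))" using v unfolding pp_ob free_module_def .
    show lin: "(%v. \<eta> y (?j y i v)) : Lin K (FS (Reg K) (Arr C (x i) y)) (ob_mod M y)"
     using lin_comp[OF jl[OF i, of y] \<eta>l[OF y]] unfolding pp_ob free_module_def .
    fix a k assume a: "a : Arr C (x i) y" and "k : El (Reg K)"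
    hence k: "k : El K" by simp
    have "arr_map (cat_mod_dsum {..<n} (%i. ?pp (x i))) (x i) y a (?j (x i) i (?s (Ident C (x i)) \<one>\<^sub>K)) =
      ?j y i (?s a \<one>\<^sub>K)"
    proof
     fix j
     show "arr_map (cat_mod_dsum {..<n} (%i. ?pp (x i))) (x i) y a (?j (x i) i (?s (Ident C (x i)) \<one>\<^sub>K)) j =
      ?j y i (?s a \<one>\<^sub>K) j"
     proof (cases "j < n")
      case True
      note al = cat_module.arr_linear[OF pp_cat_module[OF K C x[OF True]] x[OF i] y a]
      show ?thesis
      proof (cases "j = i")
       case True
       thus ?thesis
        using pp_single[OF K C x[OF i] x[OF i] y a M.Ident_closed[OF x[OF i]] K.one_closed]
         M.Comp_Ident_right[OF x[OF i] y a] by (simp add: cat_mod_dsum_def dinj_def)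
      next
       case False
       thus ?thesis using lin_zero[OF Pl Pl al] by (simp add: cat_mod_dsum_def dinj_def)
      qed
     qed (simp add: cat_mod_dsum_def dinj_def)
    qed
    hence "\<eta> y (?j y i (?s a \<one>\<^sub>K)) = arr_map M (x i) y a (m i)"
     using \<eta> x[OF i] y a lin_cl[OF jl[OF i] s1[OF i]] unfolding cat_module_homs_def Dob m_def by force
    hence sN: "\<eta> y (?j y i (?s a \<one>\<^sub>K)) : ?N" using gspan_arr[of "x i" "m i" ?Gs a C y] a i by simp
    have sk: "?s a k = k \<odot>\<^sub>(FS (Reg K) (Arr C (x i) y)) ?s a \<one>\<^sub>K"
     using k by (auto simp: single_def)
    have "?s a \<one>\<^sub>K : El (FS (Reg K) (Arr C (x i) y))"
     using free_single_cl[OF K.ring_axioms a K.one_closed] unfolding free_module_def .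
    from lin_smult[OF lin k this] show "\<eta> y (?j y i (?s a k)) : ?N"
     unfolding sk using subD(4)[OF N k sN] by (simp only:)
   qed
   hence "\<eta> y c : ?N" if "c : El (?D y)" for c
    by (intro dsum_into[OF _ M.ob_lm[OF y] \<eta>l[OF y] N _ that] Pl)
   thus "El (ob_mod M y) <= ?N" unfolding surj[OF y, unfolded Dob, symmetric] by (rule image_subsetI)
  qed simp
 next
  assume "fg K C M"
  then obtain Gs where Gs: "finite Gs" "!!x m. (x, m) : Gs ==> x : Ob C & m : El (ob_mod M x)"
   "!!y. y : Ob C ==> El (ob_mod M y) <= gspan K C M Gs (%x. {\<zero>\<^sub>(ob_mod M x)}) y" by (rule fgE) (rule that)
  obtain gl where gl: "set gl = Gs" using finite_list[OF Gs(1)] by blast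
  define n where "n = length gl"
  define x where "x i = fst (gl ! i)" for i
  define m where "m i = snd (gl ! i)" for i
  have x: "x i : Ob C" and m: "m i : El (ob_mod M (x i))" if "i < n" for i
   using that Gs(2)[of "x i" "m i"] gl by (auto simp: n_def x_def m_def)
  let ?D = "%y. finite_dsum {..<n} (%i. ob_mod (?pp (x i)) y)"
  let ?l = "%i. pp_lift K M (x i) (m i)"
  \<comment> \<open>The sum of the maps that correspond to the generators under the Yoneda
    lemma.\<close>
  define \<eta> where "\<eta> y c = (\<Oplus>\<^sub>(ob_mod M y)i\<in>{..<n}. ?l i y (c i))" for y c
  have ll: "?l i y : Lin K (ob_mod (?pp (x i)) y) (ob_mod M y)" if "i < n" "y : Ob C" for i y
   unfolding pp_ob by (rule pp_lift_lin[OF K C M x[OF that(1)] m[OF that(1)] that(2)])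
  have Dob: "ob_mod (cat_mod_dsum {..<n} (%i. ?pp (x i))) y = ?D y" for y by (simp add: cat_mod_dsum_def)
  have proj: "(%c. c i) : Lin K (?D y) (ob_mod (?pp (x i)) y)" if "i < n" for i y
   by (rule linI) (use that in \<open>auto simp: fds_simps\<close>)
  have Dl: "LMod K (?D y)" for y by (rule dsum_lm[OF K.ring_axioms Pl])
  have \<eta>l: "\<eta> y : Lin K (?D y) (ob_mod M y)" if y: "y : Ob C" for y
   unfolding \<eta>_def by (rule lin_sums[OF Dl M.ob_lm[OF y] lin_comp[OF proj ll]]) (use y in auto)
  have lc: "?l i y (c i) : El (ob_mod M y)" if "i < n" "y : Ob C" "c : El (?D y)" for i y c
   by (rule lin_cl[OF ll[OF that(1,2)] lin_cl[OF proj[OF that(1)] that(3)]])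
  have nat: "\<eta> z (arr_map (cat_mod_dsum {..<n} (%i. ?pp (x i))) y z a c) = arr_map M y z a (\<eta> y c)"
   if y: "y : Ob C" and z: "z : Ob C" and a: "a : Arr C y z" and c: "c : El (?D y)" for y z a c
  proof -
   interpret Mz: left_module K "ob_mod M z" by (rule M.ob_lm[OF z])
   note al = M.arr_linear[OF y z a]
   have "?l i z (arr_map (?pp (x i)) y z a (c i)) = arr_map M y z a (?l i y (c i))" if i: "i < n" for i
    by (rule pp_lift_nat[OF K C M x[OF i] m[OF i] y z a])
     (use lin_cl[OF proj[OF i] c] in \<open>simp add: pp_ob\<close>)
   hence "\<eta> z (arr_map (cat_mod_dsum {..<n} (%i. ?pp (x i))) y z a c) =
     (\<Oplus>\<^sub>(ob_mod M z)i\<in>{..<n}. arr_map M y z a (?l i y (c i)))"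
    unfolding \<eta>_def cat_mod_dsum_def using lin_cl[OF al lc[OF _ y c]] by (intro Mz.finsum_cong') auto
   also have "... = arr_map M y z a (\<eta> y c)"
    unfolding \<eta>_def by (rule lin_finsum[OF M.ob_lm[OF y] M.ob_lm[OF z] al, symmetric])
     (use lc[OF _ y c] in auto)
   finally show ?thesis .
  qed
  have "\<eta> : cat_module_homs K C (cat_mod_dsum {..<n} (%i. ?pp (x i))) M"
   unfolding cat_module_homs_def Dob using \<eta>l nat by blast
  moreover have "\<eta> y ` El (ob_mod (cat_mod_dsum {..<n} (%i. ?pp (x i))) y) = El (ob_mod M y)"
   if y: "y : Ob C" for y
   unfolding Dob
  proof
   show "\<eta> y ` El (?D y) <= El (ob_mod M y)" using lin_cl[OF \<eta>l[OF y]] by blast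
   interpret My: left_module K "ob_mod M y" by (rule M.ob_lm[OF y])
   have N: "submod K (ob_mod M y) (\<eta> y ` El (?D y))"
    by (rule submod_image[OF Dl M.ob_lm[OF y] \<eta>l[OF y] submod_carrier[OF Dl]])
   have "gspan K C M Gs (%x. {\<zero>\<^sub>(ob_mod M x)}) y <= \<eta> y ` El (?D y)"
   proof (rule gspan_least[OF N])
    show "{\<zero>\<^sub>(ob_mod M y)} <= \<eta> y ` El (?D y)" using subD(2)[OF N] by blast
    fix z v a assume zv: "(z, v) : Gs" and a: "a : Arr C z y"
    obtain i where i: "i < n" "gl ! i = (z, v)" using zv gl by (metis n_def in_set_conv_nth)
    hence zx: "z = x i" "v = m i" by (simp_all add: x_def m_def)
    let ?u = "dinj {..<n} (%i. ob_mod (?pp (x i)) y) i (?s a \<one>\<^sub>K)"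
    have av: "arr_map M z y a v : El (ob_mod M y)" using M.arr_cl[OF x[OF i(1)] y _ m[OF i(1)]] a zx by simp
    have u: "?u : El (?D y)"
     by (rule lin_cl[OF dinj_lin[OF Pl]])
      (use i(1) a zx free_single_cl[OF K.ring_axioms _ K.one_closed] in \<open>auto simp: pp_ob\<close>)
    have "?l i y (?s a \<one>\<^sub>K) = \<one>\<^sub>K \<odot>\<^sub>(ob_mod M y) arr_map M z y a v"
     unfolding zx by (rule pp_lift_single[OF K C M x[OF i(1)] m[OF i(1)] y _ K.one_closed]) (use a zx in simp)
    hence "?l j y (?u j) = (if i = j then arr_map M z y a v else \<zero>\<^sub>(ob_mod M y))" if j: "j < n" for j
     using lin_zero[OF Pl M.ob_lm[OF y] ll[OF j y]] My.smult_one[OF av] j by (cases "i = j") (simp_all add: dinj_def)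
    hence "\<eta> y ?u = (\<Oplus>\<^sub>(ob_mod M y)j\<in>{..<n}. if i = j then arr_map M z y a v else \<zero>\<^sub>(ob_mod M y))"
     unfolding \<eta>_def using av by (intro My.finsum_cong') auto
    also have "... = arr_map M z y a v"
     using My.add.finprod_singleton[of i "{..<n}" "%_. arr_map M z y a v"] i(1) av by simp
    finally show "arr_map M z y a v : \<eta> y ` El (?D y)" by (rule image_eqI[OF sym u])
   qed
   thus "El (ob_mod M y) <= \<eta> y ` El (?D y)" by (rule order_trans[OF Gs(3)[OF y]])
  qed
  ultimately show "fg_cat_module K C M"
   unfolding fg_cat_module_def Let_def using M x
   by (intro conjI exI[of _ n] exI[of _ x] bexI[of _ \<eta>] allI impI ballI)
 }
qed

section \<open>Retractions onto the skeleton\<close>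

text \<open>The isomorphism with the skeleton sends an element to the number of elements strictly
  below it.\<close>

lemma oi_retract:
 assumes S: "S : Ob OI"
 shows "EX n a b. a : oi_hom S (od n) & b : oi_hom (od n) S & (ALL i:fst S. b (a i) = i) & (ALL k<n. a (b k) = k)"
proof -
 note O = OI_orderD[OF S]
 define n where "n = card (fst S)"
 define rk where "rk i = card (strictly_below S i)" for i
 have fin: "finite (strictly_below S i)" for i using O(1) by (auto simp: strictly_below_def)
 have mono: "rk i < rk j" if "(i, j) : snd S" "i ~= j" for i j
 proof -
  have "i : fst S" using O(2) that(1) by auto
  hence "strictly_below S i \<subset> strictly_below S j"
   using that O(4)[of _ i j] O(5)[of i j] by (auto simp: strictly_below_def)
  thus ?thesis unfolding rk_def by (rule psubset_card_mono[OF fin])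
 qed
 have lt: "rk i < n" if "i : fst S" for i
  unfolding rk_def n_def using that by (intro psubset_card_mono[OF O(1)]) (auto simp: strictly_below_def)
 have inj: "inj_on rk (fst S)"
  by (rule inj_onI) (metis O(6) mono less_irrefl)
 have img: "rk ` fst S = {..<n}"
  by (rule card_subset_eq) (use lt in \<open>auto simp: card_image[OF inj] n_def\<close>)
 define b where "b = (\<lambda>k\<in>{..<n}. inv_into (fst S) rk k)"
 have b: "b k : fst S" "rk (b k) = k" if "k < n" for k
  using that img inv_into_into[of k rk "fst S"] f_inv_into_f[of k rk "fst S"] by (auto simp: b_def)
 have rb: "b (rk i) = i" if "i : fst S" for i using that lt inv_into_f_f[OF inj] by (simp add: b_def)
 have "restrict rk (fst S) : oi_hom S (od n)"
  unfolding oi_hom_def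
 by (use lt inj O(2) mono in \<open>fastforce\<close>)
 moreover have "b : oi_hom (od n) S"
  unfolding oi_hom_def
 proof (intro CollectI conjI allI impI)
  show "b : fst (od n) \<rightarrow>\<^sub>E fst S" using b(1) by (auto simp: b_def)
  show "inj_on b (fst (od n))" by (rule inj_onI) (metis b(2) lessThan_iff od_simps(1))
  fix k l assume "(k, l) : snd (od n)"
  hence kl: "k <= l" "l < n" by auto
  hence kn: "k < n" by simp
  show "(b k, b l) : snd S"
  proof (rule ccontr)
   assume *: "(b k, b l) ~: snd S"
   hence "(b l, b k) : snd S" "b l ~= b k" using O(6)[OF b(1)[OF kn] b(1)[OF kl(2)]] by auto
   thus False using mono[of "b l" "b k"] b(2)[OF kn] b(2)[OF kl(2)] kl(1) by simp
  qed
 qed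
 ultimately show ?thesis using rb b by (intro exI[of _ n] exI[of _ "restrict rk (fst S)"] exI[of _ b]) auto
qed

context ovi_ring
begin

text \<open>Forming combinations of the basis, with indices relabelled along \<open>r\<close>, makes
  the standard free module on \<open>J\<close> the source; its inverse takes coordinates.\<close>

lemma basis_bij:
 assumes V: "LMod R V" and fin: "finite I" and bas: "is_basis R V I v"
  and r: "bij_betw r I J"
 shows "(%c. \<Oplus>\<^sub>V i\<in>I. c (r i) \<odot>\<^sub>V v i) : Lin R (Fr J) V"
  and "bij_betw (%c. \<Oplus>\<^sub>V i\<in>I. c (r i) \<odot>\<^sub>V v i) (El (Fr J)) (El V)"
  and "!!i. i : I ==> (\<Oplus>\<^sub>V j\<in>I. e (r i) (r j) \<odot>\<^sub>V v j) = v i"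
proof -
 interpret V: left_module R V by (rule V)
 have vc: "v i : El V" if "i : I" for i using bas that by (auto simp: is_basis_def)
 have rJ: "r i : J" if "i : I" for i using r that by (auto simp: bij_betw_def)
 let ?g = "%c. \<Oplus>\<^sub>V i\<in>I. c (r i) \<odot>\<^sub>V v i"
 have Frc: "c j : El R" if "c : El (Fr J)" for c j
  using fs_val[OF RR that[unfolded free_module_def], of j] by simp
 show lin: "?g : Lin R (Fr J) V"
 proof (rule lin_sums[OF Fr V])
  fix i assume i: "i : I"
  have 1: "(%c. c (r i)) : Lin R (Fr J) RR" unfolding free_module_def by (rule eval_lin[OF RR])
  have 2: "(%k. k \<odot>\<^sub>V v i) : Lin R RR V"
   by (rule free_lift_F[where X = "{i}" and v = v, OF ring_axioms V]) (use vc i in auto)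
  show "(%c. c (r i) \<odot>\<^sub>V v i) : Lin R (Fr J) V" by (rule lin_comp[OF 1 2])
 qed
 have ex1: "EX! c. c : I \<rightarrow>\<^sub>E El R & x = (\<Oplus>\<^sub>V i\<in>I. c i \<odot>\<^sub>V v i)" if "x : El V" for x
  using bas that unfolding is_basis_def by blast
 have restr: "?g c = (\<Oplus>\<^sub>V i\<in>I. (\<lambda>i\<in>I. c (r i)) i \<odot>\<^sub>V v i)" if "c : El (Fr J)" for c
  using Frc[OF that] vc V.smult_closed by (intro V.finsum_cong') auto
 show "bij_betw ?g (El (Fr J)) (El V)"
  unfolding bij_betw_def
 proof
  show "inj_on ?g (El (Fr J))"
  proof (rule inj_onI)
   fix c d assume c: "c : El (Fr J)" and d: "d : El (Fr J)" and eq: "?g c = ?g d"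
   have cd: "(\<lambda>i\<in>I. c (r i)) : I \<rightarrow>\<^sub>E El R" "(\<lambda>i\<in>I. d (r i)) : I \<rightarrow>\<^sub>E El R"
    using Frc[OF c] Frc[OF d] by auto
   have "EX! h. h : I \<rightarrow>\<^sub>E El R & ?g c = (\<Oplus>\<^sub>V i\<in>I. h i \<odot>\<^sub>V v i)" by (rule ex1[OF lin_cl[OF lin c]])
   hence cd': "(\<lambda>i\<in>I. c (r i)) = (\<lambda>i\<in>I. d (r i))"
    by (rule ex1E) (use cd restr[OF c] restr[OF d, folded eq] in blast)
   have cr: "c (r i) = d (r i)" if "i : I" for i
    using fun_cong[OF cd', of i] that by simp
   show "c = d"
   proof
    fix j
    show "c j = d j"
    proof (cases "j : J")
     case True
     then obtain i where "i : I" "j = r i" using r by (auto simp: bij_betw_def)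
     thus ?thesis using cr by simp
    next
     case False
     thus ?thesis using c d by (simp add: free_module_def fs_iff)
    qed
   qed
  qed
  show "?g ` El (Fr J) = El V"
  proof
   show "?g ` El (Fr J) <= El V" using lin_cl[OF lin] by blast
   show "El V <= ?g ` El (Fr J)"
   proof
    fix x assume x: "x : El V"
    obtain c where c: "c : I \<rightarrow>\<^sub>E El R" "x = (\<Oplus>\<^sub>V i\<in>I. c i \<odot>\<^sub>V v i)" using ex1[OF x] by blast
    define c' where "c' j = (if j : J then c (inv_into I r j) else \<zero>)" for j
    have "inv_into I r j : I" if "j : J" for j using r that by (auto simp: bij_betw_def)
    moreover have "finite J" using bij_betw_finite[OF r] fin by simp
    ultimately have c'F: "c' : El (Fr J)"
     using c(1) by (auto simp: c'_def free_module_def fs_iff elim: finite_subset[rotated])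
    have "c' (r i) = c i" if "i : I" for i
     using that rJ r by (simp add: c'_def bij_betw_def inv_into_f_f)
    hence "?g c' = x" unfolding c(2)
     by (intro V.finsum_cong') (use PiE_mem[OF c(1)] vc V.smult_closed in auto)
    thus "x : ?g ` El (Fr J)" using c'F by blast
   qed
  qed
 qed
 show "(\<Oplus>\<^sub>V j\<in>I. e (r i) (r j) \<odot>\<^sub>V v j) = v i" if i: "i : I" for i
 proof -
  have "r j = r i <-> i = j" if "j : I" for j using r i that by (auto simp: bij_betw_def inj_on_def)
  hence "(\<Oplus>\<^sub>V j\<in>I. e (r i) (r j) \<odot>\<^sub>V v j) = (\<Oplus>\<^sub>V j\<in>I. if i = j then v j else \<zero>\<^sub>V)"
   using vc V.smult_one V.smult_l_null by (intro V.finsum_cong') (auto simp: single_def)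
  thus ?thesis using V.add.finprod_singleton[of i I v] i fin vc by simp
 qed
qed

lemma ovi_homI:
 assumes f: "f : Lin R (omod X) (omod Y) \<inter> extensional (El (omod X))"
  and r: "r : oi_hom (oind X) (oind Y)" and Y: "LMod R (omod Y)"
  and vc: "!!j. j : fst (oind Y) ==> obas Y j : El (omod Y)"
  and fv: "!!i. i : fst (oind X) ==> f (obas X i) = obas Y (r i)"
 shows "(f, r) : ovi_hom R X Y"
proof -
 interpret Y: left_module R "omod Y" by (rule Y)
 have "EX a:strictly_below (oind Y) (r i) \<rightarrow> El R. f (obas X i) = obas Y (r i) \<oplus>\<^sub>(omod Y)
   (\<Oplus>\<^sub>(omod Y)j\<in>strictly_below (oind Y) (r i). a j \<odot>\<^sub>(omod Y) obas Y j)" if i: "i : fst (oind X)" for i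
 proof (rule bexI[of _ "%_. \<zero>"])
  have sb: "obas Y j : El (omod Y)" if "j : strictly_below (oind Y) (r i)" for j
   using vc that by (auto simp: strictly_below_def)
  hence "(\<Oplus>\<^sub>(omod Y)j\<in>strictly_below (oind Y) (r i). \<zero> \<odot>\<^sub>(omod Y) obas Y j) =
    (\<Oplus>\<^sub>(omod Y)j\<in>strictly_below (oind Y) (r i). \<zero>\<^sub>(omod Y))"
   using Y.smult_l_null by (intro Y.finsum_cong') auto
  thus "f (obas X i) = obas Y (r i) \<oplus>\<^sub>(omod Y)
   (\<Oplus>\<^sub>(omod Y)j\<in>strictly_below (oind Y) (r i). \<zero> \<odot>\<^sub>(omod Y) obas Y j)"
   using fv[OF i] vc[OF oi_homD(1)[OF r i]] by simp
 qed auto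
 thus ?thesis using f r by (auto simp: ovi_hom_def)
qed

text \<open>The coordinates of the given basis, relabelled by the ranks from
  \<open>oi_retract\<close>, yield a morphism because basis vectors go to basis vectors and all
  scalars can be taken zero.\<close>

lemma ovi_retract:
 assumes X: "X : Ob (OVI R)"
 shows "EX n a b. a : ovi_hom R X (std (od n)) & b : ovi_hom R (std (od n)) X &
  Comp (OVI R) X (std (od n)) X b a = Ident (OVI R) X"
proof -
 let ?V = "omod X" and ?I = "fst (oind X)" and ?v = "obas X"
 have V: "LMod R ?V" and S: "oind X : Ob OI" and bas: "is_basis R ?V ?I ?v" using X by (auto simp: OVI_def)
 interpret V: left_module R ?V by (rule V)
 have vc: "?v i : El ?V" if "i : ?I" for i using bas that by (auto simp: is_basis_def)
 obtain n r b where r: "r : oi_hom (oind X) (od n)" and b: "b : oi_hom (od n) (oind X)"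
  and br: "!!i. i : ?I ==> b (r i) = i" and rb: "!!k. k < n ==> r (b k) = k"
  using oi_retract[OF S] by blast
 have bij: "bij_betw r ?I {..<n}"
  by (rule bij_betw_byWitness[of _ b]) (use br rb oi_homD(1)[OF r] oi_homD(1)[OF b] in auto)
 define g where "g c = (\<Oplus>\<^sub>?V i\<in>?I. c (r i) \<odot>\<^sub>?V ?v i)" for c
 note B = basis_bij[OF V OI_orderD(1)[OF S] bas bij, folded g_def]
 let ?F = "Fr {..<n}"
 interpret F: left_module R ?F by (rule Fr)
 define f where "f = (\<lambda>x\<in>El ?V. inv_into (El ?F) g x)"
 have fc: "f x : El ?F" and gf: "g (f x) = x" if "x : El ?V" for x
  using B(2) that by (auto simp: f_def bij_betw_def inv_into_into f_inv_into_f)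
 have fg: "f (g c) = c" if "c : El ?F" for c
  using B(2) that lin_cl[OF B(1) that] by (simp add: f_def bij_betw_def inv_into_f_f)
 have er: "e k : El ?F" if "k < n" for k
  using free_single_cl[OF ring_axioms _ one_closed, of k "{..<n}"] that by simp
 have f: "f : Lin R ?V ?F"
 proof (rule linI[OF fc])
  fix x y a assume x: "x : El ?V"
  show "f (x \<oplus>\<^sub>?V y) = f x \<oplus>\<^sub>?F f y" if y: "y : El ?V"
   using fg[OF F.add.m_closed[OF fc[OF x] fc[OF y]]] lin_add[OF B(1) fc[OF x] fc[OF y]] gf x y by simp
  show "f (a \<odot>\<^sub>?V x) = a \<odot>\<^sub>?F f x" if a: "a : El R"
   using fg[OF F.smult_closed[OF a fc[OF x]]] lin_smult[OF B(1) a fc[OF x]] gf x by simp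
 qed
 have fa: "(f, r) : ovi_hom R X (std (od n))"
 proof (rule ovi_homI)
  show "f : Lin R ?V (omod (std (od n))) \<inter> extensional (El ?V)" using f by (simp add: f_def)
  show "f (?v i) = obas (std (od n)) (r i)" if i: "i : ?I" for i
   using fg[OF er, of "r i"] B(3)[OF i] oi_homD(1)[OF r i] by simp
 qed (use r er Fr in auto)
 have ga: "(restrict g (El ?F), b) : ovi_hom R (std (od n)) X"
 proof (rule ovi_homI)
  show "restrict g (El ?F) : Lin R (omod (std (od n))) ?V \<inter> extensional (El (omod (std (od n))))"
   using lin_cong[OF B(1) _ Fr, of "restrict g (El ?F)"] by simp
  show "restrict g (El ?F) (obas (std (od n)) k) = ?v (b k)" if k: "k : fst (oind (std (od n)))" for k
   using B(3)[OF oi_homD(1)[OF b, of k]] rb[of k] er[of k] k by simp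
 qed (use b V vc in auto)
 have "Comp (OVI R) X (std (od n)) X (restrict g (El ?F), b) (f, r) = Ident (OVI R) X"
  using fc gf br by (auto simp: OVI_def compose_def fun_eq_iff)
 thus ?thesis using fa ga by blast
qed

end

text \<open>The cycles whose coset is generated form a submodule that contains the boundaries and
  the transitions of all generators, hence contain every cycle.\<close>

lemma (in nc_mod) homol_fg:
 assumes "hfg i"
 shows "fg K NI (hs.homology i)"
proof -
 obtain Gs where Gs: "finite Gs" "!!n z. (n, z) : Gs ==> z : Z i n" "!!n. Z i n <= hspan Gs i n"
  using assms unfolding hfg_iff by blast
 let ?q = "%n z. B i n +>\<^sub>(C i n) z"
 interpret H: cat_module K NI "hs.homology i" by (rule hs.homol_cat_module)
 have Hob: "ob_mod (hs.homology i) n = subquotient (C i n) (Z i n) (B i n)" for n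
  using hs.homol_ob[of i n] by simp
 let ?Hs = "(%(n, z). (n, ?q n z)) ` Gs"
 have HC: "n : Ob NI & z : El (ob_mod (hs.homology i) n)" if nz: "(n, z) : ?Hs" for n z
 by (use nz Gs(2) Hob subq_carrier C_left B_submod in \<open>fastforce\<close>)
 show ?thesis
 proof (rule fgI[OF _ HC])
  fix n
  let ?N = "gspan K NI (hs.homology i) ?Hs (%x. {\<zero>\<^sub>(ob_mod (hs.homology i) x)}) n"
  have N: "submod K (ob_mod (hs.homology i) n) ?N" by (rule H.gspan_zero_sub[OF HC NI_simps(1)])
  let ?W = "{z : Z i n. ?q n z : ?N}"
  have N': "submod K (subquotient (C i n) (Z i n) (B i n)) ?N" using N by (simp only: Hob)
  have W: "submod K (C i n) ?W"
   using submod_vimage[OF submod_lm[OF C_left Z_submod] H.ob_lm[OF NI_simps(1), of n, unfolded Hob]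
    subq_proj_lin[OF C_left B_submod Z_submod] N']
   by (intro submod_trans[OF _ subD(1)[OF Z_submod]]) (simp only: restr_simps)
  have "hspan Gs i n <= ?W"
  proof (rule hspan_least[OF W])
   show "B i n <= ?W"
   proof
    fix b assume b: "b : B i n"
    interpret C: left_module K "C i n" by (rule C_left)
    have bC: "b : El (C i n)" using subD(1)[OF B_submod] b by blast
    have "?q n b = ?q n \<zero>\<^sub>(C i n)"
     by (rule coset_eqI[OF C_left B_submod bC C.zero_closed])
      (rule submod_diff[OF C_left B_submod b subD(2)[OF B_submod]])
    hence "?q n b = \<zero>\<^sub>(ob_mod (hs.homology i) n)" unfolding Hob subq_zero[OF C_left B_submod] .
    thus "b : ?W" using subD(2)[OF N] b B_Z by auto
   qed
   fix m z f assume mz: "(m, z) : Gs" and f: "f : oi m n"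
   have f': "f : Arr NI m n" using f by (simp only: NI_simps)
   note zZ = Gs(2)[OF mz]
   have "arr_map (hs.homology i) m n f (?q m z) : ?N"
    by (rule gspan_arr[OF _ f']) (use mz in force)
   moreover have "arr_map (hs.homology i) m n f (?q m z) = ?q n (tr i m n f z)"
    using hs.homol_arr[OF NI_simps(1) NI_simps(1) f', of z i] Z_C[OF zZ] by simp
   ultimately show "tr i m n f z : ?W" using tr_Z[OF f zZ] by simp
  qed
  thus "El (ob_mod (hs.homology i) n) <= ?N"
   unfolding Hob subq_carrier[OF C_left B_submod] using Gs(3)[of n] by blast
 qed (use Gs(1) in simp)
qed

text \<open>Adjoining the negatives turns generators as a group into generators as a monoid, so that
  natural multiplicities suffice.\<close>

lemma (in ring) monoid_generators:
 assumes A: "A <= El R" "finite A" "generate (add_monoid R) A = El R"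
 shows "\<exists>(L :: nat) ge. (ALL c<L. ge c : El R) &
  (ALL r:El R. \<exists>a :: nat => nat. r = (\<Oplus>c\<in>{..<L}. [a c] \<cdot> ge c))"
proof -
 obtain xs where xs: "set xs = A \<union> (%x. \<ominus> x) ` A" using finite_list[of "A \<union> (%x. \<ominus> x) ` A"] A(2) by auto
 define ge where "ge c = xs ! c" for c
 have ge: "ge c : El R" if "c < length xs" for c
  using that xs A(1) nth_mem[OF that] unfolding ge_def by auto
 have single: "\<exists>a :: nat => nat. r = (\<Oplus>c\<in>{..<length xs}. [a c] \<cdot> ge c)" if r: "r : set xs" for r
 proof -
  obtain c0 where c0: "c0 < length xs" "r = ge c0" using r by (auto simp: in_set_conv_nth ge_def)
  have "(\<Oplus>c\<in>{..<length xs}. [(if c0 = c then 1 else 0 :: nat)] \<cdot> ge c) = (\<Oplus>c\<in>{..<length xs}. if c0 = c then ge c else \<zero>)"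
   using ge by (intro finsum_cong') auto
  thus ?thesis
   using add.finprod_singleton[of c0 "{..<length xs}" ge] c0 ge by (intro exI[of _ "%c. if c0 = c then 1 else 0"]) auto
 qed
 have "\<exists>a :: nat => nat. r = (\<Oplus>c\<in>{..<length xs}. [a c] \<cdot> ge c)" if "r : generate (add_monoid R) A" for r
  using that
 proof induction
  case one
  have "(\<Oplus>c\<in>{..<length xs}. [(0 :: nat)] \<cdot> ge c) = \<zero>" by (intro add.finprod_one_eqI) auto
  thus ?case by (intro exI[of _ "%_. 0"]) simp
 next
  case (incl h)
  thus ?case using single xs by blast
 next
  case (inv h)
  thus ?case using single[of "\<ominus> h"] xs by (auto simp: a_inv_def)
 next
  case (eng h1 h2)
  then obtain a b :: "nat => nat" where a: "h1 = (\<Oplus>c\<in>{..<length xs}. [a c] \<cdot> ge c)"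
   and b: "h2 = (\<Oplus>c\<in>{..<length xs}. [b c] \<cdot> ge c)" by blast
  have "(\<Oplus>c\<in>{..<length xs}. [(a c + b c)] \<cdot> ge c) = (\<Oplus>c\<in>{..<length xs}. [a c] \<cdot> ge c \<oplus> [b c] \<cdot> ge c)"
   using ge by (intro finsum_cong') (auto simp: add.nat_pow_mult)
  also have "... = h1 \<oplus> h2" unfolding a b using ge by (intro finsum_addf) auto
  finally show ?case by (intro exI[of _ "%c. a c + b c"]) simp
 qed
 thus ?thesis using ge A(3) by (intro exI[of _ "length xs"] exI[of _ ge]) auto
qed

theorem theorem1p4:
  fixes R :: "('r, 'x) ring_scheme" and K :: "('k, 'y) ring_scheme"
    and M :: "('r ovi_obj, 'r ovi_arr, 'k, 'm) cat_mod"
  assumes "ring R" and "\<one>\<^bsub>R\<^esub> \<noteq> \<zero>\<^bsub>R\<^esub>"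
    and "\<exists>A \<subseteq> carrier R. finite A \<and> generate (add_monoid R) A = carrier R"
    and "cring K" and "\<one>\<^bsub>K\<^esub> \<noteq> \<zero>\<^bsub>K\<^esub>" and "noetherian_ring K"
    and "fg_cat_module K (OVI R) M"
  shows "\<forall>i. fg_cat_module K OI (homology_U R M i)"
proof
 fix i
 note K = assms(4)
 have M: "cat_module K (OVI R) M" using assms(7) by (simp add: fg_cat_module_def)
 obtain L :: nat and ge where "!!c. c < L ==> ge c : El R"
  "!!r. r : El R ==> \<exists>a :: nat => nat. r = (\<Oplus>\<^sub>R c\<in>{..<L}. [a c] \<cdot>\<^sub>R ge c)"
  using assms(3) ring.monoid_generators[OF assms(1)] by metis
 hence ofg: "ovi_fg R L ge"
  using assms(1,2) cat_module.axioms(1)[OF M]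
  by (intro ovi_fg.intro ovi_fg_axioms.intro ovi_cat.intro ovi_cat_axioms.intro ovi_ring.intro ovi_ring_axioms.intro)
 interpret pp_homol R L ge K
  by (intro pp_homol.intro pp_homol_axioms.intro ofg K assms(6))
 let ?N = "pull_mod M (%n. std (od n))"
 interpret N: nc_mod R K ?N
  by (intro nc_mod.intro nc_mod_axioms.intro ovi_cat_axioms K pull_cat_module M)
 have "fg K (OVI R) M" using fg_cat_module_iff[OF K M] assms(7) by blast
 moreover have "EX n a b. std (od n) : Ob (OVI R) & a : Arr (OVI R) X (std (od n)) & b : Arr (OVI R) (std (od n)) X &
   Comp (OVI R) X (std (od n)) X b a = Ident (OVI R) X" if "X : Ob (OVI R)" for X
  using ovi_retract[OF that] std_Ob[OF od_Ob] unfolding Arr_OVI by blast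
 ultimately have "fg K NC ?N" using fg_pull[OF M, of "%n. std (od n)"] by blast
 hence "N.hfg i" by (rule hfg_fg[OF N.nc_mod_axioms])
 hence NI: "fg K NI (N.hs.homology i)" by (rule N.homol_fg)
 have OI_eq: "pull_cat OI (%S. S) = OI" by (simp add: pull_cat_def)
 \<comment> \<open>The same construction over all of OI unfolds to \<open>homology_U\<close> and
   shows that it is a module over OI.\<close>
 interpret H: hsys K "pull_cat OI (%S. S)" "UT R" push "ob_mod (pull_mod M std)"
  "%S. arr_map (pull_mod M std) S S" "%S T f. arr_map (pull_mod M std) S T (std_arr R S T f)"
  using hsys_module[OF K pull_cat_module[OF M], of "%S. S"] by simp
 have "H.homology i = homology_U R M i"
  unfolding H.homology_def homology_U_def by simp
 hence U: "cat_module K OI (homology_U R M i)"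
  using H.homol_cat_module[of i] unfolding OI_eq by simp
 \<comment> \<open>On the objects \<open>od n\<close> the two constructions coincide literally, so
   finite generation transfers from the skeleton.\<close>
 have "pull_mod (homology_U R M i) od = N.hs.homology i"
  unfolding N.hs.homology_def homology_U_def by (simp add: pull_mod_def)
 hence "fg K (pull_cat OI od) (pull_mod (homology_U R M i) od)" using NI by simp
 moreover have "EX n a b. od n : Ob OI & a : Arr OI S (od n) & b : Arr OI (od n) S &
   Comp OI S (od n) S b a = Ident OI S" if S: "S : Ob OI" for S
  using oi_retract[OF S] by (fastforce simp: OI_Arr OI_Comp OI_Ident compose_def)
 ultimately have "fg K OI (homology_U R M i)" using fg_pull[OF U, of od] by blast
 thus "fg_cat_module K OI (homology_U R M i)" using fg_cat_module_iff[OF K U] by blast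
qed

end
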